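(* Let $d\in\{2,3\}$, let $\Omega\subset\mathbb{R}^d$ be a bounded domain that is convex or has $C^2$ boundary, let $\Gamma=\partial\Omega$ and $\nu>0$. For a given $f_\infty\in L^2(\Omega)$, let $u_\infty\in H^2(\Omega)\cap H^1_0(\Omega)$ be the strong solution of $$-\nu\Delta u_\infty+\sum_{i=1}^d u_\infty\frac{\partial u_\infty}{\partial x_i}=f_\infty\ \text{ in }\Omega,\qquad u_\infty=0\ \text{ on }\Gamma.$$ Then for arbitrary $\varepsilon>0$ there exists (for a suitable $N$) a deep neural network $u_\infty^N\in\mathcal{F}_N$ such that $$\|u_\infty-u_\infty^N\|_{H^2(\Omega)}\le\varepsilon$$ and $$\Big\|-\nu\Delta u_\infty^N+\sum_{i=1}^d u_\infty^N\frac{\partial u_\infty^N}{\partial x_i}-f_\infty\Big\|^2+\big\|u_\infty^N|_\Gamma\big\|_{L^2(\Gamma)}^2\le C\varepsilon^2,$$ for some $C=C(\nu,\|f_\infty\|,C_{Tr})>0$.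
   Context: $\|\cdot\|$ is the $L^2(\Omega)$ norm. $C_{Tr}$ is the constant of the trace inequality $\|w|_\Gamma\|_{H^{1/2}(\Gamma)}\le C_{Tr}\|w\|_{H^1(\Omega)}$. $\mathcal{F}_N$ is the class of functions on $\Omega$ representable by a deep neural network of complexity (size) $N$, i.e. compositions of layers $x\mapsto\sigma(Wx+b)$ with weight matrices $W$, bias vectors $b$ and a smooth non-polynomial activation $\sigma\in C^\infty(\mathbb{R})$ applied componentwise (e.g. the sigmoid $e^x/(e^x+1)$ or $\tanh$), followed by an affine scalar output layer; $N$ may depend on $\varepsilon$. Constants may also depend on the domain $\Omega$ (and the embedding constants of $\Omega$). *)

theory Defs
  imports "HOL-Analysis.Analysis" "HOL-Computational_Algebra.Polynomial"
begin

section \<open>Classical derivatives\<close>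

definition partial :: "'d \<Rightarrow> (real^'d \<Rightarrow> real) \<Rightarrow> real^'d::finite \<Rightarrow> real" where
  "partial i f x = frechet_derivative f (at x) (axis i 1)"

primrec partials :: "'d list \<Rightarrow> (real^'d \<Rightarrow> real) \<Rightarrow> real^'d::finite \<Rightarrow> real" where
  "partials [] f = f"
| "partials (i # w) f = partial i (partials w f)"

definition C_k :: "nat \<Rightarrow> (real^'d::finite \<Rightarrow> real) \<Rightarrow> bool" where
  "C_k k f \<longleftrightarrow>
     (\<forall>w x. length w < k \<longrightarrow> partials w f differentiable (at x)) \<and>
     (\<forall>w. length w \<le> k \<longrightarrow> continuous_on UNIV (partials w f))"

definition C_infinity :: "(real^'d::finite \<Rightarrow> real) \<Rightarrow> bool" where
  "C_infinity f \<longleftrightarrow> (\<forall>k. C_k k f)"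

definition test_function :: "(real^'d::finite) set \<Rightarrow> (real^'d \<Rightarrow> real) \<Rightarrow> bool" where
  "test_function \<Omega> \<phi> \<longleftrightarrow> C_infinity \<phi> \<and>
     compact (closure {x. \<phi> x \<noteq> 0}) \<and> closure {x. \<phi> x \<noteq> 0} \<subseteq> \<Omega>"


section \<open>Lebesgue and Sobolev spaces on a domain\<close>

text \<open>Elements of the spaces are represented by functions; equality in the spaces is equality
  almost everywhere. Functions on \<open>\<Omega>\<close> are total functions whose values outside \<open>\<Omega>\<close> are
  irrelevant.\<close>

definition L2 :: "'a measure \<Rightarrow> ('a \<Rightarrow> real) set" where
  "L2 M = {f \<in> borel_measurable M. integrable M (\<lambda>x. (f x)\<^sup>2)}"

definition L2_norm :: "'a measure \<Rightarrow> ('a \<Rightarrow> real) \<Rightarrow> real" where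
  "L2_norm M f = sqrt (\<integral>x. (f x)\<^sup>2 \<partial>M)"

text \<open>Derivatives of order \<open>m\<close> are indexed by words of length \<open>m\<close> over the coordinate indices;
  \<open>[i, j]\<close> stands for the derivative in direction \<open>j\<close> followed by the one in direction \<open>i\<close>.\<close>

definition is_weak_deriv ::
  "(real^'d::finite) set \<Rightarrow> 'd list \<Rightarrow> (real^'d \<Rightarrow> real) \<Rightarrow> (real^'d \<Rightarrow> real) \<Rightarrow> bool" where
  "is_weak_deriv \<Omega> w u v \<longleftrightarrow> v \<in> L2 (lebesgue_on \<Omega>) \<and>
     (\<forall>\<phi>. test_function \<Omega> \<phi> \<longrightarrow>
        (\<integral>x. u x * partials w \<phi> x \<partial>lebesgue_on \<Omega>) =
        (-1) ^ length w * (\<integral>x. v x * \<phi> x \<partial>lebesgue_on \<Omega>))"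

definition weak_deriv ::
  "(real^'d::finite) set \<Rightarrow> 'd list \<Rightarrow> (real^'d \<Rightarrow> real) \<Rightarrow> real^'d \<Rightarrow> real" where
  "weak_deriv \<Omega> w u = (SOME v. is_weak_deriv \<Omega> w u v)"

definition Hk :: "nat \<Rightarrow> (real^'d::finite) set \<Rightarrow> (real^'d \<Rightarrow> real) set" where
  "Hk k \<Omega> = {u \<in> L2 (lebesgue_on \<Omega>). \<forall>w. length w \<le> k \<longrightarrow> (\<exists>v. is_weak_deriv \<Omega> w u v)}"

text \<open>The norm sums over words, so the mixed second derivatives \<open>[i, j]\<close> and \<open>[j, i]\<close> both
  contribute: the second order part is the \<open>L2\<close> norm of the Frobenius norm of the Hessian.\<close>

definition Hk_norm :: "nat \<Rightarrow> (real^'d::finite) set \<Rightarrow> (real^'d \<Rightarrow> real) \<Rightarrow> real" where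
  "Hk_norm k \<Omega> u =
     sqrt (\<Sum>w\<in>{w. length w \<le> k}. (L2_norm (lebesgue_on \<Omega>) (weak_deriv \<Omega> w u))\<^sup>2)"

definition H10 :: "(real^'d::finite) set \<Rightarrow> (real^'d \<Rightarrow> real) set" where
  "H10 \<Omega> = {u \<in> Hk 1 \<Omega>. \<exists>\<phi>. (\<forall>n::nat. test_function \<Omega> (\<phi> n)) \<and>
     (\<lambda>n. Hk_norm 1 \<Omega> (\<lambda>x. u x - \<phi> n x)) \<longlonglongrightarrow> 0}"

definition laplacian :: "(real^'d::finite) set \<Rightarrow> (real^'d \<Rightarrow> real) \<Rightarrow> real^'d \<Rightarrow> real" where
  "laplacian \<Omega> u x = (\<Sum>i\<in>UNIV. weak_deriv \<Omega> [i, i] u x)"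

definition burgers_op ::
  "real \<Rightarrow> (real^'d::finite) set \<Rightarrow> (real^'d \<Rightarrow> real) \<Rightarrow> real^'d \<Rightarrow> real" where
  "burgers_op \<nu> \<Omega> u x = - \<nu> * laplacian \<Omega> u x + (\<Sum>i\<in>UNIV. u x * weak_deriv \<Omega> [i] u x)"


section \<open>The boundary\<close>

text \<open>Near each boundary point \<open>\<Omega>\<close> lies on one side of the graph of a \<open>C\<^sup>2\<close> function of the
  coordinates other than the \<open>i\<close>-th one; independence of the \<open>i\<close>-th coordinate is expressed by
  invariance under translations along the \<open>i\<close>-th axis.\<close>

definition C2_boundary :: "(real^'d::finite) set \<Rightarrow> bool" where
  "C2_boundary \<Omega> \<longleftrightarrow> (\<forall>z\<in>frontier \<Omega>. \<exists>r>0. \<exists>i. \<exists>s\<in>{-1, 1}. \<exists>\<gamma>.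
     C_k 2 \<gamma> \<and> (\<forall>x t. \<gamma> (x + t *\<^sub>R axis i 1) = \<gamma> x) \<and>
     \<Omega> \<inter> ball z r = {x \<in> ball z r. \<gamma> x < s * x $ i})"

text \<open>\<open>m\<close>-dimensional Hausdorff measure, normalised so that it agrees with Lebesgue measure
  in dimension \<open>m\<close>. Boundedness is required explicitly because \<open>diameter\<close> is unspecified on
  unbounded sets.\<close>

definition hausdorff_gauge :: "nat \<Rightarrow> 'a::metric_space set \<Rightarrow> ennreal" where
  "hausdorff_gauge m U =
     (if U = {} then 0 else ennreal (unit_ball_vol (real m) * (diameter U / 2) ^ m))"

definition hausdorff_content :: "nat \<Rightarrow> real \<Rightarrow> 'a::metric_space set \<Rightarrow> ennreal" where
  "hausdorff_content m \<delta> A =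
     (INF U\<in>{U :: nat \<Rightarrow> 'a set. A \<subseteq> (\<Union>n. U n) \<and> (\<forall>n. bounded (U n) \<and> diameter (U n) \<le> \<delta>)}.
        \<Sum>n. hausdorff_gauge m (U n))"

definition hausdorff_outer :: "nat \<Rightarrow> 'a::metric_space set \<Rightarrow> ennreal" where
  "hausdorff_outer m A = (SUP \<delta>\<in>{0<..}. hausdorff_content m \<delta> A)"

definition hausdorff_measure :: "nat \<Rightarrow> 'a::metric_space measure" where
  "hausdorff_measure m = measure_of UNIV (sets borel) (hausdorff_outer m)"

text \<open>By the Caratheodory criterion the outer measure is a measure on the Borel sets, so
  \<open>measure_of\<close> does not fall back to the null measure.\<close>

lemma hausdorff_gauge_empty [simp]: "hausdorff_gauge m {} = 0"
  by (simp add: hausdorff_gauge_def)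

lemma hausdorff_content_le:
  assumes "A \<subseteq> (\<Union>n. U n)" "\<And>n. bounded (U n) \<and> diameter (U n) \<le> \<delta>"
  shows "hausdorff_content m \<delta> A \<le> (\<Sum>n. hausdorff_gauge m (U n))"
  unfolding hausdorff_content_def using assms by (intro INF_lower) auto

lemma hausdorff_content_ge:
  assumes "\<And>U :: nat \<Rightarrow> 'a::metric_space set. A \<subseteq> (\<Union>n. U n) \<Longrightarrow>
    (\<And>n. bounded (U n) \<and> diameter (U n) \<le> \<delta>) \<Longrightarrow> B \<le> (\<Sum>n. hausdorff_gauge m (U n))"
  shows "B \<le> hausdorff_content m \<delta> A"
  unfolding hausdorff_content_def using assms by (intro INF_greatest) auto

lemma hausdorff_content_mono: "A \<subseteq> B \<Longrightarrow> hausdorff_content m \<delta> A \<le> hausdorff_content m \<delta> B"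
  unfolding hausdorff_content_def by (intro INF_superset_mono) auto

lemma hausdorff_content_antimono:
  "\<delta> \<le> \<epsilon> \<Longrightarrow> hausdorff_content m \<epsilon> A \<le> hausdorff_content m \<delta> A"
  unfolding hausdorff_content_def by (intro INF_superset_mono) (auto intro: order_trans)

lemma hausdorff_content_empty: "\<delta> > 0 \<Longrightarrow> hausdorff_content m \<delta> {} = 0"
  using hausdorff_content_le[of "{}" "\<lambda>_. {}" \<delta> m] by simp

lemma hausdorff_content_le_outer: "\<delta> > 0 \<Longrightarrow> hausdorff_content m \<delta> A \<le> hausdorff_outer m A"
  unfolding hausdorff_outer_def by (intro SUP_upper) auto

lemma hausdorff_content_UN:
  "hausdorff_content m \<delta> (\<Union>i. A i) \<le> (\<Sum>i::nat. hausdorff_content m \<delta> (A i))"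
proof (rule ennreal_le_epsilon)
  fix e :: real assume e: "e > 0" and fin: "(\<Sum>i. hausdorff_content m \<delta> (A i)) < top"
  have fin': "hausdorff_content m \<delta> (A i) < top" for i
    using fin ennreal_suminf_lessD by blast
  have "\<exists>U. A i \<subseteq> (\<Union>n. U n) \<and> (\<forall>n::nat. bounded (U n) \<and> diameter (U n) \<le> \<delta>) \<and>
     (\<Sum>n. hausdorff_gauge m (U n)) \<le> hausdorff_content m \<delta> (A i) + ennreal (e * (1/2) ^ Suc i)" for i
  proof -
    have "hausdorff_content m \<delta> (A i) < hausdorff_content m \<delta> (A i) + ennreal (e * (1/2) ^ Suc i)"
      using fin'[of i] e by (simp add: ennreal_add_left_cancel_less[of _ 0, simplified])
    then obtain U where "U \<in> {U :: nat \<Rightarrow> 'a set. A i \<subseteq> (\<Union>n. U n) \<and> (\<forall>n. bounded (U n) \<and> diameter (U n) \<le> \<delta>)}"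
      "(\<Sum>n. hausdorff_gauge m (U n)) < hausdorff_content m \<delta> (A i) + ennreal (e * (1/2) ^ Suc i)"
      by (subst (asm) (1) hausdorff_content_def) (unfold INF_less_iff, blast)
    then show ?thesis by (intro exI[of _ U]) auto
  qed
  then obtain U where U: "\<And>i. A i \<subseteq> (\<Union>n. U i n)"
      "\<And>i n::nat. bounded (U i n) \<and> diameter (U i n) \<le> \<delta>"
      "\<And>i. (\<Sum>n. hausdorff_gauge m (U i n)) \<le> hausdorff_content m \<delta> (A i) + ennreal (e * (1/2) ^ Suc i)"
    by metis
  define V where "V = (\<lambda>k. case prod_decode k of (i, n) \<Rightarrow> U i n)"
  have "(\<Union>i. A i) \<subseteq> (\<Union>k. V k)"
  proof
    fix x assume "x \<in> (\<Union>i. A i)"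
    then obtain i n where "x \<in> U i n" using U(1) by blast
    then have "x \<in> V (prod_encode (i, n))" by (simp add: V_def)
    then show "x \<in> (\<Union>k. V k)" by blast
  qed
  then have "hausdorff_content m \<delta> (\<Union>i. A i) \<le> (\<Sum>k. hausdorff_gauge m (V k))"
    using U(2) by (intro hausdorff_content_le) (auto simp: V_def split: prod.split)
  also have "\<dots> = (\<Sum>k. (\<lambda>(i, n). hausdorff_gauge m (U i n)) (prod_decode k))"
    by (simp add: V_def split_beta)
  also have "\<dots> = (\<Sum>i. \<Sum>n. hausdorff_gauge m (U i n))"
    by (subst suminf_ennreal_2dimen[symmetric, where f="\<lambda>(i, n). hausdorff_gauge m (U i n)"]) (auto simp: o_def)
  also have "\<dots> \<le> (\<Sum>i. hausdorff_content m \<delta> (A i) + ennreal (e * (1/2) ^ Suc i))"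
    by (intro suminf_le U(3)) auto
  also have "\<dots> = (\<Sum>i. hausdorff_content m \<delta> (A i)) + (\<Sum>i. ennreal (e * (1/2) ^ Suc i))"
    by (intro suminf_add[symmetric]) auto
  also have "(\<Sum>i. ennreal (e * (1/2) ^ Suc i)) = ennreal e"
    using e sums_mult[OF power_half_series, of e] by (intro suminf_ennreal_eq) auto
  finally show "hausdorff_content m \<delta> (\<Union>i. A i) \<le> (\<Sum>i. hausdorff_content m \<delta> (A i)) + ennreal e" .
qed

lemma outer_measure_space_hausdorff: "outer_measure_space UNIV (hausdorff_outer m)"
  unfolding outer_measure_space_def positive_def increasing_def countably_subadditive_def
proof (intro conjI allI impI ballI)
  show "hausdorff_outer m {} = 0"
    by (simp add: hausdorff_outer_def hausdorff_content_empty)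
next
  fix A B :: "'a set" assume "A \<subseteq> B"
  then show "hausdorff_outer m A \<le> hausdorff_outer m B"
    unfolding hausdorff_outer_def by (intro SUP_mono) (auto intro: hausdorff_content_mono)
next
  fix A :: "nat \<Rightarrow> 'a set"
  show "hausdorff_outer m (\<Union>i. A i) \<le> (\<Sum>i. hausdorff_outer m (A i))"
    unfolding hausdorff_outer_def[of m "\<Union>i. A i"]
  proof (rule SUP_least)
    fix \<delta> :: real assume "\<delta> \<in> {0<..}"
    then show "hausdorff_content m \<delta> (\<Union>i. A i) \<le> (\<Sum>i. hausdorff_outer m (A i))"
      by (intro order_trans[OF hausdorff_content_UN] suminf_le hausdorff_content_le_outer) auto
  qed
qed

lemma hausdorff_outer_mono: "A \<subseteq> B \<Longrightarrow> hausdorff_outer m A \<le> hausdorff_outer m B"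
  using outer_measure_space_hausdorff[of m] by (auto simp: outer_measure_space_def increasing_def)

lemma hausdorff_outer_empty: "hausdorff_outer m {} = 0"
  using outer_measure_space_hausdorff[of m] by (auto simp: outer_measure_space_def positive_def)

lemma hausdorff_outer_UN: "hausdorff_outer m (\<Union>i::nat. A i) \<le> (\<Sum>i. hausdorff_outer m (A i))"
  unfolding hausdorff_outer_def[of m "\<Union>i. A i"]
  by (rule SUP_least) 
    (auto intro!: order_trans[OF hausdorff_content_UN] suminf_le hausdorff_content_le_outer)

lemma hausdorff_outer_Un: "hausdorff_outer m (A \<union> B) \<le> hausdorff_outer m A + hausdorff_outer m B"
proof -
  have "(\<Union>i::nat. (if i = 0 then A else if i = 1 then B else {})) = A \<union> B"
    by (auto split: if_splits)
  then have "hausdorff_outer m (A \<union> B) \<le>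
      (\<Sum>i::nat. hausdorff_outer m (if i = 0 then A else if i = 1 then B else {}))"
    by (metis hausdorff_outer_UN)
  also have "\<dots> = (\<Sum>i\<in>{0, 1::nat}. hausdorff_outer m (if i = 0 then A else if i = 1 then B else {}))"
    by (intro suminf_finite) (auto simp: hausdorff_outer_empty)
  finally show ?thesis by simp
qed

lemma hausdorff_content_separated:
  assumes sep: "\<And>x y. x \<in> A \<Longrightarrow> y \<in> B \<Longrightarrow> \<delta> < dist x y"
    and "\<delta> > 0"
  shows "hausdorff_content m \<delta> A + hausdorff_content m \<delta> B \<le> hausdorff_content m \<delta> (A \<union> B)"
proof (rule hausdorff_content_ge)
  fix U :: "nat \<Rightarrow> 'a set"
  assume U: "A \<union> B \<subseteq> (\<Union>n. U n)" "\<And>n. bounded (U n) \<and> diameter (U n) \<le> \<delta>"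
  define V where "V = (\<lambda>S n. if U n \<inter> S = {} then {} else U n)"
  have le: "hausdorff_content m \<delta> S \<le> (\<Sum>n. hausdorff_gauge m (V S n))" if "S \<subseteq> A \<union> B" for S
  proof (rule hausdorff_content_le)
    show "S \<subseteq> (\<Union>n. V S n)"
    proof
      fix x assume "x \<in> S"
      then obtain n where "x \<in> U n" using U(1) \<open>S \<subseteq> A \<union> B\<close> by blast
      then have "x \<in> V S n" using \<open>x \<in> S\<close> by (auto simp: V_def)
      then show "x \<in> (\<Union>n. V S n)" by blast
    qed
    show "bounded (V S n) \<and> diameter (V S n) \<le> \<delta>" for n
      using U(2)[of n] \<open>\<delta> > 0\<close> by (auto simp: V_def)
  qed
  have "U n \<inter> A = {} \<or> U n \<inter> B = {}" for n
  proof (rule ccontr)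
    assume "\<not> ?thesis"
    then obtain x y where "x \<in> U n" "x \<in> A" "y \<in> U n" "y \<in> B" by blast
    then show False
      using sep[of x y] U(2)[of n] diameter_bounded_bound[of "U n" x y] by simp
  qed
  then have "hausdorff_gauge m (V A n) + hausdorff_gauge m (V B n) \<le> hausdorff_gauge m (U n)" for n
    by (auto simp: V_def)
  then have "(\<Sum>n. hausdorff_gauge m (V A n) + hausdorff_gauge m (V B n)) \<le> (\<Sum>n. hausdorff_gauge m (U n))"
    by (intro suminf_le) auto
  moreover have "hausdorff_content m \<delta> A + hausdorff_content m \<delta> B \<le>
      (\<Sum>n. hausdorff_gauge m (V A n)) + (\<Sum>n. hausdorff_gauge m (V B n))"
    by (intro add_mono le) auto
  ultimately show "hausdorff_content m \<delta> A + hausdorff_content m \<delta> B \<le> (\<Sum>n. hausdorff_gauge m (U n))"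
    by (simp add: suminf_add[symmetric])
qed

lemma hausdorff_outer_separated:
  assumes "\<eta> > 0" and sep: "\<And>x y. x \<in> A \<Longrightarrow> y \<in> B \<Longrightarrow> \<eta> \<le> dist x y"
  shows "hausdorff_outer m A + hausdorff_outer m B \<le> hausdorff_outer m (A \<union> B)"
proof -
  have "hausdorff_content m d A + hausdorff_content m e B \<le> hausdorff_outer m (A \<union> B)"
    if "d > 0" "e > 0" for d e
  proof -
    define \<delta> where "\<delta> = min (min d e) (\<eta> / 2)"
    have \<delta>: "\<delta> > 0" "\<delta> \<le> d" "\<delta> \<le> e" "\<delta> < \<eta>" using that assms(1) by (auto simp: \<delta>_def)
    have "hausdorff_content m d A + hausdorff_content m e B \<le>
        hausdorff_content m \<delta> A + hausdorff_content m \<delta> B"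
      by (intro add_mono hausdorff_content_antimono \<delta>)
    also have "\<dots> \<le> hausdorff_content m \<delta> (A \<union> B)"
      using \<delta> sep by (intro hausdorff_content_separated) force+
    also have "\<dots> \<le> hausdorff_outer m (A \<union> B)"
      by (intro hausdorff_content_le_outer \<delta>)
    finally show ?thesis .
  qed
  then show ?thesis
    unfolding hausdorff_outer_def[of m A] hausdorff_outer_def[of m B]
    by (auto simp: ennreal_SUP_add_left[symmetric] ennreal_SUP_add_right intro!: SUP_least)
qed

lemma hausdorff_outer_chain:
  fixes R :: "nat \<Rightarrow> 'a::metric_space set"
  assumes "\<And>i j. i < j \<Longrightarrow> \<exists>\<eta>>0. \<forall>x\<in>R i. \<forall>y\<in>R j. \<eta> \<le> dist x y"
  shows "(\<Sum>i<n. hausdorff_outer m (R i)) \<le> hausdorff_outer m (\<Union>i<n. R i)"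
proof (induction n)
  case (Suc n)
  obtain \<eta> where \<eta>: "\<And>i. i < n \<Longrightarrow> \<eta> i > 0" "\<And>i x y. i < n \<Longrightarrow> x \<in> R i \<Longrightarrow> y \<in> R n \<Longrightarrow> \<eta> i \<le> dist x y"
    using assms[of _ n] by metis
  define e where "e = Min (insert 1 (\<eta> ` {..<n}))"
  have "e > 0" using \<eta>(1) by (auto simp: e_def)
  moreover have "e \<le> dist x y" if xy: "x \<in> (\<Union>i<n. R i)" "y \<in> R n" for x y :: 'a
  proof -
    obtain i where "i < n" "x \<in> R i" using xy(1) by auto
    then have "e \<le> \<eta> i" by (auto simp: e_def)
    also have "\<eta> i \<le> dist x y" by (rule \<eta>(2)) fact+
    finally show ?thesis .
  qed
  ultimately have "hausdorff_outer m (\<Union>i<n. R i) + hausdorff_outer m (R n) \<le>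
      hausdorff_outer m ((\<Union>i<n. R i) \<union> R n)"
    by (intro hausdorff_outer_separated) auto
  also have "(\<Union>i<n. R i) \<union> R n = (\<Union>i<Suc n. R i)" by (auto simp: less_Suc_eq)
  finally show ?case using Suc by (simp add: add_mono order_trans[OF add_right_mono])
qed simp

lemma closed_hausdorff_caratheodory:
  assumes C: "closed C"
  shows "hausdorff_outer m (S \<inter> C) + hausdorff_outer m (S - C) \<le> hausdorff_outer m S"
proof (cases "hausdorff_outer m S = top")
  case False
  define A where "A = (\<lambda>n::nat. {x \<in> S. \<forall>y\<in>C. 1 / real (Suc n) \<le> dist x y})"
  define R where "R = (\<lambda>n. A (Suc n) - A n)"
  have A_mono: "A n \<subseteq> A (n + k)" for n k
  proof -
    have "1 / real (Suc (n + k)) \<le> 1 / real (Suc n)" by (simp add: field_simps)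
    then show ?thesis unfolding A_def by (blast intro: order_trans)
  qed
  have ex: "\<exists>n. x \<in> A n" if x: "x \<in> S - C" for x
  proof -
    have "open (- C)" using C by auto
    then obtain e where e: "e > 0" "\<And>y. dist y x < e \<Longrightarrow> y \<notin> C"
      using x unfolding open_dist by blast
    obtain n where "1 / real (Suc n) < e" using nat_approx_posE[OF e(1)] by auto
    then have "x \<in> A n" using x e(2) unfolding A_def
      by (auto simp: dist_commute) (meson less_le_trans linorder_not_le order.strict_trans)
    then show ?thesis ..
  qed
  have cover: "S - C \<subseteq> A n \<union> (\<Union>k. R (k + n))" for n
  proof
    fix x assume x: "x \<in> S - C"
    show "x \<in> A n \<union> (\<Union>k. R (k + n))"
    proof (cases "x \<in> A n")
      case False
      define p where "p = (LEAST k. x \<in> A k)"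
      have p: "x \<in> A p" unfolding p_def using ex[OF x] by (rule LeastI_ex)
      have "n < p"
        using A_mono[of p "n - p"] p False by (cases "p \<le> n") auto
      moreover have "x \<notin> A (p - 1)"
        using not_less_Least[of "p - 1" "\<lambda>k. x \<in> A k"] \<open>n < p\<close> by (auto simp: p_def)
      ultimately have "x \<in> R ((p - 1 - n) + n)" using p by (auto simp: R_def)
      then show ?thesis by blast
    qed simp
  qed
  have sepR: "\<exists>\<eta>>0. \<forall>x\<in>R i. \<forall>y\<in>R j. \<eta> \<le> dist x y" if "i + 2 \<le> j" for i j
  proof (intro exI conjI ballI)
    show "1 / real (i + 2) - 1 / real (Suc j) > 0"
      using that frac_less2[of 1 1 "real (i + 2)" "real (Suc j)"] by simp
    fix x y assume "x \<in> R i" "y \<in> R j"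
    then obtain z where z: "z \<in> C" "dist y z < 1 / real (Suc j)"
      by (auto simp: R_def A_def not_le)
    have "1 / real (i + 2) \<le> dist x z" using \<open>x \<in> R i\<close> z(1) by (auto simp: R_def A_def)
    also have "\<dots> \<le> dist x y + dist y z" by (rule dist_triangle)
    finally show "1 / real (i + 2) - 1 / real (Suc j) \<le> dist x y" using z(2) by simp
  qed
  have R_sub: "R i \<subseteq> S" for i by (auto simp: R_def A_def)
  have bound: "(\<Sum>k. hausdorff_outer m (R (2 * k + c))) \<le> hausdorff_outer m S" for c
  proof (rule suminf_le_const)
    fix n
    have "(\<Sum>k<n. hausdorff_outer m (R (2 * k + c))) \<le> hausdorff_outer m (\<Union>k<n. R (2 * k + c))"
      by (rule hausdorff_outer_chain) (rule sepR, simp)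
    also have "\<dots> \<le> hausdorff_outer m S" using R_sub by (intro hausdorff_outer_mono) blast
    finally show "(\<Sum>k<n. hausdorff_outer m (R (2 * k + c))) \<le> hausdorff_outer m S" .
  qed simp
  have "(\<Sum>k. hausdorff_outer m (R k)) \<le> hausdorff_outer m S + hausdorff_outer m S"
  proof (rule suminf_le_const)
    fix n
    have "(\<Sum>k<n. hausdorff_outer m (R k)) \<le> (\<Sum>k<2 * n. hausdorff_outer m (R k))"
      by (intro sum_mono2) auto
    also have "\<dots> = (\<Sum>k<n. hausdorff_outer m (R (2 * k + 0))) + (\<Sum>k<n. hausdorff_outer m (R (2 * k + 1)))"
      by (induction n) (auto simp: algebra_simps)
    also have "\<dots> \<le> (\<Sum>k. hausdorff_outer m (R (2 * k + 0))) + (\<Sum>k. hausdorff_outer m (R (2 * k + 1)))"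
      by (intro add_mono sum_le_suminf) auto
    also have "\<dots> \<le> hausdorff_outer m S + hausdorff_outer m S" by (intro add_mono bound)
    finally show "(\<Sum>k<n. hausdorff_outer m (R k)) \<le> hausdorff_outer m S + hausdorff_outer m S" .
  qed simp
  then have fin: "(\<Sum>k. hausdorff_outer m (R k)) \<noteq> top"
    using False by (auto simp: top_unique)
  define T where "T = (\<lambda>n. \<Sum>k. hausdorff_outer m (R (k + n)))"
  have T: "T \<longlonglongrightarrow> 0"
  proof -
    define r where "r = (\<lambda>k. enn2real (hausdorff_outer m (R k)))"
    have "hausdorff_outer m (R k) < top" for k
      using fin by (meson ennreal_suminf_lessD top.not_eq_extremum)
    then have r: "hausdorff_outer m (R k) = ennreal (r k)" "r k \<ge> 0" for k
      by (auto simp: r_def)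
    have "summable r"
      using fin r by (intro summable_suminf_not_top) auto
    then have "(\<lambda>n. \<Sum>k. r (k + n)) \<longlonglongrightarrow> 0"
      by (rule suminf_exist_split2)
    moreover have "T n = ennreal (\<Sum>k. r (k + n))" for n
      unfolding T_def r(1) using r(2) \<open>summable r\<close> by (intro suminf_ennreal2) (auto simp: summable_iff_shift)
    ultimately show ?thesis using tendsto_ennrealI[of _ 0] by (simp add: T_def)
  qed
  have "hausdorff_outer m (S \<inter> C) + hausdorff_outer m (S - C) \<le> hausdorff_outer m S + T n" for n
  proof -
    have "hausdorff_outer m (S - C) \<le> hausdorff_outer m (A n) + hausdorff_outer m (\<Union>k. R (k + n))"
      by (rule order_trans[OF hausdorff_outer_mono[OF cover[of n]] hausdorff_outer_Un])
    also have "\<dots> \<le> hausdorff_outer m (A n) + T n"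
      unfolding T_def by (intro add_left_mono hausdorff_outer_UN)
    finally have "hausdorff_outer m (S \<inter> C) + hausdorff_outer m (S - C) \<le>
        (hausdorff_outer m (S \<inter> C) + hausdorff_outer m (A n)) + T n"
      by (simp add: add_left_mono add.assoc)
    also have "hausdorff_outer m (S \<inter> C) + hausdorff_outer m (A n) \<le> hausdorff_outer m ((S \<inter> C) \<union> A n)"
      by (rule hausdorff_outer_separated[of "1 / real (Suc n)"]) (auto simp: A_def dist_commute)
    also have "\<dots> \<le> hausdorff_outer m S"
      by (intro hausdorff_outer_mono) (auto simp: A_def)
    finally show ?thesis by (simp add: add_right_mono)
  qed
  then show ?thesis
    using tendsto_add[OF tendsto_const T, of "hausdorff_outer m S"]
    by (intro tendsto_lowerbound[of _ _ sequentially]) auto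
qed simp

lemma measure_space_hausdorff: "measure_space UNIV (sets borel) (hausdorff_outer m)"
proof -
  interpret U: sigma_algebra UNIV "UNIV :: 'a set set" using sigma_algebra_Pow[of UNIV] by simp
  define L where "L = lambda_system UNIV UNIV (hausdorff_outer m :: 'a set \<Rightarrow> ennreal)"
  have L: "measure_space UNIV L (hausdorff_outer m)"
    unfolding L_def by (rule U.caratheodory_lemma[OF outer_measure_space_hausdorff])
  have "C \<in> L" if "closed C" for C :: "'a set"
    unfolding L_def U.lambda_system_eq using closed_hausdorff_caratheodory[OF that]
    by (auto intro!: antisym order_trans[OF _ hausdorff_outer_Un] hausdorff_outer_mono)
  then have "sigma_sets UNIV (Collect closed) \<subseteq> L"
    using L by (intro sigma_algebra.sigma_sets_subset) (auto simp: measure_space_def)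
  then have sub: "sets borel \<subseteq> L" by (simp add: borel_eq_closed)
  show ?thesis
    using L sub sets.sigma_algebra_axioms[of borel]
    by (auto simp: measure_space_def positive_def countably_additive_def subset_iff image_subset_iff)
qed

lemma sets_hausdorff_measure [simp]: "sets (hausdorff_measure m) = sets borel"
  and space_hausdorff_measure [simp]: "space (hausdorff_measure m) = UNIV"
  using sets.sigma_sets_eq[of borel]
  by (auto simp: hausdorff_measure_def)

lemma emeasure_hausdorff_measure:
  "A \<in> sets borel \<Longrightarrow> emeasure (hausdorff_measure m) A = hausdorff_outer m A"
  using measure_space_hausdorff[of m]
  by (intro emeasure_measure_of[OF hausdorff_measure_def]) (auto simp: measure_space_def)

definition boundary_measure :: "(real^'d::finite) set \<Rightarrow> (real^'d) measure" where
  "boundary_measure \<Omega> = restrict_space (hausdorff_measure (CARD('d) - 1)) (frontier \<Omega>)"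

text \<open>Traces are limits of boundary values of smooth functions.\<close>

definition is_trace ::
  "(real^'d::finite) set \<Rightarrow> (real^'d \<Rightarrow> real) \<Rightarrow> (real^'d \<Rightarrow> real) \<Rightarrow> bool" where
  "is_trace \<Omega> w g \<longleftrightarrow> g \<in> L2 (boundary_measure \<Omega>) \<and>
     (\<exists>\<phi>. (\<forall>n::nat. C_infinity (\<phi> n) \<and> \<phi> n \<in> Hk 1 \<Omega> \<and> \<phi> n \<in> L2 (boundary_measure \<Omega>)) \<and>
        (\<lambda>n. Hk_norm 1 \<Omega> (\<lambda>x. w x - \<phi> n x)) \<longlonglongrightarrow> 0 \<and>
        (\<lambda>n. L2_norm (boundary_measure \<Omega>) (\<lambda>x. g x - \<phi> n x)) \<longlonglongrightarrow> 0)"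

text \<open>Sobolev--Slobodeckij seminorm of order \<open>1/2\<close> on the \<open>(d - 1)\<close>-dimensional boundary: the
  exponent of the distance is \<open>(d - 1) + 2 * (1/2) = d\<close>.\<close>

definition slobodeckij_sq :: "(real^'d::finite) set \<Rightarrow> (real^'d \<Rightarrow> real) \<Rightarrow> ennreal" where
  "slobodeckij_sq \<Omega> g =
     (\<integral>\<^sup>+x. \<integral>\<^sup>+y. ennreal ((g x - g y)\<^sup>2 / dist x y ^ CARD('d))
        \<partial>boundary_measure \<Omega> \<partial>boundary_measure \<Omega>)"

definition H_half :: "(real^'d::finite) set \<Rightarrow> (real^'d \<Rightarrow> real) set" where
  "H_half \<Omega> = {g \<in> L2 (boundary_measure \<Omega>). slobodeckij_sq \<Omega> g < \<infinity>}"

definition H_half_norm :: "(real^'d::finite) set \<Rightarrow> (real^'d \<Rightarrow> real) \<Rightarrow> real" where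
  "H_half_norm \<Omega> g =
     sqrt ((L2_norm (boundary_measure \<Omega>) g)\<^sup>2 + enn2real (slobodeckij_sq \<Omega> g))"

definition trace_const :: "(real^'d::finite) set \<Rightarrow> real" where
  "trace_const \<Omega> = Inf {C. 0 \<le> C \<and>
     (\<forall>w\<in>Hk 1 \<Omega>. \<forall>g. is_trace \<Omega> w g \<longrightarrow>
        g \<in> H_half \<Omega> \<and> H_half_norm \<Omega> g \<le> C * Hk_norm 1 \<Omega> w)}"


section \<open>Deep neural networks\<close>

definition smooth_activation :: "(real \<Rightarrow> real) \<Rightarrow> bool" where
  "smooth_activation \<sigma> \<longleftrightarrow>
     (\<forall>n x. (deriv ^^ n) \<sigma> field_differentiable (at x)) \<and> (\<nexists>p. \<forall>x. \<sigma> x = poly p x)"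

text \<open>A layer is a pair of a weight matrix, given by the list of its rows, and a bias vector.\<close>

type_synonym layer = "real list list \<times> real list"

definition dot :: "real list \<Rightarrow> real list \<Rightarrow> real" where
  "dot v w = sum_list (map2 (*) v w)"

definition apply_layer :: "(real \<Rightarrow> real) \<Rightarrow> layer \<Rightarrow> real list \<Rightarrow> real list" where
  "apply_layer \<sigma> = (\<lambda>(W, b) v. map \<sigma> (map2 (\<lambda>r \<beta>. dot r v + \<beta>) W b))"

text \<open>\<open>compatible n Ls m\<close>: the layers can be composed, mapping input vectors of length \<open>n\<close> to
  output vectors of length \<open>m\<close>.\<close>

fun compatible :: "nat \<Rightarrow> layer list \<Rightarrow> nat \<Rightarrow> bool" where
  "compatible n [] m \<longleftrightarrow> n = m"
| "compatible n ((W, b) # Ls) m \<longleftrightarrow>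
     W \<noteq> [] \<and> length b = length W \<and> (\<forall>r\<in>set W. length r = n) \<and> compatible (length W) Ls m"

text \<open>The coordinates of the input in an arbitrary but fixed order.\<close>

definition coords :: "real^'d::finite \<Rightarrow> real list" where
  "coords x = map (\<lambda>k. x $ from_nat_into UNIV k) [0..<CARD('d)]"

definition network ::
  "(real \<Rightarrow> real) \<Rightarrow> layer list \<Rightarrow> real list \<Rightarrow> real \<Rightarrow> real^'d::finite \<Rightarrow> real" where
  "network \<sigma> Ls c \<beta> x = dot c (fold (apply_layer \<sigma>) Ls (coords x)) + \<beta>"

text \<open>The size of a network is the total number of its weights and biases.\<close>

definition network_size :: "layer list \<Rightarrow> real list \<Rightarrow> nat" where
  "network_size Ls c =
     (\<Sum>(W, b)\<leftarrow>Ls. sum_list (map length W) + length b) + length c + 1"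

definition DNN :: "(real \<Rightarrow> real) \<Rightarrow> nat \<Rightarrow> (real^'d::finite \<Rightarrow> real) set" where
  "DNN \<sigma> N = {network \<sigma> Ls c \<beta> | Ls c \<beta>.
     Ls \<noteq> [] \<and> compatible CARD('d) Ls (length c) \<and> network_size Ls c = N}"

end

theory Submission
  imports Defs
begin

text \<open>Networks with one hidden layer are dense in the \<open>H\<^sup>2\<close> norm, and each of the quantities to be
  estimated is controlled by the square of the \<open>H\<^sup>2\<close> error of an approximation \<open>v\<close> to \<open>u\<close>. Taking that
  error small enough for the given data therefore absorbs every constant, and \<open>C = 1\<close> is possible.

  Convex domains and domains with \<open>C\<^sup>2\<close> boundary have the uniform cone property: near each boundary
  point the closure of \<open>\<Omega>\<close> is pushed into \<open>\<Omega>\<close> by a fixed cone of directions. Localising with a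
  partition of unity, translating along the cone and mollifying with a kernel supported in it
  approximates \<open>u\<close> up to the boundary. When the kernel is replaced by a nearby combination of
  exponential ridge functions, the mollification becomes such a combination as well, and this is
  approximated, with its derivatives, by ridge functions of any smooth non-polynomial \<open>\<sigma>\<close>.

  In dimension at most three, averaging Taylor's formula over the cone bounds \<open>sup v\<close> by the \<open>H\<^sup>2\<close>
  norm, so the nonlinear term is continuous in \<open>H\<^sup>2\<close>. Integrating along the tubes in the cone
  direction issuing from a separated subset of the boundary bounds the \<open>L\<^sup>2\<close> norm for the Hausdorff
  measure by the \<open>H\<^sup>1\<close> norm. Applied to \<open>v - \<phi>\<close> with \<open>\<phi>\<close> a test function close to \<open>u\<close>, this
  estimates the boundary values of \<open>v\<close>.\<close>

text \<open>A change of variables that flattens the boundary would spoil second derivatives when the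
  domain is merely convex; translation commutes with derivatives of every order, so both shapes are
  treated through the one property that they share. Exponentials are the intermediate class for two
  reasons. The function \<open>exp (v \<bullet> (y - x))\<close> splits into a factor in
  \<open>x\<close> and a factor in \<open>y\<close>, so integrating against it never leaves the
  finite exponential sums; and products of exponentials are exponentials, so a product kernel can be
  fitted one variable at a time.

  The nonlinear term creates a circularity: the gradient error is multiplied by the supremum of the
  approximant, which has to be bounded before the accuracy is chosen. A reference network of
  accuracy one gives this bound. On the boundary the norm is taken with respect to the Hausdorff
  measure itself, so the trace estimate comes from packing and covering: Riemann sums over separated
  points, in which all powers of the mesh size cancel, take the place of integration in
  charts.\<close>

inductive_set palg :: "('a \<Rightarrow> real) set \<Rightarrow> ('a \<Rightarrow> real) set" for B where
  base: "f \<in> B \<Longrightarrow> f \<in> palg B"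
| const: "(\<lambda>_. c) \<in> palg B"
| add: "f \<in> palg B \<Longrightarrow> g \<in> palg B \<Longrightarrow> (\<lambda>x. f x + g x) \<in> palg B"
| mult: "f \<in> palg B \<Longrightarrow> g \<in> palg B \<Longrightarrow> (\<lambda>x. f x * g x) \<in> palg B"

subsection \<open>Smooth functions of one variable\<close>

definition smooth :: "(real \<Rightarrow> real) \<Rightarrow> bool" where
  "smooth f \<longleftrightarrow> (\<forall>n x. (deriv ^^ n) f field_differentiable (at x))"

lemma smooth_DERIV:
  "smooth f \<Longrightarrow> ((deriv ^^ n) f has_real_derivative (deriv ^^ Suc n) f x) (at x)"
  by (simp add: smooth_def DERIV_deriv_iff_field_differentiable)

lemma smooth_higher_deriv: "smooth f \<Longrightarrow> smooth ((deriv ^^ n) f)"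
  unfolding smooth_def by (simp flip: funpow_add[THEN fun_cong, unfolded o_def])

lemma smooth_continuous: "smooth f \<Longrightarrow> continuous_on S ((deriv ^^ n) f)"
  by (meson smooth_DERIV DERIV_isCont continuous_at_imp_continuous_on)

text \<open>Every iterated derivative stays in \<open>S\<close>, so smoothness follows from closure
  under a single differentiation, without a formula for the derivative of order
  \<open>n\<close>.\<close>

lemma smooth_coinduct:
  assumes "\<And>f. f \<in> S \<Longrightarrow> \<exists>g\<in>S. \<forall>x. (f has_real_derivative g x) (at x)" and "f \<in> S"
  shows "smooth f"
proof -
  have *: "deriv g \<in> S \<and> (\<forall>x. g field_differentiable (at x))" if "g \<in> S" for g
  proof -
    obtain g' where g': "g' \<in> S" "\<forall>x. (g has_real_derivative g' x) (at x)" using assms(1)[OF \<open>g \<in> S\<close>] by blast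
    then have "deriv g = g'" by (auto intro: DERIV_imp_deriv)
    then show ?thesis using g' by (auto simp: field_differentiable_def)
  qed
  have "(deriv ^^ n) f \<in> S" for n by (induction n) (auto simp: assms *)
  then show ?thesis using * by (auto simp: smooth_def)
qed

text \<open>The sum and product rules make \<open>palg B\<close> closed under differentiation as
  soon as the derivatives of the generators belong to it, so only generators ever have to be
  differentiated.\<close>

lemma smooth_palg:
  assumes B: "\<And>b. b \<in> B \<Longrightarrow> \<exists>g\<in>palg B. \<forall>x. (b has_real_derivative g x) (at x)" and f: "f \<in> palg B"
  shows "smooth f"
proof (rule smooth_coinduct[OF _ f])
  fix f assume "f \<in> palg B"
  then show "\<exists>g\<in>palg B. \<forall>x. (f has_real_derivative g x) (at x)"
  proof induction
    case (base f) then show ?case by (rule B)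
  next
    case (const c) then show ?case by (intro bexI[of _ "\<lambda>_. 0"]) (auto intro: palg.const)
  next
    case (add f g)
    then obtain f' g' where "f' \<in> palg B" "g' \<in> palg B" "\<forall>x. (f has_real_derivative f' x) (at x)"
      "\<forall>x. (g has_real_derivative g' x) (at x)" by blast
    then show ?case
      by (intro bexI[of _ "\<lambda>x. f' x + g' x"]) (auto intro: palg.add DERIV_add)
  next
    case (mult f g)
    then obtain f' g' where "f' \<in> palg B" "g' \<in> palg B" "\<forall>x. (f has_real_derivative f' x) (at x)"
      "\<forall>x. (g has_real_derivative g' x) (at x)" by blast
    then show ?case using mult
      by (intro bexI[of _ "\<lambda>x. f' x * g x + g' x * f x"]) (auto intro: palg.add palg.mult DERIV_mult)
  qed
qed

lemma smooth_mult:
  assumes "smooth f" "smooth g" shows "smooth (\<lambda>x. f x * g x)"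
proof (rule smooth_palg[of "Collect smooth"])
  show "\<exists>h\<in>palg (Collect smooth). \<forall>x. (b has_real_derivative h x) (at x)" if "b \<in> Collect smooth" for b
    using that smooth_DERIV[of b 0] smooth_higher_deriv[of b 1] by (intro bexI[of _ "deriv b"]) (auto intro: palg.base)
qed (use assms in \<open>auto intro: palg.intros\<close>)

lemma smooth_affine:
  assumes "smooth f" shows "smooth (\<lambda>x. f (a * x + b))"
proof (rule smooth_palg[of "{\<lambda>x. (deriv ^^ n) f (a * x + b) | n. True}"])
  fix g assume "g \<in> {\<lambda>x. (deriv ^^ n) f (a * x + b) | n. True}"
  then obtain n where g: "g = (\<lambda>x. (deriv ^^ n) f (a * x + b))" by blast
  have "(g has_real_derivative (deriv ^^ Suc n) f (a * x + b) * a) (at x)" for x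
    unfolding g by (rule DERIV_chain2[OF smooth_DERIV[OF assms]]) (auto intro!: derivative_eq_intros)
  then show "\<exists>h\<in>palg {\<lambda>x. (deriv ^^ n) f (a * x + b) | n. True}. \<forall>x. (g has_real_derivative h x) (at x)"
    by (intro bexI[of _ "\<lambda>x. (deriv ^^ Suc n) f (a * x + b) * a"] palg.mult[OF palg.base palg.const]) blast+
qed (auto intro!: palg.base exI[of _ 0])

definition flat :: "real \<Rightarrow> real" where
  "flat x = (if x > 0 then exp (- inverse x) else 0)"

lemma flat_nonneg: "flat x \<ge> 0" and flat_pos_iff: "flat x > 0 \<longleftrightarrow> x > 0" and flat_zero: "x \<le> 0 \<Longrightarrow> flat x = 0"
  by (auto simp: flat_def)

text \<open>The generators are the functions \<open>inverse x ^ k * exp (- inverse x)\<close>,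
  extended by zero. The derivative of the one with index \<open>k\<close> combines those with
  indices \<open>k + 1\<close> and \<open>k + 2\<close>; at the origin its difference quotient is
  exactly the one with index \<open>k + 1\<close>, which tends to zero.\<close>

lemma smooth_flat: "smooth flat"
proof -
  define b where "b = (\<lambda>k x. if x > (0::real) then inverse x ^ k * exp (- inverse x) else 0)"
  have lim: "(b k \<longlongrightarrow> 0) (at 0)" for k
  proof -
    have "((\<lambda>x::real. inverse x ^ k / exp (inverse x)) \<longlongrightarrow> 0) (at_right 0)"
      by (rule filterlim_compose[OF tendsto_power_div_exp_0 filterlim_inverse_at_top_right])
    then have "(b k \<longlongrightarrow> 0) (at_right 0)"
      by (rule Lim_transform_eventually)
        (auto simp: b_def exp_minus divide_inverse eventually_at_filter)
    moreover have "(b k \<longlongrightarrow> 0) (at_left 0)"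
      by (rule Lim_transform_eventually[OF tendsto_const]) (auto simp: b_def eventually_at_filter)
    ultimately show ?thesis by (simp add: filterlim_split_at)
  qed
  have D: "(b k has_real_derivative (- real k) * b (Suc k) x + b (k + 2) x) (at x)" for k x
  proof -
    consider "x > 0" | "x = 0" | "x < 0" by linarith
    then show ?thesis
    proof cases
      case 1
      have "((\<lambda>x. inverse x ^ k * exp (- inverse x)) has_real_derivative
          (- real k) * b (Suc k) x + b (k + 2) x) (at x)"
      proof -
        have "((\<lambda>x. inverse x ^ k) has_real_derivative - real k * inverse x ^ Suc k) (at x)"
          using DERIV_power[OF DERIV_inverse[of x], of k] 1 by (cases k) (auto simp: algebra_simps)
        moreover have "((\<lambda>x. exp (- inverse x)) has_real_derivative exp (- inverse x) * (inverse x)\<^sup>2) (at x)"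
          using 1 by (auto intro!: derivative_eq_intros simp: power2_eq_square)
        ultimately show ?thesis
          by (rule DERIV_cong[OF DERIV_mult]) (use 1 in \<open>simp add: b_def power2_eq_square algebra_simps\<close>)
      qed
      moreover have "\<forall>\<^sub>F y in nhds x. b k y = inverse y ^ k * exp (- inverse y)"
        using eventually_nhds_in_open[of "{0<..}" x] 1 by (auto elim!: eventually_mono simp: b_def)
      ultimately show ?thesis by (subst DERIV_cong_ev[OF refl _ refl])
    next
      case 2
      have "(\<lambda>h. (b k (0 + h) - b k 0) / h) = (\<lambda>h. b (Suc k) h)"
        by (auto simp: b_def fun_eq_iff divide_inverse)
      then have "(b k has_real_derivative 0) (at 0)" using lim[of "Suc k"] by (simp add: DERIV_def)
      then show ?thesis using 2 by (simp add: b_def)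
    next
      case 3
      have "\<forall>\<^sub>F y in nhds x. b k y = 0"
        using eventually_nhds_in_open[of "{..<0}" x] 3 by (auto elim!: eventually_mono simp: b_def)
      then have "(b k has_real_derivative 0) (at x)" by (subst DERIV_cong_ev[OF refl _ refl]) auto
      then show ?thesis using 3 by (simp add: b_def)
    qed
  qed
  have "smooth (b 0)"
  proof (rule smooth_palg[of "range b"])
    fix g assume "g \<in> range b"
    then obtain k where "g = b k" by blast
    then show "\<exists>h\<in>palg (range b). \<forall>x. (g has_real_derivative h x) (at x)"
      by (intro bexI[of _ "\<lambda>x. (- real k) * b (Suc k) x + b (k + 2) x"] allI
          palg.add palg.mult[OF palg.const palg.base] palg.base)
        (auto simp only: intro!: D)
  qed (auto intro: palg.base)
  moreover have "b 0 = flat" by (auto simp: b_def flat_def)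
  ultimately show ?thesis by simp
qed

subsection \<open>Smooth functions of several variables\<close>

lemma partial_eqI: "(f has_derivative f') (at x) \<Longrightarrow> partial i f x = f' (axis i 1)"
  unfolding partial_def using frechet_derivative_at by metis

lemma partials_append: "partials (v @ w) f = partials v (partials w f)"
  by (induction v) auto

text \<open>Differentiability of all iterated partial derivatives also yields their continuity, so
  both clauses of \<open>C_k\<close> come from the closure of \<open>S\<close> under
  \<open>partial\<close>.\<close>

lemma C_infinity_coinduct:
  assumes S: "\<And>f x. f \<in> S \<Longrightarrow> f differentiable (at x)" "\<And>f i. f \<in> S \<Longrightarrow> partial i f \<in> S" and f: "f \<in> S"
  shows "C_infinity f"
proof -
  have "partials w f \<in> S" for w by (induction w) (auto simp: assms)
  then show ?thesis unfolding C_infinity_def C_k_def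
    by (auto intro!: S(1) continuous_at_imp_continuous_on differentiable_imp_continuous_within)
qed

lemma C_infinity_partials: "C_infinity f \<Longrightarrow> C_infinity (partials w f)"
proof (rule C_infinity_coinduct[of "{partials v f | v. True}"])
  fix g i assume "g \<in> {partials v f |v. True}"
  then obtain v where "g = partials v f" by blast
  then have "partial i g = partials (i # v) f" by simp
  then show "partial i g \<in> {partials v f |v. True}" by blast
qed (auto simp: C_infinity_def C_k_def)

lemma C_infinity_differentiable: "C_infinity f \<Longrightarrow> f differentiable (at x)"
  unfolding C_infinity_def C_k_def by (metis length_greater_0_conv lessI list.size(3) partials.simps(1))

lemma C_infinity_partial: "C_infinity f \<Longrightarrow> C_infinity (partial i f)"
  using C_infinity_partials[of f "[i]"] by simp

lemma C_infinity_continuous: "C_infinity f \<Longrightarrow> continuous_on S f"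
  using C_infinity_differentiable by (meson continuous_at_imp_continuous_on differentiable_imp_continuous_within)

lemma C_infinity_borel: "C_infinity f \<Longrightarrow> f \<in> borel_measurable borel"
  by (simp add: C_infinity_continuous borel_measurable_continuous_onI)

lemma has_derivative_partials:
  assumes "f differentiable (at x)"
  shows "(f has_derivative (\<lambda>h. \<Sum>i\<in>UNIV. h $ i * partial i f x)) (at x)"
proof -
  have D: "(f has_derivative frechet_derivative f (at x)) (at x)"
    using assms by (simp add: frechet_derivative_works)
  have lin: "linear (frechet_derivative f (at x))" using D by (rule has_derivative_linear)
  have "frechet_derivative f (at x) h = (\<Sum>i\<in>UNIV. h $ i * partial i f x)" for h
  proof -
    have "frechet_derivative f (at x) h = frechet_derivative f (at x) (\<Sum>i\<in>UNIV. h $ i *\<^sub>R axis i 1)"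
      by (metis (mono_tags, lifting) basis_expansion scalar_mult_eq_scaleR sum.cong)
    then show ?thesis by (simp add: linear_sum[OF lin] linear_cmul[OF lin] partial_def)
  qed
  then show ?thesis using D by presburger
qed

lemma has_derivative_partial:
  "f differentiable (at x) \<Longrightarrow> \<exists>f'. (f has_derivative f') (at x) \<and> (\<forall>i. partial i f x = f' (axis i 1))"
  using partial_eqI by (metis differentiable_def)

lemma partial_const [simp]: "partial i (\<lambda>x. c) = (\<lambda>x. 0)"
  by (auto simp: fun_eq_iff intro!: partial_eqI[of _ "\<lambda>_. 0", simplified])

lemma partial_add:
  assumes "f differentiable (at x)" "g differentiable (at x)"
  shows "partial i (\<lambda>x. f x + g x) x = partial i f x + partial i g x"
proof -
  obtain f' g' where f': "(f has_derivative f') (at x)" "\<forall>i. partial i f x = f' (axis i 1)"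
    "(g has_derivative g') (at x)" "\<forall>i. partial i g x = g' (axis i 1)"
    using has_derivative_partial assms by metis
  show ?thesis using partial_eqI[OF has_derivative_add[OF f'(1,3)]] f'(2,4) by simp
qed

lemma partial_mult:
  assumes "f differentiable (at x)" "g differentiable (at x)"
  shows "partial i (\<lambda>x. f x * g x) x = f x * partial i g x + partial i f x * g x"
proof -
  obtain f' g' where f': "(f has_derivative f') (at x)" "\<forall>i. partial i f x = f' (axis i 1)"
    "(g has_derivative g') (at x)" "\<forall>i. partial i g x = g' (axis i 1)"
    using has_derivative_partial assms by metis
  show ?thesis using partial_eqI[OF has_derivative_mult[OF f'(1,3)]] f'(2,4) by simp
qed

lemma partial_compose:
  assumes "f differentiable (at x)" "(h has_real_derivative D) (at (f x))"
  shows "(\<lambda>x. h (f x)) differentiable (at x)" "partial i (\<lambda>x. h (f x)) x = D * partial i f x"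
proof -
  obtain f' where f': "(f has_derivative f') (at x)" "\<forall>i. partial i f x = f' (axis i 1)"
    using has_derivative_partial assms by metis
  have "((\<lambda>x. h (f x)) has_derivative (\<lambda>y. f' y * D)) (at x)"
    using has_derivative_compose[OF f'(1), of h "(*) D"] assms(2)
    by (simp add: has_field_derivative_def mult.commute)
  then show "(\<lambda>x. h (f x)) differentiable (at x)" "partial i (\<lambda>x. h (f x)) x = D * partial i f x"
    using partial_eqI f'(2) by (fastforce simp: differentiable_def)+
qed

lemma C_infinity_palg:
  assumes B: "\<And>b x. b \<in> B \<Longrightarrow> b differentiable (at x)" "\<And>b i. b \<in> B \<Longrightarrow> partial i b \<in> palg B"
    and f: "f \<in> palg B"
  shows "C_infinity f"
proof (rule C_infinity_coinduct[OF _ _ f])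
  have diff: "f differentiable (at x)" if "f \<in> palg B" for f x
    using that
  proof induction
    case (base f) then show ?case by (rule B(1))
  qed (simp_all add: differentiable_const differentiable_add differentiable_mult)
  then show "f differentiable (at x)" if "f \<in> palg B" for f x using that .
  show "partial i f \<in> palg B" if "f \<in> palg B" for f i
    using that
  proof induction
    case (add f g)
    have "partial i (\<lambda>x. f x + g x) = (\<lambda>x. partial i f x + partial i g x)"
      using partial_add diff add(1,2) by blast
    with add show ?case by (simp add: palg.add)
  next
    case (mult f g)
    have "partial i (\<lambda>x. f x * g x) = (\<lambda>x. f x * partial i g x + partial i f x * g x)"
      using partial_mult diff mult(1,2) by blast
    with mult show ?case by (simp add: palg.add palg.mult)
  qed (simp_all add: B(2) palg.const)
qed

lemma palg_C_infinity: "f \<in> palg (Collect C_infinity) \<Longrightarrow> C_infinity f"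
  by (erule C_infinity_palg[rotated 2]) (auto intro: palg.base C_infinity_partial C_infinity_differentiable)

lemma C_infinity_const: "C_infinity (\<lambda>_. c)"
  by (rule palg_C_infinity) (rule palg.const)

lemma C_infinity_add: "C_infinity f \<Longrightarrow> C_infinity g \<Longrightarrow> C_infinity (\<lambda>x. f x + g x)"
  by (rule palg_C_infinity) (auto intro: palg.intros)

lemma C_infinity_mult: "C_infinity f \<Longrightarrow> C_infinity g \<Longrightarrow> C_infinity (\<lambda>x. f x * g x)"
  by (rule palg_C_infinity) (auto intro: palg.intros)

lemma C_infinity_diff: "C_infinity f \<Longrightarrow> C_infinity g \<Longrightarrow> C_infinity (\<lambda>x. f x - g x)"
  using C_infinity_add[OF _ C_infinity_mult[OF C_infinity_const[of "-1"]], of f g] by simp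

lemma C_infinity_sum: "(\<And>a. a \<in> A \<Longrightarrow> C_infinity (f a)) \<Longrightarrow> C_infinity (\<lambda>x. \<Sum>a\<in>A. f a x)"
  by (induction A rule: infinite_finite_induct) (auto intro: C_infinity_const C_infinity_add)

lemma C_infinity_prod: "(\<And>a. a \<in> A \<Longrightarrow> C_infinity (f a)) \<Longrightarrow> C_infinity (\<lambda>x. \<Prod>a\<in>A. f a x)"
  by (induction A rule: infinite_finite_induct) (auto intro: C_infinity_const C_infinity_mult)

lemma has_derivative_inner_affine: "((\<lambda>x. v \<bullet> x + b) has_derivative (\<lambda>h. v \<bullet> h)) (at x)"
  by (auto intro!: derivative_eq_intros)

lemma partial_inner_affine: "partial i (\<lambda>x. v \<bullet> x + b) = (\<lambda>x. v $ i)"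
  using partial_eqI[OF has_derivative_inner_affine] by (auto simp: fun_eq_iff inner_axis)

lemma C_infinity_inner_affine: "C_infinity (\<lambda>x. v \<bullet> x + b)"
  by (rule C_infinity_palg[of "{\<lambda>x. v \<bullet> x + b}"])
     (auto simp: partial_inner_affine intro: palg.intros has_derivative_inner_affine differentiableI)

lemma C_infinity_nth: "C_infinity (\<lambda>x. x $ i)"
  using C_infinity_inner_affine[of "axis i 1" 0] by (simp add: inner_axis' )

text \<open>With \<open>f\<close> fixed, the generators are the compositions of all derivatives of
  \<open>h\<close> with \<open>f\<close>, together with every smooth function. By the chain rule a
  partial derivative of such a composition is a product of two generators.\<close>

lemma C_infinity_compose:
  assumes h: "smooth h" and f: "C_infinity f" shows "C_infinity (\<lambda>x. h (f x))"
proof (rule C_infinity_palg)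
  let ?H = "{\<lambda>x. (deriv ^^ n) h (f x) | n. True}"
  let ?B = "?H \<union> Collect C_infinity"
  show "b differentiable (at x)" if bB: "b \<in> ?B" for b x
  proof (cases "C_infinity b")
    case False
    then obtain n where b: "b = (\<lambda>x. (deriv ^^ n) h (f x))" using bB by blast
    show ?thesis unfolding b by (rule partial_compose(1)[OF C_infinity_differentiable[OF f] smooth_DERIV[OF h]])
  qed (rule C_infinity_differentiable)
  show "partial i b \<in> palg ?B" if bB: "b \<in> ?B" for b i
  proof (cases "C_infinity b")
    case True
    then show ?thesis by (intro palg.base UnI2) (simp add: C_infinity_partial)
  next
    case False
    then obtain n where b: "b = (\<lambda>x. (deriv ^^ n) h (f x))" using bB by blast
    have eq: "partial i b = (\<lambda>x. (deriv ^^ Suc n) h (f x) * partial i f x)"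
      unfolding b by (rule ext) (rule partial_compose(2)[OF C_infinity_differentiable[OF f] smooth_DERIV[OF h]])
    have "(\<lambda>x. (deriv ^^ Suc n) h (f x)) \<in> ?H" by blast
    moreover have "partial i f \<in> Collect C_infinity" using f by (simp add: C_infinity_partial)
    ultimately show ?thesis unfolding eq by (intro palg.mult palg.base UnI1 UnI2)
  qed
  have "(\<lambda>x. (deriv ^^ 0) h (f x)) \<in> ?H" by blast
  then show "(\<lambda>x. h (f x)) \<in> palg ?B" by (intro palg.base UnI1) simp
qed

text \<open>\<open>inverse\<close> is not smooth on the whole line, so the composition rule does not
  apply. Instead the reciprocal itself is a generator: its partial derivatives are polynomials in it
  and in partial derivatives of \<open>f\<close>.\<close>

lemma C_infinity_inverse:
  assumes f: "C_infinity f" "\<And>x. f x \<noteq> 0" shows "C_infinity (\<lambda>x. inverse (f x))"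
proof (rule C_infinity_palg)
  let ?B = "insert (\<lambda>x. inverse (f x)) (Collect C_infinity)"
  have D: "(inverse has_real_derivative - (inverse (f x) * inverse (f x))) (at (f x))" for x
    using DERIV_inverse[of "f x"] f(2) by (simp add: power2_eq_square numeral_2_eq_2)
  show "b differentiable (at x)" if bB: "b \<in> ?B" for b x
  proof (cases "C_infinity b")
    case False
    then have b: "b = (\<lambda>x. inverse (f x))" using bB by blast
    show ?thesis unfolding b by (rule partial_compose(1)[OF C_infinity_differentiable[OF f(1)] D])
  qed (rule C_infinity_differentiable)
  show "partial i b \<in> palg ?B" if bB: "b \<in> ?B" for b i
  proof (cases "C_infinity b")
    case True
    then show ?thesis by (intro palg.base insertI2) (simp add: C_infinity_partial)
  next
    case False
    then have b: "b = (\<lambda>x. inverse (f x))" using bB by blast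
    have eq: "partial i b = (\<lambda>x. (-1) * (inverse (f x) * inverse (f x)) * partial i f x)"
      unfolding b by (rule ext) (simp add: partial_compose(2)[OF C_infinity_differentiable[OF f(1)] D])
    have "partial i f \<in> Collect C_infinity" using f by (simp add: C_infinity_partial)
    then show ?thesis unfolding eq
      by (intro palg.mult palg.const palg.base[of "partial i f"] palg.base[OF insertI1] insertI2)
  qed
qed (rule palg.base, rule insertI1)

lemma partials_const: "partials w (\<lambda>_. c) = (\<lambda>_. if w = [] then c else 0)"
  by (induction w) auto

lemma partials_add:
  assumes "C_infinity f" "C_infinity g"
  shows "partials w (\<lambda>x. f x + g x) = (\<lambda>x. partials w f x + partials w g x)"
proof (induction w)
  case (Cons i w)
  show ?case unfolding partials.simps Cons
    by (rule ext) (intro partial_add C_infinity_differentiable C_infinity_partials assms)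
qed simp

lemma partials_cmult:
  assumes "C_infinity f"
  shows "partials w (\<lambda>x. c * f x) = (\<lambda>x. c * partials w f x)"
proof (induction w)
  case (Cons i w)
  have "partial i (\<lambda>x. c * partials w f x) x = c * partial i (partials w f) x" for x
    by (subst partial_mult) (auto intro: C_infinity_differentiable C_infinity_partials assms)
  then show ?case unfolding partials.simps Cons by blast
qed simp

lemma partials_diff:
  assumes "C_infinity f" "C_infinity g"
  shows "partials w (\<lambda>x. f x - g x) = (\<lambda>x. partials w f x - partials w g x)"
  using partials_add[OF assms(1) C_infinity_mult[OF C_infinity_const assms(2)], of w "-1"]
    partials_cmult[OF assms(2), of w "-1"] by simp

lemma partials_sum:
  assumes "\<And>a. a \<in> A \<Longrightarrow> C_infinity (f a)"
  shows "partials w (\<lambda>x. \<Sum>a\<in>A. f a x) = (\<lambda>x. \<Sum>a\<in>A. partials w (f a) x)"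
  using assms
proof (induction A rule: infinite_finite_induct)
  case (insert a A)
  have f: "C_infinity (f a)" and F: "C_infinity (\<lambda>x. \<Sum>a\<in>A. f a x)"
    using insert.prems by (simp, simp add: C_infinity_sum)
  have IH: "partials w (\<lambda>x. \<Sum>a\<in>A. f a x) = (\<lambda>x. \<Sum>a\<in>A. partials w (f a) x)"
    using insert.prems by (intro insert.IH) simp
  show ?case using partials_add[OF f F, of w] insert.hyps unfolding IH by simp
qed (simp_all add: partials_const)

lemma partials_ridge:
  assumes "smooth h"
  shows "partials w (\<lambda>x. h (v \<bullet> x + b)) = (\<lambda>x. (\<Prod>i\<leftarrow>w. v $ i) * (deriv ^^ length w) h (v \<bullet> x + b))"
proof (induction w)
  case (Cons i w)
  let ?c = "\<Prod>i\<leftarrow>w. v $ i" and ?h = "(deriv ^^ length w) h"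
  have C: "C_infinity (\<lambda>x. ?h (v \<bullet> x + b))"
    by (rule C_infinity_compose[OF smooth_higher_deriv[OF assms] C_infinity_inner_affine])
  have "partial i (\<lambda>x. ?h (v \<bullet> x + b)) x = (deriv ^^ Suc (length w)) h (v \<bullet> x + b) * v $ i" for x
    using partial_compose(2)[OF C_infinity_differentiable[OF C_infinity_inner_affine[of v b]]
        smooth_DERIV[OF assms, of "length w"], of i x]
    unfolding partial_inner_affine .
  moreover have "partial i (\<lambda>x. ?c * ?h (v \<bullet> x + b)) = (\<lambda>x. ?c * partial i (\<lambda>x. ?h (v \<bullet> x + b)) x)"
    using partials_cmult[OF C, of "[i]" ?c] by simp
  ultimately show ?case unfolding partials.simps Cons by (simp add: mult_ac)
qed simp

lemma partial_translate:
  assumes "f differentiable (at (y - c))"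
  shows "partial i (\<lambda>y. f (y - c)) y = partial i f (y - c)" "(\<lambda>y. f (y - c)) differentiable (at y)"
proof -
  obtain f' where f': "(f has_derivative f') (at (y - c))"
    "\<forall>i. partial i f (y - c) = f' (axis i 1)" using has_derivative_partial assms by blast
  have "((\<lambda>y. y - c) has_derivative (\<lambda>h. h)) (at y)" by (auto intro!: derivative_eq_intros)
  from has_derivative_compose[OF this, of f f'] f'(1)
  have "((\<lambda>y. f (y - c)) has_derivative f') (at y)" by simp
  then show "partial i (\<lambda>y. f (y - c)) y = partial i f (y - c)" "(\<lambda>y. f (y - c)) differentiable (at y)"
    using partial_eqI f'(2) by (metis, auto simp: differentiable_def)
qed

lemma partials_translate:
  assumes "C_infinity f"
  shows "partials w (\<lambda>y. f (y - c)) = (\<lambda>y. partials w f (y - c))"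
proof (induction w)
  case (Cons i w)
  show ?case unfolding partials.simps Cons
    by (rule ext) (intro partial_translate C_infinity_differentiable C_infinity_partials assms)
qed simp

lemma C_infinity_translate:
  assumes "C_infinity f" shows "C_infinity (\<lambda>y. f (y - c))"
proof (rule C_infinity_coinduct[of "{\<lambda>y. g (y - c) | g. C_infinity g}"])
  fix g assume "g \<in> {\<lambda>y. g (y - c) | g. C_infinity g}"
  then obtain h where h: "C_infinity h" "g = (\<lambda>y. h (y - c))" by blast
  show "g differentiable (at x)" for x unfolding h(2)
    by (intro partial_translate C_infinity_differentiable h)
  show "partial i g \<in> {\<lambda>y. g (y - c) | g. C_infinity g}" for i
    using partials_translate[OF h(1), of "[i]" c] C_infinity_partial[OF h(1), of i] h(2) by auto
qed (use assms in auto)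

text \<open>Each variable occurs in a single factor, so a partial derivative acts on that factor
  alone; a word matters only through the number of occurrences of each letter.\<close>

lemma partials_prod:
  fixes f :: "'d::finite \<Rightarrow> real \<Rightarrow> real"
  assumes "\<And>i. smooth (f i)"
  shows "partials w (\<lambda>z. \<Prod>i\<in>UNIV. f i (z $ i)) = (\<lambda>z. \<Prod>i\<in>UNIV. (deriv ^^ count_list w i) (f i) (z $ i))"
proof (induction w)
  case (Cons k w)
  define F where "F = (\<lambda>i. (deriv ^^ count_list w i) (f i))"
  have F: "smooth (F i)" for i unfolding F_def by (intro smooth_higher_deriv assms)
  have eq: "(\<Prod>i\<in>UNIV. G i) = G k * (\<Prod>i\<in>UNIV - {k}. G i)" for G :: "'d \<Rightarrow> real"
    by (rule prod.remove) auto
  have Ck: "C_infinity (\<lambda>z. F i (z $ i))" for i by (rule C_infinity_compose[OF F C_infinity_nth])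
  have Pk: "C_infinity (\<lambda>z. \<Prod>i\<in>A. F i (z $ i))" for A by (rule C_infinity_prod) (rule Ck)
  note D = partial_mult[OF C_infinity_differentiable[OF Ck] C_infinity_differentiable[OF Pk]]
  have p: "partial k (\<lambda>z. F i (z $ i)) z = deriv (F i) (z $ i) * (if i = k then 1 else 0)" for i and z :: "real ^ 'd"
  proof -
    have "partial k (\<lambda>z. z $ i) z = (if i = k then 1 else 0)"
      by (subst partial_eqI[OF bounded_linear.has_derivative[OF bounded_linear_vec_nth has_derivative_ident]])
        (simp add: axis_def)
    moreover have "(F i has_real_derivative deriv (F i) (z $ i)) (at (z $ i))"
      using smooth_DERIV[OF F, of 0] by simp
    ultimately show ?thesis
      using partial_compose(2)[OF C_infinity_differentiable[OF C_infinity_nth[of i]], of "F i" _ z k] by simp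
  qed
  have 0: "partial k (\<lambda>z. \<Prod>i\<in>A. F i (z $ i)) = (\<lambda>z. 0)" if "k \<notin> A" for A
  proof -
    have "finite A" by simp
    then show ?thesis using that
    proof (induction A rule: finite_induct)
      case (insert i A)
      have "partial k (\<lambda>z. F i (z $ i) * (\<Prod>i\<in>A. F i (z $ i))) z = 0" for z
        unfolding D using insert by (auto simp: p)
      then show ?case using insert by auto
    qed simp
  qed
  have "partial k (\<lambda>z. \<Prod>i\<in>UNIV. F i (z $ i)) z = deriv (F k) (z $ k) * (\<Prod>i\<in>UNIV - {k}. F i (z $ i))" for z
    unfolding eq D by (simp add: 0 p)
  also have "\<dots> z = (\<Prod>i\<in>UNIV. (deriv ^^ count_list (k # w) i) (f i) (z $ i))" for z
    unfolding eq[of "\<lambda>i. (deriv ^^ count_list (k # w) i) (f i) (z $ i)"]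
    by (auto simp: F_def intro!: prod.cong)
  finally show ?case unfolding partials.simps Cons by (simp add: F_def fun_eq_iff)
qed simp

section \<open>Continuity of translations and mollification for square integrable functions\<close>

lemma ennreal_sq_add_le: "ennreal ((a + b)\<^sup>2) \<le> 2 * ennreal (a\<^sup>2) + 2 * ennreal (b\<^sup>2)"
proof -
  have "(a + b)\<^sup>2 \<le> 2 * a\<^sup>2 + 2 * b\<^sup>2" using sum_squares_bound[of a b] by (simp add: power2_sum)
  then have "ennreal ((a + b)\<^sup>2) \<le> ennreal (2 * a\<^sup>2 + 2 * b\<^sup>2)" by (rule ennreal_leI)
  also have "\<dots> = 2 * ennreal (a\<^sup>2) + 2 * ennreal (b\<^sup>2)"
    by (simp add: ennreal_plus ennreal_mult)
  finally show ?thesis .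
qed

text \<open>Error bookkeeping: these constants arise when the square of a sum of two or of three
  terms, each of squared norm at most \<open>a\<close>, is estimated by repeated use of the two-term
  inequality.\<close>

lemma ennreal_calc:
  fixes a :: real assumes "a \<ge> 0"
  shows "2 * ennreal a + 2 * ennreal a = ennreal (4 * a)"
    "2 * ennreal a + 2 * (2 * ennreal a + 2 * ennreal a) = ennreal (10 * a)"
proof -
  have *: "numeral k * ennreal a = ennreal (numeral k * a)" for k
    using assms by (simp add: ennreal_mult'')
  show "2 * ennreal a + 2 * ennreal a = ennreal (4 * a)"
    "2 * ennreal a + 2 * (2 * ennreal a + 2 * ennreal a) = ennreal (10 * a)"
    unfolding *[symmetric] distrib_left by (simp_all flip: distrib_right add: mult.assoc[symmetric])
qed

lemma nn_integral_sq_add_le: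
  fixes f g :: "'a \<Rightarrow> real"
  assumes [measurable]: "f \<in> borel_measurable M" "g \<in> borel_measurable M"
  shows "(\<integral>\<^sup>+x. ennreal ((f x + g x)\<^sup>2) \<partial>M) \<le> 2 * (\<integral>\<^sup>+x. ennreal ((f x)\<^sup>2) \<partial>M) + 2 * (\<integral>\<^sup>+x. ennreal ((g x)\<^sup>2) \<partial>M)"
proof -
  have "(\<integral>\<^sup>+x. ennreal ((f x + g x)\<^sup>2) \<partial>M) \<le> (\<integral>\<^sup>+x. 2 * ennreal ((f x)\<^sup>2) + 2 * ennreal ((g x)\<^sup>2) \<partial>M)"
    by (intro nn_integral_mono ennreal_sq_add_le)
  then show ?thesis by (simp add: nn_integral_add nn_integral_cmult)
qed

lemma nn_integral_lborel_shift:
  fixes f :: "'a::euclidean_space \<Rightarrow> ennreal"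
  assumes [measurable]: "f \<in> borel_measurable borel"
  shows "(\<integral>\<^sup>+x. f (x + h) \<partial>lborel) = (\<integral>\<^sup>+x. f x \<partial>lborel)"
proof -
  have "(\<integral>\<^sup>+x. f x \<partial>lborel) = (\<integral>\<^sup>+x. f x \<partial>distr lborel borel ((+) h))" by (simp add: lborel_distr_plus)
  also have "\<dots> = (\<integral>\<^sup>+x. f (x + h) \<partial>lborel)" by (subst nn_integral_distr) (auto simp: add.commute)
  finally show ?thesis by simp
qed

definition translation_continuous :: "('a::euclidean_space \<Rightarrow> real) \<Rightarrow> bool" where
  "translation_continuous g \<longleftrightarrow>
     (\<forall>e>0. \<exists>d>0. \<forall>h. norm h < d \<longrightarrow> (\<integral>\<^sup>+x. ennreal ((g (x + h) - g x)\<^sup>2) \<partial>lborel) \<le> ennreal e)"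

lemma translation_continuousD:
  assumes "translation_continuous g" "e > 0"
  obtains d where "d > 0"
    "\<forall>h. norm h < d \<longrightarrow> (\<integral>\<^sup>+x. ennreal ((g (x + h) - g x)\<^sup>2) \<partial>lborel) \<le> ennreal e"
  using assms unfolding translation_continuous_def by blast

lemma translation_continuous_add:
  assumes [measurable]: "f \<in> borel_measurable borel" "g \<in> borel_measurable borel"
    and "translation_continuous f" "translation_continuous g"
  shows "translation_continuous (\<lambda>x. f x + g x)"
  unfolding translation_continuous_def
proof (intro allI impI)
  fix e :: real assume "e > 0"
  then have "e / 4 > 0" by simp
  obtain d1 where d1: "d1 > 0" "\<forall>h. norm h < d1 \<longrightarrow> (\<integral>\<^sup>+x. ennreal ((f (x + h) - f x)\<^sup>2) \<partial>lborel) \<le> ennreal (e / 4)"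
    by (rule translation_continuousD[OF assms(3) \<open>e / 4 > 0\<close>])
  obtain d2 where d2: "d2 > 0" "\<forall>h. norm h < d2 \<longrightarrow> (\<integral>\<^sup>+x. ennreal ((g (x + h) - g x)\<^sup>2) \<partial>lborel) \<le> ennreal (e / 4)"
    by (rule translation_continuousD[OF assms(4) \<open>e / 4 > 0\<close>])
  note d = d1(1) d2(1) d1(2) d2(2)
  have "(\<integral>\<^sup>+x. ennreal ((f (x + h) + g (x + h) - (f x + g x))\<^sup>2) \<partial>lborel) \<le> ennreal e" if "norm h < min d1 d2" for h
  proof -
    have "(\<integral>\<^sup>+x. ennreal ((f (x + h) + g (x + h) - (f x + g x))\<^sup>2) \<partial>lborel)
        = (\<integral>\<^sup>+x. ennreal (((f (x + h) - f x) + (g (x + h) - g x))\<^sup>2) \<partial>lborel)"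
      by (simp add: algebra_simps)
    also have "\<dots> \<le> 2 * (\<integral>\<^sup>+x. ennreal ((f (x + h) - f x)\<^sup>2) \<partial>lborel) + 2 * (\<integral>\<^sup>+x. ennreal ((g (x + h) - g x)\<^sup>2) \<partial>lborel)"
      by (rule nn_integral_sq_add_le) measurable
    also have "\<dots> \<le> 2 * ennreal (e / 4) + 2 * ennreal (e / 4)"
      using d that by (intro add_mono mult_left_mono) auto
    also have "\<dots> = ennreal e" using ennreal_calc(1)[of "e / 4"] \<open>e > 0\<close> by simp
    finally show ?thesis .
  qed
  then show "\<exists>d>0. \<forall>h. norm h < d \<longrightarrow>
      (\<integral>\<^sup>+x. ennreal ((f (x + h) + g (x + h) - (f x + g x))\<^sup>2) \<partial>lborel) \<le> ennreal e"
    using d(1,2) by (intro exI[of _ "min d1 d2"]) auto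
qed

lemma translation_continuous_cmult:
  assumes [measurable]: "f \<in> borel_measurable borel" and f: "translation_continuous f"
  shows "translation_continuous (\<lambda>x. c * f x)"
  unfolding translation_continuous_def
proof (intro allI impI)
  fix e :: real assume "e > 0"
  have pos: "e / (c\<^sup>2 + 1) > 0" using \<open>e > 0\<close> by (simp add: add_nonneg_pos)
  then obtain d where d: "d > 0" "\<forall>h. norm h < d \<longrightarrow> (\<integral>\<^sup>+x. ennreal ((f (x + h) - f x)\<^sup>2) \<partial>lborel) \<le> ennreal (e / (c\<^sup>2 + 1))"
    using f unfolding translation_continuous_def by blast
  have "(\<integral>\<^sup>+x. ennreal ((c * f (x + h) - c * f x)\<^sup>2) \<partial>lborel) \<le> ennreal e" if "norm h < d" for h
  proof -
    have "(\<integral>\<^sup>+x. ennreal ((c * f (x + h) - c * f x)\<^sup>2) \<partial>lborel) = (\<integral>\<^sup>+x. ennreal (c\<^sup>2) * ennreal ((f (x + h) - f x)\<^sup>2) \<partial>lborel)"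
      by (intro nn_integral_cong) (simp flip: ennreal_mult'' add: power_mult_distrib[symmetric] algebra_simps)
    also have "\<dots> = ennreal (c\<^sup>2) * (\<integral>\<^sup>+x. ennreal ((f (x + h) - f x)\<^sup>2) \<partial>lborel)"
      by (rule nn_integral_cmult) measurable
    also have "\<dots> \<le> ennreal (c\<^sup>2) * ennreal (e / (c\<^sup>2 + 1))" using d that by (intro mult_left_mono) auto
    also have "\<dots> = ennreal (c\<^sup>2 * (e / (c\<^sup>2 + 1)))" using pos by (intro ennreal_mult''[symmetric]) simp
    also have "\<dots> \<le> ennreal e"
    proof (rule ennreal_leI)
      have "c\<^sup>2 + 1 > 0" by (simp add: add_nonneg_pos)
      then show "c\<^sup>2 * (e / (c\<^sup>2 + 1)) \<le> e" using \<open>e > 0\<close> by (simp add: field_simps)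
    qed
    finally show ?thesis .
  qed
  then show "\<exists>d>0. \<forall>h. norm h < d \<longrightarrow> (\<integral>\<^sup>+x. ennreal ((c * f (x + h) - c * f x)\<^sup>2) \<partial>lborel) \<le> ennreal e"
    using d(1) by blast
qed

text \<open>The difference \<open>g (x + h) - g x\<close> splits into that of an approximant
  \<open>f\<close> and two errors. Translation invariance gives the shifted error the same norm as
  the unshifted one. Each part is at most \<open>e / 16\<close>, and
  \<open>10 * (e / 16) \<le> e\<close>.\<close>

lemma translation_continuous_approx:
  assumes [measurable]: "g \<in> borel_measurable borel"
    and "\<And>e. e > 0 \<Longrightarrow> \<exists>f\<in>borel_measurable borel. translation_continuous f \<and> (\<integral>\<^sup>+x. ennreal ((f x - g x)\<^sup>2) \<partial>lborel) \<le> ennreal e"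
  shows "translation_continuous g"
  unfolding translation_continuous_def
proof (intro allI impI)
  fix e :: real assume "e > 0"
  then obtain f where [measurable]: "f \<in> borel_measurable borel" and tf: "translation_continuous f"
    and f: "(\<integral>\<^sup>+x. ennreal ((f x - g x)\<^sup>2) \<partial>lborel) \<le> ennreal (e / 16)"
    using assms(2)[of "e / 16"] by auto
  have "e / 16 > 0" using \<open>e > 0\<close> by simp
  obtain d where d: "d > 0" "\<forall>h. norm h < d \<longrightarrow> (\<integral>\<^sup>+x. ennreal ((f (x + h) - f x)\<^sup>2) \<partial>lborel) \<le> ennreal (e / 16)"
    by (rule translation_continuousD[OF tf \<open>e / 16 > 0\<close>])
  have "(\<integral>\<^sup>+x. ennreal ((g (x + h) - g x)\<^sup>2) \<partial>lborel) \<le> ennreal e" if "norm h < d" for h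
  proof -
    have s: "(\<integral>\<^sup>+x. ennreal ((g (x + h) - f (x + h))\<^sup>2) \<partial>lborel) \<le> ennreal (e / 16)"
      using f nn_integral_lborel_shift[of "\<lambda>x. ennreal ((g x - f x)\<^sup>2)" h] by (simp add: power2_commute)
    have "(\<integral>\<^sup>+x. ennreal ((g (x + h) - g x)\<^sup>2) \<partial>lborel)
        = (\<integral>\<^sup>+x. ennreal (((g (x + h) - f (x + h)) + ((f (x + h) - f x) + (f x - g x)))\<^sup>2) \<partial>lborel)"
      by (simp add: algebra_simps)
    also have "\<dots> \<le> 2 * (\<integral>\<^sup>+x. ennreal ((g (x + h) - f (x + h))\<^sup>2) \<partial>lborel)
        + 2 * (\<integral>\<^sup>+x. ennreal (((f (x + h) - f x) + (f x - g x))\<^sup>2) \<partial>lborel)"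
      by (rule nn_integral_sq_add_le) measurable
    also have "\<dots> \<le> 2 * ennreal (e / 16) + 2 * (2 * ennreal (e / 16) + 2 * ennreal (e / 16))"
      using d that f by (intro add_mono mult_left_mono s order_trans[OF nn_integral_sq_add_le]) auto
    also have "\<dots> = ennreal (10 * (e / 16))" by (rule ennreal_calc(2)) (use \<open>e > 0\<close> in simp)
    also have "\<dots> \<le> ennreal e" using \<open>e > 0\<close> by (intro ennreal_leI) simp
    finally show ?thesis .
  qed
  then show "\<exists>d>0. \<forall>h. norm h < d \<longrightarrow> (\<integral>\<^sup>+x. ennreal ((g (x + h) - g x)\<^sup>2) \<partial>lborel) \<le> ennreal e"
    using d(1) by blast
qed

text \<open>\<open>K n\<close> consists of the points of \<open>U\<close> at distance at least
  \<open>1 / Suc n\<close> from the complement. A shorter shift changes the indicator only where one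
  of the two points lies in \<open>U - K n\<close>, and these sets of finite measure decrease to the
  empty set.\<close>

lemma translation_continuous_indicator_open:
  fixes U :: "'a::euclidean_space set"
  assumes "open U" and fin: "emeasure lborel U < \<infinity>"
  shows "translation_continuous (indicator U)"
  unfolding translation_continuous_def
proof (intro allI impI)
  fix e :: real assume "e > 0"
  define K where "K = (\<lambda>n::nat. {x. ball x (1 / Suc n) \<subseteq> U})"
  have closedK: "closed (K n)" for n
  proof -
    have "x \<in> K n \<longleftrightarrow> (\<forall>y. y \<notin> U \<longrightarrow> 1 / Suc n \<le> dist x y)" for x
      unfolding K_def mem_Collect_eq subset_iff mem_ball not_less[symmetric] by blast
    then have "K n = (\<Inter>y\<in>-U. {x. 1 / Suc n \<le> dist x y})" by blast
    moreover have "closed {x. 1 / Suc n \<le> dist x y}" for y :: 'a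
      by (intro closed_Collect_le continuous_intros)
    ultimately show ?thesis by auto
  qed
  have [measurable]: "U \<in> sets borel" "K n \<in> sets borel" for n using \<open>open U\<close> closedK by auto
  have "(\<lambda>n. emeasure lborel (U - K n)) \<longlonglongrightarrow> emeasure lborel (\<Inter>n. U - K n)"
  proof (rule Lim_emeasure_decseq)
    show "decseq (\<lambda>n. U - K n)"
    proof (rule decseq_SucI)
      fix n have "1 / real (Suc (Suc n)) \<le> 1 / real (Suc n)" by (simp add: field_simps)
      then have "ball x (1 / Suc (Suc n)) \<subseteq> ball x (1 / Suc n)" for x :: 'a by (rule subset_ball)
      then show "U - K (Suc n) \<subseteq> U - K n" by (auto simp: K_def)
    qed
    show "emeasure lborel (U - K n) \<noteq> \<infinity>" for n
      using fin emeasure_mono[of "U - K n" U lborel] by (auto simp: top_unique)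
  qed auto
  also have eq: "(\<Inter>n. U - K n) = {}"
  proof -
    have "\<exists>n. x \<in> K n" if xU: "x \<in> U" for x
    proof -
      obtain r where r: "r > 0" "ball x r \<subseteq> U" using \<open>open U\<close> xU by (rule openE)
      obtain n where "1 / real (Suc n) < r" by (rule nat_approx_posE[OF r(1)])
      then have "ball x (1 / Suc n) \<subseteq> ball x r" by (intro subset_ball) simp
      then show ?thesis using r by (auto simp: K_def)
    qed
    then show ?thesis by blast
  qed
  finally have "(\<lambda>n. emeasure lborel (U - K n)) \<longlonglongrightarrow> 0" by simp
  then have "\<forall>\<^sub>F n in sequentially. emeasure lborel (U - K n) < ennreal (e / 2)"
    using \<open>e > 0\<close> by (intro order_tendstoD) auto
  then obtain n where n: "emeasure lborel (U - K n) < ennreal (e / 2)" by (auto simp: eventually_sequentially)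
  have "(\<integral>\<^sup>+x. ennreal ((indicator U (x + h) - indicator U x)\<^sup>2) \<partial>lborel) \<le> ennreal e" if h: "norm h < 1 / Suc n" for h
  proof -
    have "(\<integral>\<^sup>+x. ennreal ((indicator U (x + h) - indicator U x)\<^sup>2) \<partial>lborel)
        \<le> (\<integral>\<^sup>+x. indicator (U - K n) (x + h) + indicator (U - K n) x \<partial>lborel)"
    proof (rule nn_integral_mono)
      fix x
      have "x \<notin> K n" if "x + h \<notin> U"
      proof -
        have "x + h \<in> ball x (1 / Suc n)" using h by (simp add: dist_norm)
        then show ?thesis using that unfolding K_def by blast
      qed
      moreover have "x + h \<notin> K n" if "x \<notin> U"
      proof -
        have "x \<in> ball (x + h) (1 / Suc n)" using h by (simp add: dist_norm)
        then show ?thesis using that unfolding K_def by blast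
      qed
      ultimately show "ennreal ((indicator U (x + h) - indicator U x)\<^sup>2) \<le> indicator (U - K n) (x + h) + indicator (U - K n) x"
        by (auto simp: indicator_def)
    qed
    also have "\<dots> = (\<integral>\<^sup>+x. indicator (U - K n) (x + h) \<partial>lborel) + (\<integral>\<^sup>+x. indicator (U - K n) x \<partial>lborel)"
      by (rule nn_integral_add) measurable
    also have "\<dots> = emeasure lborel (U - K n) + emeasure lborel (U - K n)"
      by (subst nn_integral_lborel_shift) auto
    also have "\<dots> \<le> ennreal (e / 2) + ennreal (e / 2)" using n by (intro add_mono) auto
    also have "\<dots> = ennreal e" using \<open>e > 0\<close> by (simp flip: ennreal_plus)
    finally show ?thesis .
  qed
  then show "\<exists>d>0. \<forall>h. norm h < d \<longrightarrow> (\<integral>\<^sup>+x. ennreal ((indicator U (x + h) - indicator U x)\<^sup>2) \<partial>lborel) \<le> ennreal e"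
    by (intro exI[of _ "1 / Suc n"]) auto
qed

text \<open>Outer regularity gives an open set of finite measure whose indicator is as close as
  desired, and the property passes to limits.\<close>

lemma translation_continuous_indicator:
  fixes A :: "'a::euclidean_space set"
  assumes [measurable]: "A \<in> sets borel" and fin: "emeasure lborel A < \<infinity>"
  shows "translation_continuous (indicator A)"
proof (rule translation_continuous_approx)
  fix e :: real assume "e > 0"
  obtain U where U: "open U" "A \<subseteq> U" "emeasure lborel (U - A) < e"
    using outer_regular_lborel[OF assms(1) \<open>e > 0\<close>] by blast
  have [measurable]: "U \<in> sets borel" using U by auto
  have "emeasure lborel U \<le> emeasure lborel A + emeasure lborel (U - A)"
    using emeasure_subadditive[of A lborel "U - A"] U(2) by (simp add: Un_absorb1)
  also have "\<dots> < \<infinity>" using fin less_trans[OF U(3) ennreal_less_top] by (simp add: ennreal_add_less_top)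
  finally have "translation_continuous (indicator U)" by (rule translation_continuous_indicator_open[OF U(1)])
  moreover have "(\<integral>\<^sup>+x. ennreal ((indicator U x - indicator A x)\<^sup>2) \<partial>lborel) = (\<integral>\<^sup>+x. indicator (U - A) x \<partial>lborel)"
    using U(2) by (intro nn_integral_cong) (auto simp: indicator_def)
  ultimately show "\<exists>f\<in>borel_measurable borel. translation_continuous f \<and> (\<integral>\<^sup>+x. ennreal ((f x - indicator A x)\<^sup>2) \<partial>lborel) \<le> ennreal e"
    using U by (intro bexI[of _ "indicator U"]) auto
qed measurable

text \<open>Simple functions \<open>F i\<close> bounded by \<open>2 * \<bar>g\<bar>\<close> converge
  to \<open>g\<close> pointwise. By Chebyshev's inequality their nonzero level sets have finite
  measure, so each \<open>F i\<close> is a finite combination of translation continuous indicators;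
  \<open>10 * g^2\<close> dominates the squared differences.\<close>

theorem L2_translation_continuous:
  fixes g :: "'a::euclidean_space \<Rightarrow> real"
  assumes [measurable]: "g \<in> borel_measurable borel" and fin: "(\<integral>\<^sup>+x. ennreal ((g x)\<^sup>2) \<partial>lborel) < \<infinity>"
  shows "translation_continuous g"
proof (rule translation_continuous_approx)
  fix e :: real assume "e > 0"
  obtain F where F: "\<And>i. simple_function lborel (F i)" "\<And>x. (\<lambda>i. F i x) \<longlonglongrightarrow> g x" "\<And>i x. norm (F i x) \<le> 2 * norm (g x)"
    using borel_measurable_implies_sequence_metric[of g lborel 0] by auto
  have Fm[measurable]: "F i \<in> borel_measurable borel" for i
    using borel_measurable_simple_function[OF F(1)] by simp
  have sqF: "(F i x)\<^sup>2 \<le> 4 * (g x)\<^sup>2" for i x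
    using power_mono[OF F(3)[of i x], of 2] by (simp add: power_mult_distrib)
  have tF: "translation_continuous (F i)" for i
  proof -
    have fin_i: "emeasure lborel (F i -` {y}) < \<infinity>" if "y \<noteq> 0" for y
    proof -
      have "ennreal (y\<^sup>2 / 4) * emeasure lborel (F i -` {y}) = (\<integral>\<^sup>+x. ennreal (y\<^sup>2 / 4) * indicator (F i -` {y}) x \<partial>lborel)"
        using measurable_sets[OF Fm, of "{y}" i] by (subst nn_integral_cmult_indicator) auto
      also have "\<dots> \<le> (\<integral>\<^sup>+x. ennreal ((g x)\<^sup>2) \<partial>lborel)"
        using sqF[of i] by (intro nn_integral_mono) (auto simp: indicator_def mult.commute intro!: ennreal_leI)
      also have "\<dots> < \<infinity>" by (rule fin)
      finally show ?thesis using that by (auto simp: ennreal_mult_less_top)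
    qed
    have "translation_continuous (\<lambda>x. \<Sum>y\<in>Y. y * indicator (F i -` {y}) x)"
      if "finite Y" "Y \<subseteq> range (F i) - {0}" for Y
      using that
    proof (induction Y rule: finite_induct)
      case empty
      then show ?case by (auto simp: translation_continuous_def intro: exI[of _ 1])
    next
      case (insert y Y)
      have [measurable]: "F i -` {z} \<in> sets borel" for z using measurable_sets[OF Fm, of "{z}" i] by simp
      have "translation_continuous (\<lambda>x. y * indicator (F i -` {y}) x + (\<Sum>y\<in>Y. y * indicator (F i -` {y}) x))"
      proof (rule translation_continuous_add)
        show "translation_continuous (\<lambda>x. y * indicator (F i -` {y}) x)"
          using insert.prems fin_i[of y] by (intro translation_continuous_cmult translation_continuous_indicator) auto
        show "translation_continuous (\<lambda>x. \<Sum>y\<in>Y. y * indicator (F i -` {y}) x)"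
          using insert by blast
      qed measurable
      then show ?case unfolding sum.insert[OF insert.hyps] .
    qed
    moreover have "F i x = (\<Sum>y\<in>range (F i) - {0}. y * indicator (F i -` {y}) x)" for x
    proof -
      have fi: "finite (range (F i))" using F(1)[of i] by (simp add: simple_function_def)
      have "(\<Sum>y\<in>range (F i) - {0}. y * indicator (F i -` {y}) x) = (\<Sum>y\<in>range (F i) - {0}. if y = F i x then F i x else 0)"
        by (intro sum.cong) (auto simp: indicator_def)
      also have "\<dots> = F i x" using fi by (simp add: sum.delta)
      finally show ?thesis by simp
    qed
    moreover have "finite (range (F i) - {0})" using F(1)[of i] by (simp add: simple_function_def)
    ultimately show ?thesis by (metis (no_types, lifting) ext subset_refl)
  qed
  have "(\<lambda>i. \<integral>\<^sup>+x. ennreal ((F i x - g x)\<^sup>2) \<partial>lborel) \<longlonglongrightarrow> (\<integral>\<^sup>+(x::'a). 0 \<partial>lborel)"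
  proof (rule nn_integral_dominated_convergence[where M = lborel and u = "\<lambda>i x. ennreal ((F i x - g x)\<^sup>2)"
        and u' = "\<lambda>_. 0" and w = "\<lambda>x. ennreal (10 * (g x)\<^sup>2)"])
    have "(\<integral>\<^sup>+x. ennreal (10 * (g x)\<^sup>2) \<partial>lborel) = 10 * (\<integral>\<^sup>+x. ennreal ((g x)\<^sup>2) \<partial>lborel)"
      by (subst nn_integral_cmult[symmetric]) (auto simp: ennreal_mult)
    then show "(\<integral>\<^sup>+x. ennreal (10 * (g x)\<^sup>2) \<partial>lborel) < \<infinity>" using fin by (simp add: ennreal_mult_less_top)
    show "AE x in lborel. ennreal ((F i x - g x)\<^sup>2) \<le> ennreal (10 * (g x)\<^sup>2)" for i
    proof (intro AE_I2 ennreal_leI)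
      fix x show "(F i x - g x)\<^sup>2 \<le> 10 * (g x)\<^sup>2"
        using sqF[of i x] sum_squares_bound[of "F i x" "- g x"] by (simp add: power2_diff)
    qed
    have "(\<lambda>i. ennreal ((F i x - g x)\<^sup>2)) \<longlonglongrightarrow> ennreal ((g x - g x)\<^sup>2)" for x
      by (intro tendsto_intros F(2) tendsto_ennrealI)
    then show "AE x in lborel. (\<lambda>i. ennreal ((F i x - g x)\<^sup>2)) \<longlonglongrightarrow> 0" by simp
  qed auto
  then have "\<forall>\<^sub>F i in sequentially. (\<integral>\<^sup>+x. ennreal ((F i x - g x)\<^sup>2) \<partial>lborel) < ennreal e"
    using \<open>e > 0\<close> by (intro order_tendstoD) auto
  then obtain i where "(\<integral>\<^sup>+x. ennreal ((F i x - g x)\<^sup>2) \<partial>lborel) < ennreal e" by (auto simp: eventually_sequentially)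
  then show "\<exists>f\<in>borel_measurable borel. translation_continuous f \<and> (\<integral>\<^sup>+x. ennreal ((f x - g x)\<^sup>2) \<partial>lborel) \<le> ennreal e"
    using tF[of i] by (intro bexI[of _ "F i"]) auto
qed measurable

text \<open>For \<open>0 \<le> \<kappa> \<le> B\<close> the inequality
  \<open>\<bar>g\<bar> \<le> g^2 + 1\<close> gives the integrable majorant
  \<open>B * g^2 + \<kappa>\<close>.\<close>

lemma integrable_mult_kernel:
  fixes g \<kappa> :: "'a::euclidean_space \<Rightarrow> real"
  assumes [measurable]: "g \<in> borel_measurable borel" "\<kappa> \<in> borel_measurable borel"
    and fin: "(\<integral>\<^sup>+x. ennreal ((g x)\<^sup>2) \<partial>lborel) < \<infinity>"
    and k: "\<And>z. 0 \<le> \<kappa> z" "\<And>z. \<kappa> z \<le> B" "(\<integral>\<^sup>+z. ennreal (\<kappa> z) \<partial>lborel) = 1"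
  shows "integrable lborel (\<lambda>z. g (x + z) * \<kappa> z)" "integrable lborel \<kappa>"
proof -
  show K: "integrable lborel \<kappa>" using k by (intro integrableI_nonneg) auto
  have "(\<integral>\<^sup>+z. ennreal ((g (z + x))\<^sup>2) \<partial>lborel) < \<infinity>"
    by (subst nn_integral_lborel_shift[of "\<lambda>z. ennreal ((g z)\<^sup>2)"]) (use fin in auto)
  then have G: "integrable lborel (\<lambda>z. (g (x + z))\<^sup>2)"
    by (intro integrableI_nonneg) (auto simp: add.commute)
  show "integrable lborel (\<lambda>z. g (x + z) * \<kappa> z)"
  proof (rule Bochner_Integration.integrable_bound[of _ "\<lambda>z. B * (g (x + z))\<^sup>2 + \<kappa> z"])
    have "\<bar>a\<bar> * b \<le> B * a\<^sup>2 + b" if "0 \<le> b" "b \<le> B" for a b :: real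
    proof -
      have "\<bar>a\<bar> \<le> a\<^sup>2 + 1" using sum_squares_bound[of "\<bar>a\<bar>" 1] by simp
      then have "\<bar>a\<bar> * b \<le> (a\<^sup>2 + 1) * b" using that by (intro mult_right_mono)
      also have "\<dots> \<le> B * a\<^sup>2 + b" using mult_right_mono[OF that(2), of "a\<^sup>2"] by (simp add: algebra_simps)
      finally show ?thesis .
    qed
    then show "AE z in lborel. norm (g (x + z) * \<kappa> z) \<le> norm (B * (g (x + z))\<^sup>2 + \<kappa> z)"
      using k(1,2) by (auto simp: abs_mult intro!: AE_I2 order_trans[OF _ abs_ge_self])
  qed (use G K in auto)
qed

text \<open>The radius \<open>d\<close> is fixed before the kernel, and the kernel may sit
  off-centre in the ball, so that it can later be placed inside a cone. Cauchy-Schwarz for the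
  probability density \<open>\<kappa>\<close> bounds the squared error at \<open>x\<close> by the
  average of \<open>(g (x + z) - g x)^2\<close>; after exchanging the integrals, translation
  continuity applies to each shift \<open>z\<close>.\<close>

theorem L2_mollify:
  fixes g :: "'a::euclidean_space \<Rightarrow> real"
  assumes gm[measurable]: "g \<in> borel_measurable borel" and fin: "(\<integral>\<^sup>+x. ennreal ((g x)\<^sup>2) \<partial>lborel) < \<infinity>"
    and "e > 0"
  shows "\<exists>d>0. \<forall>\<kappa> B. \<kappa> \<in> borel_measurable borel \<longrightarrow> (\<forall>z. 0 \<le> \<kappa> z \<and> \<kappa> z \<le> B) \<longrightarrow>
    (\<integral>\<^sup>+z. ennreal (\<kappa> z) \<partial>lborel) = 1 \<longrightarrow> (\<forall>z. d \<le> norm z \<longrightarrow> \<kappa> z = 0) \<longrightarrow>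
    (\<integral>\<^sup>+x. ennreal (((\<integral>y. g y * \<kappa> (y - x) \<partial>lborel) - g x)\<^sup>2) \<partial>lborel) \<le> ennreal e"
proof -
  obtain d where d: "d > 0" "\<forall>h. norm h < d \<longrightarrow> (\<integral>\<^sup>+x. ennreal ((g (x + h) - g x)\<^sup>2) \<partial>lborel) \<le> ennreal e"
    using L2_translation_continuous[OF gm fin] \<open>e > 0\<close> unfolding translation_continuous_def by blast
  show ?thesis
  proof (intro exI[of _ d] conjI allI impI)
    fix \<kappa> :: "'a \<Rightarrow> real" and B
    assume km[measurable]: "\<kappa> \<in> borel_measurable borel" and k01: "\<forall>z. 0 \<le> \<kappa> z \<and> \<kappa> z \<le> B"
      and k1: "(\<integral>\<^sup>+z. ennreal (\<kappa> z) \<partial>lborel) = 1" and k0: "\<forall>z. d \<le> norm z \<longrightarrow> \<kappa> z = 0"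
    have k: "0 \<le> \<kappa> z" "\<kappa> z \<le> B" for z using k01 by auto
    note int = integrable_mult_kernel[OF gm km fin k k1]
    have int1: "(\<integral>z. \<kappa> z \<partial>lborel) = 1"
      using k1 nn_integral_eq_integral[OF int(2)] k(1) by (simp add: integral_nonneg_AE)
    have D: "(\<integral>y. g y * \<kappa> (y - x) \<partial>lborel) - g x = (\<integral>z. (g (x + z) - g x) * \<kappa> z \<partial>lborel)" for x
    proof -
      have "(\<integral>y. g y * \<kappa> (y - x) \<partial>lborel) = (\<integral>y. g y * \<kappa> (y - x) \<partial>distr lborel borel ((+) x))"
        by (simp add: lborel_distr_plus)
      also have "\<dots> = (\<integral>z. g (x + z) * \<kappa> z \<partial>lborel)" by (subst integral_distr) auto
      finally have "(\<integral>y. g y * \<kappa> (y - x) \<partial>lborel) - g x = (\<integral>z. g (x + z) * \<kappa> z \<partial>lborel) - (\<integral>z. g x * \<kappa> z \<partial>lborel)"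
        by (simp add: int1)
      also have "\<dots> = (\<integral>z. g (x + z) * \<kappa> z - g x * \<kappa> z \<partial>lborel)"
        using int by (intro Bochner_Integration.integral_diff[symmetric]) auto
      finally show ?thesis by (simp add: algebra_simps)
    qed
    have "ennreal (((\<integral>y. g y * \<kappa> (y - x) \<partial>lborel) - g x)\<^sup>2) \<le> (\<integral>\<^sup>+z. ennreal ((g (x + z) - g x)\<^sup>2) * ennreal (\<kappa> z) \<partial>lborel)" for x
    proof -
      have I: "integrable lborel (\<lambda>z. (g (x + z) - g x) * \<kappa> z)"
        using int by (simp add: left_diff_distrib)
      have "ennreal (((\<integral>y. g y * \<kappa> (y - x) \<partial>lborel) - g x)\<^sup>2) = (ennreal (norm (\<integral>z. (g (x + z) - g x) * \<kappa> z \<partial>lborel)))\<^sup>2"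
        unfolding D by (simp add: ennreal_power)
      also have "\<dots> \<le> (\<integral>\<^sup>+z. norm ((g (x + z) - g x) * \<kappa> z) \<partial>lborel)\<^sup>2"
        by (intro power_mono integral_norm_bound_ennreal I) auto
      also have "\<dots> = (\<integral>\<^sup>+z. ennreal (\<bar>g (x + z) - g x\<bar> * sqrt (\<kappa> z)) * ennreal (sqrt (\<kappa> z)) \<partial>lborel)\<^sup>2"
        using k(1) by (intro arg_cong2[where f=power] nn_integral_cong refl)
          (simp flip: ennreal_mult add: abs_mult mult.assoc)
      also have "\<dots> \<le> (\<integral>\<^sup>+z. (ennreal (\<bar>g (x + z) - g x\<bar> * sqrt (\<kappa> z)))\<^sup>2 \<partial>lborel) * (\<integral>\<^sup>+z. (ennreal (sqrt (\<kappa> z)))\<^sup>2 \<partial>lborel)"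
        by (rule Cauchy_Schwarz_nn_integral) measurable
      also have "(\<integral>\<^sup>+z. (ennreal (sqrt (\<kappa> z)))\<^sup>2 \<partial>lborel) = 1"
        using k(1) k1 by (simp add: ennreal_power)
      also have "(\<integral>\<^sup>+z. (ennreal (\<bar>g (x + z) - g x\<bar> * sqrt (\<kappa> z)))\<^sup>2 \<partial>lborel) = (\<integral>\<^sup>+z. ennreal ((g (x + z) - g x)\<^sup>2) * ennreal (\<kappa> z) \<partial>lborel)"
        using k(1) by (intro nn_integral_cong) (simp add: ennreal_power power_mult_distrib ennreal_mult'')
      finally show ?thesis by simp
    qed
    then have "(\<integral>\<^sup>+x. ennreal (((\<integral>y. g y * \<kappa> (y - x) \<partial>lborel) - g x)\<^sup>2) \<partial>lborel)
        \<le> (\<integral>\<^sup>+x. \<integral>\<^sup>+z. ennreal ((g (x + z) - g x)\<^sup>2) * ennreal (\<kappa> z) \<partial>lborel \<partial>lborel)"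
      by (intro nn_integral_mono) auto
    also have "\<dots> = (\<integral>\<^sup>+z. \<integral>\<^sup>+x. ennreal ((g (x + z) - g x)\<^sup>2) * ennreal (\<kappa> z) \<partial>lborel \<partial>lborel)"
      by (rule lborel_pair.Fubini') measurable
    also have "\<dots> = (\<integral>\<^sup>+z. (\<integral>\<^sup>+x. ennreal ((g (x + z) - g x)\<^sup>2) \<partial>lborel) * ennreal (\<kappa> z) \<partial>lborel)"
      by (intro nn_integral_cong nn_integral_multc) measurable
    also have "\<dots> \<le> (\<integral>\<^sup>+z. ennreal e * ennreal (\<kappa> z) \<partial>lborel)"
    proof (rule nn_integral_mono)
      fix z show "(\<integral>\<^sup>+x. ennreal ((g (x + z) - g x)\<^sup>2) \<partial>lborel) * ennreal (\<kappa> z) \<le> ennreal e * ennreal (\<kappa> z)"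
        using d k0 by (cases "norm z < d") (auto intro: mult_right_mono)
    qed
    also have "\<dots> = ennreal e" using k1 by (simp add: nn_integral_cmult)
    finally show "(\<integral>\<^sup>+x. ennreal (((\<integral>y. g y * \<kappa> (y - x) \<partial>lborel) - g x)\<^sup>2) \<partial>lborel) \<le> ennreal e" .
  qed (rule d)
qed

subsection \<open>Borel representatives of square integrable functions\<close>

text \<open>Elements of \<open>L2 (lebesgue_on \<Omega>)\<close> are only Lebesgue measurable and
  arbitrary outside \<Omega>. A Borel function that vanishes there can be integrated over the whole
  space with \<open>lborel\<close>, where translations and Fubini's theorem are at hand.\<close>

definition L2_rep :: "'a::euclidean_space set \<Rightarrow> ('a \<Rightarrow> real) \<Rightarrow> ('a \<Rightarrow> real) \<Rightarrow> bool" where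
  "L2_rep \<Omega> f g \<longleftrightarrow> g \<in> borel_measurable borel \<and> (\<forall>x. x \<notin> \<Omega> \<longrightarrow> g x = 0) \<and>
     (AE x in lebesgue_on \<Omega>. f x = g x) \<and> (\<integral>\<^sup>+x. ennreal ((g x)\<^sup>2) \<partial>lborel) < \<infinity>"

lemma lebesgue_on_lborel:
  fixes g :: "'a::euclidean_space \<Rightarrow> real"
  assumes "\<Omega> \<in> sets borel" "g \<in> borel_measurable borel" "\<And>x. x \<notin> \<Omega> \<Longrightarrow> g x = 0"
  shows "(\<integral>x. g x \<partial>lebesgue_on \<Omega>) = (\<integral>x. g x \<partial>lborel)" "integrable (lebesgue_on \<Omega>) g \<longleftrightarrow> integrable lborel g"
proof -
  have \<Omega>: "\<Omega> \<in> sets lebesgue" using assms(1) by simp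
  have ind: "(\<lambda>x. indicator \<Omega> x *\<^sub>R g x) = g" using assms(3) by (auto simp: indicator_def fun_eq_iff)
  show "(\<integral>x. g x \<partial>lebesgue_on \<Omega>) = (\<integral>x. g x \<partial>lborel)"
  proof -
    have "(\<integral>x. g x \<partial>lebesgue_on \<Omega>) = (\<integral>x. indicator \<Omega> x *\<^sub>R g x \<partial>lebesgue)"
      using \<Omega> by (intro integral_restrict_space) simp
    then show ?thesis using assms(2) by (simp only: ind) (simp add: integral_completion)
  qed
  show "integrable (lebesgue_on \<Omega>) g \<longleftrightarrow> integrable lborel g"
  proof -
    have "integrable (lebesgue_on \<Omega>) g \<longleftrightarrow> integrable lebesgue (\<lambda>x. indicator \<Omega> x *\<^sub>R g x)"
      using \<Omega> by (intro integrable_restrict_space) simp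
    then show ?thesis using assms(2) by (simp only: ind) (simp add: integrable_completion)
  qed
qed

lemma borel_measurable_lebesgue_on:
  fixes g :: "'a::euclidean_space \<Rightarrow> 'b::topological_space"
  shows "g \<in> borel_measurable borel \<Longrightarrow> g \<in> borel_measurable (lebesgue_on \<Omega>)"
  by (intro measurable_restrict_space1) (auto intro: measurable_completion)

lemma integrable_sq_iff:
  fixes g :: "'a \<Rightarrow> real"
  assumes "g \<in> borel_measurable M"
  shows "integrable M (\<lambda>x. (g x)\<^sup>2) \<longleftrightarrow> (\<integral>\<^sup>+x. ennreal ((g x)\<^sup>2) \<partial>M) < \<infinity>"
  using assms by (subst integrable_iff_bounded) auto

text \<open>A function measurable for the completion agrees with a Borel function outside a null
  set, and cutting it off outside \<Omega> keeps it Borel.\<close>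

lemma L2_rep_exists:
  assumes \<Omega>: "\<Omega> \<in> sets borel" and f: "f \<in> L2 (lebesgue_on \<Omega>)"
  shows "\<exists>g. L2_rep \<Omega> f g"
proof -
  have \<Omega>L: "\<Omega> \<inter> space lebesgue \<in> sets lebesgue" using \<Omega> by simp
  have fm: "f \<in> borel_measurable (lebesgue_on \<Omega>)" and fi: "integrable (lebesgue_on \<Omega>) (\<lambda>x. (f x)\<^sup>2)"
    using f by (auto simp: L2_def)
  have "(\<lambda>x. f x * indicator \<Omega> x) \<in> borel_measurable lebesgue"
    using fm borel_measurable_restrict_space_iff[OF \<Omega>L, of f] by (simp add: mult.commute)
  then obtain g' where g': "g' \<in> borel_measurable lborel" "AE x in lborel. f x * indicator \<Omega> x = g' x"
    using completion_ex_borel_measurable_real by blast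
  define g where "g = (\<lambda>x. indicator \<Omega> x * g' x)"
  have gm: "g \<in> borel_measurable borel" using g'(1) \<Omega> by (simp add: g_def)
  have g0: "g x = 0" if "x \<notin> \<Omega>" for x using that by (simp add: g_def)
  have "AE x in lebesgue. f x * indicator \<Omega> x = g' x" using g'(2) by (rule AE_completion)
  then have ae: "AE x in lebesgue_on \<Omega>. f x = g x"
    unfolding AE_restrict_space_iff[OF \<Omega>L] g_def by eventually_elim (auto simp: indicator_def)
  have "integrable (lebesgue_on \<Omega>) (\<lambda>x. (g x)\<^sup>2)"
    by (rule integrable_cong_AE_imp[OF fi]) (use ae gm in \<open>auto intro!: borel_measurable_lebesgue_on\<close>)
  then have "integrable lborel (\<lambda>x. (g x)\<^sup>2)"
    using lebesgue_on_lborel(2)[OF \<Omega>, of "\<lambda>x. (g x)\<^sup>2"] gm g0 by simp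
  then have "(\<integral>\<^sup>+x. ennreal ((g x)\<^sup>2) \<partial>lborel) < \<infinity>"
    using integrable_sq_iff[of g lborel] gm by simp
  then show ?thesis using gm g0 ae unfolding L2_rep_def by blast
qed

lemma L2_repD:
  assumes "L2_rep \<Omega> f g"
  shows "g \<in> borel_measurable borel" "\<And>x. x \<notin> \<Omega> \<Longrightarrow> g x = 0" "AE x in lebesgue_on \<Omega>. f x = g x"
    "(\<integral>\<^sup>+x. ennreal ((g x)\<^sup>2) \<partial>lborel) < \<infinity>" "integrable lborel (\<lambda>x. (g x)\<^sup>2)"
  using assms integrable_sq_iff[of g lborel] by (auto simp: L2_rep_def)

lemma L2_rep_integral:
  assumes \<Omega>: "\<Omega> \<in> sets borel" and f: "f \<in> borel_measurable (lebesgue_on \<Omega>)" and r: "L2_rep \<Omega> f g"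
    and \<phi>: "\<phi> \<in> borel_measurable borel"
  shows "(\<integral>x. f x * \<phi> x \<partial>lebesgue_on \<Omega>) = (\<integral>x. g x * \<phi> x \<partial>lborel)"
proof -
  note [measurable] = f borel_measurable_lebesgue_on[OF \<phi>] borel_measurable_lebesgue_on[OF L2_repD(1)[OF r]]
  have "(\<integral>x. f x * \<phi> x \<partial>lebesgue_on \<Omega>) = (\<integral>x. g x * \<phi> x \<partial>lebesgue_on \<Omega>)"
    using L2_repD(3)[OF r] by (intro integral_cong_AE) auto
  also have "\<dots> = (\<integral>x. g x * \<phi> x \<partial>lborel)"
    using L2_repD(1,2)[OF r] \<phi> by (intro lebesgue_on_lborel \<Omega>) auto
  finally show ?thesis .
qed

lemma AE_lebesgue_on_lborel:
  assumes "\<Omega> \<in> sets borel" "AE x in lborel. x \<in> \<Omega> \<longrightarrow> P x"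
  shows "AE x in lebesgue_on \<Omega>. P x"
  using assms AE_completion[OF assms(2)] by (subst AE_restrict_space_iff) auto

lemma L2_norm_rep:
  assumes \<Omega>: "\<Omega> \<in> sets borel" and f: "f \<in> borel_measurable (lebesgue_on \<Omega>)" and r: "L2_rep \<Omega> f g"
  shows "(L2_norm (lebesgue_on \<Omega>) f)\<^sup>2 = (\<integral>x. (g x)\<^sup>2 \<partial>lborel)"
proof -
  note [measurable] = f borel_measurable_lebesgue_on[OF L2_repD(1)[OF r]]
  have "(\<integral>x. (f x)\<^sup>2 \<partial>lebesgue_on \<Omega>) = (\<integral>x. (g x)\<^sup>2 \<partial>lebesgue_on \<Omega>)"
    using L2_repD(3)[OF r] by (intro integral_cong_AE) auto
  also have "\<dots> = (\<integral>x. (g x)\<^sup>2 \<partial>lborel)"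
    using L2_repD(1,2)[OF r] by (intro lebesgue_on_lborel \<Omega>) auto
  finally show ?thesis by (simp add: L2_norm_def)
qed

lemma L2_rep_diff:
  assumes r: "L2_rep \<Omega> f g" and r': "L2_rep \<Omega> f' g'"
  shows "L2_rep \<Omega> (\<lambda>x. f x - f' x) (\<lambda>x. g x - g' x)"
proof -
  note [measurable] = L2_repD(1)[OF r] L2_repD(1)[OF r']
  have "(\<integral>\<^sup>+x. ennreal ((g x + - g' x)\<^sup>2) \<partial>lborel) \<le> 2 * (\<integral>\<^sup>+x. ennreal ((g x)\<^sup>2) \<partial>lborel) + 2 * (\<integral>\<^sup>+x. ennreal ((- g' x)\<^sup>2) \<partial>lborel)"
    by (rule nn_integral_sq_add_le) auto
  also have "\<dots> < \<infinity>" using L2_repD(4)[OF r] L2_repD(4)[OF r'] by (simp add: ennreal_mult_less_top ennreal_add_less_top)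
  finally show ?thesis
    using L2_repD(1,2,3)[OF r] L2_repD(1,2,3)[OF r'] unfolding L2_rep_def by auto
qed

lemma L2_rep_smooth:
  assumes \<Omega>: "open \<Omega>" "bounded \<Omega>" and v: "C_infinity v"
  shows "L2_rep \<Omega> v (\<lambda>x. indicator \<Omega> x * v x)" "v \<in> L2 (lebesgue_on \<Omega>)"
proof -
  have [measurable]: "v \<in> borel_measurable borel" "\<Omega> \<in> sets borel" using C_infinity_borel[OF v] \<Omega> by auto
  have "compact (v ` closure \<Omega>)"
    using \<Omega> by (intro compact_continuous_image C_infinity_continuous v) (simp add: compact_closure)
  then obtain B where B: "\<And>x. x \<in> \<Omega> \<Longrightarrow> \<bar>v x\<bar> \<le> B"
    using compact_imp_bounded bounded_iff closure_subset by (metis image_eqI real_norm_def subsetD)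
  have "(\<integral>\<^sup>+x. ennreal ((indicator \<Omega> x * v x)\<^sup>2) \<partial>lborel) \<le> (\<integral>\<^sup>+x. ennreal (B\<^sup>2) * indicator \<Omega> x \<partial>lborel)"
  proof (intro nn_integral_mono)
    fix x
    have "(v x)\<^sup>2 \<le> B\<^sup>2" if "x \<in> \<Omega>" using power_mono[OF B[OF that], of 2] by simp
    then show "ennreal ((indicator \<Omega> x * v x)\<^sup>2) \<le> ennreal (B\<^sup>2) * indicator \<Omega> x"
      by (auto simp: indicator_def intro: ennreal_leI)
  qed
  also have "\<dots> = ennreal (B\<^sup>2) * emeasure lborel \<Omega>" by (rule nn_integral_cmult_indicator) simp
  also have "\<dots> < \<infinity>" using emeasure_bounded_finite[OF \<Omega>(2)] by (simp add: ennreal_mult_less_top)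
  finally show r: "L2_rep \<Omega> v (\<lambda>x. indicator \<Omega> x * v x)"
    unfolding L2_rep_def by (auto intro!: AE_lebesgue_on_lborel AE_I2)
  have vm: "v \<in> borel_measurable (lebesgue_on \<Omega>)" by (intro borel_measurable_lebesgue_on) auto
  have "integrable (lebesgue_on \<Omega>) (\<lambda>x. (indicator \<Omega> x * v x)\<^sup>2)"
    using L2_repD(5)[OF r] by (subst lebesgue_on_lborel(2)) auto
  then have "integrable (lebesgue_on \<Omega>) (\<lambda>x. (v x)\<^sup>2)"
    by (rule integrable_cong_AE_imp) (use vm L2_repD(3)[OF r] in auto)
  with vm show "v \<in> L2 (lebesgue_on \<Omega>)" by (simp add: L2_def)
qed

subsection \<open>Integration by parts\<close>

lemma DERIV_line:
  assumes "C_infinity F"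
  shows "((\<lambda>t. F (x + t *\<^sub>R v)) has_real_derivative (\<Sum>i\<in>UNIV. v $ i * partial i F (x + t *\<^sub>R v))) (at t)"
proof -
  have "((\<lambda>t. x + t *\<^sub>R v) has_derivative (\<lambda>h. h *\<^sub>R v)) (at t)" by (auto intro!: derivative_eq_intros)
  from has_derivative_compose[OF this has_derivative_partials[OF C_infinity_differentiable[OF assms]]]
  have "((\<lambda>t. F (x + t *\<^sub>R v)) has_derivative (\<lambda>h. \<Sum>i\<in>UNIV. (h *\<^sub>R v) $ i * partial i F (x + t *\<^sub>R v))) (at t)" .
  moreover have "(\<lambda>h. \<Sum>i\<in>UNIV. (h *\<^sub>R v) $ i * partial i F (x + t *\<^sub>R v)) = (*) (\<Sum>i\<in>UNIV. v $ i * partial i F (x + t *\<^sub>R v))"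
    by (simp add: fun_eq_iff sum_distrib_left mult_ac)
  ultimately show ?thesis by (simp add: has_field_derivative_def)
qed

lemma partials_zero_open:
  assumes "open S" "\<And>y. y \<in> S \<Longrightarrow> f y = 0" "x \<in> S"
  shows "partials w f x = 0"
  using assms(3)
proof (induction w arbitrary: x)
  case (Cons i w)
  have "((\<lambda>_. 0) has_derivative (\<lambda>_. 0)) (at x)" by simp
  then have "(partials w f has_derivative (\<lambda>_. 0)) (at x)"
    by (rule has_derivative_transform_within_open[OF _ assms(1) Cons.prems]) (use Cons.IH in simp)
  then show ?case using partial_eqI by fastforce
qed (use assms in simp)

lemma test_function_zero:
  assumes "test_function \<Omega> \<phi>"
  shows "x \<notin> \<Omega> \<Longrightarrow> partials w \<phi> x = 0" "\<exists>R. \<forall>x. R < norm x \<longrightarrow> partials w \<phi> x = 0"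
proof -
  let ?S = "closure {x. \<phi> x \<noteq> 0}"
  have z: "partials w \<phi> x = 0" if "x \<notin> ?S" for x
  proof (rule partials_zero_open[of "- ?S"])
    show "\<phi> y = 0" if "y \<in> - ?S" for y using that closure_subset[of "{x. \<phi> x \<noteq> 0}"] by blast
  qed (use that in auto)
  show "x \<notin> \<Omega> \<Longrightarrow> partials w \<phi> x = 0" using assms z by (auto simp: test_function_def)
  have "bounded ?S" using assms by (auto simp: test_function_def compact_imp_bounded)
  then obtain R where "\<forall>x\<in>?S. norm x \<le> R" using bounded_iff by blast
  then show "\<exists>R. \<forall>x. R < norm x \<longrightarrow> partials w \<phi> x = 0" using z by (meson linorder_not_le)
qed

lemma C_infinity_bounded_support:
  assumes F: "C_infinity F" and R: "\<And>x. R < norm x \<Longrightarrow> F x = 0"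
  shows "\<exists>B. \<forall>x. \<bar>F x\<bar> \<le> B" "integrable lborel F"
proof -
  have "compact (F ` cball 0 R)" by (intro compact_continuous_image C_infinity_continuous F compact_cball)
  then obtain B where B: "\<forall>y\<in>F ` cball 0 R. norm y \<le> B" using compact_imp_bounded bounded_iff by blast
  have B: "\<bar>F x\<bar> \<le> \<bar>B\<bar>" for x
  proof (cases "R < norm x")
    case False
    then have "F x \<in> F ` cball 0 R" by simp
    then have "norm (F x) \<le> B" using B by blast
    then show ?thesis by simp
  qed (simp add: R)
  then show "\<exists>B. \<forall>x. \<bar>F x\<bar> \<le> B" by blast
  have "integrable lborel (\<lambda>x. indicator (cball 0 R) x *\<^sub>R F x)"
    by (intro borel_integrable_compact C_infinity_continuous F compact_cball)
  moreover have "(\<lambda>x. indicator (cball 0 R) x *\<^sub>R F x) = F" using R by (auto simp: indicator_def fun_eq_iff)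
  ultimately show "integrable lborel F" by simp
qed

text \<open>Difference quotients integrate to zero by translation invariance and converge
  dominatedly to the partial derivative: the mean value theorem bounds them by \<open>B\<close>, and
  steps of length at most one keep them supported in the ball of radius
  \<open>R + 1\<close>.\<close>

lemma integral_partial_zero:
  fixes F :: "real^'d::finite \<Rightarrow> real"
  assumes F: "C_infinity F" and R: "\<And>x. R < norm x \<Longrightarrow> F x = 0"
  shows "(\<integral>x. partial i F x \<partial>lborel) = 0"
proof -
  have R': "partial i F x = 0" if "R < norm x" for x
  proof -
    have "open {x::real^'d. R < norm x}" by (intro open_Collect_less continuous_intros)
    then show ?thesis using partials_zero_open[of "{x. R < norm x}" F x "[i]"] R that by simp
  qed
  obtain B where B: "\<And>x. \<bar>partial i F x\<bar> \<le> B"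
    using C_infinity_bounded_support(1)[OF C_infinity_partial[OF F] R'] by blast
  define h where "h = (\<lambda>n. 1 / real (Suc n))"
  have h: "0 < h n" "h n \<le> 1" for n by (auto simp: h_def)
  have h0: "h \<longlonglongrightarrow> 0" unfolding h_def by (rule LIMSEQ_Suc[OF lim_1_over_n])
  let ?e = "axis i 1 :: real^'d"
  define q where "q = (\<lambda>n x. (F (x + h n *\<^sub>R ?e) - F x) / h n)"
  have D: "((\<lambda>t. F (x + t *\<^sub>R ?e)) has_real_derivative partial i F (x + t *\<^sub>R ?e)) (at t)" for x t
  proof -
    have "(\<Sum>j\<in>UNIV. ?e $ j * partial j F (x + t *\<^sub>R ?e)) = partial i F (x + t *\<^sub>R ?e)"
      by (simp add: axis_def if_distrib[of "\<lambda>a. a * _"] sum.delta cong: if_cong)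
    then show ?thesis using DERIV_line[OF F, of x ?e t] by simp
  qed
  have [measurable]: "F \<in> borel_measurable borel" "partial i F \<in> borel_measurable borel"
    using C_infinity_borel F C_infinity_partial by auto
  have Fi: "integrable lborel F" by (rule C_infinity_bounded_support(2)[OF F R])
  have lim: "(\<lambda>n. \<integral>x. q n x \<partial>lborel) \<longlonglongrightarrow> (\<integral>x. partial i F x \<partial>lborel)"
  proof (rule integral_dominated_convergence[where w = "\<lambda>x. indicator (cball 0 (R + 1)) x *\<^sub>R B"])
    show "integrable lborel (\<lambda>x::real^'d. indicator (cball 0 (R + 1)) x *\<^sub>R B)"
      by (intro borel_integrable_compact compact_cball continuous_on_const)
    show "AE x in lborel. (\<lambda>n. q n x) \<longlonglongrightarrow> partial i F x"
    proof (rule AE_I2)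
      fix x
      have "((\<lambda>t. (F (x + t *\<^sub>R ?e) - F x) / t) \<longlongrightarrow> partial i F x) (at 0)"
        using D[of x 0] by (simp add: DERIV_def)
      moreover have "filterlim h (at 0) sequentially"
        using h0 h(1) by (auto simp: filterlim_at eventually_sequentially less_imp_neq[symmetric])
      ultimately show "(\<lambda>n. q n x) \<longlonglongrightarrow> partial i F x"
        unfolding q_def by (rule filterlim_compose)
    qed
    show "AE x in lborel. norm (q n x) \<le> indicator (cball 0 (R + 1)) x *\<^sub>R B" for n
    proof (rule AE_I2)
      fix x
      show "norm (q n x) \<le> indicator (cball 0 (R + 1)) x *\<^sub>R B"
      proof (cases "norm x \<le> R + 1")
        case True
        obtain z where "F (x + h n *\<^sub>R ?e) - F (x + 0 *\<^sub>R ?e) = (h n - 0) * partial i F (x + z *\<^sub>R ?e)"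
          using MVT2[OF h(1)[of n], of "\<lambda>t. F (x + t *\<^sub>R ?e)" "\<lambda>t. partial i F (x + t *\<^sub>R ?e)"] D by blast
        then have "q n x = partial i F (x + z *\<^sub>R ?e)" using h(1)[of n] by (simp add: q_def)
        then show ?thesis using B True by (simp add: indicator_def)
      next
        case False
        have "norm (h n *\<^sub>R ?e) \<le> 1" using h[of n] by simp
        then have "R < norm (x + h n *\<^sub>R ?e)"
          using False norm_triangle_ineq2[of x "- (h n *\<^sub>R ?e)"] by simp
        then have "q n x = 0" using False R by (simp add: q_def)
        then show ?thesis using False by (simp add: indicator_def)
      qed
    qed
  qed (auto simp: q_def)
  have "(\<integral>x. q n x \<partial>lborel) = 0" for n
  proof -
    have Fs: "integrable lborel (\<lambda>x. F (x + h n *\<^sub>R ?e))" "(\<integral>x. F (x + h n *\<^sub>R ?e) \<partial>lborel) = (\<integral>x. F x \<partial>lborel)"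
    proof -
      have "distr lborel borel ((+) (h n *\<^sub>R ?e)) = (lborel :: (real^'d) measure)" by (rule lborel_distr_plus)
      then have "integrable (distr lborel borel ((+) (h n *\<^sub>R ?e))) F"
        "(\<integral>x. F x \<partial>distr lborel borel ((+) (h n *\<^sub>R ?e))) = (\<integral>x. F x \<partial>lborel)" using Fi by simp_all
      then show "integrable lborel (\<lambda>x. F (x + h n *\<^sub>R ?e))" "(\<integral>x. F (x + h n *\<^sub>R ?e) \<partial>lborel) = (\<integral>x. F x \<partial>lborel)"
        by (subst (asm) integrable_distr_eq, auto simp: add.commute)
          (subst (asm) integral_distr, auto simp: add.commute)
    qed
    then show ?thesis unfolding q_def using Fi by (simp add: Bochner_Integration.integral_diff)
  qed
  then show ?thesis using LIMSEQ_unique[OF lim] by simp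
qed

text \<open>The outermost derivative of the word is moved to \<open>v\<close> first and therefore
  ends up innermost there, which reverses the word.\<close>

lemma integration_by_parts_test:
  assumes "C_infinity v" and \<phi>: "test_function \<Omega> \<phi>"
  shows "(\<integral>x. v x * partials w \<phi> x \<partial>lborel) = (-1) ^ length w * (\<integral>x. partials (rev w) v x * \<phi> x \<partial>lborel)"
  using assms(1)
proof (induction w arbitrary: v)
  case (Cons i w)
  have C\<phi>: "C_infinity (partials w \<phi>)" "C_infinity (partials (i # w) \<phi>)"
    using \<phi> C_infinity_partials unfolding test_function_def by blast+
  obtain R where R: "\<And>x. R < norm x \<Longrightarrow> partials w \<phi> x = 0" using test_function_zero(2)[OF \<phi>] by blast
  obtain R' where R': "\<And>x. R' < norm x \<Longrightarrow> partials (i # w) \<phi> x = 0" using test_function_zero(2)[OF \<phi>] by blast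
  note Cv = C_infinity_mult[OF Cons.prems C\<phi>(1)] C_infinity_mult[OF Cons.prems C\<phi>(2)]
    C_infinity_mult[OF C_infinity_partial[OF Cons.prems] C\<phi>(1)]
  have I1: "integrable lborel (\<lambda>x. v x * partials (i # w) \<phi> x)"
    by (rule C_infinity_bounded_support(2)[OF Cv(2), of R']) (simp del: partials.simps add: R')
  have I2: "integrable lborel (\<lambda>x. partial i v x * partials w \<phi> x)"
    by (rule C_infinity_bounded_support(2)[OF Cv(3), of R]) (simp add: R)
  have "0 = (\<integral>x. partial i (\<lambda>x. v x * partials w \<phi> x) x \<partial>lborel)"
    by (rule integral_partial_zero[OF Cv(1), of R, symmetric]) (simp add: R)
  also have "\<dots> = (\<integral>x. v x * partials (i # w) \<phi> x + partial i v x * partials w \<phi> x \<partial>lborel)"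
    using partial_mult[OF C_infinity_differentiable[OF Cons.prems] C_infinity_differentiable[OF C\<phi>(1)]] by simp
  also have "\<dots> = (\<integral>x. v x * partials (i # w) \<phi> x \<partial>lborel) + (\<integral>x. partial i v x * partials w \<phi> x \<partial>lborel)"
    by (rule Bochner_Integration.integral_add[OF I1 I2])
  finally show ?case using Cons.IH[OF C_infinity_partial[OF Cons.prems], of i] by (simp add: partials_append)
qed simp

lemma is_weak_deriv_smooth:
  assumes \<Omega>: "open \<Omega>" "bounded \<Omega>" and v: "C_infinity v"
  shows "is_weak_deriv \<Omega> w v (partials (rev w) v)"
  unfolding is_weak_deriv_def
proof (intro conjI allI impI)
  show "partials (rev w) v \<in> L2 (lebesgue_on \<Omega>)" by (intro L2_rep_smooth(2) \<Omega> C_infinity_partials v)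
  fix \<phi> assume \<phi>: "test_function \<Omega> \<phi>"
  have m: "partials u \<phi> \<in> borel_measurable borel" "partials u v \<in> borel_measurable borel" for u
    using \<phi> v C_infinity_borel C_infinity_partials unfolding test_function_def by blast+
  have z: "x \<notin> \<Omega> \<Longrightarrow> partials u \<phi> x = 0" for x u by (rule test_function_zero(1)[OF \<phi>])
  have "(\<integral>x. v x * partials w \<phi> x \<partial>lebesgue_on \<Omega>) = (\<integral>x. v x * partials w \<phi> x \<partial>lborel)"
    using \<Omega> m(1)[of w] m(2)[of "[]"] z[of _ w] by (intro lebesgue_on_lborel) auto
  also have "\<dots> = (-1) ^ length w * (\<integral>x. partials (rev w) v x * \<phi> x \<partial>lborel)"
    by (rule integration_by_parts_test[OF v \<phi>])
  also have "(\<integral>x. partials (rev w) v x * \<phi> x \<partial>lborel) = (\<integral>x. partials (rev w) v x * \<phi> x \<partial>lebesgue_on \<Omega>)"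
    using \<Omega> m(1)[of "[]"] m(2) z[of _ "[]"] by (intro lebesgue_on_lborel(1)[symmetric]) auto
  finally show "(\<integral>x. v x * partials w \<phi> x \<partial>lebesgue_on \<Omega>) =
    (-1) ^ length w * (\<integral>x. partials (rev w) v x * \<phi> x \<partial>lebesgue_on \<Omega>)" .
qed

lemma is_weak_deriv_rep:
  assumes \<Omega>: "open \<Omega>" and u: "u \<in> L2 (lebesgue_on \<Omega>)" and d: "is_weak_deriv \<Omega> w u v"
    and r: "L2_rep \<Omega> u g" "L2_rep \<Omega> v g'" and \<phi>: "test_function \<Omega> \<phi>"
  shows "(\<integral>x. g x * partials w \<phi> x \<partial>lborel) = (-1) ^ length w * (\<integral>x. g' x * \<phi> x \<partial>lborel)"
proof -
  have m: "partials u \<phi> \<in> borel_measurable borel" for u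
    using \<phi> C_infinity_borel C_infinity_partials unfolding test_function_def by blast
  show ?thesis
    using d \<phi> L2_rep_integral[OF _ _ r(1) m[of w]] L2_rep_integral[OF _ _ r(2) m[of "[]"]] u \<Omega>
    unfolding is_weak_deriv_def L2_def by auto
qed

subsection \<open>Smooth kernels and uniqueness of weak derivatives\<close>

lemma C_infinity_bump: "C_infinity (\<lambda>y. flat (r - (norm (y - p :: real^'d::finite))\<^sup>2))"
proof (rule C_infinity_compose[OF smooth_flat])
  have "(\<lambda>y::real^'d. r - (norm (y - p))\<^sup>2) = (\<lambda>y. r - (\<Sum>i\<in>UNIV. (y $ i - p $ i) * (y $ i - p $ i)))"
    by (simp add: power2_norm_eq_inner inner_vec_def)
  moreover have "C_infinity (\<lambda>y::real^'d. r - (\<Sum>i\<in>UNIV. (y $ i - p $ i) * (y $ i - p $ i)))"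
    by (intro C_infinity_diff C_infinity_const C_infinity_sum C_infinity_mult C_infinity_nth)
  ultimately show "C_infinity (\<lambda>y::real^'d. r - (norm (y - p))\<^sup>2)" by simp
qed

text \<open>A product of one-variable bumps rather than a radial function: the product form allows
  the kernel to be approximated by exponentials one variable at a time. The centre \<open>c\<close>
  is arbitrary so that the kernel can be placed on the axis of a cone.\<close>

lemma kernel_exists:
  fixes c :: "real^'d::finite"
  assumes "q > 0"
  shows "\<exists>f \<kappa> B. (\<forall>i. smooth (f i)) \<and> \<kappa> = (\<lambda>z::real^'d. \<Prod>i\<in>UNIV. f i (z $ i)) \<and> C_infinity \<kappa> \<and>
    (\<forall>z. 0 \<le> \<kappa> z \<and> \<kappa> z \<le> B) \<and> (\<integral>\<^sup>+z. ennreal (\<kappa> z) \<partial>lborel) = 1 \<and> (\<forall>z. \<kappa> z \<noteq> 0 \<longrightarrow> norm (z - c) < q)"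
proof -
  \<comment> \<open>Half the side of a cube: if every coordinate is off by less than
    \<open>a\<close>, then the sum of the deviations, hence the norm, is below
    \<open>q\<close>.\<close>
  define a where "a = q / real CARD('d)"
  have a: "a > 0" using assms by (simp add: a_def)
  define \<beta> where "\<beta> = (\<lambda>i s. flat (1 * s + (a - c $ i)) * flat ((-1) * s + (a + c $ i)))"
  have \<beta>s: "smooth (\<beta> i)" for i unfolding \<beta>_def by (intro smooth_mult smooth_affine smooth_flat)
  have \<beta>0: "0 \<le> \<beta> i s" for i s by (simp add: \<beta>_def flat_nonneg)
  have \<beta>p: "\<beta> i s > 0 \<longleftrightarrow> \<bar>s - c $ i\<bar> < a" for i s
    using flat_nonneg[of "1 * s + (a - c $ i)"] flat_nonneg[of "(-1) * s + (a + c $ i)"]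
    by (auto simp: \<beta>_def zero_less_mult_iff flat_pos_iff)
  define P where "P = (\<lambda>z::real^'d. \<Prod>i\<in>UNIV. \<beta> i (z $ i))"
  have CP: "C_infinity P" unfolding P_def by (rule C_infinity_prod) (rule C_infinity_compose[OF \<beta>s C_infinity_nth])
  have P0: "0 \<le> P z" for z unfolding P_def by (intro prod_nonneg) (simp add: \<beta>0)
  have Pc: "P c > 0" unfolding P_def by (intro prod_pos) (simp add: \<beta>p a)
  have Psupp: "norm (z - c) < q" if "P z \<noteq> 0" for z
  proof -
    have "\<beta> i (z $ i) \<noteq> 0" for i using that by (auto simp: P_def)
    then have "\<bar>z $ i - c $ i\<bar> < a" for i using \<beta>p \<beta>0 by (metis less_eq_real_def)
    then have "(\<Sum>i\<in>UNIV. \<bar>(z - c) $ i\<bar>) < (\<Sum>i\<in>(UNIV::'d set). a)"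
      by (intro sum_strict_mono) auto
    then show ?thesis using norm_le_l1_cart[of "z - c"] by (simp add: a_def)
  qed
  have Pz: "P z = 0" if "norm c + q < norm z" for z
  proof (rule ccontr)
    assume "P z \<noteq> 0"
    then show False using Psupp[of z] that norm_triangle_sub[of z c] by simp
  qed
  have [measurable]: "P \<in> borel_measurable borel" by (rule C_infinity_borel[OF CP])
  have PI: "integrable lborel P" by (rule C_infinity_bounded_support(2)[OF CP Pz])
  obtain B where B: "\<And>z. \<bar>P z\<bar> \<le> B" using C_infinity_bounded_support(1)[OF CP Pz] by blast
  have I: "(\<integral>\<^sup>+z. ennreal (P z) \<partial>lborel) = ennreal (integral\<^sup>L lborel P)"
    using P0 by (intro nn_integral_eq_integral PI) auto
  \<comment> \<open>A nonnegative function of integral zero vanishes almost everywhere, whereas the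
    set where \<open>P\<close> is nonzero is open and contains \<open>c\<close>.\<close>
  have Ipos: "integral\<^sup>L lborel P > 0"
  proof (rule ccontr)
    assume "\<not> ?thesis"
    then have "(\<integral>\<^sup>+z. ennreal (P z) \<partial>lborel) = 0" using I by (simp add: ennreal_neg)
    then have "AE z in lborel. P z = 0" using P0 by (subst (asm) nn_integral_0_iff_AE) (auto simp: ennreal_eq_0_iff antisym)
    then have "{z. P z \<noteq> 0} \<in> null_sets lborel" by (subst (asm) AE_iff_null) auto
    then have "negligible {z. P z \<noteq> 0}"
      unfolding negligible_iff_null_sets by (rule null_sets_completionI)
    moreover have "open {z. P z \<noteq> 0}" by (intro open_Collect_neq C_infinity_continuous CP continuous_on_const)
    ultimately show False using Pc open_not_negligible[of "{z. P z \<noteq> 0}"] by (metis (mono_tags, lifting) empty_Collect_eq less_irrefl)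
  qed
  \<comment> \<open>The normalisation is split evenly among the factors by a root, so that the
    normalised kernel is again a product.\<close>
  define K where "K = root CARD('d) (1 / integral\<^sup>L lborel P)"
  have K: "K ^ CARD('d) = 1 / integral\<^sup>L lborel P" "K \<ge> 0"
    unfolding K_def using Ipos by (auto intro: real_root_pow_pos2)
  define f where "f = (\<lambda>i s. K * \<beta> i s)"
  define \<kappa> where "\<kappa> = (\<lambda>z::real^'d. \<Prod>i\<in>UNIV. f i (z $ i))"
  have \<kappa>: "\<kappa> z = P z / integral\<^sup>L lborel P" for z
  proof -
    have "\<kappa> z = K ^ CARD('d) * (\<Prod>i\<in>UNIV. \<beta> i (z $ i))"
      unfolding \<kappa>_def f_def prod.distrib by simp
    also have "(\<Prod>i\<in>UNIV. \<beta> i (z $ i)) = P z" by (simp add: P_def)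
    finally show ?thesis by (simp add: K)
  qed
  have "smooth (f i)" for i
  proof -
    have "smooth (\<lambda>s. K)" unfolding smooth_def
    proof (intro allI)
      fix n x
      have "(deriv ^^ n) (\<lambda>s. K) = (\<lambda>s. if n = 0 then K else 0)" by (induction n) auto
      then show "(deriv ^^ n) (\<lambda>s. K) field_differentiable at x" by simp
    qed
    then show ?thesis unfolding f_def by (rule smooth_mult[OF _ \<beta>s])
  qed
  moreover have "C_infinity \<kappa>"
    unfolding \<kappa>_def by (rule C_infinity_prod) (rule C_infinity_compose[OF calculation C_infinity_nth])
  moreover have "0 \<le> \<kappa> z \<and> \<kappa> z \<le> B / integral\<^sup>L lborel P" for z
    using P0[of z] B[of z] Ipos unfolding \<kappa> by (auto intro: divide_right_mono)
  moreover have "(\<integral>\<^sup>+z. ennreal (\<kappa> z) \<partial>lborel) = 1"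
  proof -
    have "(\<integral>\<^sup>+z. ennreal (\<kappa> z) \<partial>lborel) = (\<integral>\<^sup>+z. ennreal (P z) * ennreal (1 / integral\<^sup>L lborel P) \<partial>lborel)"
      using P0 Ipos by (intro nn_integral_cong) (simp add: \<kappa> flip: ennreal_mult)
    also have "\<dots> = ennreal (integral\<^sup>L lborel P) * ennreal (1 / integral\<^sup>L lborel P)"
      by (subst nn_integral_multc) (auto simp: I)
    also have "\<dots> = 1" using Ipos by (simp flip: ennreal_mult)
    finally show ?thesis .
  qed
  moreover have "norm (z - c) < q" if "\<kappa> z \<noteq> 0" for z using that Psupp by (auto simp: \<kappa>)
  ultimately show ?thesis using \<kappa>_def by blast
qed

text \<open>What has to lie in \<Omega> is the intersection of the two supports. The shifted kernel
  is supported in a closed ball of radius \<open>q'\<close>, and the gap between \<open>q'\<close>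
  and \<open>q\<close> leaves room for taking closures.\<close>

lemma test_function_localized:
  assumes \<theta>: "C_infinity \<theta>" and \<kappa>: "C_infinity \<kappa>" and q: "q' < q" "\<And>z. \<kappa> z \<noteq> 0 \<Longrightarrow> norm (z - c) < q'"
    and sub: "closure {y. \<theta> y \<noteq> 0} \<inter> ball (x + c) q \<subseteq> \<Omega>"
  shows "test_function \<Omega> (\<lambda>y. \<theta> y * \<kappa> (y - x))"
proof -
  let ?S = "{y. \<theta> y * \<kappa> (y - x) \<noteq> 0}"
  have S: "?S \<subseteq> cball (x + c) q'"
  proof
    fix y assume "y \<in> ?S"
    then have "norm (y - x - c) < q'" using q(2)[of "y - x"] by auto
    then show "y \<in> cball (x + c) q'" by (simp add: dist_norm norm_minus_commute algebra_simps)
  qed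
  then have 1: "closure ?S \<subseteq> cball (x + c) q'" by (intro closure_minimal) auto
  have "?S \<subseteq> {y. \<theta> y \<noteq> 0}" by auto
  then have 2: "closure ?S \<subseteq> closure {y. \<theta> y \<noteq> 0}" by (rule closure_mono)
  have "bounded (closure ?S)" using 1 bounded_subset bounded_cball by blast
  then have "compact (closure ?S)" by (simp add: compact_eq_bounded_closed)
  moreover have "closure ?S \<subseteq> \<Omega>" using 1 2 sub q(1) by (fastforce simp: subset_iff)
  moreover have "C_infinity (\<lambda>y. \<theta> y * \<kappa> (y - x))"
    by (intro C_infinity_mult \<theta> C_infinity_translate[OF \<kappa>])
  ultimately show ?thesis by (simp add: test_function_def)
qed

text \<open>On a ball inside \<Omega>, multiply \<open>g\<close> by a bump \<open>\<theta>\<close>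
  that is positive on it. Every value of a mollification of \<open>g * \<theta>\<close> is the
  integral of \<open>g\<close> against a test function, hence zero, so the squared norm of
  \<open>g * \<theta>\<close> is below every \<open>e\<close>. Countably many such balls exhaust
  \<Omega> by Lindelof's theorem.\<close>

lemma fundamental_lemma:
  fixes g :: "real^'d::finite \<Rightarrow> real"
  assumes \<Omega>: "open \<Omega>" and gm[measurable]: "g \<in> borel_measurable borel"
    and fin: "(\<integral>\<^sup>+x. ennreal ((g x)\<^sup>2) \<partial>lborel) < \<infinity>"
    and test: "\<And>\<phi>. test_function \<Omega> \<phi> \<Longrightarrow> (\<integral>x. g x * \<phi> x \<partial>lborel) = 0"
  shows "AE x in lborel. x \<in> \<Omega> \<longrightarrow> g x = 0"
proof -
  have local: "AE x in lborel. x \<in> ball p r \<longrightarrow> g x = 0" if r: "r > 0" "cball p r \<subseteq> \<Omega>" for p r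
  proof -
    define \<theta> where "\<theta> = (\<lambda>y::real^'d. flat (r\<^sup>2 - (norm (y - p))\<^sup>2))"
    have \<theta>: "C_infinity \<theta>" unfolding \<theta>_def by (rule C_infinity_bump)
    have [measurable]: "\<theta> \<in> borel_measurable borel" by (rule C_infinity_borel[OF \<theta>])
    have supp: "{y. \<theta> y \<noteq> 0} \<subseteq> ball p r"
    proof
      fix y assume "y \<in> {y. \<theta> y \<noteq> 0}"
      then have "\<not> r\<^sup>2 - (norm (y - p))\<^sup>2 \<le> 0" using flat_zero[of "r\<^sup>2 - (norm (y - p))\<^sup>2"] by (auto simp: \<theta>_def)
      then have "norm (y - p) < r" using r(1) power2_less_imp_less[of "norm (y - p)" r] by simp
      then show "y \<in> ball p r" by (simp add: dist_norm norm_minus_commute)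
    qed
    then have "{y. \<theta> y \<noteq> 0} \<subseteq> cball p r" using ball_subset_cball by (rule order_trans)
    then have "closure {y. \<theta> y \<noteq> 0} \<subseteq> cball p r" using closed_cball by (rule closure_minimal)
    then have suppc: "closure {y. \<theta> y \<noteq> 0} \<subseteq> \<Omega>" using r(2) by (rule order_trans)
    have \<theta>1: "0 \<le> \<theta> y" "\<theta> y \<le> 1" for y by (auto simp: \<theta>_def flat_def)
    define G where "G = (\<lambda>y. g y * \<theta> y)"
    have Gm[measurable]: "G \<in> borel_measurable borel" by (simp add: G_def)
    have "(\<integral>\<^sup>+x. ennreal ((G x)\<^sup>2) \<partial>lborel) \<le> (\<integral>\<^sup>+x. ennreal ((g x)\<^sup>2) \<partial>lborel)"
      using \<theta>1 by (intro nn_integral_mono ennreal_leI) (auto simp: G_def power_mult_distrib intro!: mult_left_le power_le_one)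
    then have Gfin: "(\<integral>\<^sup>+x. ennreal ((G x)\<^sup>2) \<partial>lborel) < \<infinity>" using fin by (rule le_less_trans)
    have small: "(\<integral>\<^sup>+x. ennreal ((G x)\<^sup>2) \<partial>lborel) \<le> ennreal e" if "e > 0" for e
    proof -
      obtain d where d: "d > 0" and D: "\<forall>\<kappa> B. \<kappa> \<in> borel_measurable borel \<longrightarrow> (\<forall>z. 0 \<le> \<kappa> z \<and> \<kappa> z \<le> B) \<longrightarrow>
        (\<integral>\<^sup>+z. ennreal (\<kappa> z) \<partial>lborel) = 1 \<longrightarrow> (\<forall>z. d \<le> norm z \<longrightarrow> \<kappa> z = 0) \<longrightarrow>
        (\<integral>\<^sup>+x. ennreal (((\<integral>y. G y * \<kappa> (y - x) \<partial>lborel) - G x)\<^sup>2) \<partial>lborel) \<le> ennreal e"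
        using L2_mollify[OF Gm Gfin \<open>e > 0\<close>] by blast
      obtain \<kappa> :: "real^'d \<Rightarrow> real" and B where \<kappa>: "C_infinity \<kappa>" "\<forall>z. 0 \<le> \<kappa> z \<and> \<kappa> z \<le> B" "(\<integral>\<^sup>+z. ennreal (\<kappa> z) \<partial>lborel) = 1"
        "\<forall>z. \<kappa> z \<noteq> 0 \<longrightarrow> norm (z - 0) < d"
        using kernel_exists[OF d, of "0 :: real^'d"] by blast
      have "\<forall>z. d \<le> norm z \<longrightarrow> \<kappa> z = 0" using \<kappa>(4) by force
      then have "(\<integral>\<^sup>+x. ennreal (((\<integral>y. G y * \<kappa> (y - x) \<partial>lborel) - G x)\<^sup>2) \<partial>lborel) \<le> ennreal e"
        using D \<kappa> C_infinity_borel[OF \<kappa>(1)] by blast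
      moreover have "(\<integral>y. G y * \<kappa> (y - x) \<partial>lborel) = 0" for x
      proof -
        \<comment> \<open>The support of \<open>\<theta>\<close> already lies in \<Omega>, so the
          condition on the ball holds for any radius above \<open>d\<close>; \<open>d + 1\<close> is
          one.\<close>
        have "test_function \<Omega> (\<lambda>y. \<theta> y * \<kappa> (y - x))"
          by (rule test_function_localized[OF \<theta> \<kappa>(1), of d "d + 1" 0]) (use \<kappa>(4) suppc in \<open>simp, simp, blast\<close>)
        from test[OF this] show ?thesis by (simp add: G_def mult.assoc)
      qed
      ultimately show ?thesis by simp
    qed
    have "(\<integral>\<^sup>+x. ennreal ((G x)\<^sup>2) \<partial>lborel) \<le> 0"
      by (rule ennreal_le_epsilon) (use small in auto)
    then have "(\<integral>\<^sup>+x. ennreal ((G x)\<^sup>2) \<partial>lborel) = 0" by simp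
    then have "AE x in lborel. G x = 0" by (subst (asm) nn_integral_0_iff_AE) auto
    then show ?thesis
    proof eventually_elim
      fix x assume "G x = 0"
      show "x \<in> ball p r \<longrightarrow> g x = 0"
      proof
        assume "x \<in> ball p r"
        then have "norm (x - p) < r" by (simp add: dist_norm norm_minus_commute)
        then have "(norm (x - p))\<^sup>2 < r\<^sup>2" using power_strict_mono[of "norm (x - p)" r 2] by simp
        then have "\<theta> x > 0" by (simp add: \<theta>_def flat_pos_iff)
        then show "g x = 0" using \<open>G x = 0\<close> by (simp add: G_def)
      qed
    qed
  qed
  obtain D where D: "countable D" "D \<subseteq> Pow \<Omega>" "\<And>X. X \<in> D \<Longrightarrow> \<exists>p r. r > 0 \<and> cball p r \<subseteq> \<Omega> \<and> X = ball p r" "\<Omega> = \<Union>D"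
  proof -
    let ?F = "{X. \<exists>p r. r > 0 \<and> cball p r \<subseteq> \<Omega> \<and> X = ball p r}"
    obtain D where D: "D \<subseteq> ?F" "countable D" "\<Union>D = \<Union>?F"
      using Lindelof[of ?F] by auto
    have sub: "x \<in> \<Union>?F" if x: "x \<in> \<Omega>" for x
    proof -
      obtain r where "r > 0" "cball x r \<subseteq> \<Omega>" using \<Omega> x unfolding open_contains_cball by blast
      then show ?thesis by (intro UnionI[of "ball x r"]) auto
    qed
    have F\<Omega>: "X \<subseteq> \<Omega>" if "X \<in> ?F" for X using that ball_subset_cball by blast
    show ?thesis
    proof (rule that[of D])
      show "D \<subseteq> Pow \<Omega>" using D(1) F\<Omega> by blast
      show "\<Omega> = \<Union>D" unfolding D(3) using sub F\<Omega> by blast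
    qed (use D in blast)+
  qed
  have "AE x in lborel. \<forall>X\<in>D. x \<in> X \<longrightarrow> g x = 0"
  proof (subst AE_ball_countable[OF D(1)], intro ballI)
    fix X assume "X \<in> D"
    then obtain p r where "r > 0" "cball p r \<subseteq> \<Omega>" "X = ball p r" using D(3) by blast
    then show "AE x in lborel. x \<in> X \<longrightarrow> g x = 0" using local by blast
  qed
  then show ?thesis by eventually_elim (use D(4) in blast)
qed

lemma integrable_mult_sq:
  fixes f g :: "'a \<Rightarrow> real"
  assumes [measurable]: "f \<in> borel_measurable M" "g \<in> borel_measurable M"
    and "integrable M (\<lambda>x. (f x)\<^sup>2)" "integrable M (\<lambda>x. (g x)\<^sup>2)"
  shows "integrable M (\<lambda>x. f x * g x)"
proof (rule Bochner_Integration.integrable_bound[OF Bochner_Integration.integrable_add[OF assms(3,4)]])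
  show "AE x in M. norm (f x * g x) \<le> norm ((f x)\<^sup>2 + (g x)\<^sup>2)"
  proof (rule AE_I2)
    fix x
    have "2 * \<bar>f x\<bar> * \<bar>g x\<bar> \<le> (f x)\<^sup>2 + (g x)\<^sup>2" using sum_squares_bound[of "\<bar>f x\<bar>" "\<bar>g x\<bar>"] by simp
    moreover have "0 \<le> \<bar>f x\<bar> * \<bar>g x\<bar>" by simp
    ultimately have "\<bar>f x\<bar> * \<bar>g x\<bar> \<le> (f x)\<^sup>2 + (g x)\<^sup>2" by linarith
    then show "norm (f x * g x) \<le> norm ((f x)\<^sup>2 + (g x)\<^sup>2)" by (simp add: abs_mult)
  qed
qed measurable

text \<open>The difference of the two representatives integrates to zero against every test
  function. The equality holds almost everywhere in the whole space because both representatives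
  vanish outside \<Omega>.\<close>

lemma weak_deriv_unique:
  fixes u :: "real^'d::finite \<Rightarrow> real"
  assumes \<Omega>: "open \<Omega>" and d: "is_weak_deriv \<Omega> w u v" "is_weak_deriv \<Omega> w u v'"
    and r: "L2_rep \<Omega> v g" "L2_rep \<Omega> v' g'"
  shows "AE x in lborel. g x = g' x"
proof -
  have \<Omega>b: "\<Omega> \<in> sets borel" using \<Omega> by simp
  have vm: "v \<in> borel_measurable (lebesgue_on \<Omega>)" "v' \<in> borel_measurable (lebesgue_on \<Omega>)"
    using d by (simp_all add: is_weak_deriv_def L2_def)
  have "AE x in lborel. x \<in> \<Omega> \<longrightarrow> g x - g' x = 0"
  proof (rule fundamental_lemma[OF \<Omega>])
    note rd = L2_rep_diff[OF r]
    show "(\<lambda>x. g x - g' x) \<in> borel_measurable borel" "(\<integral>\<^sup>+x. ennreal ((g x - g' x)\<^sup>2) \<partial>lborel) < \<infinity>"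
      by (rule L2_repD[OF rd])+
    fix \<phi> assume \<phi>: "test_function \<Omega> \<phi>"
    have m: "\<phi> \<in> borel_measurable borel" using \<phi> C_infinity_borel unfolding test_function_def by blast
    obtain R where R: "\<And>x. R < norm x \<Longrightarrow> \<phi> x = 0"
      using test_function_zero(2)[OF \<phi>, of "[]"] by auto
    have \<phi>2: "integrable lborel (\<lambda>x. \<phi> x * \<phi> x)"
      by (rule C_infinity_bounded_support(2)[of _ R]) (use \<phi> R in \<open>auto simp: test_function_def intro: C_infinity_mult\<close>)
    have int: "integrable lborel (\<lambda>x. h x * \<phi> x)" if "L2_rep \<Omega> f h" for f h
      using \<phi>2 m L2_repD(1,5)[OF that] by (intro integrable_mult_sq) (simp_all add: power2_eq_square)
    have "(-1) ^ length w * (\<integral>x. v x * \<phi> x \<partial>lebesgue_on \<Omega>) = (-1) ^ length w * (\<integral>x. v' x * \<phi> x \<partial>lebesgue_on \<Omega>)"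
      using d[unfolded is_weak_deriv_def, THEN conjunct2, rule_format, OF \<phi>] by (rule trans[OF sym])
    then have "(\<integral>x. v x * \<phi> x \<partial>lebesgue_on \<Omega>) = (\<integral>x. v' x * \<phi> x \<partial>lebesgue_on \<Omega>)" by simp
    then have "(\<integral>x. g x * \<phi> x \<partial>lborel) = (\<integral>x. g' x * \<phi> x \<partial>lborel)"
      using L2_rep_integral[OF \<Omega>b vm(1) r(1) m] L2_rep_integral[OF \<Omega>b vm(2) r(2) m] by simp
    then show "(\<integral>x. (g x - g' x) * \<phi> x \<partial>lborel) = 0"
      using int[OF r(1)] int[OF r(2)] by (simp add: left_diff_distrib)
  qed
  then show ?thesis
    by eventually_elim (use L2_repD(2)[OF r(1)] L2_repD(2)[OF r(2)] in \<open>metis eq_iff_diff_eq_0\<close>)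
qed

subsection \<open>Universal approximation in one variable\<close>

definition comb :: "(real \<Rightarrow> real) \<Rightarrow> (real \<times> real \<times> real) list \<Rightarrow> real \<Rightarrow> real" where
  "comb \<psi> L s = (\<Sum>(c, a, b)\<leftarrow>L. c * \<psi> (a * s + b))"

lemma comb_Nil [simp]: "comb \<psi> [] s = 0"
  and comb_Cons [simp]: "comb \<psi> ((c, a, b) # L) s = c * \<psi> (a * s + b) + comb \<psi> L s"
  and comb_append: "comb \<psi> (L @ L') s = comb \<psi> L s + comb \<psi> L' s"
  by (auto simp: comb_def)

lemma comb_cmult: "comb \<psi> (map (\<lambda>(c, a, b). (d * c, a, b)) L) s = d * comb \<psi> L s"
  by (induction L) (auto simp: algebra_simps)

text \<open>Dilations have to be nonzero because the weights are later divided by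
  \<open>a^2\<close>, when a combination of second derivatives is integrated twice.\<close>

definition combable :: "(real \<Rightarrow> real) \<Rightarrow> real \<Rightarrow> (real \<Rightarrow> real) \<Rightarrow> bool" where
  "combable \<psi> R f \<longleftrightarrow> (\<forall>e>0. \<exists>L. (\<forall>(c, a, b)\<in>set L. a \<noteq> 0) \<and> (\<forall>s\<in>{-R..R}. \<bar>f s - comb \<psi> L s\<bar> < e))"

lemma combableE:
  assumes "combable \<psi> R f" "e > 0"
  obtains L where "\<forall>(c, a, b)\<in>set L. a \<noteq> 0" "\<forall>s\<in>{-R..R}. \<bar>f s - comb \<psi> L s\<bar> < e"
  using assms unfolding combable_def by blast

lemma combable_lim:
  assumes "\<And>e. e > 0 \<Longrightarrow> \<exists>g. combable \<psi> R g \<and> (\<forall>s\<in>{-R..R}. \<bar>f s - g s\<bar> < e)"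
  shows "combable \<psi> R f"
  unfolding combable_def
proof (intro allI impI)
  fix e :: real assume "e > 0"
  then have e2: "e / 2 > 0" by simp
  obtain g where g: "combable \<psi> R g" "\<forall>s\<in>{-R..R}. \<bar>f s - g s\<bar> < e / 2" using assms[OF e2] by blast
  obtain L where L: "\<forall>(c, a, b)\<in>set L. a \<noteq> 0" "\<forall>s\<in>{-R..R}. \<bar>g s - comb \<psi> L s\<bar> < e / 2"
    by (rule combableE[OF g(1) e2])
  have "\<bar>f s - comb \<psi> L s\<bar> < e" if "s \<in> {-R..R}" for s
    using g(2)[rule_format, OF that] L(2)[rule_format, OF that] by linarith
  then show "\<exists>L. (\<forall>(c, a, b)\<in>set L. a \<noteq> 0) \<and> (\<forall>s\<in>{-R..R}. \<bar>f s - comb \<psi> L s\<bar> < e)"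
    using L(1) by blast
qed

lemma combable_add:
  assumes f: "combable \<psi> R f" and g: "combable \<psi> R g"
  shows "combable \<psi> R (\<lambda>s. f s + g s)"
  unfolding combable_def
proof (intro allI impI)
  fix e :: real assume "e > 0"
  then have e2: "e / 2 > 0" by simp
  obtain L where L: "\<forall>(c, a, b)\<in>set L. a \<noteq> 0" "\<forall>s\<in>{-R..R}. \<bar>f s - comb \<psi> L s\<bar> < e / 2"
    by (rule combableE[OF f e2])
  obtain L' where L': "\<forall>(c, a, b)\<in>set L'. a \<noteq> 0" "\<forall>s\<in>{-R..R}. \<bar>g s - comb \<psi> L' s\<bar> < e / 2"
    by (rule combableE[OF g e2])
  have "\<bar>f s + g s - comb \<psi> (L @ L') s\<bar> < e" if "s \<in> {-R..R}" for s
    using L(2)[rule_format, OF that] L'(2)[rule_format, OF that] unfolding comb_append by linarith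
  moreover have "\<forall>(c, a, b)\<in>set (L @ L'). a \<noteq> 0" using L(1) L'(1) by auto
  ultimately show "\<exists>L. (\<forall>(c, a, b)\<in>set L. a \<noteq> 0) \<and> (\<forall>s\<in>{-R..R}. \<bar>f s + g s - comb \<psi> L s\<bar> < e)"
    by blast
qed

lemma combable_cmult:
  assumes f: "combable \<psi> R f"
  shows "combable \<psi> R (\<lambda>s. d * f s)"
  unfolding combable_def
proof (intro allI impI)
  fix e :: real assume "e > 0"
  then have e2: "e / (\<bar>d\<bar> + 1) > 0" by simp
  obtain L where L: "\<forall>(c, a, b)\<in>set L. a \<noteq> 0" "\<forall>s\<in>{-R..R}. \<bar>f s - comb \<psi> L s\<bar> < e / (\<bar>d\<bar> + 1)"
    by (rule combableE[OF f e2])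
  have "\<bar>d * f s - comb \<psi> (map (\<lambda>(c, a, b). (d * c, a, b)) L) s\<bar> < e" if "s \<in> {-R..R}" for s
  proof -
    have "\<bar>d * f s - comb \<psi> (map (\<lambda>(c, a, b). (d * c, a, b)) L) s\<bar> = \<bar>d\<bar> * \<bar>f s - comb \<psi> L s\<bar>"
      unfolding comb_cmult by (simp flip: abs_mult right_diff_distrib)
    also have "\<dots> \<le> \<bar>d\<bar> * (e / (\<bar>d\<bar> + 1))" using L(2)[rule_format, OF that] by (intro mult_left_mono) auto
    also have "\<dots> < e" using \<open>e > 0\<close> by (simp add: field_simps)
    finally show ?thesis .
  qed
  moreover have "\<forall>(c, a, b)\<in>set (map (\<lambda>(c, a, b). (d * c, a, b)) L). a \<noteq> 0" using L(1) by auto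
  ultimately show "\<exists>L. (\<forall>(c, a, b)\<in>set L. a \<noteq> 0) \<and> (\<forall>s\<in>{-R..R}. \<bar>d * f s - comb \<psi> L s\<bar> < e)"
    by blast
qed

lemma combable_base: "a \<noteq> 0 \<Longrightarrow> combable \<psi> R (\<lambda>s. \<psi> (a * s + b))"
  unfolding combable_def by (auto intro!: exI[of _ "[(1, a, b)]"])

text \<open>Differentiating \<open>\<psi> (a s + b)\<close> repeatedly in \<open>a\<close> produces the functions
  \<open>s ^ n * \<psi>\<^sup>(\<^sup>n\<^sup>) (a s + b)\<close>, which become monomials at \<open>a = 0\<close>.\<close>

lemma uniform_parameter:
  assumes "smooth \<psi>" "e > 0"
  shows "\<exists>d>0. \<forall>a'. \<bar>a' - a\<bar> < d \<longrightarrow>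
    (\<forall>s\<in>{-R..R}. \<bar>s ^ n * (deriv ^^ n) \<psi> (a' * s + b) - s ^ n * (deriv ^^ n) \<psi> (a * s + b)\<bar> < e)"
proof -
  let ?G = "\<lambda>p::real \<times> real. snd p ^ n * (deriv ^^ n) \<psi> (fst p * snd p + b)"
  let ?S = "{a - 1..a + 1} \<times> {-R..R}"
  have "continuous_on ?S ?G"
    by (intro continuous_intros continuous_on_compose2[OF smooth_continuous[OF assms(1), of UNIV]]) auto
  moreover have "compact ?S" by (intro compact_Times compact_Icc)
  ultimately have "uniformly_continuous_on ?S ?G" by (rule compact_uniformly_continuous)
  then obtain d where d: "d > 0" "\<And>p q. p \<in> ?S \<Longrightarrow> q \<in> ?S \<Longrightarrow> dist q p < d \<Longrightarrow> dist (?G q) (?G p) < e"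
    using \<open>e > 0\<close> unfolding uniformly_continuous_on_def by metis
  show ?thesis
  proof (intro exI[of _ "min d 1"] conjI allI impI ballI)
    fix a' s assume a': "\<bar>a' - a\<bar> < min d 1" and s: "s \<in> {-R..R}"
    have "dist (?G (a', s)) (?G (a, s)) < e"
      by (rule d(2)) (use a' s in \<open>auto simp: dist_Pair_Pair dist_real_def\<close>)
    then show "\<bar>s ^ n * (deriv ^^ n) \<psi> (a' * s + b) - s ^ n * (deriv ^^ n) \<psi> (a * s + b)\<bar> < e"
      by (simp add: dist_real_def)
  qed (use d in auto)
qed

text \<open>By the mean value theorem the difference quotient in \<open>a\<close> of the function
  for \<open>n\<close> equals the function for \<open>n + 1\<close> at an intermediate parameter.
  Uniform continuity in the parameter makes it close to the value at \<open>a\<close>, uniformly in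
  \<open>s\<close>.\<close>

lemma combable_param_deriv:
  assumes "smooth \<psi>" "a \<noteq> 0"
  shows "combable \<psi> R (\<lambda>s. s ^ n * (deriv ^^ n) \<psi> (a * s + b))"
  using \<open>a \<noteq> 0\<close>
proof (induction n arbitrary: a)
  case 0
  then show ?case using combable_base by simp
next
  case (Suc n)
  let ?G = "\<lambda>n a s. s ^ n * (deriv ^^ n) \<psi> (a * s + b)"
  show ?case
  proof (rule combable_lim)
    fix e :: real assume "e > 0"
    obtain d where d: "d > 0" "\<forall>a'. \<bar>a' - a\<bar> < d \<longrightarrow> (\<forall>s\<in>{-R..R}. \<bar>?G (Suc n) a' s - ?G (Suc n) a s\<bar> < e)"
      using uniform_parameter[OF assms(1) \<open>e > 0\<close>] by blast
    \<comment> \<open>The step moves \<open>a\<close> away from zero, so that \<open>a + h\<close>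
      is again an admissible dilation.\<close>
    define h where "h = (if a > 0 then d / 2 else - d / 2)"
    have h: "h \<noteq> 0" "a + h \<noteq> 0" "\<bar>h\<bar> < d" using d(1) Suc.prems by (auto simp: h_def)
    have "combable \<psi> R (\<lambda>s. inverse h * (?G n (a + h) s + (-1) * ?G n a s))"
      using Suc.IH[OF h(2)] Suc.IH[OF Suc.prems] by (intro combable_cmult combable_add)
    moreover have "\<bar>?G (Suc n) a s - inverse h * (?G n (a + h) s + (-1) * ?G n a s)\<bar> < e" if s: "s \<in> {-R..R}" for s
    proof -
      have D: "((\<lambda>a. ?G n a s) has_real_derivative ?G (Suc n) x s) (at x)" for x
      proof -
        have "((\<lambda>a. (deriv ^^ n) \<psi> (a * s + b)) has_real_derivative (deriv ^^ Suc n) \<psi> (x * s + b) * s) (at x)"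
          by (rule DERIV_chain2[OF smooth_DERIV[OF assms(1)]]) (auto intro!: derivative_eq_intros)
        from DERIV_cmult[OF this, of "s ^ n"] show ?thesis by (simp add: mult_ac)
      qed
      have "\<exists>z. \<bar>z - a\<bar> < d \<and> ?G n (a + h) s - ?G n a s = h * ?G (Suc n) z s"
      proof (cases "h > 0")
        case True
        then obtain z where "z > a" "z < a + h" "?G n (a + h) s - ?G n a s = (a + h - a) * ?G (Suc n) z s"
          using MVT2[of a "a + h" "\<lambda>a. ?G n a s" "\<lambda>x. ?G (Suc n) x s"] D by auto
        then show ?thesis using h(3) by (intro exI[of _ z]) auto
      next
        case False
        then have "a + h < a" using h(1) by simp
        then obtain z where "z > a + h" "z < a" "?G n a s - ?G n (a + h) s = (a - (a + h)) * ?G (Suc n) z s"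
          using MVT2[of "a + h" a "\<lambda>a. ?G n a s" "\<lambda>x. ?G (Suc n) x s"] D by blast
        then show ?thesis using h(3) False by (intro exI[of _ z]) auto
      qed
      then obtain z where z: "\<bar>z - a\<bar> < d" "?G n (a + h) s - ?G n a s = h * ?G (Suc n) z s" by blast
      have "inverse h * (?G n (a + h) s + (-1) * ?G n a s) = ?G (Suc n) z s"
        using z(2) h(1) by (simp del: power_Suc funpow.simps)
      then show ?thesis using d(2)[rule_format, OF z(1) s] by (simp only: abs_minus_commute)
    qed
    ultimately show "\<exists>g. combable \<psi> R g \<and> (\<forall>s\<in>{-R..R}. \<bar>?G (Suc n) a s - g s\<bar> < e)" by blast
  qed
qed

lemma combable_monomial:
  assumes "smooth \<psi>" "(deriv ^^ n) \<psi> b \<noteq> 0"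
  shows "combable \<psi> R (\<lambda>s. s ^ n)"
proof -
  \<comment> \<open>The dilation \<open>0\<close> is not admissible; its monomial is reached as a
    uniform limit of small positive dilations \<open>d / 2\<close>.\<close>
  have "combable \<psi> R (\<lambda>s. s ^ n * (deriv ^^ n) \<psi> (0 * s + b))"
  proof (rule combable_lim)
    fix e :: real assume "e > 0"
    then obtain d where d: "d > 0" "\<forall>a'. \<bar>a' - 0\<bar> < d \<longrightarrow>
        (\<forall>s\<in>{-R..R}. \<bar>s ^ n * (deriv ^^ n) \<psi> (a' * s + b) - s ^ n * (deriv ^^ n) \<psi> (0 * s + b)\<bar> < e)"
      using uniform_parameter[OF assms(1)] by blast
    have "\<bar>d / 2 - 0\<bar> < d" using d(1) by simp
    from d(2)[rule_format, OF this] combable_param_deriv[OF assms(1), of "d / 2" R n b] d(1)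
    show "\<exists>g. combable \<psi> R g \<and> (\<forall>s\<in>{-R..R}. \<bar>s ^ n * (deriv ^^ n) \<psi> (0 * s + b) - g s\<bar> < e)"
      by (intro exI[of _ "\<lambda>s. s ^ n * (deriv ^^ n) \<psi> (d / 2 * s + b)"]) (auto simp: abs_minus_commute)
  qed
  from combable_cmult[OF this, of "inverse ((deriv ^^ n) \<psi> b)"] show ?thesis using assms(2) by (simp add: field_simps)
qed

text \<open>Each derivative of \<open>\<psi>\<close> is nonzero at some point, which provides every
  monomial; the theorem of Stone and Weierstrass passes from polynomials to continuous
  functions.\<close>

lemma combable_continuous:
  assumes "smooth \<psi>" "\<And>n. \<exists>b. (deriv ^^ n) \<psi> b \<noteq> 0" "continuous_on {-R..R} f"
  shows "combable \<psi> R f"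
proof (rule combable_lim)
  fix e :: real assume "e > 0"
  obtain g where g: "real_polynomial_function g" "\<And>x. x \<in> {-R..R} \<Longrightarrow> \<bar>f x - g x\<bar> < e"
    using Stone_Weierstrass_real_polynomial_function[OF compact_Icc assms(3) \<open>e > 0\<close>] by blast
  obtain a n where gs: "g = (\<lambda>x. \<Sum>i\<le>n. a i * x ^ i)"
    using g(1) real_polynomial_function_iff_sum by blast
  have mono: "combable \<psi> R (\<lambda>s. s ^ i)" for i
    using combable_monomial[OF assms(1)] assms(2)[of i] by blast
  have "combable \<psi> R (\<lambda>s. \<Sum>i\<le>n. a i * s ^ i)"
  proof (induction n)
    case 0
    show ?case using combable_cmult[OF mono[of 0], of "a 0"] by simp
  next
    case (Suc n)
    show ?case using combable_add[OF Suc combable_cmult[OF mono[of "Suc n"], of "a (Suc n)"]] by (simp only: sum.atMost_Suc)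
  qed
  then show "\<exists>g. combable \<psi> R g \<and> (\<forall>s\<in>{-R..R}. \<bar>f s - g s\<bar> < e)" using g(2) gs by blast
qed

section \<open>Approximation together with two derivatives on an interval\<close>

lemma comb_DERIV:
  assumes "smooth \<psi>"
  shows "((\<lambda>s. \<Sum>(c, a, b)\<leftarrow>L. c * a ^ m * (deriv ^^ m) \<psi> (a * s + b)) has_real_derivative
    (\<Sum>(c, a, b)\<leftarrow>L. c * a ^ Suc m * (deriv ^^ Suc m) \<psi> (a * s + b))) (at s)"
proof (induction L)
  case (Cons p L)
  obtain c a b where p: "p = (c, a, b)" by (cases p)
  have "((\<lambda>s. (deriv ^^ m) \<psi> (a * s + b)) has_real_derivative (deriv ^^ Suc m) \<psi> (a * s + b) * a) (at s)"
    by (rule DERIV_chain2[OF smooth_DERIV[OF assms]]) (auto intro!: derivative_eq_intros)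
  from DERIV_add[OF DERIV_cmult[OF this, of "c * a ^ m"] Cons]
  show ?case unfolding p by (simp del: funpow.simps add: mult_ac)
qed simp

lemma higher_deriv_comb:
  assumes "smooth \<psi>"
  shows "(deriv ^^ m) (\<lambda>s. comb \<psi> L s + \<beta>) =
    (\<lambda>s. (\<Sum>(c, a, b)\<leftarrow>L. c * a ^ m * (deriv ^^ m) \<psi> (a * s + b)) + (if m = 0 then \<beta> else 0))"
proof (induction m)
  case 0
  then show ?case by (simp add: comb_def)
next
  case (Suc m)
  have "deriv ((deriv ^^ m) (\<lambda>s. comb \<psi> L s + \<beta>)) s = (\<Sum>(c, a, b)\<leftarrow>L. c * a ^ Suc m * (deriv ^^ Suc m) \<psi> (a * s + b)) + 0" for s
    unfolding Suc by (intro DERIV_imp_deriv DERIV_add comb_DERIV assms DERIV_const)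
  then show ?case by (simp add: fun_eq_iff)
qed

lemma smooth_comb:
  assumes "smooth \<psi>" shows "smooth (\<lambda>s. comb \<psi> L s + \<beta>)"
proof -
  have "((deriv ^^ m) (\<lambda>s. comb \<psi> L s + \<beta>) has_real_derivative
     (\<Sum>(c, a, b)\<leftarrow>L. c * a ^ Suc m * (deriv ^^ Suc m) \<psi> (a * s + b)) + 0) (at s)" for m s
    unfolding higher_deriv_comb[OF assms] by (intro DERIV_add comb_DERIV assms DERIV_const)
  then show ?thesis unfolding smooth_def field_differentiable_def by blast
qed

lemma smooth_diff:
  assumes "smooth f" "smooth g"
  shows "smooth (\<lambda>x. f x - g x)" "(deriv ^^ m) (\<lambda>x. f x - g x) = (\<lambda>x. (deriv ^^ m) f x - (deriv ^^ m) g x)"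
proof -
  have *: "(deriv ^^ m) (\<lambda>x. f x - g x) = (\<lambda>x. (deriv ^^ m) f x - (deriv ^^ m) g x)" for m
  proof (induction m)
    case (Suc m)
    have "deriv (\<lambda>x. (deriv ^^ m) f x - (deriv ^^ m) g x) x = (deriv ^^ Suc m) f x - (deriv ^^ Suc m) g x" for x
      by (intro DERIV_imp_deriv DERIV_diff smooth_DERIV assms)
    then show ?case by (simp add: Suc fun_eq_iff)
  qed simp
  show "(deriv ^^ m) (\<lambda>x. f x - g x) = (\<lambda>x. (deriv ^^ m) f x - (deriv ^^ m) g x)" by (rule *)
  have "((deriv ^^ m) (\<lambda>x. f x - g x) has_real_derivative (deriv ^^ Suc m) f x - (deriv ^^ Suc m) g x) (at x)" for m x
    unfolding * by (intro DERIV_diff smooth_DERIV assms)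
  then show "smooth (\<lambda>x. f x - g x)" unfolding smooth_def field_differentiable_def by blast
qed

lemma bound_by_derivative:
  fixes f :: "real \<Rightarrow> real"
  assumes "\<And>x. (f has_real_derivative f' x) (at x)" "f 0 = 0" "\<And>x. x \<in> {-R..R} \<Longrightarrow> \<bar>f' x\<bar> \<le> B" "s \<in> {-R..R}"
  shows "\<bar>f s\<bar> \<le> B * R"
proof -
  have "\<bar>f s - f 0\<bar> \<le> B * \<bar>s - 0\<bar>"
    using field_differentiable_bound[of "{-R..R}" f f' B s 0] assms
    by (auto intro: has_field_derivative_at_within)
  also have "\<dots> \<le> B * R"
    using assms(3)[OF assms(4)] assms(4) by (intro mult_left_mono) auto
  finally show ?thesis using assms(2) by simp
qed

text \<open>The second derivative is approximated and then integrated back. Dividing the weights by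
  the squared dilations turns a combination of copies of \<open>\<psi>\<close>, the second
  derivative of \<open>\<sigma>\<close>, into one of copies of \<open>\<sigma>\<close>. The affine
  function left undetermined is corrected by the constant \<open>\<beta>\<close> and one further
  neuron, so that the error vanishes at zero together with its derivative and is controlled by its
  second derivative.\<close>

theorem comb_dense_C2:
  assumes \<sigma>: "smooth \<sigma>" "\<And>n. \<exists>b. (deriv ^^ n) \<sigma> b \<noteq> 0" and g: "smooth g" and "R \<ge> 0" "e > 0"
  shows "\<exists>L \<beta>. \<forall>m\<le>2. \<forall>s\<in>{-R..R}. \<bar>(deriv ^^ m) g s - (deriv ^^ m) (\<lambda>s. comb \<sigma> L s + \<beta>) s\<bar> \<le> e"
proof -
  define \<psi> where "\<psi> = (deriv ^^ 2) \<sigma>"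
  have \<psi>: "smooth \<psi>" unfolding \<psi>_def by (rule smooth_higher_deriv[OF \<sigma>(1)])
  have \<psi>n: "\<exists>b. (deriv ^^ n) \<psi> b \<noteq> 0" for n
    using \<sigma>(2)[of "n + 2"] unfolding \<psi>_def funpow_add o_def .
  \<comment> \<open>Chosen so that the bounds \<open>2 * e'\<close>, \<open>2 * e' * R\<close> and
    \<open>2 * e' * R * R\<close> for the errors of order two, one and zero add up to
    \<open>e\<close>.\<close>
  define e' where "e' = e / (2 * (1 + R + R * R))"
  have den: "2 * (1 + R + R * R) > 0" using \<open>R \<ge> 0\<close> by (simp add: add_pos_nonneg)
  have e': "e' > 0" using den \<open>e > 0\<close> by (simp add: e'_def)
  obtain L0 where L0: "\<forall>(c, a, b)\<in>set L0. a \<noteq> 0"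
      "\<forall>s\<in>{-R..R}. \<bar>(deriv ^^ 2) g s - comb \<psi> L0 s\<bar> < e'"
    by (rule combableE[OF combable_continuous[OF \<psi> \<psi>n smooth_continuous[OF g, of "{-R..R}" 2]] e'])
  define L1 where "L1 = map (\<lambda>(c, a, b). (c / a\<^sup>2, a, b)) L0"
  define E where "E = (\<lambda>s. g s - (comb \<sigma> L1 s + 0))"
  have E: "smooth E" unfolding E_def by (intro smooth_diff g smooth_comb \<sigma>)
  have E2: "(deriv ^^ 2) E s = (deriv ^^ 2) g s - comb \<psi> L0 s" for s
  proof -
    have "(\<Sum>(c, a, b)\<leftarrow>L1. c * a ^ 2 * (deriv ^^ 2) \<sigma> (a * s + b)) = comb \<psi> L0 s"
      unfolding L1_def using L0(1) by (induction L0) (auto simp: \<psi>_def)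
    then show ?thesis unfolding E_def smooth_diff(2)[OF g smooth_comb[OF \<sigma>(1)]] higher_deriv_comb[OF \<sigma>(1)] by simp
  qed
  \<comment> \<open>The extra neuron \<open>q * \<sigma> (h * s + b0)\<close> is almost affine for a
    small dilation \<open>h\<close>; a nonzero first derivative of \<open>\<sigma>\<close> at
    \<open>b0\<close> allows its slope to be prescribed.\<close>
  obtain b0 where b0: "(deriv ^^ 1) \<sigma> b0 \<noteq> 0" using \<sigma>(2) by blast
  have "compact ((deriv ^^ 2) \<sigma> ` {b0 - R..b0 + R})"
    by (intro compact_continuous_image smooth_continuous \<sigma>) simp
  then obtain M where M: "\<forall>x\<in>{b0 - R..b0 + R}. \<bar>(deriv ^^ 2) \<sigma> x\<bar> \<le> M"
    using compact_imp_bounded bounded_iff by (metis image_eqI real_norm_def)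
  have M0: "M \<ge> 0" using M \<open>R \<ge> 0\<close> by (meson abs_ge_zero order_trans atLeastAtMost_iff diff_ge_0_iff_ge le_add_same_cancel1 diff_le_eq)
  define B where "B = (deriv ^^ 1) E 0"
  \<comment> \<open>Once the slope at zero is set to \<open>B\<close>, the second derivative of the
    extra neuron carries the factor \<open>h\<close>; this choice keeps it below \<open>e'\<close>.
    The bound \<open>h \<le> 1\<close> keeps the arguments in the interval to which \<open>M\<close>
    refers.\<close>
  define h where "h = min 1 (e' / (\<bar>B / (deriv ^^ 1) \<sigma> b0\<bar> * M + 1))"
  have K0: "\<bar>B / (deriv ^^ 1) \<sigma> b0\<bar> * M + 1 > 0" using M0 by (intro add_nonneg_pos mult_nonneg_nonneg) auto
  have h: "0 < h" "h \<le> 1" using e' K0 by (auto simp: h_def)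
  define q where "q = B / (h * (deriv ^^ 1) \<sigma> b0)"
  define L where "L = (q, h, b0) # L1"
  define \<beta> where "\<beta> = E 0 - q * \<sigma> b0"
  define F where "F = (\<lambda>s. g s - (comb \<sigma> L s + \<beta>))"
  have F: "smooth F" unfolding F_def by (intro smooth_diff g smooth_comb \<sigma>)
  have Fm: "(deriv ^^ m) F s = (deriv ^^ m) E s - q * h ^ m * (deriv ^^ m) \<sigma> (h * s + b0) - (if m = 0 then \<beta> else 0)" for m s
    unfolding F_def E_def smooth_diff(2)[OF g smooth_comb[OF \<sigma>(1)]] higher_deriv_comb[OF \<sigma>(1)] L_def by simp
  have F0: "(deriv ^^ 0) F 0 = 0" unfolding Fm by (simp add: \<beta>_def)
  have F1: "(deriv ^^ 1) F 0 = 0" unfolding Fm using h b0 by (simp add: q_def B_def)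
  have F2: "\<bar>(deriv ^^ 2) F s\<bar> \<le> 2 * e'" if s: "s \<in> {-R..R}" for s
  proof -
    have "\<bar>h * s\<bar> \<le> 1 * R" unfolding abs_mult using h s by (intro mult_mono) auto
    then have "\<bar>(deriv ^^ 2) \<sigma> (h * s + b0)\<bar> \<le> M" by (intro M[rule_format]) auto
    moreover have "q * h ^ 2 = B / (deriv ^^ 1) \<sigma> b0 * h" using h b0 by (simp add: q_def power2_eq_square field_simps)
    ultimately have "\<bar>q * h ^ 2 * (deriv ^^ 2) \<sigma> (h * s + b0)\<bar> \<le> \<bar>B / (deriv ^^ 1) \<sigma> b0 * h\<bar> * M"
      by (simp only: abs_mult[of _ "(deriv ^^ 2) \<sigma> (h * s + b0)"] mult_left_mono abs_ge_zero)
    also have "\<dots> \<le> (\<bar>B / (deriv ^^ 1) \<sigma> b0\<bar> * M + 1) * h" using h by (simp add: abs_mult algebra_simps)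
    also have "\<dots> \<le> (\<bar>B / (deriv ^^ 1) \<sigma> b0\<bar> * M + 1) * (e' / (\<bar>B / (deriv ^^ 1) \<sigma> b0\<bar> * M + 1))"
      using K0 by (intro mult_left_mono) (auto simp: h_def)
    also have "\<dots> = e'" using K0 by simp
    finally have "\<bar>q * h ^ 2 * (deriv ^^ 2) \<sigma> (h * s + b0)\<bar> \<le> e'" .
    moreover have "\<bar>(deriv ^^ 2) E s\<bar> < e'" unfolding E2 by (rule L0(2)[rule_format, OF s])
    ultimately show ?thesis unfolding Fm by (simp del: funpow.simps)
  qed
  have F1b: "\<bar>(deriv ^^ 1) F s\<bar> \<le> 2 * e' * R" if "s \<in> {-R..R}" for s
    using bound_by_derivative[of "(deriv ^^ 1) F" "(deriv ^^ 2) F" R "2 * e'" s] smooth_DERIV[OF F, of 1] F1 F2 that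
    by (simp add: numeral_2_eq_2)
  have F0b: "\<bar>(deriv ^^ 0) F s\<bar> \<le> 2 * e' * R * R" if "s \<in> {-R..R}" for s
    using bound_by_derivative[of "(deriv ^^ 0) F" "(deriv ^^ 1) F" R "2 * e' * R" s] smooth_DERIV[OF F, of 0] F0 F1b that
    by simp
  have e'eq: "2 * e' + 2 * e' * R + 2 * e' * R * R = e"
  proof -
    have "2 * e' + 2 * e' * R + 2 * e' * R * R = e' * (2 * (1 + R + R * R))" by (simp add: algebra_simps)
    then show ?thesis using den by (simp add: e'_def)
  qed
  have nn: "0 \<le> 2 * e' * R" "0 \<le> 2 * e' * R * R" using e' \<open>R \<ge> 0\<close> by auto
  show ?thesis
  proof (intro exI[of _ L] exI[of _ \<beta>] allI impI ballI)
    fix m :: nat and s assume "m \<le> 2" "s \<in> {-R..R}"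
    then have "\<bar>(deriv ^^ m) F s\<bar> \<le> e"
    proof -
      consider "m = 0" | "m = 1" | "m = 2" using \<open>m \<le> 2\<close> by linarith
      then show ?thesis
        using F2[of s] F1b[of s] F0b[of s] \<open>s \<in> {-R..R}\<close> e'eq nn e' by cases auto
    qed
    then show "\<bar>(deriv ^^ m) g s - (deriv ^^ m) (\<lambda>s. comb \<sigma> L s + \<beta>) s\<bar> \<le> e"
      unfolding F_def smooth_diff(2)[OF g smooth_comb[OF \<sigma>(1)]] .
  qed
qed

lemma smooth_activation_smooth: "smooth_activation \<sigma> \<Longrightarrow> smooth \<sigma>"
  by (simp add: smooth_activation_def smooth_def)

text \<open>If the derivative of order \<open>n\<close> vanished identically, integrating it
  \<open>n\<close> times would exhibit \<open>\<sigma>\<close> as a polynomial; the induction on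
  \<open>k\<close> performs the integrations one by one.\<close>

lemma smooth_activation_nonpolynomial:
  assumes "smooth_activation \<sigma>" shows "\<exists>b. (deriv ^^ n) \<sigma> b \<noteq> 0"
proof (rule ccontr)
  assume "\<not> ?thesis"
  then have zero: "(deriv ^^ n) \<sigma> x = 0" for x by blast
  have "\<exists>p. \<forall>x. (deriv ^^ (n - k)) \<sigma> x = poly p x" if "k \<le> n" for k
    using that
  proof (induction k)
    case 0
    then show ?case using zero by (intro exI[of _ 0]) simp
  next
    case (Suc k)
    then obtain p where p: "\<forall>x. (deriv ^^ (n - k)) \<sigma> x = poly p x" by auto
    have k: "n - k = Suc (n - Suc k)" using Suc.prems by simp
    obtain P where P: "pderiv P = p"
    proof -
      define P where "P = (\<Sum>i\<le>degree p. monom (coeff p i / (real i + 1)) (Suc i))"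
      have "pderiv P = (\<Sum>i\<le>degree p. monom (coeff p i) i)"
        unfolding P_def by (simp add: higher_pderiv_sum[of 1, simplified] pderiv_monom add.commute)
      also have "\<dots> = p" by (rule poly_as_sum_of_monoms)
      finally show ?thesis using that by blast
    qed
    let ?f = "(deriv ^^ (n - Suc k)) \<sigma>"
    have "((\<lambda>x. ?f x - poly P x) has_real_derivative 0) (at x)" for x
      using DERIV_diff[OF smooth_DERIV[OF smooth_activation_smooth[OF assms], of "n - Suc k" x] poly_DERIV[of P x]]
      unfolding k[symmetric] P using p by simp
    then have const: "?f x - poly P x = ?f 0 - poly P 0" for x
      using DERIV_isconst_all by blast
    have "\<forall>x. ?f x = poly (P + [:?f 0 - poly P 0:]) x" using const by (auto simp: algebra_simps)
    then show ?case by blast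
  qed
  from this[of n] show False using assms by (auto simp: smooth_activation_def)
qed

lemma higher_deriv_exp: "(deriv ^^ n) (exp :: real \<Rightarrow> real) = exp"
proof (induction n)
  case (Suc n)
  have "deriv (exp :: real \<Rightarrow> real) = exp" by (intro ext DERIV_imp_deriv DERIV_exp)
  then show ?case using Suc by simp
qed simp

lemma smooth_exp: "smooth exp"
  unfolding smooth_def higher_deriv_exp field_differentiable_def using DERIV_exp by blast

subsection \<open>Ridge functions and networks\<close>

definition rcomb :: "(real \<Rightarrow> real) \<Rightarrow> (real \<times> (real^'d) \<times> real) list \<Rightarrow> real^'d::finite \<Rightarrow> real" where
  "rcomb \<sigma> L x = (\<Sum>(c, v, b)\<leftarrow>L. c * \<sigma> (v \<bullet> x + b))"

lemma rcomb_Nil [simp]: "rcomb \<sigma> [] x = 0"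
  and rcomb_Cons [simp]: "rcomb \<sigma> ((c, v, b) # L) x = c * \<sigma> (v \<bullet> x + b) + rcomb \<sigma> L x"
  and rcomb_append: "rcomb \<sigma> (L @ L') x = rcomb \<sigma> L x + rcomb \<sigma> L' x"
  by (auto simp: rcomb_def)

lemma C_infinity_rcomb: "smooth \<sigma> \<Longrightarrow> C_infinity (rcomb \<sigma> L)"
proof (induction L)
  case Nil
  then show ?case using C_infinity_const[of 0] by (simp add: rcomb_def[abs_def])
next
  case (Cons p L)
  obtain c v b where p: "p = (c, v, b)" by (cases p)
  have "C_infinity (\<lambda>x. c * \<sigma> (v \<bullet> x + b) + rcomb \<sigma> L x)"
    using Cons by (intro C_infinity_add C_infinity_mult C_infinity_const C_infinity_compose[OF _ C_infinity_inner_affine])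
  then show ?case unfolding p rcomb_Cons[abs_def] .
qed

lemma partials_rcomb:
  assumes "smooth \<sigma>"
  shows "partials w (rcomb \<sigma> L) = (\<lambda>x. \<Sum>(c, v, b)\<leftarrow>L. c * ((\<Prod>i\<leftarrow>w. v $ i) * (deriv ^^ length w) \<sigma> (v \<bullet> x + b)))"
proof (induction L)
  case Nil
  have "rcomb \<sigma> [] = (\<lambda>_. 0)" by (simp add: fun_eq_iff)
  then show ?case by (simp add: partials_const)
next
  case (Cons p L)
  obtain c v b where p: "p = (c, v, b)" by (cases p)
  have C: "C_infinity (\<lambda>x. \<sigma> (v \<bullet> x + b))" by (rule C_infinity_compose[OF assms C_infinity_inner_affine])
  have "partials w (\<lambda>x. c * \<sigma> (v \<bullet> x + b) + rcomb \<sigma> L x) =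
      (\<lambda>x. c * ((\<Prod>i\<leftarrow>w. v $ i) * (deriv ^^ length w) \<sigma> (v \<bullet> x + b)) + partials w (rcomb \<sigma> L) x)"
    unfolding partials_add[OF C_infinity_mult[OF C_infinity_const C] C_infinity_rcomb[OF assms]]
      partials_cmult[OF C] partials_ridge[OF assms] ..
  then show ?case unfolding p rcomb_Cons[abs_def] Cons by simp
qed

text \<open>The derivative of a ridge function depends on the word only through its length and the
  product of the corresponding components of the direction. This reconciles words with the reversed
  ones that integration by parts produces.\<close>

lemma partials_rcomb_rev:
  assumes "smooth \<sigma>" shows "partials (rev w) (rcomb \<sigma> L) = partials w (rcomb \<sigma> L)"
  unfolding partials_rcomb[OF assms] by (simp add: rev_map[symmetric] prod_list.rev)

text \<open>Exponents add, so exponential sums form an algebra. This turns a product of one-variable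
  approximations into a ridge combination.\<close>

lemma rcomb_exp_mult: "\<exists>L. \<forall>x. rcomb exp Lb x * rcomb exp La x = rcomb exp L x"
proof (induction Lb)
  case Nil
  then show ?case by (intro exI[of _ "[]"]) simp
next
  case (Cons p Lb)
  obtain c v b where p: "p = (c, v, b)" by (cases p)
  obtain L where L: "\<forall>x. rcomb exp Lb x * rcomb exp La x = rcomb exp L x" using Cons by blast
  have "c * exp (v \<bullet> x + b) * rcomb exp La x = rcomb exp (map (\<lambda>(c', v', b'). (c * c', v + v', b + b')) La) x" for x
    by (induction La) (auto simp: algebra_simps exp_add inner_add_left)
  then have "rcomb exp (p # Lb) x * rcomb exp La x =
      rcomb exp (map (\<lambda>(c', v', b'). (c * c', v + v', b + b')) La @ L) x" for x
    unfolding rcomb_append p rcomb_Cons using L by (simp add: distrib_right)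
  then show ?case by blast
qed

lemma rcomb_exp_prod:
  assumes "finite I" "\<And>i. i \<in> I \<Longrightarrow> \<exists>L. \<forall>x. f i x = rcomb exp L x"
  shows "\<exists>L. \<forall>x. (\<Prod>i\<in>I. f i x) = rcomb exp L x"
  using assms
proof (induction I rule: finite_induct)
  case empty
  show ?case by (intro exI[of _ "[(1, 0, 0)]"]) simp
next
  case (insert i I)
  then obtain L L' where "\<forall>x. f i x = rcomb exp L x" "\<forall>x. (\<Prod>i\<in>I. f i x) = rcomb exp L' x" by blast
  moreover obtain L'' where "\<forall>x. rcomb exp L x * rcomb exp L' x = rcomb exp L'' x" using rcomb_exp_mult by blast
  ultimately show ?case using insert.hyps by auto
qed

text \<open>Factors are exchanged one at a time. The bound on the product of the \<open>b i\<close>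
  is carried along because the induction step uses it, and \<open>M + 1\<close> dominates both
  families since \<open>d \<le> 1\<close>.\<close>

lemma prod_close:
  fixes a b :: "'i \<Rightarrow> real" and M d :: real
  assumes "finite I" "\<And>i. i \<in> I \<Longrightarrow> \<bar>b i\<bar> \<le> M" "\<And>i. i \<in> I \<Longrightarrow> \<bar>a i - b i\<bar> \<le> d" "1 \<le> M" "0 \<le> d" "d \<le> 1"
  shows "\<bar>(\<Prod>i\<in>I. a i) - (\<Prod>i\<in>I. b i)\<bar> \<le> card I * (M + 1) ^ card I * d \<and> \<bar>\<Prod>i\<in>I. b i\<bar> \<le> (M + 1) ^ card I"
  using assms
proof (induction I rule: finite_induct)
  case (insert i I)
  let ?A = "\<Prod>i\<in>I. a i" and ?B = "\<Prod>i\<in>I. b i"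
  have IH: "\<bar>?A - ?B\<bar> \<le> card I * (M + 1) ^ card I * d" "\<bar>?B\<bar> \<le> (M + 1) ^ card I"
    using insert by auto
  have bi: "\<bar>b i\<bar> \<le> M" "\<bar>a i - b i\<bar> \<le> d" using insert.prems by auto
  then have ai: "\<bar>a i\<bar> \<le> M + 1" using \<open>d \<le> 1\<close> by linarith
  have "\<bar>a i * ?A - b i * ?B\<bar> = \<bar>a i * (?A - ?B) + (a i - b i) * ?B\<bar>" by (simp add: algebra_simps)
  also have "\<dots> \<le> \<bar>a i\<bar> * \<bar>?A - ?B\<bar> + \<bar>a i - b i\<bar> * \<bar>?B\<bar>"
    by (intro order_trans[OF abs_triangle_ineq]) (simp add: abs_mult)
  also have "\<dots> \<le> (M + 1) * (card I * (M + 1) ^ card I * d) + d * (M + 1) ^ card I"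
    using IH ai bi \<open>1 \<le> M\<close> \<open>0 \<le> d\<close> by (intro add_mono mult_mono) auto
  also have "\<dots> \<le> (M + 1) * (card I * (M + 1) ^ card I * d) + (M + 1) * (d * (M + 1) ^ card I)"
    using \<open>1 \<le> M\<close> \<open>0 \<le> d\<close> mult_right_mono[of 1 "M + 1" "d * (M + 1) ^ card I"] by simp
  also have "\<dots> = card (insert i I) * (M + 1) ^ card (insert i I) * d"
    using insert.hyps by (simp add: algebra_simps)
  finally have 1: "\<bar>prod a (insert i I) - prod b (insert i I)\<bar> \<le> card (insert i I) * (M + 1) ^ card (insert i I) * d"
    using insert.hyps by simp
  have "\<bar>b i * ?B\<bar> \<le> (M + 1) * (M + 1) ^ card I"
    unfolding abs_mult using bi(1) IH(2) \<open>1 \<le> M\<close> by (intro mult_mono) auto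
  then have "\<bar>prod b (insert i I)\<bar> \<le> (M + 1) ^ card (insert i I)" using insert.hyps by simp
  with 1 show ?case by blast
qed auto

text \<open>Each factor is approximated in its own variable together with its first two derivatives.
  Derivatives of a product of this kind are products of derivatives, so \<open>prod_close\<close>
  transfers the error.\<close>

lemma exp_dense_product:
  fixes f :: "'d::finite \<Rightarrow> real \<Rightarrow> real"
  assumes f: "\<And>i. smooth (f i)" and "R \<ge> 0" "e > 0"
  shows "\<exists>L. \<forall>w z. length w \<le> 2 \<longrightarrow> (\<forall>i. \<bar>z $ i\<bar> \<le> R) \<longrightarrow>
    \<bar>partials w (\<lambda>z. \<Prod>i\<in>UNIV. f i (z $ i)) z - partials w (rcomb exp L) z\<bar> \<le> e"
proof -
  have "\<exists>M\<ge>1. \<forall>i. \<forall>m\<le>2. \<forall>s\<in>{-R..R}. \<bar>(deriv ^^ m) (f i) s\<bar> \<le> M"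
  proof -
    have "bounded (\<Union>p\<in>UNIV \<times> {..2::nat}. (deriv ^^ snd p) (f (fst p)) ` {-R..R})"
      by (intro bounded_UN compact_imp_bounded compact_continuous_image ballI) (auto intro: smooth_continuous f)
    then obtain M where "\<forall>y\<in>(\<Union>p\<in>UNIV \<times> {..2::nat}. (deriv ^^ snd p) (f (fst p)) ` {-R..R}). norm y \<le> M"
      using bounded_iff by blast
    then have "\<bar>(deriv ^^ m) (f i) s\<bar> \<le> M" if "m \<le> 2" "s \<in> {-R..R}" for i m s
      using that by (auto intro: bspec[OF _ UN_I[of "(i, m)"]])
    then show ?thesis by (intro exI[of _ "max 1 M"]) (auto intro: max.coboundedI2)
  qed
  then obtain M where M: "M \<ge> 1" "\<And>i m s. m \<le> 2 \<Longrightarrow> s \<in> {-R..R} \<Longrightarrow> \<bar>(deriv ^^ m) (f i) s\<bar> \<le> M" by blast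
  define K where "K = real CARD('d) * (M + 1) ^ CARD('d)"
  have K: "K > 0" using M(1) by (simp add: K_def)
  define d where "d = min 1 (e / K)"
  have d: "0 < d" "d \<le> 1" "K * d \<le> e" using K \<open>e > 0\<close> by (auto simp: d_def min_def field_simps)
  have "\<forall>i. \<exists>L \<beta>. \<forall>m\<le>2. \<forall>s\<in>{-R..R}. \<bar>(deriv ^^ m) (f i) s - (deriv ^^ m) (\<lambda>s. comb exp L s + \<beta>) s\<bar> \<le> d"
    using comb_dense_C2[OF smooth_exp _ f \<open>R \<ge> 0\<close> d(1)] by (simp add: higher_deriv_exp)
  then obtain L \<beta> where L: "\<And>i m s. m \<le> 2 \<Longrightarrow> s \<in> {-R..R} \<Longrightarrow>
      \<bar>(deriv ^^ m) (f i) s - (deriv ^^ m) (\<lambda>s. comb exp (L i) s + \<beta> i) s\<bar> \<le> d"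
    by metis
  define g where "g = (\<lambda>i s. comb exp (L i) s + \<beta> i)"
  have g: "smooth (g i)" for i unfolding g_def by (intro smooth_comb smooth_exp)
  have "\<exists>L'. \<forall>z::real^'d. (\<Prod>i\<in>UNIV. g i (z $ i)) = rcomb exp L' z"
  proof (rule rcomb_exp_prod)
    fix i :: 'd
    have "comb exp Q (z $ i) = rcomb exp (map (\<lambda>(c, a, b). (c, a *\<^sub>R axis i 1, b)) Q) z" for z :: "real^'d" and Q
      by (induction Q) (auto simp: inner_axis')
    \<comment> \<open>The additive constant becomes a ridge term with direction zero, since
      \<open>exp 0 = 1\<close>.\<close>
    then have "g i (z $ i) = rcomb exp ((\<beta> i, 0, 0) # map (\<lambda>(c, a, b). (c, a *\<^sub>R axis i 1, b)) (L i)) z" for z :: "real^'d"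
      by (simp add: g_def)
    then show "\<exists>L. \<forall>z::real^'d. g i (z $ i) = rcomb exp L z" by blast
  qed simp
  then obtain L' where "\<forall>z::real^'d. (\<Prod>i\<in>UNIV. g i (z $ i)) = rcomb exp L' z" by blast
  then have L': "rcomb exp L' = (\<lambda>z. \<Prod>i\<in>UNIV. g i (z $ i))" by (simp add: fun_eq_iff)
  show ?thesis
  proof (intro exI[of _ L'] allI impI)
    fix w :: "'d list" and z :: "real^'d" assume w: "length w \<le> 2" and z: "\<forall>i. \<bar>z $ i\<bar> \<le> R"
    have cw: "count_list w i \<le> 2" for i using w count_le_length[of w i] by linarith
    have zi: "z $ i \<in> {-R..R}" for i using z[rule_format, of i] by auto
    have "\<bar>(\<Prod>i\<in>UNIV. (deriv ^^ count_list w i) (g i) (z $ i)) - (\<Prod>i\<in>UNIV. (deriv ^^ count_list w i) (f i) (z $ i))\<bar>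
        \<le> CARD('d) * (M + 1) ^ CARD('d) * d"
    proof (rule conjunct1[OF prod_close])
      show "\<bar>(deriv ^^ count_list w i) (f i) (z $ i)\<bar> \<le> M" for i by (rule M(2)[OF cw zi])
      show "\<bar>(deriv ^^ count_list w i) (g i) (z $ i) - (deriv ^^ count_list w i) (f i) (z $ i)\<bar> \<le> d" for i
        using L[OF cw zi, of i i i] by (simp only: g_def abs_minus_commute)
    qed (use M(1) d in auto)
    also have "\<dots> \<le> e" using d(3) by (simp add: K_def)
    finally show "\<bar>partials w (\<lambda>z. \<Prod>i\<in>UNIV. f i (z $ i)) z - partials w (rcomb exp L') z\<bar> \<le> e"
      unfolding L' partials_prod[OF f] partials_prod[OF g] by (simp add: abs_minus_commute)
  qed
qed

lemma prod_list_norm_bound: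
  fixes v :: "real^'d::finite"
  shows "\<bar>\<Prod>i\<leftarrow>w. v $ i\<bar> \<le> norm v ^ length w"
proof (induction w)
  case (Cons i w)
  then show ?case using component_le_norm_cart[of v i] by (auto simp: abs_mult intro: mult_mono)
qed simp

lemma network_dense_ridge:
  fixes v :: "real^'d::finite"
  assumes \<sigma>: "smooth \<sigma>" "\<And>n. \<exists>b. (deriv ^^ n) \<sigma> b \<noteq> 0" and g: "smooth g" and "e > 0" "R \<ge> 0"
  shows "\<exists>L \<beta>. \<forall>w x. length w \<le> 2 \<longrightarrow> norm x \<le> R \<longrightarrow>
    \<bar>partials w (\<lambda>x. g (v \<bullet> x)) x - partials w (\<lambda>x. rcomb \<sigma> L x + \<beta>) x\<bar> \<le> e"
proof -
  \<comment> \<open>Each differentiation of a ridge function brings down one component of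
    \<open>v\<close>; \<open>V\<close> bounds all products of at most two of them.\<close>
  define V where "V = (1 + norm v)\<^sup>2"
  have V: "V > 0" by (auto simp: V_def add_nonneg_eq_0_iff intro!: zero_less_power add_pos_nonneg)
  have eV: "e / V > 0" using V \<open>e > 0\<close> by simp
  have RV: "norm v * R \<ge> 0" using \<open>R \<ge> 0\<close> by simp
  obtain L \<beta> where L: "\<forall>m\<le>2. \<forall>s\<in>{-(norm v * R)..norm v * R}.
      \<bar>(deriv ^^ m) g s - (deriv ^^ m) (\<lambda>s. comb \<sigma> L s + \<beta>) s\<bar> \<le> e / V"
    using comb_dense_C2[OF \<sigma> g RV eV] by blast
  define L' where "L' = map (\<lambda>(c, a, b). (c, a *\<^sub>R v, b)) L"
  have eq: "rcomb \<sigma> L' x = comb \<sigma> L (v \<bullet> x)" for x unfolding L'_def by (induction L) auto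
  show ?thesis
  proof (intro exI[of _ L'] exI[of _ \<beta>] allI impI)
    fix w :: "'d list" and x :: "real^'d" assume w: "length w \<le> 2" and x: "norm x \<le> R"
    have "\<bar>v \<bullet> x\<bar> \<le> norm v * norm x" by (rule Cauchy_Schwarz_ineq2)
    also have "\<dots> \<le> norm v * R" using x by (intro mult_left_mono) auto
    finally have vx: "v \<bullet> x \<in> {-(norm v * R)..norm v * R}" by auto
    have "\<bar>\<Prod>i\<leftarrow>w. v $ i\<bar> \<le> norm v ^ length w" by (rule prod_list_norm_bound)
    also have "\<dots> \<le> (1 + norm v) ^ length w" by (intro power_mono) auto
    also have "\<dots> \<le> V" unfolding V_def using w by (intro power_increasing) auto
    finally have P: "\<bar>\<Prod>i\<leftarrow>w. v $ i\<bar> \<le> V" .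
    have "\<bar>partials w (\<lambda>x. g (v \<bullet> x + 0)) x - partials w (\<lambda>x. (\<lambda>s. comb \<sigma> L s + \<beta>) (v \<bullet> x + 0)) x\<bar>
      = \<bar>\<Prod>i\<leftarrow>w. v $ i\<bar> * \<bar>(deriv ^^ length w) g (v \<bullet> x) - (deriv ^^ length w) (\<lambda>s. comb \<sigma> L s + \<beta>) (v \<bullet> x)\<bar>"
      unfolding partials_ridge[OF g] partials_ridge[OF smooth_comb[OF \<sigma>(1)]]
      by (simp flip: abs_mult right_diff_distrib)
    also have "\<dots> \<le> V * (e / V)"
      using P L w vx V by (intro mult_mono) auto
    also have "\<dots> = e" using V by simp
    finally show "\<bar>partials w (\<lambda>x. g (v \<bullet> x)) x - partials w (\<lambda>x. rcomb \<sigma> L' x + \<beta>) x\<bar> \<le> e"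
      unfolding eq by simp
  qed
qed

text \<open>Every term of the exponential sum is a smooth function of the single variable
  \<open>v \<bullet> x\<close>, so the terms are approximated separately, each with half of the
  tolerance still left.\<close>

lemma network_dense_exp:
  fixes P :: "(real \<times> (real^'d::finite) \<times> real) list"
  assumes \<sigma>: "smooth \<sigma>" "\<And>n. \<exists>b. (deriv ^^ n) \<sigma> b \<noteq> 0" and "e > 0" "R \<ge> 0"
  shows "\<exists>L \<beta>. \<forall>w x. length w \<le> 2 \<longrightarrow> norm x \<le> R \<longrightarrow>
    \<bar>partials w (rcomb exp P) x - partials w (\<lambda>x. rcomb \<sigma> L x + \<beta>) x\<bar> \<le> e"
  using \<open>e > 0\<close>
proof (induction P arbitrary: e)
  case Nil
  then show ?case
    by (intro exI[of _ "[]"] exI[of _ 0]) (simp add: rcomb_def[abs_def] partials_const)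
next
  case (Cons p P)
  obtain c v b where p: "p = (c, v, b)" by (cases p)
  have e2: "e / 2 > 0" using Cons.prems by simp
  obtain L \<beta> where L: "\<forall>w x. length w \<le> 2 \<longrightarrow> norm x \<le> R \<longrightarrow>
    \<bar>partials w (rcomb exp P) x - partials w (\<lambda>x. rcomb \<sigma> L x + \<beta>) x\<bar> \<le> e / 2"
    using Cons.IH[OF e2] by blast
  define g where "g = (\<lambda>s. comb exp [(c, 1, b)] s + 0)"
  have g: "smooth g" unfolding g_def by (intro smooth_comb smooth_exp)
  obtain L' \<beta>' where L': "\<forall>w x. length w \<le> 2 \<longrightarrow> norm x \<le> R \<longrightarrow>
    \<bar>partials w (\<lambda>x. g (v \<bullet> x)) x - partials w (\<lambda>x. rcomb \<sigma> L' x + \<beta>') x\<bar> \<le> e / 2"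
    using network_dense_ridge[OF \<sigma> g e2 \<open>R \<ge> 0\<close>] by blast
  have Cg: "C_infinity (\<lambda>x. g (v \<bullet> x))" using C_infinity_compose[OF g C_infinity_inner_affine[of v 0]] by simp
  have C: "C_infinity (\<lambda>x. rcomb \<sigma> Q x + q)" for Q and q
    by (intro C_infinity_add C_infinity_rcomb \<sigma> C_infinity_const)
  show ?case
  proof (intro exI[of _ "L' @ L"] exI[of _ "\<beta>' + \<beta>"] allI impI)
    fix w :: "'d list" and x :: "real^'d" assume w: "length w \<le> 2" and x: "norm x \<le> R"
    have 1: "rcomb exp (p # P) = (\<lambda>x. g (v \<bullet> x) + rcomb exp P x)" by (simp add: p g_def fun_eq_iff)
    have 2: "(\<lambda>x. rcomb \<sigma> (L' @ L) x + (\<beta>' + \<beta>)) = (\<lambda>x. (rcomb \<sigma> L' x + \<beta>') + (rcomb \<sigma> L x + \<beta>))"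
      by (simp add: rcomb_append fun_eq_iff)
    show "\<bar>partials w (rcomb exp (p # P)) x - partials w (\<lambda>x. rcomb \<sigma> (L' @ L) x + (\<beta>' + \<beta>)) x\<bar> \<le> e"
      unfolding 1 2 partials_add[OF Cg C_infinity_rcomb[OF smooth_exp]] partials_add[OF C C]
      using L[rule_format, OF w x] L'[rule_format, OF w x] by linarith
  qed
qed

section \<open>Ridge combinations as networks with one hidden layer\<close>

lemma dot_coords: "dot (coords v) (coords x) = v \<bullet> (x :: real^'d::finite)"
proof -
  have "dot (coords v) (coords x) = (\<Sum>k\<leftarrow>[0..<CARD('d)]. v $ from_nat_into UNIV k * x $ from_nat_into UNIV k)"
    unfolding dot_def coords_def by (simp add: map2_map_map)
  also have "\<dots> = (\<Sum>k\<in>{..<CARD('d)}. v $ from_nat_into UNIV k * x $ from_nat_into UNIV k)"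
    by (simp add: interv_sum_list_conv_sum_set_nat atLeast0LessThan)
  also have "\<dots> = (\<Sum>i\<in>UNIV. v $ i * x $ i)"
    by (rule sum.reindex_bij_betw) (rule bij_betw_from_nat_into_finite, simp)
  finally show ?thesis by (simp add: inner_vec_def)
qed

lemma rcomb_DNN:
  fixes L :: "(real \<times> (real^'d::finite) \<times> real) list"
  shows "\<exists>N. (\<lambda>x. rcomb \<sigma> L x + \<beta>) \<in> DNN \<sigma> N"
proof -
  \<comment> \<open>A neuron with output weight zero keeps the hidden layer nonempty when
    \<open>L\<close> is empty, as \<open>compatible\<close> demands.\<close>
  define Q where "Q = (0, 0, 0) # L"
  define W where "W = map (\<lambda>(c, v, b). coords v) Q"
  define B where "B = map (\<lambda>(c, v, b). b) Q"
  define c where "c = map fst Q"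
  have "dot c (map \<sigma> (map2 (\<lambda>r \<beta>. dot r (coords x) + \<beta>) W B)) = rcomb \<sigma> Q x" for x
    unfolding W_def B_def c_def
    by (induction Q) (auto simp: dot_def[of "_ # _"] dot_coords, simp_all add: dot_def)
  then have "network \<sigma> [(W, B)] c \<beta> x = rcomb \<sigma> L x + \<beta>" for x
    unfolding network_def by (simp add: apply_layer_def Q_def)
  then have "(\<lambda>x. rcomb \<sigma> L x + \<beta>) = network \<sigma> [(W, B)] c \<beta>" by (simp add: fun_eq_iff)
  moreover have "compatible CARD('d) [(W, B)] (length c)"
    by (auto simp: W_def B_def c_def Q_def coords_def)
  ultimately have "(\<lambda>x. rcomb \<sigma> L x + \<beta>) \<in> DNN \<sigma> (network_size [(W, B)] c)"
    unfolding DNN_def by blast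
  then show ?thesis by blast
qed

subsection \<open>The uniform cone property\<close>

text \<open>The direction \<open>e = 0\<close> is allowed and serves the balls contained in \<open>\<Omega>\<close>. The cone acts on the doubled
  ball so that functions supported in \<open>ball z r\<close> can be translated.\<close>

definition cone_at :: "'a::euclidean_space set \<Rightarrow> 'a \<Rightarrow> real \<Rightarrow> 'a \<Rightarrow> real \<Rightarrow> bool" where
  "cone_at \<Omega> z r e \<rho> \<longleftrightarrow> 0 < r \<and> 0 < \<rho> \<and>
     (\<forall>x\<in>closure \<Omega> \<inter> ball z (2 * r). \<forall>t b. 0 < t \<and> t \<le> 1 \<and> norm b < \<rho> \<longrightarrow> x + t *\<^sub>R (e + b) \<in> \<Omega>)"

definition cone_cover :: "'a::euclidean_space set \<Rightarrow> 'a set \<Rightarrow> ('a \<Rightarrow> real) \<Rightarrow> ('a \<Rightarrow> 'a) \<Rightarrow> real \<Rightarrow> bool" where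
  "cone_cover \<Omega> Z r e \<rho> \<longleftrightarrow> finite Z \<and> 0 < \<rho> \<and> closure \<Omega> \<subseteq> (\<Union>z\<in>Z. ball z (r z)) \<and>
     (\<forall>z\<in>Z. cone_at \<Omega> z (r z) (e z) \<rho>)"

lemma cone_atD:
  "cone_at \<Omega> z r e \<rho> \<Longrightarrow> x \<in> closure \<Omega> \<Longrightarrow> dist z x < 2 * r \<Longrightarrow> 0 < t \<Longrightarrow> t \<le> 1 \<Longrightarrow> norm b < \<rho> \<Longrightarrow>
    x + t *\<^sub>R (e + b) \<in> \<Omega>"
  unfolding cone_at_def by auto

lemma cone_at_mono: "cone_at \<Omega> z r e \<rho> \<Longrightarrow> 0 < \<rho>' \<Longrightarrow> \<rho>' \<le> \<rho> \<Longrightarrow> cone_at \<Omega> z r e \<rho>'"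
  unfolding cone_at_def by auto

lemma cone_at_interior:
  assumes "open \<Omega>" "z \<in> \<Omega>"
  shows "\<exists>r e \<rho>. cone_at \<Omega> z r e \<rho>"
proof -
  obtain d where d: "d > 0" "ball z d \<subseteq> \<Omega>" using assms openE by metis
  have "cone_at \<Omega> z (d / 4) 0 (d / 2)"
    unfolding cone_at_def
  proof (intro conjI ballI allI impI)
    fix x b :: 'a and t :: real assume x: "x \<in> closure \<Omega> \<inter> ball z (2 * (d / 4))" and t: "0 < t \<and> t \<le> 1 \<and> norm b < d / 2"
    have "t * norm b \<le> 1 * norm b" using t by (intro mult_right_mono) auto
    then have "norm (t *\<^sub>R b) < d / 2" using t by simp
    moreover have "norm (x - z) < d / 2" using x by (simp add: dist_norm norm_minus_commute)
    ultimately have "norm (x + t *\<^sub>R b - z) < d"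
      using norm_triangle_ineq[of "x - z" "t *\<^sub>R b"] by (simp add: algebra_simps)
    then show "x + t *\<^sub>R (0 + b) \<in> \<Omega>" using d(2) by (auto simp: dist_norm norm_minus_commute)
  qed (use d in auto)
  then show ?thesis by blast
qed

text \<open>The direction leads from \<open>z\<close> to an interior point \<open>p\<close>. Then
  \<open>x + t *\<^sub>R (p - z + b)\<close> is a convex combination of \<open>x\<close> in the
  closure and of the point \<open>p + (x - z) + b\<close> in a ball around \<open>p\<close>, hence
  interior.\<close>

lemma cone_at_convex:
  assumes "open \<Omega>" "\<Omega> \<noteq> {}" "convex \<Omega>" "z \<in> closure \<Omega>"
  shows "\<exists>r e \<rho>. cone_at \<Omega> z r e \<rho>"
proof -
  obtain p where "p \<in> \<Omega>" using assms by blast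
  then obtain d where d: "d > 0" "ball p d \<subseteq> \<Omega>" using assms openE by metis
  have "cone_at \<Omega> z (d / 4) (p - z) (d / 2)"
    unfolding cone_at_def
  proof (intro conjI ballI allI impI)
    fix x b :: 'a and t :: real assume x: "x \<in> closure \<Omega> \<inter> ball z (2 * (d / 4))" and t: "0 < t \<and> t \<le> 1 \<and> norm b < d / 2"
    define y where "y = p + (x - z) + b"
    have "norm (x - z) < d / 2" using x by (simp add: dist_norm norm_minus_commute)
    then have "norm ((x - z) + b) < d" using t norm_triangle_ineq[of "x - z" b] by linarith
    then have "y \<in> interior \<Omega>"
      using d(2) \<open>open \<Omega>\<close> by (auto simp: y_def dist_norm interior_open subset_iff norm_minus_commute
          intro!: d(2)[THEN subsetD])
    then have "x - t *\<^sub>R (x - y) \<in> interior \<Omega>"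
      using mem_interior_closure_convex_shrink[of \<Omega> y x t] x t \<open>convex \<Omega>\<close> by auto
    moreover have "x - t *\<^sub>R (x - y) = x + t *\<^sub>R (p - z + b)" by (simp add: y_def algebra_simps)
    ultimately show "x + t *\<^sub>R (p - z + b) \<in> \<Omega>" using \<open>open \<Omega>\<close> by (simp add: interior_open)
  qed (use d in auto)
  then show ?thesis by blast
qed

lemma C_k_Lipschitz_ball:
  fixes \<gamma> :: "real^'d::finite \<Rightarrow> real"
  assumes "C_k 2 \<gamma>"
  shows "\<exists>L\<ge>0. \<forall>x\<in>ball z r. \<forall>y\<in>ball z r. \<bar>\<gamma> x - \<gamma> y\<bar> \<le> L * norm (x - y)"
proof -
  have diff: "\<gamma> differentiable (at x)" for x
    using assms unfolding C_k_def by (metis list.size(3) partials.simps(1) pos2)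
  have cont: "continuous_on UNIV (partial i \<gamma>)" for i
    using assms unfolding C_k_def by (metis One_nat_def length_Cons list.size(3) one_le_numeral partials.simps)
  have "bounded (\<Union>i. partial i \<gamma> ` cball z r)"
    by (intro bounded_UN ballI compact_imp_bounded compact_continuous_image continuous_on_subset[OF cont]) auto
  then obtain M where M: "\<forall>y\<in>(\<Union>i. partial i \<gamma> ` cball z r). norm y \<le> M" using bounded_iff by blast
  define L where "L = real CARD('d) * \<bar>M\<bar>"
  have "norm (\<gamma> x - \<gamma> y) \<le> L * norm (x - y)" if "x \<in> ball z r" "y \<in> ball z r" for x y
  proof (rule differentiable_bound[OF convex_ball _ _ that])
    fix x assume x: "x \<in> ball z r"
    show "(\<gamma> has_derivative (\<lambda>h. \<Sum>i\<in>UNIV. h $ i * partial i \<gamma> x)) (at x within ball z r)"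
      by (rule has_derivative_at_withinI[OF has_derivative_partials[OF diff]])
    show "onorm (\<lambda>h. \<Sum>i\<in>UNIV. h $ i * partial i \<gamma> x) \<le> L"
    proof (rule onorm_le)
      fix h
      have "norm (\<Sum>i\<in>UNIV. h $ i * partial i \<gamma> x) \<le> (\<Sum>i\<in>(UNIV::'d set). norm h * \<bar>M\<bar>)"
      proof (rule sum_norm_le)
        fix i
        have "partial i \<gamma> x \<in> (\<Union>i. partial i \<gamma> ` cball z r)" using x by (intro UN_I[of i] imageI) auto
        then have "norm (partial i \<gamma> x) \<le> M" using M by blast
        then have "\<bar>partial i \<gamma> x\<bar> \<le> \<bar>M\<bar>" by simp
        then show "norm (h $ i * partial i \<gamma> x) \<le> norm h * \<bar>M\<bar>"
          using component_le_norm_cart[of h i] by (auto simp: abs_mult intro!: mult_mono)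
      qed
      then show "norm (\<Sum>i\<in>UNIV. h $ i * partial i \<gamma> x) \<le> L * norm h" by (simp add: L_def mult_ac)
    qed
  qed
  then show ?thesis by (intro exI[of _ L]) (auto simp: L_def)
qed

text \<open>In the direction of the graph a step of size \<open>t\<close> gains height
  \<open>t * \<kappa>\<close> and leaves \<open>\<gamma>\<close> unchanged. The deviation
  \<open>b\<close> costs at most \<open>t * \<rho> * (1 + L)\<close>, from the Lipschitz variation
  of \<open>\<gamma>\<close> and from its own component along the axis, which is less than the
  gain.\<close>

lemma cone_at_C2_boundary:
  fixes \<Omega> :: "(real^'d::finite) set"
  assumes "C2_boundary \<Omega>" "z \<in> frontier \<Omega>"
  shows "\<exists>r e \<rho>. cone_at \<Omega> z r e \<rho>"
proof -
  obtain r i s \<gamma> where r: "r > 0" and s: "s \<in> {-1, 1::real}" and \<gamma>: "C_k 2 \<gamma>"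
    and inv: "\<And>x t. \<gamma> (x + t *\<^sub>R axis i 1) = \<gamma> x"
    and \<Omega>: "\<Omega> \<inter> ball z r = {x \<in> ball z r. \<gamma> x < s * x $ i}"
    using assms unfolding C2_boundary_def by blast
  obtain L where L: "L \<ge> 0" "\<And>x y. x \<in> ball z r \<Longrightarrow> y \<in> ball z r \<Longrightarrow> \<bar>\<gamma> x - \<gamma> y\<bar> \<le> L * norm (x - y)"
    using C_k_Lipschitz_ball[OF \<gamma>, of z r] by blast
  have cont: "continuous_on UNIV \<gamma>" using \<gamma> unfolding C_k_def by (metis list.size(3) partials.simps(1) zero_le)
  \<comment> \<open>Starting within \<open>r / 2\<close> of \<open>z\<close>, a displacement below
    \<open>\<kappa> + \<rho> < r / 2\<close> stays in \<open>ball z r\<close>, where the graph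
    describes \<Omega>.\<close>
  define \<kappa> where "\<kappa> = r / 4"
  define \<rho> where "\<rho> = \<kappa> / (2 * (1 + L))"
  have \<kappa>: "\<kappa> > 0" using r by (simp add: \<kappa>_def)
  have \<rho>: "\<rho> > 0" "\<rho> * (1 + L) < \<kappa>" "\<rho> < \<kappa>" using \<kappa> L(1) by (auto simp: \<rho>_def field_simps add_pos_nonneg)
  have le: "\<gamma> x \<le> s * x $ i" if x: "x \<in> closure \<Omega>" "x \<in> ball z r" for x
  proof -
    have "x \<in> closure (\<Omega> \<inter> ball z r)"
      using x open_Int_closure_subset[of "ball z r" \<Omega>] by (auto simp: Int_commute)
    also have "closure (\<Omega> \<inter> ball z r) \<subseteq> {x. \<gamma> x \<le> s * x $ i}"
    proof (rule closure_minimal)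
      show "closed {x. \<gamma> x \<le> s * x $ i}"
        by (intro closed_Collect_le cont continuous_intros)
    qed (use \<Omega> in auto)
    finally show ?thesis by simp
  qed
  have "cone_at \<Omega> z (r / 4) ((\<kappa> * s) *\<^sub>R axis i 1) \<rho>"
    unfolding cone_at_def
  proof (intro conjI ballI allI impI)
    fix x b :: "real^'d" and t :: real
    assume x: "x \<in> closure \<Omega> \<inter> ball z (2 * (r / 4))" and t: "0 < t \<and> t \<le> 1 \<and> norm b < \<rho>"
    let ?y = "x + t *\<^sub>R ((\<kappa> * s) *\<^sub>R axis i 1 + b)"
    have xz: "norm (x - z) < r / 2" using x by (simp add: dist_norm norm_minus_commute)
    have tb: "norm (t *\<^sub>R b) \<le> t * \<rho>" "t * \<rho> \<le> \<rho>" using t \<rho> by auto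
    have s1: "\<bar>s\<bar> = 1" "s * s = 1" using s by auto
    have te: "norm (t *\<^sub>R ((\<kappa> * s) *\<^sub>R axis i (1::real) :: real^'d)) \<le> \<kappa>"
      using t \<kappa> s1 by (simp add: abs_mult mult_left_le_one_le)
    have y: "?y \<in> ball z r"
    proof -
      have "norm (?y - z) \<le> norm (x - z) + norm (t *\<^sub>R ((\<kappa> * s) *\<^sub>R axis i (1::real) :: real^'d)) + norm (t *\<^sub>R b)"
        by (rule order_trans[OF _ norm_triangle_mono[OF norm_triangle_ineq order_refl]]) (simp add: algebra_simps)
      also have "\<dots> < r" using xz te tb \<rho> \<kappa>_def by linarith
      finally show ?thesis by (simp add: dist_norm norm_minus_commute)
    qed
    have xb: "x + t *\<^sub>R b \<in> ball z r"
    proof -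
      have "norm (x + t *\<^sub>R b - z) \<le> norm (x - z) + norm (t *\<^sub>R b)"
        by (rule order_trans[OF _ norm_triangle_ineq]) (simp add: algebra_simps)
      also have "\<dots> < r" using xz tb \<rho> \<kappa>_def by linarith
      finally show ?thesis by (simp add: dist_norm norm_minus_commute)
    qed
    have xr: "x \<in> ball z r" using x r by auto
    have "?y = (x + t *\<^sub>R b) + (t * (\<kappa> * s)) *\<^sub>R axis i 1" by (simp add: algebra_simps)
    then have "\<gamma> ?y = \<gamma> (x + t *\<^sub>R b)" by (metis inv)
    also have "\<dots> \<le> \<gamma> x + L * (t * \<rho>)"
      using L(2)[OF xb xr] mult_left_mono[OF tb(1) L(1)] by simp
    also have "\<dots> \<le> s * x $ i + L * (t * \<rho>)" using le[OF _ xr] x by auto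
    also have "\<dots> < s * x $ i + t * \<kappa> - t * \<rho>"
      using mult_strict_left_mono[OF \<rho>(2), of t] t by (simp add: algebra_simps)
    also have "\<dots> \<le> s * x $ i + t * \<kappa> + s * (t * b $ i)"
    proof -
      have "\<bar>s * (t * b $ i)\<bar> \<le> t * \<rho>"
        using component_le_norm_cart[of b i] t s1 by (simp add: abs_mult mult_left_mono)
      then show ?thesis by linarith
    qed
    also have "\<dots> = s * ?y $ i" using s1 by (simp add: algebra_simps axis_def)
    finally show "?y \<in> \<Omega>" using \<Omega> y by blast
  qed (use r \<rho> in auto)
  then show ?thesis by blast
qed

text \<open>Compactness of the closure leaves finitely many balls, and shrinking a cone keeps its
  property, so the least opening serves all of them.\<close>

theorem cone_cover_exists:
  fixes \<Omega> :: "(real^'d::finite) set"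
  assumes "open \<Omega>" "\<Omega> \<noteq> {}" "bounded \<Omega>" "convex \<Omega> \<or> C2_boundary \<Omega>"
  shows "\<exists>Z r e \<rho>. cone_cover \<Omega> Z r e \<rho>"
proof -
  have "\<exists>r e \<rho>. cone_at \<Omega> z r e \<rho>" if "z \<in> closure \<Omega>" for z
  proof (cases "convex \<Omega>")
    case True
    then show ?thesis using cone_at_convex that assms by blast
  next
    case False
    then show ?thesis using that assms cone_at_interior cone_at_C2_boundary
      unfolding frontier_def by (metis DiffI interior_open)
  qed
  then obtain r e \<rho> where c: "\<And>z. z \<in> closure \<Omega> \<Longrightarrow> cone_at \<Omega> z (r z) (e z) (\<rho> z)" by metis
  have cpt: "compact (closure \<Omega>)" using \<open>bounded \<Omega>\<close> by (simp add: compact_closure)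
  have cov: "closure \<Omega> \<subseteq> (\<Union>z\<in>closure \<Omega>. ball z (r z))"
    using c unfolding cone_at_def by force
  obtain Z where Z: "Z \<subseteq> closure \<Omega>" "finite Z" "closure \<Omega> \<subseteq> (\<Union>z\<in>Z. ball z (r z))"
    using compactE_image[OF cpt open_ball cov] by metis
  have "Z \<noteq> {}" using Z(3) \<open>\<Omega> \<noteq> {}\<close> closure_subset by fastforce
  define \<rho>0 where "\<rho>0 = Min (\<rho> ` Z)"
  have "\<rho>0 \<in> \<rho> ` Z" unfolding \<rho>0_def using Z \<open>Z \<noteq> {}\<close> by (intro Min_in) auto
  then have "\<rho>0 > 0" using c Z(1) unfolding cone_at_def by blast
  moreover have "\<rho>0 \<le> \<rho> z" if "z \<in> Z" for z unfolding \<rho>0_def using Z that by simp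
  ultimately have "cone_cover \<Omega> Z r e \<rho>0"
    unfolding cone_cover_def using Z c by (blast intro: cone_at_mono)
  then show ?thesis by blast
qed

subsection \<open>Approximation in the Sobolev norm\<close>

definition sq_int :: "('a::euclidean_space \<Rightarrow> real) \<Rightarrow> bool" where
  "sq_int h \<longleftrightarrow> h \<in> borel_measurable borel \<and> (\<integral>\<^sup>+x. ennreal ((h x)\<^sup>2) \<partial>lborel) < \<infinity>"

lemma sq_intD: "sq_int h \<Longrightarrow> h \<in> borel_measurable borel" "sq_int h \<Longrightarrow> integrable lborel (\<lambda>x. (h x)\<^sup>2)"
  "sq_int h \<Longrightarrow> (\<integral>\<^sup>+x. ennreal ((h x)\<^sup>2) \<partial>lborel) < \<infinity>"
  using integrable_sq_iff[of h lborel] by (auto simp: sq_int_def)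

lemma sq_int_add: "sq_int f \<Longrightarrow> sq_int g \<Longrightarrow> sq_int (\<lambda>x. f x + g x)"
  unfolding sq_int_def
  by (auto intro!: le_less_trans[OF nn_integral_sq_add_le] simp: ennreal_mult_less_top ennreal_add_less_top)

lemma sq_int_mult_bounded:
  assumes f: "sq_int f" and [measurable]: "g \<in> borel_measurable borel" and g: "\<And>x. \<bar>g x\<bar> \<le> B"
  shows "sq_int (\<lambda>x. g x * f x)"
  unfolding sq_int_def
proof
  note [measurable] = sq_intD(1)[OF f]
  have "(\<integral>\<^sup>+x. ennreal ((g x * f x)\<^sup>2) \<partial>lborel) \<le> (\<integral>\<^sup>+x. ennreal (B\<^sup>2) * ennreal ((f x)\<^sup>2) \<partial>lborel)"
  proof (rule nn_integral_mono)
    fix x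
    have "(g x)\<^sup>2 \<le> B\<^sup>2" using power_mono[OF g[of x], of 2] by simp
    then have "(g x * f x)\<^sup>2 \<le> B\<^sup>2 * (f x)\<^sup>2" unfolding power_mult_distrib by (rule mult_right_mono) simp
    then show "ennreal ((g x * f x)\<^sup>2) \<le> ennreal (B\<^sup>2) * ennreal ((f x)\<^sup>2)"
      by (simp flip: ennreal_mult add: ennreal_leI)
  qed
  also have "\<dots> = ennreal (B\<^sup>2) * (\<integral>\<^sup>+x. ennreal ((f x)\<^sup>2) \<partial>lborel)" by (rule nn_integral_cmult) measurable
  also have "\<dots> < \<infinity>" using sq_intD(3)[OF f] by (simp add: ennreal_mult_less_top)
  finally show "(\<integral>\<^sup>+x. ennreal ((g x * f x)\<^sup>2) \<partial>lborel) < \<infinity>" .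
qed (use sq_intD(1)[OF f] in simp)

lemma sq_int_integrable: "sq_int f \<Longrightarrow> sq_int g \<Longrightarrow> integrable lborel (\<lambda>x. f x * g x)"
  by (intro integrable_mult_sq) (auto dest: sq_intD)

lemma sq_int_smooth:
  assumes "C_infinity F" "\<And>x. R < norm x \<Longrightarrow> F x = 0"
  shows "sq_int F"
proof -
  have "integrable lborel (\<lambda>x. F x * F x)"
    by (rule C_infinity_bounded_support(2)[of _ R]) (auto intro: C_infinity_mult assms)
  then show ?thesis
    using C_infinity_borel[OF assms(1)] integrable_sq_iff[of F lborel] by (simp add: sq_int_def power2_eq_square)
qed

lemma sq_int_test:
  assumes "test_function \<Omega> \<phi>" shows "sq_int (partials w \<phi>)"
proof -
  obtain R where "\<forall>x. R < norm x \<longrightarrow> partials w \<phi> x = 0" using test_function_zero(2)[OF assms] by blast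
  then show ?thesis
    using assms C_infinity_partials[of \<phi> w] by (intro sq_int_smooth[of _ R]) (auto simp: test_function_def)
qed

subsubsection \<open>Partition of unity\<close>

lemma partition_of_unity:
  fixes \<Omega> :: "(real^'d::finite) set"
  assumes "bounded \<Omega>" and Z: "finite Z" "closure \<Omega> \<subseteq> (\<Union>z\<in>Z. ball z (r z))"
  shows "\<exists>\<theta>. (\<forall>z. C_infinity (\<theta> z)) \<and> (\<forall>z y. z \<in> Z \<longrightarrow> \<theta> z y \<noteq> 0 \<longrightarrow> dist z y \<le> \<bar>r z\<bar>) \<and>
    (\<forall>y\<in>\<Omega>. (\<Sum>z\<in>Z. \<theta> z y) = 1)"
proof -
  define \<psi> where "\<psi> = (\<lambda>z y::real^'d. flat ((r z)\<^sup>2 - (norm (y - z))\<^sup>2))"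
  have \<psi>: "C_infinity (\<psi> z)" for z unfolding \<psi>_def by (rule C_infinity_bump)
  have \<psi>0: "0 \<le> \<psi> z y" for z y by (simp add: \<psi>_def flat_nonneg)
  define T where "T = (\<lambda>y. \<Sum>z\<in>Z. \<psi> z y)"
  have T: "C_infinity T" unfolding T_def by (rule C_infinity_sum) (rule \<psi>)
  have Tpos: "T y > 0" if "y \<in> closure \<Omega>" for y
  proof -
    obtain z where z: "z \<in> Z" "dist z y < r z" using Z(2) \<open>y \<in> closure \<Omega>\<close> by auto
    then have "(norm (y - z))\<^sup>2 < (r z)\<^sup>2"
      using power_strict_mono[of "norm (y - z)" "r z" 2] by (simp add: dist_norm norm_minus_commute)
    then have "\<psi> z y > 0" by (simp add: \<psi>_def flat_pos_iff)
    then show ?thesis unfolding T_def using Z(1) z(1) \<psi>0 by (intro sum_pos2[of Z z]) auto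
  qed
  obtain m where m: "m > 0" "\<And>y. y \<in> \<Omega> \<Longrightarrow> m \<le> T y"
  proof (cases "\<Omega> = {}")
    case False
    have "compact (closure \<Omega>)" "closure \<Omega> \<noteq> {}" using \<open>bounded \<Omega>\<close> False by (auto simp: compact_closure)
    from continuous_attains_inf[OF this C_infinity_continuous[OF T]]
    obtain y0 where y0: "y0 \<in> closure \<Omega>" "\<forall>y\<in>closure \<Omega>. T y0 \<le> T y" ..
    have "T y0 \<le> T y" if "y \<in> \<Omega>" for y using y0(2) that closure_subset by blast
    then show ?thesis by (rule that[OF Tpos[OF y0(1)]])
  qed (use that[of 1] in auto)
  \<comment> \<open>\<open>T\<close> itself may vanish far from \<Omega>. The added term is smooth,
    vanishes where \<open>T \<ge> m\<close>, in particular on \<Omega>, and is positive elsewhere,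
    so the denominator is positive on the whole space.\<close>
  define T' where "T' = (\<lambda>y. T y + flat ((-1) * T y + m))"
  have sm: "smooth (\<lambda>s. flat ((-1) * s + m))" by (rule smooth_affine[OF smooth_flat])
  have T': "C_infinity T'" unfolding T'_def by (rule C_infinity_add[OF T C_infinity_compose[OF sm T]])
  have T'pos: "T' y > 0" for y
  proof (cases "T y \<ge> m")
    case True
    then show ?thesis using m(1) flat_nonneg[of "(-1) * T y + m"] unfolding T'_def by linarith
  next
    case False
    then have "flat ((-1) * T y + m) > 0" by (simp add: flat_pos_iff)
    moreover have "T y \<ge> 0" unfolding T_def by (intro sum_nonneg \<psi>0)
    ultimately show ?thesis unfolding T'_def by linarith
  qed
  then have T'0: "T' y \<noteq> 0" for y by (metis less_irrefl)
  have T'\<Omega>: "T' y = T y" if "y \<in> \<Omega>" for y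
    using m(2)[OF that] by (simp add: T'_def flat_zero)
  define \<theta> where "\<theta> = (\<lambda>z y. \<psi> z y * inverse (T' y))"
  show ?thesis
  proof (intro exI[of _ \<theta>] conjI allI impI ballI)
    show "C_infinity (\<theta> z)" for z
      unfolding \<theta>_def by (rule C_infinity_mult[OF \<psi> C_infinity_inverse[OF T' T'0]])
    show "dist z y \<le> \<bar>r z\<bar>" if "z \<in> Z" "\<theta> z y \<noteq> 0" for z y
    proof -
      have "\<psi> z y \<noteq> 0" using that by (auto simp: \<theta>_def)
      then have "(norm (y - z))\<^sup>2 \<le> (r z)\<^sup>2"
        using flat_zero[of "(r z)\<^sup>2 - (norm (y - z))\<^sup>2"] by (force simp: \<psi>_def)
      then show ?thesis by (metis abs_le_square_iff abs_norm_cancel dist_norm norm_minus_commute)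
    qed
    show "(\<Sum>z\<in>Z. \<theta> z y) = 1" if "y \<in> \<Omega>" for y
    proof -
      have "(\<Sum>z\<in>Z. \<theta> z y) = T y * inverse (T' y)" by (simp add: \<theta>_def T_def sum_distrib_right)
      then show ?thesis using T'\<Omega>[OF that] T'0[of y] by simp
    qed
  qed
qed

subsubsection \<open>Leibniz rule for localised weak derivatives\<close>

text \<open>\<open>G w\<close> stands for the weak derivative of order \<open>w\<close> of a function. The last equation is meant for
  words of length two only.\<close>

fun leibniz :: "(real^'d::finite \<Rightarrow> real) \<Rightarrow> ('d list \<Rightarrow> real^'d \<Rightarrow> real) \<Rightarrow> 'd list \<Rightarrow> real^'d \<Rightarrow> real" where
  "leibniz \<theta> G [] y = \<theta> y * G [] y"
| "leibniz \<theta> G [i] y = \<theta> y * G [i] y + partials [i] \<theta> y * G [] y"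
| "leibniz \<theta> G (i # k # w) y = \<theta> y * G [i, k] y + partials [k] \<theta> y * G [i] y
     + (partials [i] \<theta> y * G [k] y + partials [k, i] \<theta> y * G [] y)"

lemma words_le_2:
  assumes "length w \<le> 2"
  obtains "w = []" | i where "w = [i]" | i k where "w = [i, k]"
  using assms by (cases w; cases "tl w"; cases "tl (tl w)") auto

text \<open>The translated kernel that plays the part of \<open>\<eta>\<close> may reach outside
  \<Omega>; its products with derivatives of the localising function are the test functions. The
  rule is therefore derived by testing with these products and solving for the integral in which
  \<open>\<eta>\<close> carries all derivatives.\<close>

lemma leibniz_weak_deriv:
  fixes G :: "'d::finite list \<Rightarrow> real^'d \<Rightarrow> real"
  assumes G: "\<And>w. length w \<le> 2 \<Longrightarrow> sq_int (G w)"
    and ibp: "\<And>w \<phi>. length w \<le> 2 \<Longrightarrow> test_function \<Omega> \<phi> \<Longrightarrow>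
      (\<integral>x. G [] x * partials w \<phi> x \<partial>lborel) = (-1) ^ length w * (\<integral>x. G w x * \<phi> x \<partial>lborel)"
    and \<theta>: "C_infinity \<theta>" and \<eta>: "C_infinity \<eta>"
    and test: "\<And>v. test_function \<Omega> (\<lambda>y. partials v \<theta> y * \<eta> y)"
    and w: "length w \<le> 2"
  shows "(\<integral>y. (\<theta> y * G [] y) * partials w \<eta> y \<partial>lborel) = (-1) ^ length w * (\<integral>y. leibniz \<theta> G w y * \<eta> y \<partial>lborel)"
proof -
  have P: "partials [i] (\<lambda>y. partials v \<theta> y * \<eta> y) = (\<lambda>y. partials v \<theta> y * partials [i] \<eta> y + partials (i # v) \<theta> y * \<eta> y)" for i v
    using partial_mult[OF C_infinity_differentiable[OF C_infinity_partials[OF \<theta>]] C_infinity_differentiable[OF \<eta>], of i v]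
    by (simp add: fun_eq_iff)
  have int: "integrable lborel (\<lambda>y. G w y * (partials v \<theta> y * \<eta> y))" if "length w \<le> 2" for w v
    using sq_int_integrable[OF G[OF that] sq_int_test[OF test, of "[]" v]] by simp
  \<comment> \<open>By the product rule this function is \<open>G w\<close> times a derivative of a
    test function minus a term covered by \<open>int\<close>.\<close>
  have int1: "integrable lborel (\<lambda>y. G w y * (partials v \<theta> y * partials [i] \<eta> y))" if "length w \<le> 2" for w v i
  proof -
    have "integrable lborel (\<lambda>y. G w y * partials [i] (\<lambda>y. partials v \<theta> y * \<eta> y) y - G w y * (partials (i # v) \<theta> y * \<eta> y))"
      by (intro Bochner_Integration.integrable_diff int that sq_int_integrable[OF G[OF that] sq_int_test[OF test]])
    then show ?thesis unfolding P by (simp add: algebra_simps)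
  qed
  have first: "(\<integral>y. G [] y * (partials v \<theta> y * partials [i] \<eta> y) \<partial>lborel) =
     - (\<integral>y. G [i] y * (partials v \<theta> y * \<eta> y) \<partial>lborel) - (\<integral>y. G [] y * (partials (i # v) \<theta> y * \<eta> y) \<partial>lborel)" for v i
  proof -
    have "(\<integral>y. G [] y * (partials v \<theta> y * partials [i] \<eta> y) \<partial>lborel) + (\<integral>y. G [] y * (partials (i # v) \<theta> y * \<eta> y) \<partial>lborel)
      = (\<integral>y. G [] y * (partials v \<theta> y * partials [i] \<eta> y) + G [] y * (partials (i # v) \<theta> y * \<eta> y) \<partial>lborel)"
      by (intro Bochner_Integration.integral_add[symmetric] int int1) auto
    also have "\<dots> = - (\<integral>y. G [i] y * (partials v \<theta> y * \<eta> y) \<partial>lborel)"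
      using ibp[OF _ test, of "[i]" v] unfolding P by (simp add: algebra_simps)
    finally show ?thesis by simp
  qed
  show ?thesis
    using w
  proof (cases rule: words_le_2)
    case 1
    then show ?thesis by simp
  next
    case (2 i)
    have i: "integrable lborel (\<lambda>y. G [i] y * (\<theta> y * \<eta> y))" "integrable lborel (\<lambda>y. G [] y * (partials [i] \<theta> y * \<eta> y))"
      using int[of "[i]" "[]"] int[of "[]" "[i]"] by auto
    have "(\<integral>y. leibniz \<theta> G w y * \<eta> y \<partial>lborel) = (\<integral>y. G [i] y * (\<theta> y * \<eta> y) + G [] y * (partials [i] \<theta> y * \<eta> y) \<partial>lborel)"
      unfolding 2 by (intro Bochner_Integration.integral_cong refl) (simp only: leibniz.simps, simp only: algebra_simps)
    also have "\<dots> = (\<integral>y. G [i] y * (\<theta> y * \<eta> y) \<partial>lborel) + (\<integral>y. G [] y * (partials [i] \<theta> y * \<eta> y) \<partial>lborel)"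
      by (rule Bochner_Integration.integral_add[OF i])
    finally have L: "(\<integral>y. leibniz \<theta> G w y * \<eta> y \<partial>lborel) = (\<integral>y. G [i] y * (\<theta> y * \<eta> y) \<partial>lborel) + (\<integral>y. G [] y * (partials [i] \<theta> y * \<eta> y) \<partial>lborel)" .
    have "(\<integral>y. (\<theta> y * G [] y) * partials w \<eta> y \<partial>lborel) = (\<integral>y. G [] y * (partials [] \<theta> y * partials [i] \<eta> y) \<partial>lborel)"
      unfolding 2 by (simp add: mult_ac)
    then show ?thesis unfolding L first by (simp add: 2)
  next
    case (3 i k)
    let ?I = "\<lambda>w v. \<integral>y. G w y * (partials v \<theta> y * \<eta> y) \<partial>lborel"
    have "(\<integral>y. leibniz \<theta> G w y * \<eta> y \<partial>lborel) = (\<integral>y. (G [i, k] y * (partials [] \<theta> y * \<eta> y) + G [i] y * (partials [k] \<theta> y * \<eta> y))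
       + (G [k] y * (partials [i] \<theta> y * \<eta> y) + G [] y * (partials [k, i] \<theta> y * \<eta> y)) \<partial>lborel)"
      unfolding 3 by (intro Bochner_Integration.integral_cong refl)
        (simp only: leibniz.simps partials.simps(1), simp only: algebra_simps)
    also have "\<dots> = (?I [i, k] [] + ?I [i] [k]) + (?I [k] [i] + ?I [] [k, i])"
      by (subst Bochner_Integration.integral_add, (intro Bochner_Integration.integrable_add int; simp)+)+
        (simp only: partials.simps)
    finally have L: "(\<integral>y. leibniz \<theta> G w y * \<eta> y \<partial>lborel) = (?I [i, k] [] + ?I [i] [k]) + (?I [k] [i] + ?I [] [k, i])" .
    \<comment> \<open>The second derivative of \<open>\<theta> * \<eta>\<close> contains the wanted
      term and three others with derivatives on \<open>\<theta>\<close>; the two in which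
      \<open>\<eta>\<close> is still differentiated are reduced by \<open>first\<close>.\<close>
    have PP: "partials [i, k] (\<lambda>y. partials [] \<theta> y * \<eta> y) y = partials [] \<theta> y * partials [i, k] \<eta> y
       + partials [i] \<theta> y * partials [k] \<eta> y + (partials [k] \<theta> y * partials [i] \<eta> y + partials [i, k] \<theta> y * \<eta> y)" for y
    proof -
      have C: "C_infinity (\<lambda>y. partials [] \<theta> y * partials [k] \<eta> y)" "C_infinity (\<lambda>y. partials [k] \<theta> y * \<eta> y)"
        by (intro C_infinity_mult C_infinity_partials \<theta> \<eta>)+
      have "partials [i, k] (\<lambda>y. partials [] \<theta> y * \<eta> y) = partials [i] (partials [k] (\<lambda>y. partials [] \<theta> y * \<eta> y))" by simp
      also have "\<dots> = partials [i] (\<lambda>y. partials [] \<theta> y * partials [k] \<eta> y + partials [k] \<theta> y * \<eta> y)" unfolding P ..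
      also have "\<dots> = (\<lambda>y. partials [i] (\<lambda>y. partials [] \<theta> y * partials [k] \<eta> y) y + partials [i] (\<lambda>y. partials [k] \<theta> y * \<eta> y) y)"
        by (rule partials_add[OF C])
      also have "partials [i] (\<lambda>y. partials [] \<theta> y * partials [k] \<eta> y) = (\<lambda>y. partials [] \<theta> y * partials [i, k] \<eta> y + partials [i] \<theta> y * partials [k] \<eta> y)"
        using partial_mult[OF C_infinity_differentiable[OF \<theta>] C_infinity_differentiable[OF C_infinity_partial[OF \<eta>, of k]]]
        by (simp add: fun_eq_iff)
      finally show ?thesis unfolding P by simp
    qed
    have i2: "integrable lborel (\<lambda>y. G [] y * partials [i, k] (\<lambda>y. partials [] \<theta> y * \<eta> y) y)"
      by (rule sq_int_integrable[OF G sq_int_test[OF test]]) simp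
    have "(\<integral>y. (\<theta> y * G [] y) * partials w \<eta> y \<partial>lborel) =
      (\<integral>y. (G [] y * partials [i, k] (\<lambda>y. partials [] \<theta> y * \<eta> y) y - G [] y * (partials [i] \<theta> y * partials [k] \<eta> y))
         - (G [] y * (partials [k] \<theta> y * partials [i] \<eta> y) + G [] y * (partials [i, k] \<theta> y * \<eta> y)) \<partial>lborel)"
      unfolding 3 PP by (intro Bochner_Integration.integral_cong refl) (simp only: partials.simps(1), simp only: algebra_simps)
    also have "\<dots> = ((\<integral>y. G [] y * partials [i, k] (\<lambda>y. partials [] \<theta> y * \<eta> y) y \<partial>lborel)
        - (\<integral>y. G [] y * (partials [i] \<theta> y * partials [k] \<eta> y) \<partial>lborel))
        - ((\<integral>y. G [] y * (partials [k] \<theta> y * partials [i] \<eta> y) \<partial>lborel) + ?I [] [i, k])"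
      by (subst Bochner_Integration.integral_diff Bochner_Integration.integral_add,
          (intro Bochner_Integration.integrable_add Bochner_Integration.integrable_diff int int1 i2; simp)+)+ (rule refl)
    also have "(\<integral>y. G [] y * partials [i, k] (\<lambda>y. partials [] \<theta> y * \<eta> y) y \<partial>lborel) = ?I [i, k] []"
      using ibp[OF _ test, of "[i, k]" "[]"] by simp
    finally show ?thesis unfolding L first by (simp add: 3)
  qed
qed

lemma sq_int_leibniz:
  assumes G: "\<And>w. length w \<le> 2 \<Longrightarrow> sq_int (G w)" and \<theta>: "C_infinity \<theta>" "\<And>x. R < norm x \<Longrightarrow> \<theta> x = 0"
    and w: "length w \<le> 2"
  shows "sq_int (leibniz \<theta> G w)"
proof -
  have mult: "sq_int (\<lambda>y. partials v \<theta> y * G w y)" if "length w \<le> 2" for v w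
  proof -
    have "open {x::real^'a. R < norm x}" by (intro open_Collect_less continuous_intros)
    then have "partials v \<theta> x = 0" if "R < norm x" for x
      using partials_zero_open[of "{x. R < norm x}" \<theta> x v] \<theta>(2) that by simp
    then obtain B where "\<forall>x. \<bar>partials v \<theta> x\<bar> \<le> B"
      using C_infinity_bounded_support(1)[OF C_infinity_partials[OF \<theta>(1)], of R v] by blast
    then show ?thesis
      using sq_int_mult_bounded[OF G[OF that] C_infinity_borel[OF C_infinity_partials[OF \<theta>(1)]]] by blast
  qed
  show ?thesis
    using w
  proof (cases rule: words_le_2)
    case 1
    then show ?thesis using mult[of "[]" "[]"] by (simp add: leibniz.simps[abs_def])
  next
    case (2 i)
    then show ?thesis using sq_int_add[OF mult[of "[i]" "[]"] mult[of "[]" "[i]"]] by (simp add: leibniz.simps[abs_def])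
  next
    case (3 i k)
    then show ?thesis
      using sq_int_add[OF sq_int_add[OF mult[of "[i, k]" "[]"] mult[of "[i]" "[k]"]] sq_int_add[OF mult[of "[k]" "[i]"] mult[of "[]" "[k, i]"]]]
      by (simp add: leibniz.simps[abs_def])
  qed
qed

text \<open>On \<Omega> the partition sums to one, so its derivatives sum to zero and the lower
  order Leibniz terms cancel in the sum.\<close>

lemma leibniz_partition:
  assumes \<Omega>: "open \<Omega>" and \<theta>: "\<And>z. C_infinity (\<theta> z)" "\<And>y. y \<in> \<Omega> \<Longrightarrow> (\<Sum>z\<in>Z. \<theta> z y) = 1"
    and "y \<in> \<Omega>" "length w \<le> 2"
  shows "(\<Sum>z\<in>Z. leibniz (\<theta> z) G w y) = G w y"
proof -
  have d: "(\<Sum>z\<in>Z. partials v (\<theta> z) y) = 0" if "v \<noteq> []" for v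
  proof -
    have "partials v (\<lambda>y. (\<Sum>z\<in>Z. \<theta> z y) + (-1)) y = 0"
      by (rule partials_zero_open[OF \<Omega> _ \<open>y \<in> \<Omega>\<close>]) (simp add: \<theta>(2))
    then show ?thesis
      using that unfolding partials_add[OF C_infinity_sum[OF \<theta>(1)] C_infinity_const] partials_sum[OF \<theta>(1)] partials_const
      by simp
  qed
  show ?thesis
    using assms(5)
  proof (cases rule: words_le_2)
    case 1
    then show ?thesis using \<theta>(2)[OF \<open>y \<in> \<Omega>\<close>] by (simp flip: sum_distrib_right)
  next
    case (2 i)
    then show ?thesis using \<theta>(2)[OF \<open>y \<in> \<Omega>\<close>] d[of "[i]"]
      by (simp add: sum.distrib flip: sum_distrib_right)
  next
    case (3 i k)
    then show ?thesis using \<theta>(2)[OF \<open>y \<in> \<Omega>\<close>] d[of "[i]"] d[of "[k]"] d[of "[k, i]"]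
      by (simp add: sum.distrib flip: sum_distrib_right)
  qed
qed

subsubsection \<open>Convolution with exponential sums\<close>

text \<open>\<open>exp (v \<bullet> (y - x) + b)\<close> is a function of \<open>y\<close> times
  \<open>exp (- (v \<bullet> x))\<close>, so integration against \<open>H\<close> only produces a
  constant \<open>K\<close>. The sign appears because differentiation is in \<open>x\<close> instead
  of \<open>y\<close>.\<close>

lemma convolution_rcomb_exp:
  assumes "\<And>v b. integrable lborel (\<lambda>y. H y * exp (v \<bullet> y + b))"
  shows "\<exists>P. \<forall>w x. partials w (rcomb exp P) x = (-1) ^ length w * (\<integral>y. H y * partials w (rcomb exp L) (y - x) \<partial>lborel) \<and>
     integrable lborel (\<lambda>y. H y * partials w (rcomb exp L) (y - x))"
proof (induction L)
  case Nil
  show ?case unfolding partials_rcomb[OF smooth_exp] by (intro exI[of _ "[]"]) simp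
next
  case (Cons p L)
  obtain c v b where p: "p = (c, v, b)" by (cases p)
  obtain P where P: "\<And>w x. partials w (rcomb exp P) x = (-1) ^ length w * (\<integral>y. H y * partials w (rcomb exp L) (y - x) \<partial>lborel)"
    "\<And>w x. integrable lborel (\<lambda>y. H y * partials w (rcomb exp L) (y - x))" using Cons by blast
  define K where "K = (\<integral>y. H y * exp (v \<bullet> y + b) \<partial>lborel)"
  have neg: "(\<Prod>i\<leftarrow>w. (- v) $ i) = (-1) ^ length w * (\<Prod>i\<leftarrow>w. v $ i)" for w by (induction w) auto
  show ?case
  proof (intro exI[of _ "(c * K, - v, 0) # P"] allI conjI)
    fix w and x
    let ?q = "c * (\<Prod>i\<leftarrow>w. v $ i) * exp (- (v \<bullet> x))"
    have split: "H y * partials w (rcomb exp (p # L)) (y - x) = ?q * (H y * exp (v \<bullet> y + b)) + H y * partials w (rcomb exp L) (y - x)" for y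
      unfolding p partials_rcomb[OF smooth_exp] higher_deriv_exp
      by (simp add: inner_diff_right exp_add exp_diff exp_minus field_simps)
    have i1: "integrable lborel (\<lambda>y. ?q * (H y * exp (v \<bullet> y + b)))" by (intro integrable_mult_right assms)
    show "integrable lborel (\<lambda>y. H y * partials w (rcomb exp (p # L)) (y - x))"
      unfolding split by (intro Bochner_Integration.integrable_add i1 P(2))
    have "(\<integral>y. H y * partials w (rcomb exp (p # L)) (y - x) \<partial>lborel) = ?q * K + (\<integral>y. H y * partials w (rcomb exp L) (y - x) \<partial>lborel)"
      unfolding split K_def by (subst Bochner_Integration.integral_add[OF i1 P(2)]) simp
    moreover have "partials w (rcomb exp ((c * K, - v, 0) # P)) x = (-1) ^ length w * (?q * K) + partials w (rcomb exp P) x"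
      unfolding partials_rcomb[OF smooth_exp] higher_deriv_exp by (simp add: neg)
    ultimately show "partials w (rcomb exp ((c * K, - v, 0) # P)) x = (-1) ^ length w * (\<integral>y. H y * partials w (rcomb exp (p # L)) (y - x) \<partial>lborel)"
      unfolding P(1) by (simp add: distrib_left)
  qed
qed

lemma partials_rcomb_sum:
  assumes "finite Z" "smooth \<sigma>"
  shows "\<exists>P. \<forall>w x. partials w (rcomb \<sigma> P) x = (\<Sum>z\<in>Z. partials w (rcomb \<sigma> (Q z)) x)"
  using assms(1)
proof (induction Z rule: finite_induct)
  case empty
  show ?case unfolding partials_rcomb[OF assms(2)] by (intro exI[of _ "[]"]) simp
next
  case (insert z Z)
  then obtain P where P: "\<forall>w x. partials w (rcomb \<sigma> P) x = (\<Sum>z\<in>Z. partials w (rcomb \<sigma> (Q z)) x)" by blast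
  have "partials w (rcomb \<sigma> (Q z @ P)) x = partials w (rcomb \<sigma> (Q z)) x + partials w (rcomb \<sigma> P) x" for w x
    unfolding partials_rcomb[OF assms(2)] by simp
  then show ?case using P insert.hyps by (intro exI[of _ "Q z @ P"]) simp
qed

lemma finite_words: "finite {w :: 'd::finite list. length w \<le> n}"
  using finite_lists_length_le[of "UNIV :: 'd set" n] by simp

lemma integral_kernel_measurable:
  fixes h \<kappa> :: "'a::euclidean_space \<Rightarrow> real"
  assumes [measurable]: "h \<in> borel_measurable borel" "\<kappa> \<in> borel_measurable borel"
  shows "(\<lambda>x. \<integral>y. h y * \<kappa> (y - x) \<partial>lborel) \<in> borel_measurable borel"
  by measurable

text \<open>The kernel moved to \<open>x\<close> lives at points
  \<open>x + t *\<^sub>R (e + b)\<close> with small \<open>b\<close>. Where it meets the support of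
  \<open>\<xi>\<close>, the base point \<open>x\<close> is within \<open>2 * r\<close> of
  \<open>z\<close>, so the cone property places the intersection in \<Omega>, however close
  \<open>x\<close> is to the boundary. The margin between \<open>t * \<rho> / 2\<close> and
  \<open>t * \<rho>\<close> absorbs the closure.\<close>

lemma localized_test_function:
  fixes \<xi> \<kappa> :: "real^'d::finite \<Rightarrow> real"
  assumes c: "cone_at \<Omega> z r e \<rho>" and x: "x \<in> \<Omega>" and t: "0 < t" "t \<le> 1" "t * (norm e + \<rho>) < r"
    and \<xi>: "C_infinity \<xi>" "\<And>y. \<xi> y \<noteq> 0 \<Longrightarrow> dist z y \<le> r"
    and \<kappa>: "C_infinity \<kappa>" "\<And>y. \<kappa> y \<noteq> 0 \<Longrightarrow> norm (y - t *\<^sub>R e) < t * \<rho> / 2"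
  shows "test_function \<Omega> (\<lambda>y. \<xi> y * \<kappa> (y - x))"
proof (rule test_function_localized[OF \<xi>(1) \<kappa>(1)])
  have \<rho>: "\<rho> > 0" using c by (simp add: cone_at_def)
  then show "t * \<rho> / 2 < t * \<rho>" using t by simp
  have sub: "closure {y. \<xi> y \<noteq> 0} \<subseteq> cball z r" using \<xi>(2) by (intro closure_minimal) auto
  show "closure {y. \<xi> y \<noteq> 0} \<inter> ball (x + t *\<^sub>R e) (t * \<rho>) \<subseteq> \<Omega>"
  proof
    fix y assume y: "y \<in> closure {y. \<xi> y \<noteq> 0} \<inter> ball (x + t *\<^sub>R e) (t * \<rho>)"
    define b where "b = (1 / t) *\<^sub>R (y - x - t *\<^sub>R e)"
    have n: "norm (y - x - t *\<^sub>R e) < t * \<rho>" using y by (simp add: dist_norm norm_minus_commute algebra_simps)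
    moreover have "norm b = norm (y - x - t *\<^sub>R e) / t" unfolding b_def norm_scaleR using t by simp
    ultimately have b: "norm b < \<rho>" using t by (simp add: divide_less_eq mult.commute)
    have yeq: "y = x + t *\<^sub>R (e + b)" using t by (simp add: b_def algebra_simps)
    have "norm (y - x) \<le> norm (y - x - t *\<^sub>R e) + norm (t *\<^sub>R e)" 
      using norm_triangle_ineq[of "y - x - t *\<^sub>R e" "t *\<^sub>R e"] by simp
    then have "dist y x < r" using n t by (simp add: dist_norm algebra_simps)
    moreover have "dist z y \<le> r" using y sub by auto
    ultimately have "dist z x < 2 * r" using dist_triangle[of z x y] by simp
    then show "y \<in> \<Omega>" unfolding yeq using cone_atD[OF c _ _ t(1,2) b] x closure_subset by blast
  qed
qed (rule \<kappa>(2))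

text \<open>For \<open>x\<close> in \<Omega>, the integral of the localised function against a
  derivative of the kernel is, up to sign, the mollification of
  \<open>leibniz (\<theta> z) G w\<close>. One exponential sum \<open>P\<close> therefore
  approximates all derivatives up to order two, and the patches add up to \<open>G w\<close> by
  \<open>leibniz_partition\<close>.\<close>

theorem sobolev_approximation:
  fixes \<Omega> :: "(real^'d::finite) set" and G :: "'d list \<Rightarrow> real^'d \<Rightarrow> real"
  assumes \<Omega>: "open \<Omega>" "bounded \<Omega>" and cover: "cone_cover \<Omega> Z r e \<rho>"
    and G: "\<And>w. length w \<le> 2 \<Longrightarrow> sq_int (G w)" "\<And>w x. length w \<le> 2 \<Longrightarrow> x \<notin> \<Omega> \<Longrightarrow> G w x = 0"
    and ibp: "\<And>w \<phi>. length w \<le> 2 \<Longrightarrow> test_function \<Omega> \<phi> \<Longrightarrow>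
      (\<integral>x. G [] x * partials w \<phi> x \<partial>lborel) = (-1) ^ length w * (\<integral>x. G w x * \<phi> x \<partial>lborel)"
    and "\<epsilon> > 0"
  shows "\<exists>P. \<forall>w. length w \<le> 2 \<longrightarrow>
    (\<integral>\<^sup>+x. ennreal ((G w x - partials w (rcomb exp P) x)\<^sup>2) * indicator \<Omega> x \<partial>lborel) \<le> ennreal \<epsilon>"
proof -
  let ?W = "{w :: 'd list. length w \<le> 2}"
  have Z: "finite Z" "closure \<Omega> \<subseteq> (\<Union>z\<in>Z. ball z (r z))" "\<rho> > 0"
    and cone: "\<And>z. z \<in> Z \<Longrightarrow> cone_at \<Omega> z (r z) (e z) \<rho>"
    using cover by (auto simp: cone_cover_def)
  have rpos: "r z > 0" if "z \<in> Z" for z using cone[OF that] by (simp add: cone_at_def)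
  have [measurable]: "\<Omega> \<in> sets borel" using \<Omega> by simp
  obtain \<theta> where \<theta>: "\<And>z. C_infinity (\<theta> z)" "\<And>z y. z \<in> Z \<Longrightarrow> \<theta> z y \<noteq> 0 \<Longrightarrow> dist z y \<le> r z"
    "\<And>y. y \<in> \<Omega> \<Longrightarrow> (\<Sum>z\<in>Z. \<theta> z y) = 1"
    using partition_of_unity[OF \<Omega>(2) Z(1,2)] rpos by (metis abs_of_pos)
  have \<theta>supp: "partials v (\<theta> z) y = 0" if "z \<in> Z" "\<not> dist z y \<le> r z" for z y v
  proof (rule partials_zero_open[of "- cball z (r z)"])
    show "\<theta> z y = 0" if "y \<in> - cball z (r z)" for y using \<theta>(2)[OF \<open>z \<in> Z\<close>, of y] that by auto
  qed (use that in auto)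
  have \<theta>far: "\<theta> z y = 0" if "z \<in> Z" "norm z + r z < norm y" for z y
  proof (rule ccontr)
    assume "\<theta> z y \<noteq> 0"
    then have "dist z y \<le> r z" by (rule \<theta>(2)[OF \<open>z \<in> Z\<close>])
    then show False using that norm_triangle_sub[of y z] by (simp add: dist_norm norm_minus_commute)
  qed
  define g where "g = (\<lambda>z. leibniz (\<theta> z) G)"
  have g: "sq_int (g z w)" if "z \<in> Z" "length w \<le> 2" for z w
    unfolding g_def by (rule sq_int_leibniz[OF G(1) \<theta>(1) \<theta>far[OF that(1)] that(2)])
  define n where "n = real (card Z)"
  \<comment> \<open>With \<open>n\<close> patches, squaring the sum of the mollification errors
    costs a factor \<open>n\<close>, and adding their integrals costs another; \<open>e1\<close>
    limits this contribution to half of \<open>\<epsilon>\<close>.\<close>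
  define e1 where "e1 = \<epsilon> / (4 * (n * n + 1))"
  have e1: "e1 > 0" using \<open>\<epsilon> > 0\<close> by (simp add: e1_def add_nonneg_pos)
  define MOL where "MOL = (\<lambda>z w d. \<forall>\<kappa> B. \<kappa> \<in> borel_measurable borel \<longrightarrow> (\<forall>y. 0 \<le> \<kappa> y \<and> \<kappa> y \<le> B) \<longrightarrow>
    (\<integral>\<^sup>+y. ennreal (\<kappa> y) \<partial>lborel) = 1 \<longrightarrow> (\<forall>y. d \<le> norm y \<longrightarrow> \<kappa> y = 0) \<longrightarrow>
    (\<integral>\<^sup>+x. ennreal (((\<integral>y. g z w y * \<kappa> (y - x) \<partial>lborel) - g z w x)\<^sup>2) \<partial>lborel) \<le> ennreal e1)"
  have "\<exists>d>0. z \<in> Z \<longrightarrow> length w \<le> 2 \<longrightarrow> MOL z w d" for z w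
  proof (cases "z \<in> Z \<and> length w \<le> 2")
    case True
    then show ?thesis
      using L2_mollify[OF sq_intD(1)[OF g] sq_intD(3)[OF g] e1, of z w] unfolding MOL_def by blast
  qed (auto intro: exI[of _ 1])
  then obtain d where d: "\<And>z w. d z w > 0" "\<And>z w. z \<in> Z \<Longrightarrow> length w \<le> 2 \<Longrightarrow> MOL z w (d z w)"
    by metis
  \<comment> \<open>One step length for all patches and words: short enough for the kernels to stay
    within the mollification radii \<open>d z w\<close> and for the displacements to stay below
    \<open>r z\<close>.\<close>
  obtain t where t: "0 < t" "t \<le> 1" "\<And>z. z \<in> Z \<Longrightarrow> t * (norm (e z) + \<rho>) < r z"
    "\<And>z w. z \<in> Z \<Longrightarrow> length w \<le> 2 \<Longrightarrow> t * (norm (e z) + \<rho>) < d z w"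
  proof -
    have ev: "\<forall>\<^sub>F t in at_right 0. t * c < m" if "c > 0" "m > 0" for c m :: real
      by (rule eventually_at_rightI[of 0 "m / c"]) (use that in \<open>auto simp: field_simps\<close>)
    have c: "norm (e z) + \<rho> > 0" for z using Z(3) by (simp add: add_nonneg_pos)
    have "\<forall>\<^sub>F t in at_right 0. t \<in> {0<..<1::real}" by (rule eventually_at_rightI[of 0 1]) auto
    moreover have "\<forall>\<^sub>F t in at_right 0. \<forall>z\<in>Z. t * (norm (e z) + \<rho>) < r z"
      using Z(1) rpos c ev by (intro eventually_ball_finite) auto
    moreover have "\<forall>\<^sub>F t in at_right 0. \<forall>z\<in>Z. \<forall>w\<in>?W. t * (norm (e z) + \<rho>) < d z w"
      using Z(1) finite_words d(1) c ev by (intro eventually_ball_finite ballI) auto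
    ultimately have "\<forall>\<^sub>F t in at_right 0. t \<in> {0<..<1::real} \<and> (\<forall>z\<in>Z. t * (norm (e z) + \<rho>) < r z) \<and>
        (\<forall>z\<in>Z. \<forall>w\<in>?W. t * (norm (e z) + \<rho>) < d z w)"
      by eventually_elim blast
    from eventually_happens'[OF trivial_limit_at_right_real this]
    obtain t where "t \<in> {0<..<1::real} \<and> (\<forall>z\<in>Z. t * (norm (e z) + \<rho>) < r z) \<and>
        (\<forall>z\<in>Z. \<forall>w\<in>?W. t * (norm (e z) + \<rho>) < d z w)" ..
    then show ?thesis by (intro that[of t]) auto
  qed
  have "t * \<rho> / 2 > 0" using t Z(3) by simp
  note pos = this
  define KER where "KER = (\<lambda>z (f :: 'd \<Rightarrow> real \<Rightarrow> real) \<kappa> B. (\<forall>i. smooth (f i)) \<and> \<kappa> = (\<lambda>y::real^'d. \<Prod>i\<in>UNIV. f i (y $ i)) \<and>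
    C_infinity \<kappa> \<and> (\<forall>y. 0 \<le> \<kappa> y \<and> \<kappa> y \<le> B) \<and> (\<integral>\<^sup>+y. ennreal (\<kappa> y) \<partial>lborel) = 1 \<and>
    (\<forall>y. \<kappa> y \<noteq> 0 \<longrightarrow> norm (y - t *\<^sub>R e z) < t * \<rho> / 2))"
  have "\<exists>f \<kappa> B. KER z f \<kappa> B" for z
    unfolding KER_def by (rule kernel_exists[OF pos])
  then obtain f \<kappa> B where KER: "\<And>z. KER z (f z) (\<kappa> z) (B z)" by metis
  note K0 = KER[unfolded KER_def]
  note fs = K0[THEN conjunct1, rule_format]
  note K1 = K0[THEN conjunct2]
  note \<kappa>f = K1[THEN conjunct1]
  note K2 = K1[THEN conjunct2]
  note \<kappa>1 = K2[THEN conjunct1]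
  note K3 = K2[THEN conjunct2]
  note \<kappa> = \<kappa>1 K3[THEN conjunct1] K3[THEN conjunct2, THEN conjunct1] K3[THEN conjunct2, THEN conjunct2, rule_format]
  have \<kappa>m[measurable]: "\<kappa> z \<in> borel_measurable borel" for z by (rule C_infinity_borel[OF \<kappa>(1)])
  have \<kappa>supp: "\<forall>y. d z w \<le> norm y \<longrightarrow> \<kappa> z y = 0" if "z \<in> Z" "length w \<le> 2" for z w
  proof (intro allI impI, rule ccontr)
    fix y assume "d z w \<le> norm y" "\<kappa> z y \<noteq> 0"
    then show False
      using \<kappa>(4)[of z y] t(4)[OF that] norm_triangle_sub[of y "t *\<^sub>R e z"] t(1) mult_pos_pos[OF t(1) Z(3)] by (simp add: distrib_left)
  qed
  define M where "M = (\<lambda>z w x. \<integral>y. g z w y * \<kappa> z (y - x) \<partial>lborel)"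
  have M: "(\<integral>\<^sup>+x. ennreal ((M z w x - g z w x)\<^sup>2) \<partial>lborel) \<le> ennreal e1" if "z \<in> Z" "length w \<le> 2" for z w
    using d(2)[OF that] \<kappa>supp[OF that] \<kappa>m \<kappa>(2,3) unfolding MOL_def M_def by blast
  have Mm: "M z w \<in> borel_measurable borel" if "z \<in> Z" "length w \<le> 2" for z w
    unfolding M_def by (rule integral_kernel_measurable[OF sq_intD(1)[OF g[OF that]] \<kappa>m])
  define H where "H = (\<lambda>z y. \<theta> z y * G [] y)"
  have HG: "H z = g z []" for z by (simp add: H_def g_def fun_eq_iff)
  have H: "sq_int (H z)" if "z \<in> Z" for z unfolding HG by (rule g[OF that]) simp
  have H0: "H z y = 0" if "y \<notin> \<Omega>" for z y using G(2)[of "[]" y] that by (simp add: H_def)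
  have Hexp: "integrable lborel (\<lambda>y. H z y * exp (v \<bullet> y + b))" if "z \<in> Z" for z v b
  proof -
    have "C_infinity (\<lambda>y. exp (v \<bullet> y + b))" by (rule C_infinity_compose[OF smooth_exp C_infinity_inner_affine])
    from L2_rep_smooth(1)[OF \<Omega> this] have "sq_int (\<lambda>y. indicator \<Omega> y * exp (v \<bullet> y + b))"
      by (simp add: L2_rep_def sq_int_def)
    from sq_int_integrable[OF H[OF that] this] show ?thesis
      by (rule Bochner_Integration.integrable_cong[THEN iffD1, rotated 2]) (use H0 in \<open>auto simp: indicator_def\<close>)
  qed
  have Hint: "integrable lborel (H z)" if "z \<in> Z" for z using Hexp[OF that, of 0 0] by simp
  define K where "K = (\<Sum>z\<in>Z. \<integral>y. \<bar>H z y\<bar> \<partial>lborel)"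
  have K: "K \<ge> 0" unfolding K_def by (intro sum_nonneg integral_nonneg_AE) auto
  have finO: "emeasure lborel \<Omega> < \<infinity>" using emeasure_bounded_finite[OF \<Omega>(2)] .
  define vol where "vol = measure lborel \<Omega>"
  have vol: "emeasure lborel \<Omega> = ennreal vol" "vol \<ge> 0"
    using finO by (auto simp: vol_def emeasure_eq_ennreal_measure)
  \<comment> \<open>Replacing the kernels changes the values by at most \<open>e2 * K\<close> on a
    set of volume \<open>vol\<close>; this choice limits the contribution to half of
    \<open>\<epsilon>\<close>, and the added ones keep the denominators positive.\<close>
  define e2 where "e2 = sqrt (\<epsilon> / (4 * (vol + 1))) / (K + 1)"
  have e2: "e2 > 0" using \<open>\<epsilon> > 0\<close> vol K by (simp add: e2_def)
  obtain R0 where R0: "\<And>x. x \<in> \<Omega> \<Longrightarrow> norm x \<le> R0" "R0 \<ge> 0"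
    using \<Omega>(2) bounded_iff by (metis bounded_pos less_imp_le)
  \<comment> \<open>Since \<open>H z\<close> vanishes outside \<Omega>, only differences of two
    points of \<Omega> occur as arguments of the kernel, and their coordinates are at most
    \<open>2 * R0\<close> in absolute value.\<close>
  have "\<forall>z. \<exists>L. \<forall>w y. length w \<le> 2 \<longrightarrow> (\<forall>i. \<bar>y $ i\<bar> \<le> 2 * R0) \<longrightarrow>
    \<bar>partials w (\<kappa> z) y - partials w (rcomb exp L) y\<bar> \<le> e2"
    unfolding \<kappa>f by (intro allI exp_dense_product fs e2) (use R0 in auto)
  then obtain L where L: "\<And>z w y. length w \<le> 2 \<Longrightarrow> (\<And>i. \<bar>y $ i\<bar> \<le> 2 * R0) \<Longrightarrow>
    \<bar>partials w (\<kappa> z) y - partials w (rcomb exp (L z)) y\<bar> \<le> e2" by metis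
  define CQ where "CQ = (\<lambda>z Q. \<forall>w x. partials w (rcomb exp Q) x = (-1) ^ length w * (\<integral>y. H z y * partials w (rcomb exp (L z)) (y - x) \<partial>lborel) \<and>
     integrable lborel (\<lambda>y. H z y * partials w (rcomb exp (L z)) (y - x)))"
  have "\<exists>Q. z \<in> Z \<longrightarrow> CQ z Q" for z
    unfolding CQ_def using convolution_rcomb_exp[OF Hexp] by blast
  then obtain Q where "\<And>z. z \<in> Z \<Longrightarrow> CQ z (Q z)" by metis
  note CQ = this[unfolded CQ_def, rule_format]
  have Q: "partials w (rcomb exp (Q z)) x = (-1) ^ length w * (\<integral>y. H z y * partials w (rcomb exp (L z)) (y - x) \<partial>lborel)"
     "integrable lborel (\<lambda>y. H z y * partials w (rcomb exp (L z)) (y - x))" if "z \<in> Z" for z w x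
    using CQ[OF that] by (rule conjunct1, rule conjunct2)
  obtain P where P: "\<And>w x. partials w (rcomb exp P) x = (\<Sum>z\<in>Z. partials w (rcomb exp (Q z)) x)"
    using partials_rcomb_sum[OF Z(1) smooth_exp, of Q] by blast
  have close: "\<bar>M z w x - partials w (rcomb exp (Q z)) x\<bar> \<le> e2 * (\<integral>y. \<bar>H z y\<bar> \<partial>lborel)"
    if z: "z \<in> Z" and w: "length w \<le> 2" and x: "x \<in> \<Omega>" for z w x
  proof -
    let ?k = "\<lambda>y. partials w (\<kappa> z) (y - x)" and ?l = "\<lambda>y. partials w (rcomb exp (L z)) (y - x)"
    have test: "test_function \<Omega> (\<lambda>y. partials v (\<theta> z) y * \<kappa> z (y - x))" for v
      by (rule localized_test_function[OF cone[OF z] x t(1,2) t(3)[OF z] C_infinity_partials[OF \<theta>(1)] _ \<kappa>(1) \<kappa>(4)])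
        (use \<theta>supp[OF z] in blast)
    have "(\<integral>y. (\<theta> z y * G [] y) * partials w (\<lambda>y. \<kappa> z (y - x)) y \<partial>lborel) =
      (-1) ^ length w * (\<integral>y. leibniz (\<theta> z) G w y * \<kappa> z (y - x) \<partial>lborel)"
      by (rule leibniz_weak_deriv[OF G(1) ibp \<theta>(1) C_infinity_translate[OF \<kappa>(1)] test w])
    then have "(\<integral>y. H z y * ?k y \<partial>lborel) = (-1) ^ length w * M z w x"
      unfolding partials_translate[OF \<kappa>(1)] H_def M_def g_def .
    then have Mx: "M z w x = (-1) ^ length w * (\<integral>y. H z y * ?k y \<partial>lborel)"
      by (simp flip: mult.assoc power_mult_distrib)
    have pt: "\<bar>H z y * ?k y - H z y * ?l y\<bar> \<le> e2 * \<bar>H z y\<bar>" for y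
    proof (cases "y \<in> \<Omega>")
      case True
      have "\<bar>(y - x) $ i\<bar> \<le> 2 * R0" for i
        using component_le_norm_cart[of "y - x" i] norm_triangle_ineq4[of y x] R0(1)[OF True] R0(1)[OF x] by linarith
      from L[OF w this] have "\<bar>H z y\<bar> * \<bar>?k y - ?l y\<bar> \<le> \<bar>H z y\<bar> * e2" by (intro mult_left_mono) auto
      then show ?thesis by (simp flip: abs_mult right_diff_distrib add: mult.commute)
    qed (simp add: H0)
    have Hm[measurable]: "H z \<in> borel_measurable borel" by (rule sq_intD(1)[OF H[OF z]])
    have km[measurable]: "partials w (\<kappa> z) \<in> borel_measurable borel" by (rule C_infinity_borel[OF C_infinity_partials[OF \<kappa>(1)]])
    have lm[measurable]: "partials w (rcomb exp (L z)) \<in> borel_measurable borel" by (rule C_infinity_borel[OF C_infinity_partials[OF C_infinity_rcomb[OF smooth_exp]]])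
    have bnd: "integrable lborel (\<lambda>y. e2 * \<bar>H z y\<bar>)" using Hint[OF z] by simp
    have di: "integrable lborel (\<lambda>y. H z y * ?k y - H z y * ?l y)"
      by (rule Bochner_Integration.integrable_bound[OF bnd]) (use pt e2 in \<open>auto simp: abs_mult intro!: AE_I2\<close>)
    have "M z w x - partials w (rcomb exp (Q z)) x = (-1) ^ length w * (\<integral>y. H z y * ?k y - H z y * ?l y \<partial>lborel)"
    proof -
      have "integrable lborel (\<lambda>y. H z y * ?k y)"
        using Bochner_Integration.integrable_add[OF di Q(2)[OF z, of w x]] by simp
      then show ?thesis unfolding Mx Q(1)[OF z]
        by (simp add: Bochner_Integration.integral_diff[OF _ Q(2)[OF z]] right_diff_distrib)
    qed
    then have "\<bar>M z w x - partials w (rcomb exp (Q z)) x\<bar> = \<bar>\<integral>y. H z y * ?k y - H z y * ?l y \<partial>lborel\<bar>"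
      by (simp add: abs_mult power_abs[symmetric])
    also have "\<dots> \<le> (\<integral>y. \<bar>H z y * ?k y - H z y * ?l y\<bar> \<partial>lborel)" by (rule integral_abs_bound)
    also have "\<dots> \<le> (\<integral>y. e2 * \<bar>H z y\<bar> \<partial>lborel)" using di bnd pt by (intro integral_mono) auto
    finally show ?thesis by simp
  qed
  show ?thesis
  proof (intro exI[of _ P] allI impI)
    fix w :: "'d list" assume w: "length w \<le> 2"
    let ?D = "\<lambda>x. \<Sum>z\<in>Z. ennreal (2 * n) * ennreal ((M z w x - g z w x)\<^sup>2)"
    \<comment> \<open>The error splits into the mollification errors, small in mean square, and the
      effect of replacing the kernels, small uniformly on \<Omega>.\<close>
    have pointwise: "ennreal ((G w x - partials w (rcomb exp P) x)\<^sup>2) * indicator \<Omega> x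
        \<le> ?D x + ennreal (2 * (e2 * K)\<^sup>2) * indicator \<Omega> x" for x
    proof (cases "x \<in> \<Omega>")
      case x: True
      define a where "a = (\<Sum>z\<in>Z. g z w x - M z w x)"
      define b where "b = (\<Sum>z\<in>Z. M z w x - partials w (rcomb exp (Q z)) x)"
      have "G w x = (\<Sum>z\<in>Z. g z w x)" unfolding g_def by (rule leibniz_partition[OF \<Omega>(1) \<theta>(1,3) x w, symmetric])
      then have ab: "G w x - partials w (rcomb exp P) x = a + b" unfolding P a_def b_def by (simp add: sum_subtractf)
      have "\<bar>b\<bar> \<le> (\<Sum>z\<in>Z. e2 * (\<integral>y. \<bar>H z y\<bar> \<partial>lborel))"
        unfolding b_def by (rule order_trans[OF sum_abs sum_mono[OF close[OF _ w x]]])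
      also have "\<dots> = e2 * K" by (simp add: K_def sum_distrib_left)
      finally have b: "b\<^sup>2 \<le> (e2 * K)\<^sup>2" using power_mono[of "\<bar>b\<bar>" "e2 * K" 2] by simp
      have "a\<^sup>2 \<le> (\<Sum>z\<in>Z. (g z w x - M z w x)\<^sup>2) * n"
        unfolding a_def n_def by (rule sum_squared_le_sum_of_squares)
      then have a: "a\<^sup>2 \<le> n * (\<Sum>z\<in>Z. (M z w x - g z w x)\<^sup>2)" by (simp add: power2_commute mult.commute)
      have "(a + b)\<^sup>2 \<le> 2 * a\<^sup>2 + 2 * b\<^sup>2" using sum_squares_bound[of a b] by (simp add: power2_sum)
      also have "\<dots> \<le> (\<Sum>z\<in>Z. 2 * n * (M z w x - g z w x)\<^sup>2) + 2 * (e2 * K)\<^sup>2"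
        using a b by (simp add: sum_distrib_left[symmetric] mult.assoc)
      finally have "ennreal ((a + b)\<^sup>2) \<le> ennreal ((\<Sum>z\<in>Z. 2 * n * (M z w x - g z w x)\<^sup>2) + 2 * (e2 * K)\<^sup>2)"
        by (rule ennreal_leI)
      also have "\<dots> = (\<Sum>z\<in>Z. ennreal (2 * n * (M z w x - g z w x)\<^sup>2)) + ennreal (2 * (e2 * K)\<^sup>2)"
        by (subst ennreal_plus) (auto simp: n_def intro!: sum_nonneg sum_ennreal[symmetric])
      also have "\<dots> = ?D x + ennreal (2 * (e2 * K)\<^sup>2)" by (simp add: ennreal_mult n_def)
      finally show ?thesis using x unfolding ab by simp
    qed simp
    have "(\<integral>\<^sup>+x. ennreal ((G w x - partials w (rcomb exp P) x)\<^sup>2) * indicator \<Omega> x \<partial>lborel)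
      \<le> (\<integral>\<^sup>+x. ?D x + ennreal (2 * (e2 * K)\<^sup>2) * indicator \<Omega> x \<partial>lborel)"
      by (intro nn_integral_mono pointwise)
    also have "\<dots> = (\<Sum>z\<in>Z. ennreal (2 * n) * (\<integral>\<^sup>+x. ennreal ((M z w x - g z w x)\<^sup>2) \<partial>lborel)) + ennreal (2 * (e2 * K)\<^sup>2) * emeasure lborel \<Omega>"
    proof -
      have m: "(\<lambda>x. ennreal ((M z w x - g z w x)\<^sup>2)) \<in> borel_measurable lborel" if "z \<in> Z" for z
        using Mm[OF that w] sq_intD(1)[OF g[OF that w]] by measurable
      show ?thesis
        using m by (subst nn_integral_add) (auto simp: nn_integral_sum nn_integral_cmult nn_integral_cmult_indicator)
    qed
    also have "\<dots> \<le> (\<Sum>z\<in>Z. ennreal (2 * n) * ennreal e1) + ennreal (2 * (e2 * K)\<^sup>2) * ennreal vol"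
      unfolding vol(1) by (intro add_mono sum_mono mult_left_mono M w) auto
    also have "\<dots> = ennreal (2 * n * n * e1 + 2 * (e2 * K)\<^sup>2 * vol)"
    proof -
      have "(\<Sum>z\<in>Z. ennreal (2 * n) * ennreal e1) = ennreal (2 * n * n * e1)"
        using e1 by (simp add: n_def ennreal_of_nat_eq_real_of_nat ennreal_mult''[symmetric] mult_ac)
      moreover have "ennreal (2 * (e2 * K)\<^sup>2) * ennreal vol = ennreal (2 * (e2 * K)\<^sup>2 * vol)"
        using vol(2) by (intro ennreal_mult''[symmetric])
      moreover have "0 \<le> 2 * n * n * e1" "0 \<le> 2 * (e2 * K)\<^sup>2 * vol" using e1 vol(2) by (auto simp: n_def)
      ultimately show ?thesis by (simp add: ennreal_plus)
    qed
    also have "\<dots> \<le> ennreal \<epsilon>"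
    proof (rule ennreal_leI)
      have nn: "n * n + 1 > 0" by (simp add: add_nonneg_pos)
      have q: "2 * a * (\<epsilon> / (4 * c)) = \<epsilon> / 2 * (a / c)" if "c > 0" for a c :: real
        using that by (simp add: field_simps)
      have "2 * n * n * e1 = \<epsilon> / 2 * (n * n / (n * n + 1))" using q[OF nn, of "n * n"] by (simp only: e1_def mult.assoc)
      also have "\<dots> \<le> \<epsilon> / 2 * 1" using nn \<open>\<epsilon> > 0\<close> by (intro mult_left_mono) auto
      finally have 1: "2 * n * n * e1 \<le> \<epsilon> / 2" by simp
      have "e2 * K \<le> e2 * (K + 1)" using e2 by simp
      also have "\<dots> = sqrt (\<epsilon> / (4 * (vol + 1)))" using K by (simp add: e2_def)
      finally have "(e2 * K)\<^sup>2 \<le> (sqrt (\<epsilon> / (4 * (vol + 1))))\<^sup>2" using e2 K by (intro power_mono) auto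
      also have "\<dots> = \<epsilon> / (4 * (vol + 1))" using \<open>\<epsilon> > 0\<close> vol(2) by simp
      finally have "2 * (e2 * K)\<^sup>2 * vol \<le> 2 * (\<epsilon> / (4 * (vol + 1))) * vol" using vol(2) by (intro mult_right_mono) auto
      also have "\<dots> = \<epsilon> / 2 * (vol / (vol + 1))" using q[of "vol + 1" vol] vol(2) by (simp only: mult_ac)
      also have "\<dots> \<le> \<epsilon> / 2 * 1" using vol(2) \<open>\<epsilon> > 0\<close> by (intro mult_left_mono) auto
      finally show "2 * n * n * e1 + 2 * (e2 * K)\<^sup>2 * vol \<le> \<epsilon>" using 1 by simp
    qed
    finally show "(\<integral>\<^sup>+x. ennreal ((G w x - partials w (rcomb exp P) x)\<^sup>2) * indicator \<Omega> x \<partial>lborel) \<le> ennreal \<epsilon>" .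
  qed
qed

subsection \<open>The embedding into bounded functions\<close>

definition sobolev_energy :: "nat \<Rightarrow> (real^'d::finite) set \<Rightarrow> (real^'d \<Rightarrow> real) \<Rightarrow> ennreal" where
  "sobolev_energy k \<Omega> v =
     (\<Sum>w\<in>{w. length w \<le> k}. \<integral>\<^sup>+y. ennreal ((partials w v y)\<^sup>2) * indicator \<Omega> y \<partial>lborel)"

lemma nn_integral_lborel_scale:
  fixes F :: "'a::euclidean_space \<Rightarrow> ennreal"
  assumes [measurable]: "F \<in> borel_measurable borel" and c: "c > 0"
  shows "(\<integral>\<^sup>+k. F (x + c *\<^sub>R k) \<partial>lborel) * ennreal (c ^ DIM('a)) = (\<integral>\<^sup>+y. F y \<partial>lborel)"
proof -
  have "(\<integral>\<^sup>+y. F y \<partial>lborel) = (\<integral>\<^sup>+y. F y \<partial>density (distr lborel borel (\<lambda>k. x + c *\<^sub>R k)) (\<lambda>_. \<bar>c\<bar> ^ DIM('a)))"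
    using c by (subst lborel_affine[of c x]) auto
  also have "\<dots> = (\<integral>\<^sup>+k. ennreal (c ^ DIM('a)) * F (x + c *\<^sub>R k) \<partial>lborel)"
    using c by (subst nn_integral_density) (auto simp: nn_integral_distr)
  also have "\<dots> = ennreal (c ^ DIM('a)) * (\<integral>\<^sup>+k. F (x + c *\<^sub>R k) \<partial>lborel)" by (rule nn_integral_cmult) measurable
  finally show ?thesis by (simp add: mult.commute)
qed

lemma sum_words_bounds:
  fixes f :: "'d::finite list \<Rightarrow> real"
  assumes "\<And>w. f w \<ge> 0"
  shows "f [] \<le> (\<Sum>w\<in>{w. length w \<le> 2}. f w)" "(\<Sum>i\<in>UNIV. f [i]) \<le> (\<Sum>w\<in>{w. length w \<le> 2}. f w)"
    "(\<Sum>i\<in>UNIV. \<Sum>j\<in>UNIV. f [j, i]) \<le> (\<Sum>w\<in>{w. length w \<le> 2}. f w)"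
proof -
  show "f [] \<le> (\<Sum>w\<in>{w. length w \<le> 2}. f w)" using assms by (intro member_le_sum finite_words) auto
  have "(\<Sum>i\<in>UNIV. f [i]) = (\<Sum>w\<in>range (\<lambda>i. [i]). f w)" by (subst sum.reindex) (auto simp: inj_on_def)
  also have "\<dots> \<le> (\<Sum>w\<in>{w. length w \<le> 2}. f w)" using assms by (intro sum_mono2 finite_words) auto
  finally show "(\<Sum>i\<in>UNIV. f [i]) \<le> (\<Sum>w\<in>{w. length w \<le> 2}. f w)" .
  have "(\<Sum>i\<in>UNIV. \<Sum>j\<in>UNIV. f [j, i]) = (\<Sum>p\<in>UNIV. f [snd p, fst p])"
    by (simp add: sum.cartesian_product split_def)
  also have "\<dots> = (\<Sum>w\<in>range (\<lambda>p. [snd p, fst p]). f w)" by (subst sum.reindex) (auto simp: inj_on_def prod_eq_iff)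
  also have "\<dots> \<le> (\<Sum>w\<in>{w. length w \<le> 2}. f w)" using assms by (intro sum_mono2 finite_words) auto
  finally show "(\<Sum>i\<in>UNIV. \<Sum>j\<in>UNIV. f [j, i]) \<le> (\<Sum>w\<in>{w. length w \<le> 2}. f w)" .
qed

lemma sum_vec_sq_le:
  fixes k :: "real^'d::finite"
  shows "(\<Sum>i\<in>UNIV. k $ i * a i)\<^sup>2 \<le> (norm k)\<^sup>2 * (\<Sum>i\<in>UNIV. (a i)\<^sup>2)"
proof -
  have "(\<Sum>i\<in>UNIV. k $ i * a i)\<^sup>2 \<le> (\<Sum>i\<in>UNIV. (k $ i)\<^sup>2) * (\<Sum>i\<in>UNIV. (a i)\<^sup>2)"
    by (rule Cauchy_Schwarz_ineq_sum)
  also have "(\<Sum>i\<in>UNIV. (k $ i)\<^sup>2) = (norm k)\<^sup>2" by (simp add: norm_vec_def L2_set_def sum_nonneg)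
  finally show ?thesis .
qed

lemma square_integral_unit_interval:
  fixes h :: "real \<Rightarrow> real"
  assumes h: "continuous_on UNIV h"
  shows "ennreal ((\<integral>s. h s * indicator {0..1} s \<partial>lborel)\<^sup>2) \<le> (\<integral>\<^sup>+s. ennreal ((h s)\<^sup>2) * indicator {0..1} s \<partial>lborel)"
proof -
  have [measurable]: "h \<in> borel_measurable borel" using h by (rule borel_measurable_continuous_onI)
  have int: "integrable lborel (\<lambda>s. h s * indicator {0..1} s)"
    using borel_integrable_compact[of "{0..1::real}" h] continuous_on_subset[OF h] by (simp add: mult.commute)
  have "ennreal ((\<integral>s. h s * indicator {0..1} s \<partial>lborel)\<^sup>2) = (ennreal (norm (\<integral>s. h s * indicator {0..1} s \<partial>lborel)))\<^sup>2"
    by (simp add: ennreal_power)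
  also have "\<dots> \<le> (\<integral>\<^sup>+s. ennreal (norm (h s * indicator {0..1} s)) \<partial>lborel)\<^sup>2"
    by (intro power_mono integral_norm_bound_ennreal int) auto
  also have "\<dots> = (\<integral>\<^sup>+s. ennreal (\<bar>h s\<bar> * indicator {0..1} s) * indicator {0..1} s \<partial>lborel)\<^sup>2"
    by (intro arg_cong2[where f=power] nn_integral_cong refl) (auto simp: indicator_def)
  also have "\<dots> \<le> (\<integral>\<^sup>+s. (ennreal (\<bar>h s\<bar> * indicator {0..1} s))\<^sup>2 \<partial>lborel) * (\<integral>\<^sup>+s. (indicator {0..1::real} s)\<^sup>2 \<partial>lborel)"
    by (rule Cauchy_Schwarz_nn_integral) measurable
  also have "(\<integral>\<^sup>+s. (indicator {0..1::real} s :: ennreal)\<^sup>2 \<partial>lborel) = (\<integral>\<^sup>+s. indicator {0..1::real} s \<partial>lborel)"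
    by (intro nn_integral_cong) (auto simp: indicator_def)
  also have "\<dots> = 1" by simp
  also have "(\<integral>\<^sup>+s. (ennreal (\<bar>h s\<bar> * indicator {0..1} s))\<^sup>2 \<partial>lborel) = (\<integral>\<^sup>+s. ennreal ((h s)\<^sup>2) * indicator {0..1} s \<partial>lborel)"
    by (intro nn_integral_cong) (auto simp: indicator_def ennreal_power)
  finally show ?thesis by simp
qed

text \<open>Taylor's formula on the segment from \<open>x + k\<close> to \<open>x\<close>, with the parameter \<open>t = s\<^sup>2\<close> so that the
  weight \<open>s ^ 6\<close> absorbs the Jacobian of \<open>k \<mapsto> x + s\<^sup>2 k\<close> in dimension at most three.\<close>

lemma pointwise_sobolev:
  fixes v :: "real^'d::finite \<Rightarrow> real"
  assumes v: "C_infinity v" and R: "norm k \<le> R"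
  defines "N \<equiv> \<lambda>y. \<Sum>w\<in>{w. length w \<le> 2}. (partials w v y)\<^sup>2"
  shows "ennreal ((v x)\<^sup>2) \<le> ennreal (3 * (1 + R\<^sup>2)) * ennreal (N (x + k)) +
    ennreal (12 * R ^ 4) * (\<integral>\<^sup>+s. ennreal (s ^ 6) * ennreal (N (x + s\<^sup>2 *\<^sub>R k)) * indicator {0..1} s \<partial>lborel)"
proof -
  have R0: "R \<ge> 0" using R norm_ge_zero order_trans by blast
  define g0 where "g0 = (\<lambda>t. v (x + t *\<^sub>R k))"
  define D1 where "D1 = (\<lambda>y. \<Sum>i\<in>UNIV. k $ i * partials [i] v y)"
  define D2 where "D2 = (\<lambda>y. \<Sum>i\<in>UNIV. k $ i * (\<Sum>j\<in>UNIV. k $ j * partials [j, i] v y))"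
  define g1 where "g1 = (\<lambda>t. D1 (x + t *\<^sub>R k))"
  define g2 where "g2 = (\<lambda>t. D2 (x + t *\<^sub>R k))"
  have N0: "N y \<ge> 0" for y unfolding N_def by (intro sum_nonneg) auto
  have D1b: "(D1 y)\<^sup>2 \<le> R\<^sup>2 * N y" for y
  proof -
    have "(D1 y)\<^sup>2 \<le> (norm k)\<^sup>2 * (\<Sum>i\<in>UNIV. (partials [i] v y)\<^sup>2)" unfolding D1_def by (rule sum_vec_sq_le)
    also have "\<dots> \<le> R\<^sup>2 * N y" unfolding N_def using R sum_words_bounds(2)[of "\<lambda>w. (partials w v y)\<^sup>2"]
      by (intro mult_mono power_mono) (auto intro: sum_nonneg)
    finally show ?thesis .
  qed
  have D2b: "(D2 y)\<^sup>2 \<le> R ^ 4 * N y" for y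
  proof -
    have "(D2 y)\<^sup>2 \<le> (norm k)\<^sup>2 * (\<Sum>i\<in>UNIV. (\<Sum>j\<in>UNIV. k $ j * partials [j, i] v y)\<^sup>2)" unfolding D2_def by (rule sum_vec_sq_le)
    also have "\<dots> \<le> (norm k)\<^sup>2 * (\<Sum>i\<in>UNIV. (norm k)\<^sup>2 * (\<Sum>j\<in>UNIV. (partials [j, i] v y)\<^sup>2))"
      by (intro mult_left_mono sum_mono sum_vec_sq_le) auto
    also have "\<dots> = (norm k) ^ 4 * (\<Sum>i\<in>UNIV. \<Sum>j\<in>UNIV. (partials [j, i] v y)\<^sup>2)"
      by (simp add: sum_distrib_left power_numeral_reduce mult_ac)
    also have "\<dots> \<le> R ^ 4 * N y" unfolding N_def using R sum_words_bounds(3)[of "\<lambda>w. (partials w v y)\<^sup>2"]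
      by (intro mult_mono power_mono) (auto intro!: sum_nonneg)
    finally show ?thesis .
  qed
  have d0: "(g0 has_real_derivative g1 t) (at t)" for t
    unfolding g0_def g1_def D1_def using DERIV_line[OF v, of x k t] by simp
  have d1: "(g1 has_real_derivative g2 t) (at t)" for t
    unfolding g1_def g2_def D1_def D2_def
  proof (intro DERIV_sum DERIV_cmult)
    fix i
    show "((\<lambda>t. partials [i] v (x + t *\<^sub>R k)) has_real_derivative (\<Sum>j\<in>UNIV. k $ j * partials [j, i] v (x + t *\<^sub>R k))) (at t)"
      using DERIV_line[OF C_infinity_partials[OF v, of "[i]"], of x k t] by simp
  qed
  have cg2: "continuous_on UNIV g2"
    unfolding g2_def D2_def
    by (intro continuous_intros continuous_on_compose2[OF C_infinity_continuous[OF C_infinity_partials[OF v], of UNIV]]) auto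
  \<comment> \<open>The function \<open>s\<^sup>2 * g1 (s\<^sup>2) - g0 (s\<^sup>2)\<close> is a
    primitive of \<open>h\<close>. This is Taylor's remainder \<open>t * g2 t\<close> after the
    substitution \<open>t = s\<^sup>2\<close>; squaring \<open>h\<close> produces the factor
    \<open>4 * s ^ 6\<close>.\<close>
  define h where "h = (\<lambda>s. 2 * s ^ 3 * g2 (s\<^sup>2))"
  have ch: "continuous_on UNIV h" unfolding h_def
    by (intro continuous_intros continuous_on_compose2[OF cg2]) auto
  have sq: "((\<lambda>s::real. s\<^sup>2) has_real_derivative 2 * s) (at s)" for s by (auto intro!: derivative_eq_intros)
  have dPhi: "((\<lambda>s. s\<^sup>2 * g1 (s\<^sup>2) - g0 (s\<^sup>2)) has_real_derivative h s) (at s)" for s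
    by (rule DERIV_cong[OF DERIV_diff[OF DERIV_mult[OF sq DERIV_chain2[OF d1 sq]] DERIV_chain2[OF d0 sq]]])
       (simp add: h_def power2_eq_square power3_eq_cube algebra_simps)
  have "(\<integral>s. h s * indicator {0..1} s \<partial>lborel) = (1\<^sup>2 * g1 (1\<^sup>2) - g0 (1\<^sup>2)) - (0\<^sup>2 * g1 (0\<^sup>2) - g0 (0\<^sup>2))"
    by (rule integral_FTC_Icc_real) (use dPhi ch in \<open>auto simp: continuous_on_eq_continuous_at\<close>)
  then have vx: "v x = (\<integral>s. h s * indicator {0..1} s \<partial>lborel) + v (x + k) + - D1 (x + k)"
    by (simp add: g0_def g1_def)
  have three: "(a + b + c)\<^sup>2 \<le> 3 * a\<^sup>2 + 3 * b\<^sup>2 + 3 * c\<^sup>2" for a b c :: real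
    using sum_squares_bound[of a b] sum_squares_bound[of a c] sum_squares_bound[of b c]
    by (simp add: power2_eq_square algebra_simps)
  let ?I = "\<integral>s. h s * indicator {0..1} s \<partial>lborel"
  have "(v x)\<^sup>2 \<le> 3 * ?I\<^sup>2 + 3 * (v (x + k))\<^sup>2 + 3 * (D1 (x + k))\<^sup>2" using three[of ?I "v (x + k)" "- D1 (x + k)"] vx by simp
  also have "\<dots> \<le> 3 * ?I\<^sup>2 + 3 * (1 + R\<^sup>2) * N (x + k)"
    using D1b[of "x + k"] sum_words_bounds(1)[of "\<lambda>w. (partials w v (x + k))\<^sup>2"] by (simp add: N_def distrib_right)
  finally have "ennreal ((v x)\<^sup>2) \<le> ennreal (3 * ?I\<^sup>2 + 3 * (1 + R\<^sup>2) * N (x + k))" by (rule ennreal_leI)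
  also have "\<dots> = ennreal (3 * (1 + R\<^sup>2)) * ennreal (N (x + k)) + 3 * ennreal (?I\<^sup>2)"
    using N0 by (simp add: ennreal_plus ennreal_mult'' add.commute)
  finally have fin: "ennreal ((v x)\<^sup>2) \<le> ennreal (3 * (1 + R\<^sup>2)) * ennreal (N (x + k)) + 3 * ennreal (?I\<^sup>2)" .
  have "ennreal (?I\<^sup>2) \<le> (\<integral>\<^sup>+s. ennreal ((h s)\<^sup>2) * indicator {0..1} s \<partial>lborel)"
    by (rule square_integral_unit_interval[OF ch])
  also have "\<dots> \<le>
    (\<integral>\<^sup>+s. ennreal (4 * R ^ 4) * (ennreal (s ^ 6) * ennreal (N (x + s\<^sup>2 *\<^sub>R k)) * indicator {0..1} s) \<partial>lborel)"
  proof (rule nn_integral_mono)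
    fix s :: real
    have "(h s)\<^sup>2 = 4 * s ^ 6 * (D2 (x + s\<^sup>2 *\<^sub>R k))\<^sup>2"
      by (simp add: h_def g2_def power_mult_distrib flip: power_mult)
    also have "\<dots> \<le> 4 * s ^ 6 * (R ^ 4 * N (x + s\<^sup>2 *\<^sub>R k))" by (intro mult_left_mono D2b) simp
    finally have "ennreal ((h s)\<^sup>2) \<le> ennreal (4 * R ^ 4 * (s ^ 6 * N (x + s\<^sup>2 *\<^sub>R k)))"
      by (intro ennreal_leI) (simp add: mult_ac)
    also have "\<dots> = ennreal (4 * R ^ 4) * (ennreal (s ^ 6) * ennreal (N (x + s\<^sup>2 *\<^sub>R k)))"
      using N0 R0 by (simp add: ennreal_mult)
    finally show "ennreal ((h s)\<^sup>2) * indicator {0..1} s \<le> ennreal (4 * R ^ 4) * (ennreal (s ^ 6) * ennreal (N (x + s\<^sup>2 *\<^sub>R k)) * indicator {0..1} s)"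
      by (auto simp: indicator_def)
  qed
  also have "\<dots> = ennreal (4 * R ^ 4) * (\<integral>\<^sup>+s. ennreal (s ^ 6) * ennreal (N (x + s\<^sup>2 *\<^sub>R k)) * indicator {0..1} s \<partial>lborel)"
  proof (rule nn_integral_cmult)
    have "continuous_on UNIV N"
      unfolding N_def by (intro continuous_intros C_infinity_continuous C_infinity_partials v)
    then have [measurable]: "N \<in> borel_measurable borel" by (rule borel_measurable_continuous_onI)
    show "(\<lambda>s. ennreal (s ^ 6) * ennreal (N (x + s\<^sup>2 *\<^sub>R k)) * indicator {0..1} s) \<in> borel_measurable lborel" by measurable
  qed
  finally have "3 * ennreal (?I\<^sup>2) \<le> 3 * (ennreal (4 * R ^ 4) * (\<integral>\<^sup>+s. ennreal (s ^ 6) * ennreal (N (x + s\<^sup>2 *\<^sub>R k)) * indicator {0..1} s \<partial>lborel))"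
    by (rule mult_left_mono) simp
  also have "\<dots> = ennreal (12 * R ^ 4) * (\<integral>\<^sup>+s. ennreal (s ^ 6) * ennreal (N (x + s\<^sup>2 *\<^sub>R k)) * indicator {0..1} s \<partial>lborel)"
  proof -
    have "3 * ennreal (4 * R ^ 4) = ennreal (12 * R ^ 4)"
      using ennreal_mult[of 3 "4 * R ^ 4"] by simp
    then show ?thesis by (simp only: mult.assoc[symmetric])
  qed
  finally show ?thesis by (rule order_trans[OF fin add_left_mono])
qed

text \<open>After the pointwise estimate is integrated over the directions \<open>k\<close> in the
  ball \<open>?K\<close>, the substitution for fixed \<open>s\<close> leads to an integral over a
  subset of \<Omega>, bounded by the energy uniformly in \<open>s\<close>. The constant involves
  only the reach \<open>R\<close> of the cones and the volume \<open>B\<close> of their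
  balls.\<close>

theorem sobolev_sup_bound:
  fixes \<Omega> :: "(real^'d::finite) set"
  assumes \<Omega>: "open \<Omega>" and cover: "cone_cover \<Omega> Z r e \<rho>" and dim: "CARD('d) \<le> 3"
  shows "\<exists>C\<ge>0. \<forall>v. C_infinity v \<longrightarrow> (\<forall>x\<in>\<Omega>. ennreal ((v x)\<^sup>2) \<le> ennreal C * sobolev_energy 2 \<Omega> v)"
proof -
  have Z: "finite Z" "closure \<Omega> \<subseteq> (\<Union>z\<in>Z. ball z (r z))" "\<rho> > 0"
    and cone: "\<And>z. z \<in> Z \<Longrightarrow> cone_at \<Omega> z (r z) (e z) \<rho>"
    using cover by (auto simp: cone_cover_def)
  have [measurable]: "\<Omega> \<in> sets borel" using \<Omega> by simp
  define R where "R = (\<Sum>z\<in>Z. norm (e z)) + \<rho>"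
  have eR: "norm (e z) + \<rho> \<le> R" if "z \<in> Z" for z
    unfolding R_def using Z(1) that by (intro add_right_mono member_le_sum) auto
  define B where "B = measure lborel (ball (0::real^'d) \<rho>)"
  have B: "emeasure lborel (ball (c::real^'d) \<rho>) = ennreal B" for c
    using Z(3) by (simp add: B_def emeasure_ball content_ball)
  have B0: "B > 0" using Z(3) by (simp add: B_def content_ball)
  define C where "C = (3 * (1 + R\<^sup>2) + 12 * R ^ 4) / B"
  show ?thesis
  proof (intro exI[of _ C] conjI allI impI ballI)
    show "C \<ge> 0" using B0 by (simp add: C_def)
    fix v :: "real^'d \<Rightarrow> real" and x assume v: "C_infinity v" and x: "x \<in> \<Omega>"
    define N where "N = (\<lambda>y. \<Sum>w\<in>{w. length w \<le> 2}. (partials w v y)\<^sup>2)"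
    have "continuous_on UNIV N"
      unfolding N_def by (intro continuous_intros C_infinity_continuous C_infinity_partials v)
    then have [measurable]: "N \<in> borel_measurable borel" by (rule borel_measurable_continuous_onI)
    define S where "S = (\<integral>\<^sup>+y. ennreal (N y) * indicator \<Omega> y \<partial>lborel)"
    have S: "S = sobolev_energy 2 \<Omega> v"
    proof -
      have [measurable]: "partials w v \<in> borel_measurable borel" for w by (intro C_infinity_borel C_infinity_partials v)
      have "S = (\<integral>\<^sup>+y. (\<Sum>w\<in>{w. length w \<le> 2}. ennreal ((partials w v y)\<^sup>2) * indicator \<Omega> y) \<partial>lborel)"
        unfolding S_def N_def by (subst sum_ennreal[symmetric]) (auto simp only: zero_le_power2 sum_distrib_right)
      also have "\<dots> = sobolev_energy 2 \<Omega> v" unfolding sobolev_energy_def by (rule nn_integral_sum) measurable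
      finally show ?thesis .
    qed
    obtain z where z: "z \<in> Z" "dist z x < r z" using Z(2) x closure_subset by force
    have rz: "r z > 0" using cone[OF z(1)] by (simp add: cone_at_def)
    let ?K = "ball (e z) \<rho>"
    have K\<Omega>: "x + t *\<^sub>R k \<in> \<Omega>" if "k \<in> ?K" "0 < t" "t \<le> 1" for k t
      using cone_atD[OF cone[OF z(1)], of x t "k - e z"] that x z(2) rz closure_subset
      by (auto simp: dist_norm norm_minus_commute)
    have KR: "norm k \<le> R" if "k \<in> ?K" for k
      using that eR[OF z(1)] norm_triangle_sub[of k "e z"] by (simp add: dist_norm norm_minus_commute)
    have [measurable]: "?K \<in> sets borel" by simp
    define T where "T = (\<lambda>k s. ennreal (s ^ 6) * ennreal (N (x + s\<^sup>2 *\<^sub>R k)) * indicator {0..1::real} s * indicator ?K k)"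
    have Tm[measurable]: "(\<lambda>(k, s). T k s) \<in> borel_measurable (lborel \<Otimes>\<^sub>M lborel)"
      unfolding T_def by measurable
    have "ennreal B * ennreal ((v x)\<^sup>2) = (\<integral>\<^sup>+k. ennreal ((v x)\<^sup>2) * indicator ?K k \<partial>lborel)"
      by (subst nn_integral_cmult_indicator) (auto simp: B mult.commute)
    also have "\<dots> \<le> (\<integral>\<^sup>+k. ennreal (3 * (1 + R\<^sup>2)) * (ennreal (N (k + x)) * indicator \<Omega> (k + x)) + ennreal (12 * R ^ 4) * (\<integral>\<^sup>+s. T k s \<partial>lborel) \<partial>lborel)"
    proof (rule nn_integral_mono)
      fix k
      show "ennreal ((v x)\<^sup>2) * indicator ?K k \<le> ennreal (3 * (1 + R\<^sup>2)) * (ennreal (N (k + x)) * indicator \<Omega> (k + x)) + ennreal (12 * R ^ 4) * (\<integral>\<^sup>+s. T k s \<partial>lborel)"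
      proof (cases "k \<in> ?K")
        case True
        have "x + k \<in> \<Omega>" using K\<Omega>[OF True, of 1] by simp
        then show ?thesis
          using pointwise_sobolev[OF v KR[OF True], of x] True by (simp add: T_def N_def add.commute[of k x])
      qed simp
    qed
    also have "\<dots> = ennreal (3 * (1 + R\<^sup>2)) * (\<integral>\<^sup>+k. ennreal (N (k + x)) * indicator \<Omega> (k + x) \<partial>lborel)
        + ennreal (12 * R ^ 4) * (\<integral>\<^sup>+k. \<integral>\<^sup>+s. T k s \<partial>lborel \<partial>lborel)"
      by (subst nn_integral_add) (auto simp: nn_integral_cmult)
    also have "(\<integral>\<^sup>+k. ennreal (N (k + x)) * indicator \<Omega> (k + x) \<partial>lborel) = S"
      unfolding S_def by (rule nn_integral_lborel_shift) measurable
    also have "(\<integral>\<^sup>+k. \<integral>\<^sup>+s. T k s \<partial>lborel \<partial>lborel) = (\<integral>\<^sup>+s. \<integral>\<^sup>+k. T k s \<partial>lborel \<partial>lborel)"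
      by (rule lborel_pair.Fubini'[symmetric]) measurable
    also have "\<dots> \<le> (\<integral>\<^sup>+s. S * indicator {0..1::real} s \<partial>lborel)"
    proof (rule nn_integral_mono)
      fix s :: real
      show "(\<integral>\<^sup>+k. T k s \<partial>lborel) \<le> S * indicator {0..1} s"
      proof (cases "0 < s \<and> s \<le> 1")
        case True
        then have s2: "0 < s\<^sup>2" "s\<^sup>2 \<le> 1" by (auto simp: power_le_one)
        have "(\<integral>\<^sup>+k. T k s \<partial>lborel) \<le> (\<integral>\<^sup>+k. ennreal (s ^ 6) * (ennreal (N (x + s\<^sup>2 *\<^sub>R k)) * indicator \<Omega> (x + s\<^sup>2 *\<^sub>R k)) \<partial>lborel)"
          using K\<Omega>[OF _ s2] by (intro nn_integral_mono) (auto simp: T_def indicator_def)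
        also have "\<dots> = ennreal (s ^ 6) * (\<integral>\<^sup>+k. ennreal (N (x + s\<^sup>2 *\<^sub>R k)) * indicator \<Omega> (x + s\<^sup>2 *\<^sub>R k) \<partial>lborel)"
          by (rule nn_integral_cmult) measurable
        also have "\<dots> \<le> ennreal ((s\<^sup>2) ^ CARD('d)) * (\<integral>\<^sup>+k. ennreal (N (x + s\<^sup>2 *\<^sub>R k)) * indicator \<Omega> (x + s\<^sup>2 *\<^sub>R k) \<partial>lborel)"
        proof (intro mult_right_mono ennreal_leI)
          have "s ^ 6 = (s\<^sup>2) ^ 3" by (simp flip: power_mult)
          also have "\<dots> \<le> (s\<^sup>2) ^ CARD('d)" using s2 dim by (intro power_decreasing) auto
          finally show "s ^ 6 \<le> (s\<^sup>2) ^ CARD('d)" .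
        qed simp
        also have "\<dots> = S"
          using nn_integral_lborel_scale[of "\<lambda>y. ennreal (N y) * indicator \<Omega> y" "s\<^sup>2" x] s2
          by (simp add: S_def mult.commute)
        finally show ?thesis using True by simp
      next
        case False
        then have "T k s = 0" for k by (cases "s = 0") (auto simp: T_def indicator_def)
        then show ?thesis by simp
      qed
    qed
    also have "\<dots> = S" by (simp add: nn_integral_cmult_indicator)
    finally have "ennreal B * ennreal ((v x)\<^sup>2) \<le> ennreal (3 * (1 + R\<^sup>2)) * S + ennreal (12 * R ^ 4) * S"
      by (simp add: add_left_mono mult_left_mono)
    also have "\<dots> = ennreal (3 * (1 + R\<^sup>2) + 12 * R ^ 4) * S"
      by (subst ennreal_plus) (auto simp: distrib_right)
    finally have "ennreal (1 / B) * (ennreal B * ennreal ((v x)\<^sup>2)) \<le> ennreal (1 / B) * (ennreal (3 * (1 + R\<^sup>2) + 12 * R ^ 4) * S)"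
      by (rule mult_left_mono) simp
    moreover have q: "ennreal (1 / B) * (ennreal q * Y) = ennreal (q / B) * Y" if "q \<ge> 0" for q Y
      using B0 that by (simp flip: ennreal_mult mult.assoc)
    have "ennreal (1 / B) * (ennreal B * ennreal ((v x)\<^sup>2)) = ennreal ((v x)\<^sup>2)"
      using B0 by (subst q) auto
    moreover have "ennreal (1 / B) * (ennreal (3 * (1 + R\<^sup>2) + 12 * R ^ 4) * S) = ennreal C * S"
      unfolding C_def by (rule q) simp
    ultimately show "ennreal ((v x)\<^sup>2) \<le> ennreal C * sobolev_energy 2 \<Omega> v" by (simp add: S)
  qed
qed

subsection \<open>Tubes over a separated subset of the boundary\<close>

definition separated :: "real \<Rightarrow> 'a::metric_space set \<Rightarrow> bool" where
  "separated \<eta> X \<longleftrightarrow> (\<forall>x\<in>X. \<forall>y\<in>X. x \<noteq> y \<longrightarrow> \<eta> \<le> dist x y)"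

lemma emeasure_lborel_ball:
  fixes c :: "'a::euclidean_space"
  assumes "r \<ge> 0"
  shows "emeasure lborel (ball c r) = ennreal (unit_ball_vol DIM('a) * r ^ DIM('a))"
  using assms emeasure_ball[of r c] by (simp add: unit_ball_vol_nonneg)

text \<open>If \<open>norm e < \<rho>\<close>, the deviation \<open>b = - e\<close> would be allowed
  and the cone would place \<open>x\<close> itself in \<Omega>. Hence the direction is nonzero on
  patches that meet the boundary.\<close>

lemma boundary_cone_norm:
  assumes \<Omega>: "open \<Omega>" and c: "cone_at \<Omega> z r e \<rho>" and x: "x \<in> frontier \<Omega>" "dist z x < r"
  shows "\<rho> \<le> norm e"
proof (rule ccontr)
  assume "\<not> \<rho> \<le> norm e"
  moreover have "x \<in> closure \<Omega>" "x \<notin> \<Omega>" using x \<Omega> by (auto simp: frontier_def interior_open)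
  moreover have "0 < r" using c by (simp add: cone_at_def)
  ultimately show False using cone_atD[OF c, of x 1 "- e"] x by simp
qed

text \<open>If the two points on the axes were closer, \<open>x\<close> would nearly equal
  \<open>x' + \<tau> *\<^sub>R e\<close> with \<open>\<tau> = s' - s\<close>. As \<open>x\<close> is
  outside \<Omega>, it is not in the cone at \<open>x'\<close>, so the deviation is at least
  \<open>\<rho> * \<tau>\<close>. This makes \<open>\<tau>\<close> small and contradicts the
  distance \<open>\<eta>\<close> of the base points; the factor is chosen to satisfy
  \<open>k * (\<rho> + norm e) = \<rho> / 2\<close>.\<close>

lemma tube_separation_le:
  assumes \<Omega>: "open \<Omega>" and c: "cone_at \<Omega> z r e \<rho>"
    and x: "x \<in> frontier \<Omega>" "dist z x < r" and x': "x' \<in> frontier \<Omega>" "dist z x' < r"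
    and \<eta>: "\<eta> \<le> dist x x'" "0 < \<eta>" and s: "0 \<le> s" "s \<le> s'" "s' \<le> 1"
  shows "\<rho> / (2 * (\<rho> + norm e)) * \<eta> \<le> dist (x + s *\<^sub>R e) (x' + s' *\<^sub>R e)"
proof (rule ccontr)
  define \<tau> where "\<tau> = s' - s"
  define k where "k = \<rho> / (2 * (\<rho> + norm e))"
  have r: "0 < r" "0 < \<rho>" using c by (auto simp: cone_at_def)
  have k: "0 < k" "k \<le> 1 / 2" using r by (auto simp: k_def field_simps add_pos_nonneg)
  have kk: "k * (\<rho> + norm e) = \<rho> / 2"
  proof -
    have "\<rho> / (2 * m) * m = \<rho> / 2" if "m > 0" for m using that by simp
    from this[of "\<rho> + norm e"] show ?thesis unfolding k_def using r by (simp only: add_pos_nonneg norm_ge_zero)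
  qed
  assume "\<not> ?thesis"
  then have n: "norm (x - x' - \<tau> *\<^sub>R e) < k * \<eta>" by (simp add: k_def \<tau>_def dist_norm algebra_simps)
  have x'c: "x' \<in> closure \<Omega>" and xo: "x \<notin> \<Omega>" using x x' \<Omega> by (auto simp: frontier_def interior_open)
  have "\<rho> * \<tau> \<le> norm (x - x' - \<tau> *\<^sub>R e)"
  proof (cases "\<tau> = 0")
    case False
    then have \<tau>: "0 < \<tau>" "\<tau> \<le> 1" using s by (auto simp: \<tau>_def)
    define b where "b = (1 / \<tau>) *\<^sub>R (x - x' - \<tau> *\<^sub>R e)"
    have "x = x' + \<tau> *\<^sub>R (e + b)" using \<tau> by (simp add: b_def algebra_simps)
    then have "\<not> norm b < \<rho>" using cone_atD[OF c x'c _ \<tau>, of b] x'(2) r xo by auto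
    moreover have "norm b = norm (x - x' - \<tau> *\<^sub>R e) / \<tau>" unfolding b_def norm_scaleR using \<tau> by simp
    ultimately show ?thesis using \<tau> by (simp add: field_simps)
  qed simp
  then have \<tau>\<rho>: "\<rho> * \<tau> \<le> k * \<eta>" using n by simp
  have \<tau>0: "0 \<le> \<tau>" using s by (simp add: \<tau>_def)
  have "\<eta> \<le> norm (x - x')" using \<eta> by (simp add: dist_norm)
  also have "\<dots> \<le> norm (x - x' - \<tau> *\<^sub>R e) + norm (\<tau> *\<^sub>R e)"
    using norm_triangle_ineq[of "x - x' - \<tau> *\<^sub>R e" "\<tau> *\<^sub>R e"] by simp
  also have "\<dots> < k * \<eta> + \<tau> * norm e" using n \<tau>0 by simp
  finally have "\<rho> * \<eta> < \<rho> * (k * \<eta> + \<tau> * norm e)" using r by (intro mult_strict_left_mono)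
  also have "\<dots> = \<rho> * (k * \<eta>) + (\<rho> * \<tau>) * norm e" by (simp add: algebra_simps)
  also have "\<dots> \<le> \<rho> * (k * \<eta>) + (k * \<eta>) * norm e" using \<tau>\<rho> by (intro add_left_mono mult_right_mono) auto
  also have "\<dots> = (k * (\<rho> + norm e)) * \<eta>" by (simp add: algebra_simps)
  also have "\<dots> = \<rho> / 2 * \<eta>" unfolding kk ..
  finally show False using r \<eta>(2) by simp
qed

lemma tube_separation:
  assumes \<Omega>: "open \<Omega>" and c: "cone_at \<Omega> z r e \<rho>"
    and x: "x \<in> frontier \<Omega>" "dist z x < r" and x': "x' \<in> frontier \<Omega>" "dist z x' < r"
    and \<eta>: "\<eta> \<le> dist x x'" "0 < \<eta>" and s: "0 \<le> s" "s \<le> 1" "0 \<le> s'" "s' \<le> 1"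
  shows "\<rho> / (2 * (\<rho> + norm e)) * \<eta> \<le> dist (x + s *\<^sub>R e) (x' + s' *\<^sub>R e)"
proof (cases "s \<le> s'")
  case True
  then show ?thesis using tube_separation_le[OF \<Omega> c x x' \<eta>] s by simp
next
  case False
  have "\<eta> \<le> dist x' x" using \<eta> by (simp add: dist_commute)
  from tube_separation_le[OF \<Omega> c x' x this \<eta>(2), of s' s] False s show ?thesis by (simp add: dist_commute)
qed

text \<open>Two times at which the moving centre is within \<open>\<delta>\<close> of
  \<open>y\<close> differ by at most \<open>2 * \<delta> / norm e\<close>, so all such times lie in
  an interval of twice that length around one of them.\<close>

lemma tube_segment_length:
  fixes e :: "'a::euclidean_space"
  assumes "e \<noteq> 0" "\<delta> > 0"
  shows "(\<integral>\<^sup>+s. indicator {0..h} s * indicator (ball (x + s *\<^sub>R e) \<delta>) y \<partial>lborel) \<le> ennreal (4 * \<delta> / norm e)"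
proof (cases "\<exists>s0. y \<in> ball (x + s0 *\<^sub>R e) \<delta>")
  case True
  then obtain s0 where s0: "norm (y - x - s0 *\<^sub>R e) < \<delta>" by (auto simp: dist_norm norm_minus_commute algebra_simps)
  let ?l = "2 * \<delta> / norm e"
  have "(\<integral>\<^sup>+s. indicator {0..h} s * indicator (ball (x + s *\<^sub>R e) \<delta>) y \<partial>lborel) \<le> (\<integral>\<^sup>+s. indicator {s0 - ?l..s0 + ?l} s \<partial>lborel)"
  proof (rule nn_integral_mono)
    fix s :: real
    show "indicator {0..h} s * indicator (ball (x + s *\<^sub>R e) \<delta>) y \<le> (indicator {s0 - ?l..s0 + ?l} s :: ennreal)"
    proof (cases "y \<in> ball (x + s *\<^sub>R e) \<delta>")
      case True
      then have s: "norm (y - x - s *\<^sub>R e) < \<delta>" by (simp add: dist_norm norm_minus_commute algebra_simps)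
      have "\<bar>s - s0\<bar> * norm e = norm ((y - x - s0 *\<^sub>R e) - (y - x - s *\<^sub>R e))"
      proof -
        have "(y - x - s0 *\<^sub>R e) - (y - x - s *\<^sub>R e) = (s - s0) *\<^sub>R e" by (simp add: algebra_simps)
        then show ?thesis by simp
      qed
      also have "\<dots> \<le> 2 * \<delta>" using s s0 norm_triangle_ineq4[of "y - x - s0 *\<^sub>R e" "y - x - s *\<^sub>R e"] by linarith
      finally have "\<bar>s - s0\<bar> \<le> ?l" using assms(1) by (simp add: field_simps)
      then have "s \<in> {s0 - ?l..s0 + ?l}" by auto
      then show ?thesis by (auto simp: indicator_def)
    qed simp
  qed
  also have "\<dots> = ennreal ((s0 + ?l) - (s0 - ?l))"
    using assms by (subst nn_integral_indicator) auto
  also have "\<dots> = ennreal (4 * \<delta> / norm e)" by simp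
  finally show ?thesis .
next
  case False
  then have "indicator (ball (x + s *\<^sub>R e) \<delta>) y = (0::ennreal)" for s by (simp add: indicator_def)
  then show ?thesis by simp
qed

text \<open>By the separation of the axes the tubes of radius \<open>\<delta>\<close> are disjoint, so each \<open>y\<close> is counted only for the time
  that the segment of a single tube takes to cross the ball around \<open>y\<close>.\<close>

lemma tube_sum_bound:
  fixes e :: "'a::euclidean_space" and F :: "'a \<Rightarrow> ennreal"
  assumes \<Omega>: "open \<Omega>" and c: "cone_at \<Omega> z r e \<rho>" and e: "e \<noteq> 0"
    and X: "finite X" "X \<subseteq> frontier \<Omega> \<inter> ball z r" "separated \<eta> X" "0 < \<eta>"
    and F[measurable]: "F \<in> borel_measurable borel" and h: "h \<le> 1"
    and \<delta>: "0 < \<delta>" "2 * \<delta> \<le> \<rho> / (2 * (\<rho> + norm e)) * \<eta>"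
  shows "(\<Sum>x\<in>X. \<integral>\<^sup>+s. indicator {0..h} s * (\<integral>\<^sup>+y. F y * indicator (ball (x + s *\<^sub>R e) \<delta>) y \<partial>lborel) \<partial>lborel)
    \<le> ennreal (4 * \<delta> / norm e) * (\<integral>\<^sup>+y. F y \<partial>lborel)"
proof -
  have [measurable]: "ball w \<delta> \<in> sets borel" for w :: 'a by simp
  let ?i = "\<lambda>x s y. indicator {0..h::real} s * indicator (ball (x + s *\<^sub>R e) \<delta>) y :: ennreal"
  have im[measurable]: "(\<lambda>(s, y). ?i x s y) \<in> borel_measurable (lborel \<Otimes>\<^sub>M lborel)" for x
  proof -
    have "open {p :: real \<times> 'a. dist (x + fst p *\<^sub>R e) (snd p) < \<delta>}"
      by (intro open_Collect_less continuous_intros)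
    then have [measurable]: "{p :: real \<times> 'a. dist (x + fst p *\<^sub>R e) (snd p) < \<delta>} \<in> sets (borel \<Otimes>\<^sub>M borel)"
      unfolding borel_prod by simp
    have "(\<lambda>(s, y). ?i x s y) = (\<lambda>p. indicator {0..h} (fst p) * indicator {p. dist (x + fst p *\<^sub>R e) (snd p) < \<delta>} p)"
      by (auto simp: fun_eq_iff indicator_def)
    then show ?thesis by simp
  qed
  have im2[measurable]: "(\<lambda>s. ?i x s y) \<in> borel_measurable lborel" for x y
    using measurable_compose[OF measurable_Pair2', OF _ im, of y] by simp
  have im3[measurable]: "(\<lambda>y. ?i x s y) \<in> borel_measurable lborel" for x s by measurable
  have one: "(\<Sum>x\<in>X. \<integral>\<^sup>+s. ?i x s y \<partial>lborel) \<le> ennreal (4 * \<delta> / norm e)" for y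
  proof (cases "\<exists>x0\<in>X. \<exists>s0\<in>{0..h}. y \<in> ball (x0 + s0 *\<^sub>R e) \<delta>")
    case True
    then obtain x0 s0 where x0: "x0 \<in> X" "s0 \<in> {0..h}" "y \<in> ball (x0 + s0 *\<^sub>R e) \<delta>" by blast
    have "(\<integral>\<^sup>+s. ?i x s y \<partial>lborel) = 0" if "x \<in> X - {x0}" for x
    proof -
      have zero: "?i x s y = 0" for s
      proof (rule ccontr)
        assume "?i x s y \<noteq> 0"
        then have s: "s \<in> {0..h}" "y \<in> ball (x + s *\<^sub>R e) \<delta>" by (auto simp: indicator_def split: if_splits)
        have fr: "x \<in> frontier \<Omega>" "dist z x < r" "x0 \<in> frontier \<Omega>" "dist z x0 < r" using that x0 X(2) by auto
        have "\<eta> \<le> dist x x0" using X(3) that x0(1) by (auto simp: separated_def)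
        then have "\<rho> / (2 * (\<rho> + norm e)) * \<eta> \<le> dist (x + s *\<^sub>R e) (x0 + s0 *\<^sub>R e)"
          using s(1) x0(2) h by (intro tube_separation[OF \<Omega> c fr _ X(4)]) auto
        moreover have "dist (x + s *\<^sub>R e) (x0 + s0 *\<^sub>R e) < 2 * \<delta>"
          using s(2) x0(3) dist_triangle2[of "x + s *\<^sub>R e" "x0 + s0 *\<^sub>R e" y] by (auto simp: dist_commute)
        ultimately show False using \<delta>(2) by linarith
      qed
      show ?thesis by (subst nn_integral_cong[OF zero]) simp
    qed
    then have "(\<Sum>x\<in>X. \<integral>\<^sup>+s. ?i x s y \<partial>lborel) = (\<integral>\<^sup>+s. ?i x0 s y \<partial>lborel)"
      using X(1) x0(1) by (subst sum.remove[of X x0]) auto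
    also have "\<dots> \<le> ennreal (4 * \<delta> / norm e)" by (rule tube_segment_length[OF e \<delta>(1)])
    finally show ?thesis .
  next
    case False
    then have zero: "?i x s y = 0" if "x \<in> X" for x s using that by (auto simp: indicator_def)
    have "(\<integral>\<^sup>+s. ?i x s y \<partial>lborel) = 0" if "x \<in> X" for x
      by (subst nn_integral_cong[OF zero[OF that]]) simp
    then show ?thesis by simp
  qed
  have "(\<Sum>x\<in>X. \<integral>\<^sup>+s. indicator {0..h} s * (\<integral>\<^sup>+y. F y * indicator (ball (x + s *\<^sub>R e) \<delta>) y \<partial>lborel) \<partial>lborel)
    = (\<Sum>x\<in>X. \<integral>\<^sup>+s. \<integral>\<^sup>+y. F y * ?i x s y \<partial>lborel \<partial>lborel)"
    by (intro sum.cong nn_integral_cong refl, subst nn_integral_cmult[symmetric]) (auto simp: mult_ac)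
  also have "\<dots> = (\<Sum>x\<in>X. \<integral>\<^sup>+y. \<integral>\<^sup>+s. F y * ?i x s y \<partial>lborel \<partial>lborel)"
  proof (intro sum.cong refl lborel_pair.Fubini')
    fix x
    have "(\<lambda>p. F (snd p) * (\<lambda>(s, y). ?i x s y) p) \<in> borel_measurable (lborel \<Otimes>\<^sub>M lborel)" using im by measurable
    then show "(\<lambda>(y, s). F y * ?i x s y) \<in> borel_measurable (lborel \<Otimes>\<^sub>M lborel)"
      using measurable_compose[OF measurable_pair_swap', of "\<lambda>p. F (snd p) * (\<lambda>(s, y). ?i x s y) p" lborel lborel borel]
      by (simp add: split_beta' )
  qed
  also have "\<dots> = (\<Sum>x\<in>X. \<integral>\<^sup>+y. F y * (\<integral>\<^sup>+s. ?i x s y \<partial>lborel) \<partial>lborel)"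
    by (intro sum.cong nn_integral_cong nn_integral_cmult refl im2)
  also have "\<dots> = (\<integral>\<^sup>+y. F y * (\<Sum>x\<in>X. \<integral>\<^sup>+s. ?i x s y \<partial>lborel) \<partial>lborel)"
  proof -
    have "(\<lambda>y. \<integral>\<^sup>+s. ?i x s y \<partial>lborel) \<in> borel_measurable lborel" for x
    proof -
      have "(\<lambda>(y, s). ?i x s y) \<in> borel_measurable (lborel \<Otimes>\<^sub>M lborel)"
        using measurable_compose[OF measurable_pair_swap' im[of x]] by (simp add: split_beta')
      then show ?thesis by (rule lborel.borel_measurable_nn_integral)
    qed
    then show ?thesis unfolding sum_distrib_left by (intro nn_integral_sum[symmetric]) measurable
  qed
  also have "\<dots> \<le> (\<integral>\<^sup>+y. F y * ennreal (4 * \<delta> / norm e) \<partial>lborel)"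
    by (intro nn_integral_mono mult_left_mono one) auto
  also have "\<dots> = ennreal (4 * \<delta> / norm e) * (\<integral>\<^sup>+y. F y \<partial>lborel)"
    by (subst nn_integral_multc) (auto simp: mult.commute)
  finally show ?thesis .
qed

text \<open>The tube bound is applied to the indicator of a ball of radius
  \<open>R * (2 + norm e)\<close>, which contains all tubes of radius \<open>k * \<eta>\<close> up
  to time \<open>h\<close>. The time is kept apart from \<open>R\<close>: it is taken to be
  \<open>R\<close> for small pieces of the boundary and \<open>1\<close> for a whole patch.\<close>

lemma packing_bound:
  fixes e :: "'a::euclidean_space"
  assumes \<Omega>: "open \<Omega>" and c: "cone_at \<Omega> z r e \<rho>"
  shows "\<exists>C\<ge>0. \<forall>p (R::real) (h::real) (\<eta>::real) X. 0 < \<eta> \<longrightarrow> \<eta> \<le> R \<longrightarrow> 0 < h \<longrightarrow> h \<le> 1 \<longrightarrow> h \<le> R \<longrightarrow> finite X \<longrightarrow>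
    X \<subseteq> frontier \<Omega> \<inter> ball z r \<inter> cball p R \<longrightarrow> separated \<eta> X \<longrightarrow>
    real (card X) * \<eta> ^ (DIM('a) - 1) * h \<le> C * R ^ DIM('a)"
proof (cases "frontier \<Omega> \<inter> ball z r = {}")
  case True
  then have X: "X \<subseteq> frontier \<Omega> \<inter> ball z r \<inter> cball p R \<Longrightarrow> X = {}" for X and p :: 'a and R by blast
  show ?thesis
  proof (intro exI[of _ 0] conjI allI impI)
    fix p :: 'a and R h \<eta> :: real and X assume "X \<subseteq> frontier \<Omega> \<inter> ball z r \<inter> cball p R"
    from X[OF this] show "real (card X) * \<eta> ^ (DIM('a) - 1) * h \<le> 0 * R ^ DIM('a)" by simp
  qed simp
next
  case False
  then obtain x1 where "x1 \<in> frontier \<Omega>" "dist z x1 < r" by auto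
  then have "\<rho> \<le> norm e" by (rule boundary_cone_norm[OF \<Omega> c])
  moreover have \<rho>: "0 < \<rho>" using c by (simp add: cone_at_def)
  ultimately have e: "e \<noteq> 0" "norm e > 0" by auto
  define k where "k = \<rho> / (4 * (\<rho> + norm e))"
  have k: "0 < k" "k \<le> 1" using \<rho> by (auto simp: k_def field_simps add_pos_nonneg)
  let ?d = "DIM('a)"
  define \<omega> where "\<omega> = unit_ball_vol (real ?d)"
  have \<omega>: "\<omega> > 0" by (simp add: \<omega>_def unit_ball_vol_pos)
  define C where "C = 4 * k / norm e * (2 + norm e) ^ ?d / k ^ ?d"
  show ?thesis
  proof (intro exI[of _ C] conjI allI impI)
    show "C \<ge> 0" using k by (simp add: C_def)
    fix p :: 'a and R h \<eta> :: real and X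
    assume \<eta>: "0 < \<eta>" "\<eta> \<le> R" and h: "0 < h" "h \<le> 1" "h \<le> R" and X: "finite X"
      "X \<subseteq> frontier \<Omega> \<inter> ball z r \<inter> cball p R" "separated \<eta> X"
    define \<delta> where "\<delta> = k * \<eta>"
    have \<delta>: "0 < \<delta>" "2 * \<delta> \<le> \<rho> / (2 * (\<rho> + norm e)) * \<eta>" 
    proof -
      have "2 * (\<rho> / (4 * m) * \<eta>) = \<rho> / (2 * m) * \<eta>" for m :: real by simp
      then show "2 * \<delta> \<le> \<rho> / (2 * (\<rho> + norm e)) * \<eta>" unfolding \<delta>_def k_def by (simp only: order_refl)
      show "0 < \<delta>" using k \<eta> by (simp add: \<delta>_def)
    qed
    define R' where "R' = R * (2 + norm e)"
    have R': "R' \<ge> 0" using \<eta> by (simp add: R'_def)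
    have sub: "ball (x + s *\<^sub>R e) \<delta> \<subseteq> ball p R'" if "x \<in> X" "s \<in> {0..h}" for x s
    proof
      fix y assume y: "y \<in> ball (x + s *\<^sub>R e) \<delta>"
      have "k * \<eta> \<le> 1 * R" using k \<eta> by (intro mult_mono) auto
      then have 1: "dist y (x + s *\<^sub>R e) < R" using y by (simp add: \<delta>_def dist_commute)
      have "s * norm e \<le> R * norm e" using that h by (intro mult_right_mono) auto
      then have 2: "dist (x + s *\<^sub>R e) x \<le> R * norm e" using that by (simp add: dist_norm)
      have 3: "dist x p \<le> R" using that X(2) by (auto simp: dist_commute)
      have "dist y p \<le> dist y (x + s *\<^sub>R e) + (dist (x + s *\<^sub>R e) x + dist x p)"
        by (rule order_trans[OF dist_triangle add_left_mono[OF dist_triangle]])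
      also have "\<dots> < R' " using 1 2 3 by (simp add: R'_def algebra_simps)
      finally show "y \<in> ball p R'" by (simp add: dist_commute)
    qed
    have T: "(\<Sum>x\<in>X. \<integral>\<^sup>+s. indicator {0..h} s * (\<integral>\<^sup>+y. indicator (ball p R') y * indicator (ball (x + s *\<^sub>R e) \<delta>) y \<partial>lborel) \<partial>lborel)
      \<le> ennreal (4 * \<delta> / norm e) * (\<integral>\<^sup>+y. indicator (ball p R') y \<partial>lborel)"
      using X by (intro tube_sum_bound[OF \<Omega> c e(1) X(1) _ X(3) \<eta>(1) _ h(2) \<delta>]) (auto intro!: borel_measurable_indicator)
    have "(\<integral>\<^sup>+s. indicator {0..h} s * (\<integral>\<^sup>+y. indicator (ball p R') y * indicator (ball (x + s *\<^sub>R e) \<delta>) y \<partial>lborel) \<partial>lborel)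
        = ennreal (h * (\<omega> * \<delta> ^ ?d))" if x: "x \<in> X" for x
    proof -
      have "(\<integral>\<^sup>+s. indicator {0..h} s * (\<integral>\<^sup>+y. indicator (ball p R') y * indicator (ball (x + s *\<^sub>R e) \<delta>) y \<partial>lborel) \<partial>lborel)
        = (\<integral>\<^sup>+s. ennreal (\<omega> * \<delta> ^ ?d) * indicator {0..h} s \<partial>lborel)"
      proof (rule nn_integral_cong)
        fix s :: real
        show "indicator {0..h} s * (\<integral>\<^sup>+y. indicator (ball p R') y * indicator (ball (x + s *\<^sub>R e) \<delta>) y \<partial>lborel)
          = ennreal (\<omega> * \<delta> ^ ?d) * indicator {0..h} s"
        proof (cases "s \<in> {0..h}")
          case True
          have "(\<integral>\<^sup>+y. indicator (ball p R') y * indicator (ball (x + s *\<^sub>R e) \<delta>) y \<partial>lborel) = (\<integral>\<^sup>+y. indicator (ball (x + s *\<^sub>R e) \<delta>) y \<partial>lborel)"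
            using sub[OF x True] by (intro nn_integral_cong) (auto simp: indicator_def)
          also have "\<dots> = ennreal (\<omega> * \<delta> ^ ?d)" using \<delta>(1) emeasure_lborel_ball[of \<delta> "x + s *\<^sub>R e"] by (simp add: \<omega>_def)
          finally show ?thesis using True by simp
        qed simp
      qed
      also have "\<dots> = ennreal (\<omega> * \<delta> ^ ?d) * ennreal h" using h by (subst nn_integral_cmult_indicator) auto
      also have "\<dots> = ennreal (h * (\<omega> * \<delta> ^ ?d))" using h \<delta> \<omega> by (simp add: ennreal_mult[symmetric] mult.commute)
      finally show ?thesis .
    qed
    then have "ennreal (card X * (h * (\<omega> * \<delta> ^ ?d))) \<le> ennreal (4 * \<delta> / norm e) * (\<integral>\<^sup>+y. indicator (ball p R') y \<partial>lborel)"
      using T h \<delta> \<omega> by (simp add: ennreal_mult ennreal_of_nat_eq_real_of_nat)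
    also have "\<dots> = ennreal (4 * \<delta> / norm e * (\<omega> * R' ^ ?d))"
    proof -
      have "(\<integral>\<^sup>+y. indicator (ball p R') y \<partial>lborel) = ennreal (\<omega> * R' ^ ?d)"
        using emeasure_lborel_ball[OF R', of p] by (simp add: \<omega>_def)
      then show ?thesis using \<delta>(1) \<omega> R' by (simp only:) (intro ennreal_mult[symmetric]; simp)
    qed
    finally have "card X * (h * (\<omega> * \<delta> ^ ?d)) \<le> 4 * \<delta> / norm e * (\<omega> * R' ^ ?d)"
      using \<delta> \<omega> R' by (subst (asm) ennreal_le_iff) auto
    then have "\<omega> * (card X * h * \<delta> ^ ?d) \<le> \<omega> * (4 * \<delta> / norm e * R' ^ ?d)" by (simp only: mult_ac)
    then have 1: "card X * h * \<delta> ^ ?d \<le> 4 * \<delta> / norm e * R' ^ ?d" using \<omega> by (simp only: mult_le_cancel_left_pos)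
    have \<eta>d: "\<eta> ^ ?d = \<eta> * \<eta> ^ (?d - 1)" using DIM_positive[where 'a='a] by (metis power_eq_if less_numeral_extra(3))
    have "(k ^ ?d * \<eta>) * (card X * \<eta> ^ (?d - 1) * h) = card X * h * \<delta> ^ ?d"
      unfolding \<delta>_def power_mult_distrib \<eta>d by (simp only: mult_ac)
    also have "\<dots> \<le> 4 * \<delta> / norm e * R' ^ ?d" by (rule 1)
    also have "\<dots> = (k ^ ?d * \<eta>) * (C * R ^ ?d)"
      using k unfolding \<delta>_def C_def R'_def power_mult_distrib by simp
    finally show "card X * \<eta> ^ (?d - 1) * h \<le> C * R ^ ?d" using k \<eta> by (simp only: mult_le_cancel_left_pos mult_pos_pos zero_less_power)
  qed
qed

text \<open>The bound \<open>M\<close> provides a separated set of greatest cardinality; a point at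
  distance at least \<open>\<eta>\<close> from all its members could be added to it.\<close>

lemma maximal_separated:
  fixes A :: "'a::metric_space set"
  assumes "\<And>X. finite X \<Longrightarrow> X \<subseteq> A \<Longrightarrow> separated \<eta> X \<Longrightarrow> real (card X) \<le> M" "0 < \<eta>"
  obtains X where "finite X" "X \<subseteq> A" "separated \<eta> X" "\<And>y. y \<in> A \<Longrightarrow> \<exists>x\<in>X. dist x y < \<eta>"
proof -
  let ?P = "\<lambda>n. \<exists>X. finite X \<and> X \<subseteq> A \<and> separated \<eta> X \<and> card X = n"
  have "?P 0" by (intro exI[of _ "{}"]) (auto simp: separated_def)
  moreover have "n \<le> nat \<lceil>M\<rceil>" if "?P n" for n
  proof -
    have "real n \<le> M" using assms(1) that by blast
    then show ?thesis by linarith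
  qed
  ultimately obtain n where n: "?P n" "\<And>m. ?P m \<Longrightarrow> m \<le> n"
    using Nat.ex_has_greatest_nat[of ?P 0 "nat \<lceil>M\<rceil>"] by blast
  then obtain X where X: "finite X" "X \<subseteq> A" "separated \<eta> X" "card X = n" by blast
  have "\<exists>x\<in>X. dist x y < \<eta>" if y: "y \<in> A" for y
  proof (rule ccontr)
    assume "\<not> ?thesis"
    then have far: "\<eta> \<le> dist x y" if "x \<in> X" for x using that by force
    then have "y \<notin> X" using assms(2) by force
    moreover have "separated \<eta> (insert y X)" using X(3) far by (auto simp: separated_def dist_commute)
    ultimately have "?P (Suc n)" using X y by (intro exI[of _ "insert y X"]) auto
    then show False using n(2)[of "Suc n"] by simp
  qed
  then show ?thesis using that X by blast
qed

subsection \<open>The trace inequality for smooth functions\<close>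

text \<open>The balls of radius \<open>\<eta>\<close> around a maximal separated set cover the patch, and there are at most
  constant times \<open>(R / \<eta>) ^ (CARD('d) - 1)\<close> of them.\<close>

lemma hausdorff_patch_bound:
  fixes \<Omega> :: "(real^'d::finite) set"
  assumes \<Omega>: "open \<Omega>" and c: "cone_at \<Omega> z r e \<rho>"
  shows "\<exists>C\<ge>0. \<forall>p (R::real). 0 < R \<longrightarrow> R \<le> 1 \<longrightarrow>
    hausdorff_outer (CARD('d) - 1) (frontier \<Omega> \<inter> ball z r \<inter> cball p R) \<le> ennreal (C * R ^ (CARD('d) - 1))"
proof -
  define m where "m = CARD('d) - 1"
  have d: "CARD('d) = Suc m" by (simp add: m_def)
  have dims: "DIM(real^'d) = Suc m" "DIM(real^'d) - 1 = m" by (simp_all add: d)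
  obtain Cp where Cp0: "Cp \<ge> 0" and Cpall: "\<forall>p (R::real) (h::real) (\<eta>::real) X. 0 < \<eta> \<longrightarrow> \<eta> \<le> R \<longrightarrow> 0 < h \<longrightarrow> h \<le> 1 \<longrightarrow> h \<le> R \<longrightarrow>
    finite X \<longrightarrow> X \<subseteq> frontier \<Omega> \<inter> ball z r \<inter> cball p R \<longrightarrow> separated \<eta> X \<longrightarrow>
    real (card X) * \<eta> ^ (DIM(real^'d) - 1) * h \<le> Cp * R ^ DIM(real^'d)"
    using packing_bound[OF \<Omega> c] by blast
  note Cp = Cp0 Cpall[unfolded dims, rule_format]
  define \<omega> where "\<omega> = unit_ball_vol (real m)"
  have \<omega>: "\<omega> \<ge> 0" by (simp add: \<omega>_def unit_ball_vol_nonneg)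
  show ?thesis
    unfolding m_def[symmetric]
  proof (intro exI[of _ "\<omega> * Cp"] conjI allI impI)
    show "\<omega> * Cp \<ge> 0" using \<omega> Cp by simp
    fix p and R :: real assume R: "0 < R" "R \<le> 1"
    define A where "A = frontier \<Omega> \<inter> ball z r \<inter> cball p R"
    have "hausdorff_content m \<delta> A \<le> ennreal (\<omega> * Cp * R ^ m)" if \<delta>: "\<delta> > 0" for \<delta>
    proof -
      \<comment> \<open>The bound \<open>\<delta> / 2\<close> keeps the diameters
        \<open>2 * \<eta>\<close> of the covering balls within \<open>\<delta>\<close>; the estimate
        obtained for the content is the same for every \<open>\<delta>\<close>.\<close>
      define \<eta> where "\<eta> = min R (\<delta> / 2)"
      have \<eta>: "0 < \<eta>" "\<eta> \<le> R" "2 * \<eta> \<le> \<delta>" using R \<delta> by (auto simp: \<eta>_def)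
      have card: "real (card X) * \<eta> ^ m \<le> Cp * R ^ m" if "finite X" "X \<subseteq> A" "separated \<eta> X" for X
      proof -
        have "real (card X) * \<eta> ^ m * R \<le> Cp * R ^ m * R"
          using Cp(2)[OF \<eta>(1,2) R(1,2) order_refl that(1) _ that(3), of p] that(2) by (simp add: A_def mult_ac)
        then show ?thesis using R by simp
      qed
      obtain X where X: "finite X" "X \<subseteq> A" "separated \<eta> X" "\<And>y. y \<in> A \<Longrightarrow> \<exists>x\<in>X. dist x y < \<eta>"
      proof (rule maximal_separated[of A \<eta> "Cp * R ^ m / \<eta> ^ m"])
        fix X assume "finite X" "X \<subseteq> A" "separated \<eta> X"
        from card[OF this] show "real (card X) \<le> Cp * R ^ m / \<eta> ^ m" using \<eta> by (simp add: field_simps)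
      qed (use \<eta> in auto)
      obtain f where f: "bij_betw f {0..<card X} X" using ex_bij_betw_nat_finite[OF X(1)] by blast
      define U where "U = (\<lambda>n. if n < card X then cball (f n) \<eta> else {})"
      have diam: "diameter (cball x \<eta>) \<le> 2 * \<eta>" for x :: "real^'d" using \<eta> by (simp add: diameter_cball)
      have gauge: "hausdorff_gauge m (U n) \<le> (if n < card X then ennreal (\<omega> * \<eta> ^ m) else 0)" for n
      proof (cases "n < card X")
        case True
        have "\<omega> * (diameter (U n) / 2) ^ m \<le> \<omega> * \<eta> ^ m"
          using diam[of "f n"] \<omega> True by (intro mult_left_mono power_mono) (auto simp: U_def intro: diameter_ge_0)
        then show ?thesis using True \<eta> by (simp add: hausdorff_gauge_def U_def \<omega>_def ennreal_leI)
      qed (simp add: U_def)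
      have "hausdorff_content m \<delta> A \<le> (\<Sum>n. hausdorff_gauge m (U n))"
      proof (rule hausdorff_content_le)
        show "A \<subseteq> (\<Union>n. U n)"
        proof
          fix y assume "y \<in> A"
          then obtain x where x: "x \<in> X" "dist x y < \<eta>" using X(4) by blast
          then obtain n where "n < card X" "f n = x"
            using f unfolding bij_betw_def by (metis atLeastLessThan_iff imageE)
          then have "y \<in> U n" using x by (simp add: U_def)
          then show "y \<in> (\<Union>n. U n)" by blast
        qed
        show "bounded (U n) \<and> diameter (U n) \<le> \<delta>" for n
          using diam[of "f n"] \<eta> \<delta> by (auto simp: U_def)
      qed
      also have "\<dots> = (\<Sum>n<card X. hausdorff_gauge m (U n))"
        by (rule suminf_finite) (auto simp: U_def)
      also have "\<dots> \<le> (\<Sum>n<card X. ennreal (\<omega> * \<eta> ^ m))"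
        using gauge by (intro sum_mono) (metis lessThan_iff)
      also have "\<dots> = ennreal (\<omega> * (real (card X) * \<eta> ^ m))"
        using \<omega> \<eta> by (simp add: ennreal_of_nat_eq_real_of_nat ennreal_mult[symmetric] mult_ac)
      also have "\<dots> \<le> ennreal (\<omega> * (Cp * R ^ m))"
        using card[OF X(1-3)] \<omega> by (intro ennreal_leI mult_left_mono)
      finally show ?thesis by (simp add: mult.assoc)
    qed
    then show "hausdorff_outer m (frontier \<Omega> \<inter> ball z r \<inter> cball p R) \<le> ennreal (\<omega> * Cp * R ^ m)"
      unfolding hausdorff_outer_def A_def[symmetric] by (intro SUP_least) auto
  qed
qed

section \<open>From line integrals to boundary integrals\<close>

text \<open>The factor \<open>1 - 2 * s\<close> is one at the start and vanishes at
  \<open>s = 1 / 2\<close>, so integrating the derivative of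
  \<open>(1 - 2 * s) * (v (y + s *\<^sub>R e))\<^sup>2\<close> leaves only the value at
  \<open>y\<close>. Stopping at \<open>1 / 2\<close> leaves room for the offset \<open>s0\<close> of
  the tubes.\<close>

lemma line_trace:
  fixes v :: "real^'d::finite \<Rightarrow> real"
  assumes v: "C_infinity v"
  shows "ennreal ((v y)\<^sup>2) \<le> (\<integral>\<^sup>+s. ennreal (3 * (v (y + s *\<^sub>R e))\<^sup>2 + (\<Sum>i\<in>UNIV. e $ i * partial i v (y + s *\<^sub>R e))\<^sup>2) * indicator {0..1 / 2} s \<partial>lborel)"
proof -
  define g where "g = (\<lambda>s. v (y + s *\<^sub>R e))"
  define D where "D = (\<lambda>s. \<Sum>i\<in>UNIV. e $ i * partial i v (y + s *\<^sub>R e))"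
  have gD: "(g has_real_derivative D s) (at s)" for s unfolding g_def D_def by (rule DERIV_line[OF v])
  have cD: "continuous_on UNIV D"
    unfolding D_def
    by (intro continuous_intros continuous_on_compose2[OF C_infinity_continuous[OF C_infinity_partial[OF v], of UNIV]]) auto
  have cg: "continuous_on UNIV g" using gD by (meson DERIV_isCont continuous_at_imp_continuous_on)
  define h where "h = (\<lambda>s. - 2 * (g s)\<^sup>2 + (1 - 2 * s) * (2 * g s * D s))"
  have ch: "continuous_on UNIV h" unfolding h_def by (intro continuous_intros cg cD)
  have "((\<lambda>s. (1 - 2 * s) * (g s)\<^sup>2) has_real_derivative h s) (at s)" for s
    unfolding h_def using gD[of s] by (auto intro!: derivative_eq_intros simp: algebra_simps)
  then have "(\<integral>s. h s * indicator {0..1 / 2} s \<partial>lborel) = (1 - 2 * (1 / 2)) * (g (1 / 2))\<^sup>2 - (1 - 2 * 0) * (g 0)\<^sup>2"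
    by (intro integral_FTC_Icc_real) (use ch in \<open>auto simp: continuous_on_eq_continuous_at\<close>)
  then have I: "(v y)\<^sup>2 = norm (\<integral>s. h s * indicator {0..1 / 2} s \<partial>lborel)" by (simp add: g_def)
  have int: "integrable lborel (\<lambda>s. h s * indicator {0..1 / 2} s)"
    using borel_integrable_compact[of "{0..1 / 2::real}" h] continuous_on_subset[OF ch] by (simp add: mult.commute)
  have "ennreal ((v y)\<^sup>2) \<le> (\<integral>\<^sup>+s. ennreal (norm (h s * indicator {0..1 / 2} s)) \<partial>lborel)"
    unfolding I by (rule integral_norm_bound_ennreal[OF int])
  also have "\<dots> \<le> (\<integral>\<^sup>+s. ennreal (3 * (g s)\<^sup>2 + (D s)\<^sup>2) * indicator {0..1 / 2} s \<partial>lborel)"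
  proof (rule nn_integral_mono)
    fix s :: real
    show "ennreal (norm (h s * indicator {0..1 / 2} s)) \<le> ennreal (3 * (g s)\<^sup>2 + (D s)\<^sup>2) * indicator {0..1 / 2} s"
    proof (cases "s \<in> {0..1 / 2}")
      case True
      have "\<bar>(1 - 2 * s) * (2 * g s * D s)\<bar> \<le> 1 * \<bar>2 * g s * D s\<bar>"
        unfolding abs_mult[of "1 - 2 * s"] using True by (intro mult_right_mono) auto
      also have "\<dots> \<le> (g s)\<^sup>2 + (D s)\<^sup>2"
        using sum_squares_bound[of "\<bar>g s\<bar>" "\<bar>D s\<bar>"] by (simp add: abs_mult)
      finally have "\<bar>(1 - 2 * s) * (2 * g s * D s)\<bar> \<le> (g s)\<^sup>2 + (D s)\<^sup>2" .
      then have "\<bar>h s\<bar> \<le> 3 * (g s)\<^sup>2 + (D s)\<^sup>2" 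
      proof -
        have "\<bar>- 2 * a + q\<bar> \<le> 3 * a + b" if "\<bar>q\<bar> \<le> a + b" "0 \<le> a" for q a b :: real using that by linarith
        then show ?thesis unfolding h_def using \<open>\<bar>(1 - 2 * s) * (2 * g s * D s)\<bar> \<le> (g s)\<^sup>2 + (D s)\<^sup>2\<close> by simp
      qed
      then show ?thesis using True by (simp add: ennreal_leI del: ennreal_plus)
    qed simp
  qed
  finally show ?thesis unfolding g_def D_def .
qed

definition gradient_energy :: "(real^'d::finite \<Rightarrow> real) \<Rightarrow> real^'d \<Rightarrow> real" where
  "gradient_energy v y = (v y)\<^sup>2 + (\<Sum>i\<in>UNIV. (partial i v y)\<^sup>2)"

lemma gradient_energy_borel:
  assumes "C_infinity v" shows "gradient_energy v \<in> borel_measurable borel"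
proof -
  have "continuous_on UNIV (gradient_energy v)"
    unfolding gradient_energy_def by (intro continuous_intros C_infinity_continuous C_infinity_partial assms)
  then show ?thesis by (rule borel_measurable_continuous_onI)
qed

lemma tube_indicator_measurable:
  fixes x e :: "'a::euclidean_space"
  shows "(\<lambda>(s, y). indicator (ball (x + s *\<^sub>R e) \<delta>) y :: ennreal) \<in> borel_measurable (lborel \<Otimes>\<^sub>M lborel)"
proof -
  have "open {p :: real \<times> 'a. dist (x + fst p *\<^sub>R e) (snd p) < \<delta>}"
    by (intro open_Collect_less continuous_intros)
  then have [measurable]: "{p :: real \<times> 'a. dist (x + fst p *\<^sub>R e) (snd p) < \<delta>} \<in> sets (borel \<Otimes>\<^sub>M borel)"
    unfolding borel_prod by simp
  have "(\<lambda>(s, y). indicator (ball (x + s *\<^sub>R e) \<delta>) y :: ennreal) = indicator {p. dist (x + fst p *\<^sub>R e) (snd p) < \<delta>}"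
    by (auto simp: fun_eq_iff indicator_def)
  then show ?thesis by simp
qed

text \<open>The value at \<open>x\<close> is compared with the values on a small ball around
  \<open>x + s0 *\<^sub>R e\<close>, which the cone property puts into \<Omega> together with the
  tube that it sweeps out. Averaging \<open>line_trace\<close> over this ball and exchanging the
  integrals gives integrals over moving balls.\<close>

lemma tube_trace:
  fixes v :: "real^'d::finite \<Rightarrow> real"
  assumes \<Omega>: "open \<Omega>" and c: "cone_at \<Omega> z r e \<rho>" and v: "C_infinity v"
    and x: "x \<in> closure \<Omega>" "dist z x < r" and s0: "0 < s0" "s0 \<le> 1 / 2" and \<delta>: "0 < \<delta>" "\<delta> \<le> s0 * \<rho>"
    and close: "\<And>y. y \<in> ball (x + s0 *\<^sub>R e) \<delta> \<Longrightarrow> (v x)\<^sup>2 \<le> (v y)\<^sup>2 + \<epsilon>" and "0 \<le> \<epsilon>"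
  defines "\<omega> \<equiv> unit_ball_vol CARD('d) * \<delta> ^ CARD('d)"
  defines "F \<equiv> \<lambda>y. ennreal ((3 + (norm e)\<^sup>2) * gradient_energy v y) * indicator \<Omega> y"
  shows "ennreal (\<omega> * (v x)\<^sup>2) \<le> ennreal (\<omega> * \<epsilon>) +
    (\<integral>\<^sup>+s. indicator {0..1} s * (\<integral>\<^sup>+y. F y * indicator (ball (x + s *\<^sub>R e) \<delta>) y \<partial>lborel) \<partial>lborel)"
proof -
  let ?B = "ball (x + s0 *\<^sub>R e) \<delta>"
  define G where "G = (\<lambda>y. 3 * (v y)\<^sup>2 + (\<Sum>i\<in>UNIV. e $ i * partial i v y)\<^sup>2)"
  have r: "r > 0" and \<rho>0: "\<rho> > 0" using c by (simp_all add: cone_at_def)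
  have [measurable]: "\<Omega> \<in> sets borel" "?B \<in> sets borel" using \<Omega> by auto
  have [measurable]: "gradient_energy v \<in> borel_measurable borel" by (rule gradient_energy_borel[OF v])
  have Fm[measurable]: "F \<in> borel_measurable borel" unfolding F_def by measurable
  have "continuous_on UNIV G"
    unfolding G_def by (intro continuous_intros C_infinity_continuous C_infinity_partial v)
  then have Gm[measurable]: "G \<in> borel_measurable borel" by (rule borel_measurable_continuous_onI)
  have G: "G y \<le> (3 + (norm e)\<^sup>2) * gradient_energy v y" for y
  proof -
    have "G y \<le> 3 * (v y)\<^sup>2 + (norm e)\<^sup>2 * (\<Sum>i\<in>UNIV. (partial i v y)\<^sup>2)"
      unfolding G_def by (intro add_left_mono sum_vec_sq_le)
    also have "\<dots> \<le> (3 + (norm e)\<^sup>2) * (v y)\<^sup>2 + (3 + (norm e)\<^sup>2) * (\<Sum>i\<in>UNIV. (partial i v y)\<^sup>2)"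
      by (intro add_mono mult_right_mono) (auto intro: sum_nonneg)
    finally show ?thesis by (simp add: gradient_energy_def distrib_left)
  qed
  have \<omega>: "\<omega> \<ge> 0" using \<delta> by (simp add: \<omega>_def unit_ball_vol_nonneg)
  have B: "emeasure lborel ?B = ennreal \<omega>" using emeasure_lborel_ball[of \<delta> "x + s0 *\<^sub>R e"] \<delta> by (simp add: \<omega>_def)
  have inO: "y \<in> \<Omega>" if "y \<in> ball (x + s *\<^sub>R e) \<delta>" "s0 \<le> s" "s \<le> 1" for y s
  proof -
    have s: "0 < s" using that s0 by simp
    define b where "b = (1 / s) *\<^sub>R (y - x - s *\<^sub>R e)"
    have "norm (y - x - s *\<^sub>R e) < \<delta>" using that(1) by (simp add: dist_norm norm_minus_commute algebra_simps)
    also have "\<dots> \<le> s * \<rho>" by (rule order_trans[OF \<delta>(2) mult_right_mono[OF that(2) less_imp_le[OF \<rho>0]]])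
    finally have "norm (y - x - s *\<^sub>R e) < s * \<rho>" .
    moreover have "norm b = norm (y - x - s *\<^sub>R e) / s" unfolding b_def norm_scaleR using s by simp
    ultimately have b: "norm b < \<rho>" using s by (simp add: divide_less_eq mult.commute)
    have "y = x + s *\<^sub>R (e + b)" using s by (simp add: b_def algebra_simps)
    then show ?thesis using cone_atD[OF c x(1) _ s that(3) b] x(2) r by simp
  qed
  define \<Psi> where "\<Psi> = (\<lambda>s. indicator {0..1} s * (\<integral>\<^sup>+y. F y * indicator (ball (x + s *\<^sub>R e) \<delta>) y \<partial>lborel))"
  have \<Psi>m[measurable]: "\<Psi> \<in> borel_measurable borel"
  proof -
    have "(\<lambda>(s, y). F y * indicator (ball (x + s *\<^sub>R e) \<delta>) y) \<in> borel_measurable (lborel \<Otimes>\<^sub>M lborel)"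
    proof -
      have "(\<lambda>p. F (snd p) * (\<lambda>(s, y). indicator (ball (x + s *\<^sub>R e) \<delta>) y) p) \<in> borel_measurable (lborel \<Otimes>\<^sub>M lborel)"
        using tube_indicator_measurable[of x e \<delta>] by measurable
      then show ?thesis by (simp add: split_beta')
    qed
    then have "(\<lambda>s. \<integral>\<^sup>+y. F y * indicator (ball (x + s *\<^sub>R e) \<delta>) y \<partial>lborel) \<in> borel_measurable lborel"
      by (rule lborel.borel_measurable_nn_integral)
    then show ?thesis unfolding \<Psi>_def by simp
  qed
  have "ennreal (\<omega> * (v x)\<^sup>2) = (\<integral>\<^sup>+y. ennreal ((v x)\<^sup>2) * indicator ?B y \<partial>lborel)"
    using \<omega> by (subst nn_integral_cmult_indicator) (auto simp: B ennreal_mult mult.commute)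
  also have "\<dots> \<le> (\<integral>\<^sup>+y. ennreal \<epsilon> * indicator ?B y + (\<integral>\<^sup>+s. indicator ?B y * (ennreal (G (y + s *\<^sub>R e)) * indicator {0..1 / 2} s) \<partial>lborel) \<partial>lborel)"
  proof (rule nn_integral_mono)
    fix y
    show "ennreal ((v x)\<^sup>2) * indicator ?B y \<le> ennreal \<epsilon> * indicator ?B y + (\<integral>\<^sup>+s. indicator ?B y * (ennreal (G (y + s *\<^sub>R e)) * indicator {0..1 / 2} s) \<partial>lborel)"
    proof (cases "y \<in> ?B")
      case True
      have "ennreal ((v x)\<^sup>2) \<le> ennreal ((v y)\<^sup>2 + \<epsilon>)" using close[OF True] by (rule ennreal_leI)
      also have "\<dots> = ennreal \<epsilon> + ennreal ((v y)\<^sup>2)" using \<open>0 \<le> \<epsilon>\<close> by (simp add: add.commute)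
      also have "ennreal ((v y)\<^sup>2) \<le> (\<integral>\<^sup>+s. ennreal (G (y + s *\<^sub>R e)) * indicator {0..1 / 2} s \<partial>lborel)"
        unfolding G_def by (rule line_trace[OF v])
      finally show ?thesis using True by (simp add: add_left_mono)
    qed simp
  qed
  also have "\<dots> = ennreal (\<omega> * \<epsilon>) + (\<integral>\<^sup>+y. \<integral>\<^sup>+s. indicator ?B y * (ennreal (G (y + s *\<^sub>R e)) * indicator {0..1 / 2} s) \<partial>lborel \<partial>lborel)"
    using \<omega> \<open>0 \<le> \<epsilon>\<close> by (subst nn_integral_add) (auto simp: nn_integral_cmult_indicator B ennreal_mult mult.commute)
  also have "(\<integral>\<^sup>+y. \<integral>\<^sup>+s. indicator ?B y * (ennreal (G (y + s *\<^sub>R e)) * indicator {0..1 / 2} s) \<partial>lborel \<partial>lborel)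
    = (\<integral>\<^sup>+s. \<integral>\<^sup>+y. indicator ?B y * (ennreal (G (y + s *\<^sub>R e)) * indicator {0..1 / 2} s) \<partial>lborel \<partial>lborel)"
    by (rule lborel_pair.Fubini') measurable
  \<comment> \<open>Moving the base ball by \<open>s\<close> along \<open>e\<close> yields the ball
    of the tube at time \<open>s + s0\<close>, hence the shifted argument of
    \<open>\<Psi>\<close>.\<close>
  also have "\<dots> \<le> (\<integral>\<^sup>+s. \<Psi> (s + s0) \<partial>lborel)"
  proof (rule nn_integral_mono)
    fix s :: real
    show "(\<integral>\<^sup>+y. indicator ?B y * (ennreal (G (y + s *\<^sub>R e)) * indicator {0..1 / 2} s) \<partial>lborel) \<le> \<Psi> (s + s0)"
    proof (cases "s \<in> {0..1 / 2}")
      case True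
      let ?B' = "ball (x + (s + s0) *\<^sub>R e) \<delta>"
      have [measurable]: "?B' \<in> sets borel" by simp
      have "(\<integral>\<^sup>+y. indicator ?B y * (ennreal (G (y + s *\<^sub>R e)) * indicator {0..1 / 2} s) \<partial>lborel)
        = (\<integral>\<^sup>+y. ennreal (G (y + s *\<^sub>R e)) * indicator ?B' (y + s *\<^sub>R e) \<partial>lborel)"
        using True by (intro nn_integral_cong) (auto simp: indicator_def dist_norm algebra_simps)
      also have "\<dots> = (\<integral>\<^sup>+y. ennreal (G y) * indicator ?B' y \<partial>lborel)"
        by (rule nn_integral_lborel_shift) measurable
      also have "\<dots> \<le> (\<integral>\<^sup>+y. F y * indicator ?B' y \<partial>lborel)"
        using inO[of _ "s + s0"] True s0 G by (intro nn_integral_mono) (auto simp: F_def indicator_def intro!: ennreal_leI)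
      also have "\<dots> = \<Psi> (s + s0)" using True s0 by (simp add: \<Psi>_def)
      finally show ?thesis .
    qed simp
  qed
  also have "\<dots> = (\<integral>\<^sup>+s. \<Psi> s \<partial>lborel)" by (rule nn_integral_lborel_shift) measurable
  finally show ?thesis unfolding \<Psi>_def by (simp add: add_left_mono)
qed


text \<open>The boundary integral is compared with a Riemann sum over a maximal separated set: each
  cap has measure at most \<open>Ch * \<eta> ^ m\<close>, and each squared value is bounded by a
  tube integral. A ball of the tube has volume of order \<open>\<eta> ^ (m + 1)\<close> and the
  crossing time is of order \<open>\<eta>\<close>, so the powers of \<open>\<eta>\<close> cancel and
  the constant depends neither on \<open>\<eta>\<close> nor on \<open>v\<close>.\<close>

lemma trace_patch:
  fixes \<Omega> :: "(real^'d::finite) set"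
  assumes \<Omega>: "open \<Omega>" and c: "cone_at \<Omega> z r e \<rho>"
  shows "\<exists>C>0. \<forall>v. C_infinity v \<longrightarrow>
    (\<integral>\<^sup>+x. ennreal ((v x)\<^sup>2) * indicator (frontier \<Omega> \<inter> ball z r) x \<partial>hausdorff_measure (CARD('d) - 1))
      \<le> ennreal C * (\<integral>\<^sup>+y. ennreal (gradient_energy v y) * indicator \<Omega> y \<partial>lborel)"
proof (cases "frontier \<Omega> \<inter> ball z r = {}")
  case True
  then show ?thesis by (intro exI[of _ 1]) simp
next
  case False
  define S where "S = frontier \<Omega> \<inter> ball z r"
  define m where "m = CARD('d) - 1"
  have d: "CARD('d) = Suc m" by (simp add: m_def)
  have dims: "DIM(real^'d) = Suc m" "DIM(real^'d) - 1 = m" by (simp_all add: d)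
  have pos: "0 < r" "0 < \<rho>" using c by (simp_all add: cone_at_def)
  obtain x1 where "x1 \<in> frontier \<Omega>" "dist z x1 < r" using False by auto
  then have "\<rho> \<le> norm e" by (rule boundary_cone_norm[OF \<Omega> c])
  then have e: "e \<noteq> 0" "norm e > 0" using pos by auto
  have [measurable]: "\<Omega> \<in> sets borel" using \<Omega> by simp
  have Sc: "x \<in> closure \<Omega>" "dist z x < r" if "x \<in> S" for x using that by (auto simp: S_def frontier_def)
  obtain Cp where Cp0: "Cp \<ge> 0" and Cpall: "\<forall>p (R::real) (h::real) (\<eta>::real) X. 0 < \<eta> \<longrightarrow> \<eta> \<le> R \<longrightarrow> 0 < h \<longrightarrow> h \<le> 1 \<longrightarrow> h \<le> R \<longrightarrow>
    finite X \<longrightarrow> X \<subseteq> frontier \<Omega> \<inter> ball z r \<inter> cball p R \<longrightarrow> separated \<eta> X \<longrightarrow>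
    real (card X) * \<eta> ^ (DIM(real^'d) - 1) * h \<le> Cp * R ^ DIM(real^'d)"
    using packing_bound[OF \<Omega> c] by blast
  note Cp = Cpall[unfolded dims, rule_format]
  obtain Ch where Ch: "Ch \<ge> 0" "\<And>p (R::real). 0 < R \<Longrightarrow> R \<le> 1 \<Longrightarrow>
    hausdorff_outer m (frontier \<Omega> \<inter> ball z r \<inter> cball p R) \<le> ennreal (Ch * R ^ m)"
    using hausdorff_patch_bound[OF \<Omega> c] unfolding m_def by blast
  define R1 where "R1 = max 1 r"
  define C4 where "C4 = Cp * R1 ^ Suc m"
  have C4: "C4 \<ge> 0" using Cp0 by (simp add: C4_def R1_def)
  \<comment> \<open>The first entry is half the distance of the axes per unit of
    \<open>\<eta>\<close>, which makes tubes of radius \<open>k * \<eta>\<close> disjoint; the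
    second keeps their radius below \<open>\<eta>\<close>.\<close>
  define k where "k = min (\<rho> / (4 * (\<rho> + norm e))) (1 / 2)"
  have kp: "0 < \<rho> / (4 * (\<rho> + norm e))" using pos e by (intro divide_pos_pos mult_pos_pos add_pos_pos) auto
  have k: "0 < k" "k \<le> 1 / 2" "k \<le> \<rho> / (4 * (\<rho> + norm e))" 
    unfolding k_def by (rule min_less_iff_conj[THEN iffD2, OF conjI[OF kp]], simp, rule min.cobounded2, rule min.cobounded1)
  define \<omega>1 where "\<omega>1 = unit_ball_vol CARD('d) * k ^ CARD('d)"
  have \<omega>1: "\<omega>1 > 0" using k by (simp add: \<omega>1_def unit_ball_vol_pos)
  define C5 where "C5 = 3 + (norm e)\<^sup>2"
  define C6 where "C6 = 4 * k / norm e * C5 / \<omega>1"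
  have C5: "C5 > 0" by (simp add: C5_def add_pos_nonneg)
  have C6: "C6 \<ge> 0" using k C5 \<omega>1 by (simp add: C6_def)
  show ?thesis
    unfolding S_def[symmetric] m_def[symmetric]
  proof (intro exI[of _ "Ch * C6 + 1"] conjI allI impI)
    \<comment> \<open>The added one makes the constant positive, so that the case of infinite energy
      is trivial even when \<open>Ch * C6\<close> is zero.\<close>
    show "Ch * C6 + 1 > 0" using Ch C6 by (simp add: add_nonneg_pos)
    fix v :: "real^'d \<Rightarrow> real" assume v: "C_infinity v"
    have [measurable]: "v \<in> borel_measurable borel" by (rule C_infinity_borel[OF v])
    have gm[measurable]: "gradient_energy v \<in> borel_measurable borel" by (rule gradient_energy_borel[OF v])
    define E where "E = (\<integral>\<^sup>+y. ennreal (gradient_energy v y) * indicator \<Omega> y \<partial>lborel)"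
    show "(\<integral>\<^sup>+x. ennreal ((v x)\<^sup>2) * indicator S x \<partial>hausdorff_measure m) \<le> ennreal (Ch * C6 + 1) * E"
    proof (cases "E = top")
      case True
      have "Ch * C6 + 1 > 0" using Ch C6 by (simp add: add_nonneg_pos)
      then show ?thesis using True by (simp add: ennreal_mult_top)
    next
      case False
      then obtain I where I: "E = ennreal I" "I \<ge> 0" by (cases E) auto
      define F where "F = (\<lambda>y. ennreal (C5 * gradient_energy v y) * indicator \<Omega> y)"
      have Fm[measurable]: "F \<in> borel_measurable borel" unfolding F_def by measurable
      have ge0: "gradient_energy v y \<ge> 0" for y unfolding gradient_energy_def by (intro add_nonneg_nonneg sum_nonneg) auto
      have FI: "(\<integral>\<^sup>+y. F y \<partial>lborel) = ennreal (C5 * I)"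
      proof -
        have "(\<integral>\<^sup>+y. F y \<partial>lborel) = (\<integral>\<^sup>+y. ennreal C5 * (ennreal (gradient_energy v y) * indicator \<Omega> y) \<partial>lborel)"
          using ge0 C5 by (intro nn_integral_cong) (simp add: F_def ennreal_mult mult.assoc)
        also have "\<dots> = ennreal C5 * E" unfolding E_def by (rule nn_integral_cmult) measurable
        finally show ?thesis using I C5 by (simp add: ennreal_mult)
      qed
      have bound: "(\<integral>\<^sup>+x. ennreal ((v x)\<^sup>2) * indicator S x \<partial>hausdorff_measure m) \<le> ennreal (Ch * C6 * I + 2 * Ch * C4 * \<epsilon>)"
        if \<epsilon>: "\<epsilon> > 0" for \<epsilon>
      proof -
        have "continuous_on (cball z (r + 1)) (\<lambda>y. (v y)\<^sup>2)" by (intro continuous_intros C_infinity_continuous v)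
        then have "uniformly_continuous_on (cball z (r + 1)) (\<lambda>y. (v y)\<^sup>2)"
          by (rule compact_uniformly_continuous) simp
        then obtain q where q: "q > 0" "\<And>y y'. y \<in> cball z (r + 1) \<Longrightarrow> y' \<in> cball z (r + 1) \<Longrightarrow> dist y' y < q \<Longrightarrow> dist ((v y')\<^sup>2) ((v y)\<^sup>2) < \<epsilon>"
          using \<epsilon> unfolding uniformly_continuous_on_def by metis
        \<comment> \<open>\<open>C' * \<eta>\<close> bounds the distance from a net point
          \<open>x\<close> to everything compared with it: the cap of radius \<open>\<eta>\<close>,
          and the ball of radius \<open>\<delta>\<close> around \<open>x + s0 *\<^sub>R e\<close>,
          where \<open>s0 * norm e = \<eta> * norm e / \<rho>\<close>.\<close>
        define C' where "C' = norm e / \<rho> + 2"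
        have C': "C' \<ge> 2" using pos by (simp add: C'_def)
        define \<eta> where "\<eta> = min (min 1 (\<rho> / 2)) (min 1 q / (2 * C'))"
        have \<eta>: "0 < \<eta>" "\<eta> \<le> 1" "\<eta> \<le> \<rho> / 2" using pos q(1) C' by (auto simp: \<eta>_def)
        have \<eta>C: "C' * \<eta> < 1" "C' * \<eta> < q"
        proof -
          have "C' * \<eta> \<le> C' * (min 1 q / (2 * C'))" using C' by (intro mult_left_mono) (auto simp: \<eta>_def)
          also have "\<dots> = min 1 q / 2" using C' by simp
          finally show "C' * \<eta> < 1" "C' * \<eta> < q" using q(1) by auto
        qed
        have near: "\<bar>(v y)\<^sup>2 - (v x)\<^sup>2\<bar> \<le> \<epsilon>" if "x \<in> S" "dist x y \<le> C' * \<eta>" for x y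
        proof -
          have "dist z y \<le> dist z x + dist x y" by (rule dist_triangle)
          then have "y \<in> cball z (r + 1)" "x \<in> cball z (r + 1)" using Sc(2)[OF that(1)] that(2) \<eta>C(1) by auto
          then have "dist ((v y)\<^sup>2) ((v x)\<^sup>2) < \<epsilon>" using that(2) \<eta>C(2) by (intro q(2)) (auto simp: dist_commute)
          then show ?thesis by (simp add: dist_real_def)
        qed
        define \<delta> where "\<delta> = k * \<eta>"
        \<comment> \<open>At this time the cone has radius \<open>s0 * \<rho> = \<eta>\<close>,
          enough for the ball of radius \<open>\<delta>\<close>;
          \<open>\<eta> \<le> \<rho> / 2\<close> gives \<open>s0 \<le> 1 / 2\<close>.\<close>
        define s0 where "s0 = \<eta> / \<rho>"
        have s0: "0 < s0" "s0 \<le> 1 / 2" using \<eta> pos by (auto simp: s0_def field_simps)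
        have \<delta>: "0 < \<delta>" "\<delta> \<le> s0 * \<rho>" "2 * \<delta> \<le> \<rho> / (2 * (\<rho> + norm e)) * \<eta>" "\<delta> \<le> \<eta>"
        proof -
          show "0 < \<delta>" using k \<eta> by (simp add: \<delta>_def)
          show "\<delta> \<le> \<eta>" using k \<eta> by (simp add: \<delta>_def)
          then show "\<delta> \<le> s0 * \<rho>" using pos by (simp add: s0_def)
          have "2 * \<delta> \<le> 2 * (\<rho> / (4 * (\<rho> + norm e)) * \<eta>)" unfolding \<delta>_def using k \<eta> by (intro mult_left_mono mult_right_mono) auto
          also have "\<dots> = \<rho> / (2 * (\<rho> + norm e)) * \<eta>"
          proof -
            have "2 * (\<rho> / (4 * a) * \<eta>) = \<rho> / (2 * a) * \<eta>" for a :: real by simp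
            then show ?thesis .
          qed
          finally show "2 * \<delta> \<le> \<rho> / (2 * (\<rho> + norm e)) * \<eta>" .
        qed
        have card: "real (card X) * \<eta> ^ m \<le> C4" if "finite X" "X \<subseteq> S" "separated \<eta> X" for X
        proof -
          have "X \<subseteq> frontier \<Omega> \<inter> ball z r \<inter> cball z R1" using that(2) by (auto simp: S_def R1_def)
          from Cp[OF \<eta>(1) _ _ order_refl _ that(1) this that(3)] \<eta>(2) show ?thesis by (simp add: R1_def C4_def)
        qed
        obtain X where X: "finite X" "X \<subseteq> S" "separated \<eta> X" "\<And>y. y \<in> S \<Longrightarrow> \<exists>x\<in>X. dist x y < \<eta>"
        proof (rule maximal_separated[of S \<eta> "C4 / \<eta> ^ m"])
          fix X assume "finite X" "X \<subseteq> S" "separated \<eta> X"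
          from card[OF this] show "real (card X) \<le> C4 / \<eta> ^ m" using \<eta> by (simp add: field_simps)
        qed (use \<eta> in auto)
        define \<omega> where "\<omega> = unit_ball_vol CARD('d) * \<delta> ^ CARD('d)"
        have \<omega>eq: "\<omega> = \<omega>1 * \<eta> * \<eta> ^ m"
          unfolding \<omega>_def \<omega>1_def \<delta>_def power_mult_distrib by (simp add: d)
        have \<omega>: "\<omega> \<ge> 0" using \<omega>1 \<eta> by (simp add: \<omega>eq)
        define V where "V = (\<Sum>x\<in>X. (v x)\<^sup>2)"
        have tube: "ennreal (\<omega> * (v x)\<^sup>2) \<le> ennreal (\<omega> * \<epsilon>) +
          (\<integral>\<^sup>+s. indicator {0..1} s * (\<integral>\<^sup>+y. F y * indicator (ball (x + s *\<^sub>R e) \<delta>) y \<partial>lborel) \<partial>lborel)" if x: "x \<in> X" for x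
          unfolding \<omega>_def F_def C5_def
        proof (rule tube_trace[OF \<Omega> c v Sc(1) Sc(2) s0 \<delta>(1,2)])
          show "x \<in> S" "x \<in> S" using x X(2) by auto
          show "0 \<le> \<epsilon>" using \<epsilon> by simp
          fix y assume y: "y \<in> ball (x + s0 *\<^sub>R e) \<delta>"
          have "dist x y \<le> dist x (x + s0 *\<^sub>R e) + dist (x + s0 *\<^sub>R e) y" by (rule dist_triangle)
          also have "\<dots> \<le> s0 * norm e + \<eta>" using y \<delta>(4) s0 by (simp add: dist_norm)
          also have "\<dots> \<le> C' * \<eta>" using \<eta> pos by (simp add: C'_def s0_def distrib_left mult.commute[of _ \<eta>])
          finally have "\<bar>(v y)\<^sup>2 - (v x)\<^sup>2\<bar> \<le> \<epsilon>" using x X(2) by (intro near) auto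
          then show "(v x)\<^sup>2 \<le> (v y)\<^sup>2 + \<epsilon>" by simp
        qed
        have "ennreal (\<omega> * V) = (\<Sum>x\<in>X. ennreal (\<omega> * (v x)\<^sup>2))"
          unfolding V_def sum_distrib_left using \<omega> by (intro sum_ennreal[symmetric]) simp
        also have "\<dots> \<le> (\<Sum>x\<in>X. ennreal (\<omega> * \<epsilon>) +
          (\<integral>\<^sup>+s. indicator {0..1} s * (\<integral>\<^sup>+y. F y * indicator (ball (x + s *\<^sub>R e) \<delta>) y \<partial>lborel) \<partial>lborel))"
          by (rule sum_mono) (rule tube)
        also have "\<dots> = of_nat (card X) * ennreal (\<omega> * \<epsilon>) +
          (\<Sum>x\<in>X. \<integral>\<^sup>+s. indicator {0..1} s * (\<integral>\<^sup>+y. F y * indicator (ball (x + s *\<^sub>R e) \<delta>) y \<partial>lborel) \<partial>lborel)"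
          by (simp add: sum.distrib)
        also have "\<dots> \<le> of_nat (card X) * ennreal (\<omega> * \<epsilon>) + ennreal (4 * \<delta> / norm e) * ennreal (C5 * I)"
          unfolding FI[symmetric]
          by (intro add_left_mono tube_sum_bound[OF \<Omega> c e(1) X(1) _ X(3) \<eta>(1) Fm _ \<delta>(1,3)]) (use X(2) in \<open>auto simp: S_def\<close>)
        also have "\<dots> = ennreal (card X * (\<omega> * \<epsilon>) + 4 * \<delta> / norm e * (C5 * I))"
          using \<omega> \<epsilon> \<delta>(1) C5 I(2)
          by (simp add: ennreal_of_nat_eq_real_of_nat ennreal_mult[symmetric] ennreal_plus[symmetric] del: ennreal_plus)
        finally have "\<omega> * V \<le> card X * (\<omega> * \<epsilon>) + 4 * \<delta> / norm e * (C5 * I)"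
          using \<omega> \<epsilon> \<delta>(1) C5 I(2) by (subst (asm) ennreal_le_iff) (auto intro!: add_nonneg_nonneg)
        \<comment> \<open>Both sides are written with the common factor
          \<open>\<omega>1 * \<eta>\<close>; cancelling it leaves the weight
          \<open>\<eta> ^ m\<close> of the Riemann sum.\<close>
        then have "(\<omega>1 * \<eta>) * (\<eta> ^ m * V) \<le> (\<omega>1 * \<eta>) * (\<epsilon> * (real (card X) * \<eta> ^ m) + C6 * I)"
        proof -
          have w: "\<omega>1 * C6 = 4 * k / norm e * C5" using \<omega>1 by (simp add: C6_def)
          have "(\<omega>1 * \<eta>) * (\<epsilon> * (real (card X) * \<eta> ^ m) + C6 * I) = card X * (\<omega> * \<epsilon>) + (\<omega>1 * C6) * (\<eta> * I)"
            by (simp add: \<omega>eq algebra_simps)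
          also have "(\<omega>1 * C6) * (\<eta> * I) = 4 * \<delta> / norm e * (C5 * I)" unfolding w by (simp add: \<delta>_def mult_ac)
          finally have 1: "(\<omega>1 * \<eta>) * (\<epsilon> * (real (card X) * \<eta> ^ m) + C6 * I) = card X * (\<omega> * \<epsilon>) + 4 * \<delta> / norm e * (C5 * I)" .
          have 2: "(\<omega>1 * \<eta>) * (\<eta> ^ m * V) = \<omega> * V" by (simp add: \<omega>eq mult_ac)
          show ?thesis unfolding 1 2 by fact
        qed
        then have V1: "\<eta> ^ m * V \<le> \<epsilon> * (real (card X) * \<eta> ^ m) + C6 * I"
          using mult_pos_pos[OF \<omega>1 \<eta>(1)] by (simp only: mult_le_cancel_left_pos)
        also have "\<dots> \<le> \<epsilon> * C4 + C6 * I"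
          using card[OF X(1-3)] \<epsilon> by (intro add_right_mono mult_left_mono) auto
        finally have V1: "\<eta> ^ m * V \<le> \<epsilon> * C4 + C6 * I" .
        have Sb: "S \<in> sets borel"
          unfolding S_def by (intro sets.Int borel_closed[OF frontier_closed] borel_open[OF open_ball])
        have patch_sets: "S \<inter> cball x \<eta> \<in> sets borel" for x by (intro sets.Int Sb borel_closed[OF closed_cball])
        have "(\<integral>\<^sup>+x. ennreal ((v x)\<^sup>2) * indicator S x \<partial>hausdorff_measure m)
          \<le> (\<integral>\<^sup>+y. (\<Sum>x\<in>X. ennreal ((v x)\<^sup>2 + \<epsilon>) * indicator (S \<inter> cball x \<eta>) y) \<partial>hausdorff_measure m)"
        proof (rule nn_integral_mono)
          fix y
          show "ennreal ((v y)\<^sup>2) * indicator S y \<le> (\<Sum>x\<in>X. ennreal ((v x)\<^sup>2 + \<epsilon>) * indicator (S \<inter> cball x \<eta>) y)"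
          proof (cases "y \<in> S")
            case True
            then obtain x where x: "x \<in> X" "dist x y < \<eta>" using X(4) by blast
            have "\<eta> \<le> C' * \<eta>" using C' \<eta> by simp
            then have "\<bar>(v y)\<^sup>2 - (v x)\<^sup>2\<bar> \<le> \<epsilon>" using x X(2) by (intro near) auto
            then have "ennreal ((v y)\<^sup>2) \<le> ennreal ((v x)\<^sup>2 + \<epsilon>)" by (intro ennreal_leI) simp
            also have "\<dots> = ennreal ((v x)\<^sup>2 + \<epsilon>) * indicator (S \<inter> cball x \<eta>) y" using x True by simp
            also have "\<dots> \<le> (\<Sum>x\<in>X. ennreal ((v x)\<^sup>2 + \<epsilon>) * indicator (S \<inter> cball x \<eta>) y)"
              using X(1) x(1) by (intro member_le_sum) auto
            finally show ?thesis using True by simp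
          qed simp
        qed
        also have "\<dots> = (\<Sum>x\<in>X. ennreal ((v x)\<^sup>2 + \<epsilon>) * emeasure (hausdorff_measure m) (S \<inter> cball x \<eta>))"
        proof -
          have "(\<lambda>y. ennreal ((v x)\<^sup>2 + \<epsilon>) * indicator (S \<inter> cball x \<eta>) y) \<in> borel_measurable (hausdorff_measure m)" for x
            using patch_sets[of x] by (intro borel_measurable_times_ennreal borel_measurable_indicator) simp_all
          then show ?thesis using patch_sets by (subst nn_integral_sum) (auto simp: nn_integral_cmult_indicator)
        qed
        also have "\<dots> \<le> (\<Sum>x\<in>X. ennreal ((v x)\<^sup>2 + \<epsilon>) * ennreal (Ch * \<eta> ^ m))"
          unfolding emeasure_hausdorff_measure[OF patch_sets]
          using Ch(2)[OF \<eta>(1,2)] by (intro sum_mono mult_left_mono) (auto simp: S_def)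
        also have "\<dots> = (\<Sum>x\<in>X. ennreal (((v x)\<^sup>2 + \<epsilon>) * (Ch * \<eta> ^ m)))"
          using \<epsilon> Ch(1) \<eta> by (simp add: ennreal_mult del: ennreal_plus)
        also have "\<dots> = ennreal (\<Sum>x\<in>X. ((v x)\<^sup>2 + \<epsilon>) * (Ch * \<eta> ^ m))"
          using \<epsilon> Ch(1) \<eta> by (intro sum_ennreal) auto
        also have "(\<Sum>x\<in>X. ((v x)\<^sup>2 + \<epsilon>) * (Ch * \<eta> ^ m)) = Ch * (\<eta> ^ m * V + \<epsilon> * (real (card X) * \<eta> ^ m))"
        proof -
          have "(\<Sum>x\<in>X. ((v x)\<^sup>2 + \<epsilon>) * (Ch * \<eta> ^ m)) = (V + card X * \<epsilon>) * (Ch * \<eta> ^ m)"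
            unfolding sum_distrib_right[symmetric] by (simp add: V_def sum.distrib)
          then show ?thesis by (simp add: algebra_simps)
        qed
        also have "ennreal \<dots> \<le> ennreal (Ch * ((\<epsilon> * C4 + C6 * I) + \<epsilon> * C4))"
          using V1 card[OF X(1-3)] \<epsilon> Ch(1) by (intro ennreal_leI mult_left_mono add_mono) auto
        also have "Ch * ((\<epsilon> * C4 + C6 * I) + \<epsilon> * C4) = Ch * C6 * I + 2 * Ch * C4 * \<epsilon>" by (simp add: algebra_simps)
        finally show ?thesis .
      qed
      have "(\<integral>\<^sup>+x. ennreal ((v x)\<^sup>2) * indicator S x \<partial>hausdorff_measure m) \<le> ennreal (Ch * C6 * I)"
      proof (rule ennreal_le_epsilon)
        fix a :: real assume a: "0 < a"
        define b where "b = 2 * Ch * C4"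
        have b: "b \<ge> 0" using Ch C4 by (simp add: b_def)
        have "a / (b + 1) > 0" using a b by simp
        from bound[OF this] have "(\<integral>\<^sup>+x. ennreal ((v x)\<^sup>2) * indicator S x \<partial>hausdorff_measure m) \<le> ennreal (Ch * C6 * I + b * (a / (b + 1)))"
          by (simp only: b_def)
        also have "\<dots> \<le> ennreal (Ch * C6 * I + a)"
        proof (intro ennreal_leI add_left_mono)
          have "b + 1 > 0" using b by simp
          then show "b * (a / (b + 1)) \<le> a" using a by (simp add: field_simps)
        qed
        also have "\<dots> = ennreal (Ch * C6 * I) + ennreal a" using Ch C6 I a by (intro ennreal_plus) auto
        finally show "(\<integral>\<^sup>+x. ennreal ((v x)\<^sup>2) * indicator S x \<partial>hausdorff_measure m) \<le> ennreal (Ch * C6 * I) + ennreal a" .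
      qed
      also have "\<dots> \<le> ennreal ((Ch * C6 + 1) * I)" using I by (intro ennreal_leI mult_right_mono) auto
      also have "\<dots> = ennreal (Ch * C6 + 1) * E" using I Ch C6 by (simp add: ennreal_mult del: ennreal_plus)
      finally show ?thesis .
    qed
  qed
qed

theorem trace_inequality:
  fixes \<Omega> :: "(real^'d::finite) set"
  assumes \<Omega>: "open \<Omega>" and cover: "cone_cover \<Omega> Z r e \<rho>"
  shows "\<exists>C\<ge>0. \<forall>v. C_infinity v \<longrightarrow>
    (\<integral>\<^sup>+x. ennreal ((v x)\<^sup>2) \<partial>boundary_measure \<Omega>) \<le> ennreal C * (\<integral>\<^sup>+y. ennreal (gradient_energy v y) * indicator \<Omega> y \<partial>lborel)"
proof -
  have Z: "finite Z" "closure \<Omega> \<subseteq> (\<Union>z\<in>Z. ball z (r z))"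
    and cone: "\<And>z. z \<in> Z \<Longrightarrow> cone_at \<Omega> z (r z) (e z) \<rho>"
    using cover by (auto simp: cone_cover_def)
  let ?H = "hausdorff_measure (CARD('d) - 1) :: (real^'d) measure"
  let ?E = "\<lambda>v. \<integral>\<^sup>+y. ennreal (gradient_energy v y) * indicator \<Omega> y \<partial>lborel"
  define TP where "TP = (\<lambda>z C. C > 0 \<and> (\<forall>v. C_infinity v \<longrightarrow>
    (\<integral>\<^sup>+x. ennreal ((v x)\<^sup>2) * indicator (frontier \<Omega> \<inter> ball z (r z)) x \<partial>?H) \<le> ennreal C * ?E v))"
  have "\<exists>C. z \<in> Z \<longrightarrow> TP z C" for z
    unfolding TP_def using trace_patch[OF \<Omega> cone] by blast
  then obtain C where C: "\<And>z. z \<in> Z \<Longrightarrow> TP z (C z)" by metis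
  have C0: "0 \<le> C z" if "z \<in> Z" for z using C[OF that] by (simp add: TP_def)
  show ?thesis
  proof (intro exI[of _ "\<Sum>z\<in>Z. C z"] conjI allI impI)
    show "0 \<le> (\<Sum>z\<in>Z. C z)" by (intro sum_nonneg C0)
    fix v :: "real^'d \<Rightarrow> real" assume v: "C_infinity v"
    have [measurable]: "v \<in> borel_measurable borel" by (rule C_infinity_borel[OF v])
    have fr: "frontier \<Omega> \<in> sets borel" by (intro borel_closed) auto
    have pb: "frontier \<Omega> \<inter> ball z (r z) \<in> sets borel" for z by (intro sets.Int fr borel_open[OF open_ball])
    have "(\<integral>\<^sup>+x. ennreal ((v x)\<^sup>2) \<partial>boundary_measure \<Omega>) = (\<integral>\<^sup>+x. ennreal ((v x)\<^sup>2) * indicator (frontier \<Omega>) x \<partial>?H)"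
      unfolding boundary_measure_def using fr by (intro nn_integral_restrict_space) simp
    also have "\<dots> \<le> (\<integral>\<^sup>+x. (\<Sum>z\<in>Z. ennreal ((v x)\<^sup>2) * indicator (frontier \<Omega> \<inter> ball z (r z)) x) \<partial>?H)"
    proof (rule nn_integral_mono)
      fix x
      show "ennreal ((v x)\<^sup>2) * indicator (frontier \<Omega>) x \<le> (\<Sum>z\<in>Z. ennreal ((v x)\<^sup>2) * indicator (frontier \<Omega> \<inter> ball z (r z)) x)"
      proof (cases "x \<in> frontier \<Omega>")
        case True
        then have "x \<in> closure \<Omega>" by (simp add: frontier_def)
        then obtain z where z: "z \<in> Z" "x \<in> ball z (r z)" using Z(2) by blast
        have "ennreal ((v x)\<^sup>2) * indicator (frontier \<Omega>) x = ennreal ((v x)\<^sup>2) * indicator (frontier \<Omega> \<inter> ball z (r z)) x"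
          using True z by simp
        also have "\<dots> \<le> (\<Sum>z\<in>Z. ennreal ((v x)\<^sup>2) * indicator (frontier \<Omega> \<inter> ball z (r z)) x)"
          using Z(1) z(1) by (intro member_le_sum) auto
        finally show ?thesis .
      qed simp
    qed
    also have "\<dots> = (\<Sum>z\<in>Z. \<integral>\<^sup>+x. ennreal ((v x)\<^sup>2) * indicator (frontier \<Omega> \<inter> ball z (r z)) x \<partial>?H)"
    proof (rule nn_integral_sum)
      fix z
      have "v \<in> borel_measurable ?H" using C_infinity_borel[OF v] by (simp cong: measurable_cong_sets)
      then show "(\<lambda>x. ennreal ((v x)\<^sup>2) * indicator (frontier \<Omega> \<inter> ball z (r z)) x) \<in> borel_measurable ?H"
        using pb[of z] by (intro borel_measurable_times_ennreal borel_measurable_indicator) simp_all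
    qed
    also have "\<dots> \<le> (\<Sum>z\<in>Z. ennreal (C z) * ?E v)"
      using C v unfolding TP_def by (intro sum_mono) blast
    also have "\<dots> = ennreal (\<Sum>z\<in>Z. C z) * ?E v"
      unfolding sum_distrib_right[symmetric] by (subst sum_ennreal) (auto intro: C0)
    finally show "(\<integral>\<^sup>+x. ennreal ((v x)\<^sup>2) \<partial>boundary_measure \<Omega>) \<le> ennreal (\<Sum>z\<in>Z. C z) * ?E v" .
  qed
qed

subsection \<open>Sobolev distance to a smooth function\<close>

lemma L2_diff:
  assumes "f \<in> L2 M" "g \<in> L2 M" shows "(\<lambda>x. f x - g x) \<in> L2 M"
proof -
  have [measurable]: "f \<in> borel_measurable M" "g \<in> borel_measurable M" using assms by (auto simp: L2_def)
  have "integrable M (\<lambda>x. (f x)\<^sup>2 + (g x)\<^sup>2 - 2 * (f x * g x))"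
    using assms integrable_mult_sq[of f M g] by (auto simp: L2_def)
  then show ?thesis by (simp add: L2_def power2_diff mult.assoc)
qed

lemma L2_norm_le:
  assumes f: "f \<in> borel_measurable M" and le: "(\<integral>\<^sup>+x. ennreal ((f x)\<^sup>2) \<partial>M) \<le> ennreal c" and c: "0 \<le> c"
  shows "f \<in> L2 M" "(L2_norm M f)\<^sup>2 \<le> c"
proof -
  have "(\<integral>\<^sup>+x. ennreal ((f x)\<^sup>2) \<partial>M) < \<infinity>" using le by (simp add: le_less_trans)
  then have int: "integrable M (\<lambda>x. (f x)\<^sup>2)" using integrable_sq_iff[OF f] by blast
  with f show "f \<in> L2 M" by (simp add: L2_def)
  have "ennreal (\<integral>x. (f x)\<^sup>2 \<partial>M) \<le> ennreal c" using le nn_integral_eq_integral[OF int] by simp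
  then show "(L2_norm M f)\<^sup>2 \<le> c" using c by (simp add: L2_norm_def)
qed

lemma nn_integral_lebesgue_on:
  fixes h :: "'a::euclidean_space \<Rightarrow> ennreal"
  assumes \<Omega>: "\<Omega> \<in> sets borel" and h[measurable]: "h \<in> borel_measurable borel"
  shows "(\<integral>\<^sup>+x. h x \<partial>lebesgue_on \<Omega>) = (\<integral>\<^sup>+x. h x * indicator \<Omega> x \<partial>lborel)"
proof -
  have "(\<integral>\<^sup>+x. h x \<partial>lebesgue_on \<Omega>) = (\<integral>\<^sup>+x. h x * indicator \<Omega> x \<partial>lebesgue)"
    using \<Omega> by (intro nn_integral_restrict_space) simp
  also have "\<dots> = (\<integral>\<^sup>+x. h x * indicator \<Omega> x \<partial>lborel)"
    using \<Omega> by (intro nn_integral_completion) measurable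
  finally show ?thesis .
qed

lemma is_weak_deriv_diff:
  fixes u v :: "real^'d::finite \<Rightarrow> real"
  assumes \<Omega>: "open \<Omega>" "bounded \<Omega>" and u: "u \<in> L2 (lebesgue_on \<Omega>)" "is_weak_deriv \<Omega> w u a"
    and v: "v \<in> L2 (lebesgue_on \<Omega>)" "is_weak_deriv \<Omega> w v b"
  shows "is_weak_deriv \<Omega> w (\<lambda>x. u x - v x) (\<lambda>x. a x - b x)"
  unfolding is_weak_deriv_def
proof (intro conjI allI impI)
  have ab: "a \<in> L2 (lebesgue_on \<Omega>)" "b \<in> L2 (lebesgue_on \<Omega>)" using u(2) v(2) by (auto simp: is_weak_deriv_def)
  then show "(\<lambda>x. a x - b x) \<in> L2 (lebesgue_on \<Omega>)" by (rule L2_diff)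
  fix \<phi> assume \<phi>: "test_function \<Omega> \<phi>"
  have test: "partials w' \<phi> \<in> L2 (lebesgue_on \<Omega>)" for w'
    using \<phi> by (intro L2_rep_smooth(2) \<Omega> C_infinity_partials) (simp add: test_function_def)
  have int: "integrable (lebesgue_on \<Omega>) (\<lambda>x. h x * partials w' \<phi> x)" if "h \<in> L2 (lebesgue_on \<Omega>)" for h w'
    using that test[of w'] by (intro integrable_mult_sq) (auto simp: L2_def)
  have "(\<integral>x. (u x - v x) * partials w \<phi> x \<partial>lebesgue_on \<Omega>)
      = (\<integral>x. u x * partials w \<phi> x \<partial>lebesgue_on \<Omega>) - (\<integral>x. v x * partials w \<phi> x \<partial>lebesgue_on \<Omega>)"
    using int[OF u(1)] int[OF v(1)] by (simp add: left_diff_distrib)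
  also have "\<dots> = (-1) ^ length w * (\<integral>x. a x * \<phi> x \<partial>lebesgue_on \<Omega>) - (-1) ^ length w * (\<integral>x. b x * \<phi> x \<partial>lebesgue_on \<Omega>)"
    using u(2)[unfolded is_weak_deriv_def, THEN conjunct2, rule_format, OF \<phi>]
      v(2)[unfolded is_weak_deriv_def, THEN conjunct2, rule_format, OF \<phi>] by simp
  also have "\<dots> = (-1) ^ length w * (\<integral>x. (a x - b x) * \<phi> x \<partial>lebesgue_on \<Omega>)"
    using int[OF ab(1), of "[]"] int[OF ab(2), of "[]"] by (simp add: left_diff_distrib right_diff_distrib)
  finally show "(\<integral>x. (u x - v x) * partials w \<phi> x \<partial>lebesgue_on \<Omega>) = (-1) ^ length w * (\<integral>x. (a x - b x) * \<phi> x \<partial>lebesgue_on \<Omega>)" .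
qed

lemma is_weak_deriv_weak_deriv:
  "is_weak_deriv \<Omega> w u v \<Longrightarrow> is_weak_deriv \<Omega> w u (weak_deriv \<Omega> w u)"
  unfolding weak_deriv_def by (rule someI[of "is_weak_deriv \<Omega> w u" v])

text \<open>\<open>weak_deriv\<close> is an arbitrary choice; by uniqueness it agrees almost
  everywhere with any known weak derivative, whose representative therefore serves for it as
  well.\<close>

lemma weak_deriv_AE:
  fixes u :: "real^'d::finite \<Rightarrow> real"
  assumes \<Omega>: "open \<Omega>" and d: "is_weak_deriv \<Omega> w u v" and r: "L2_rep \<Omega> v g"
  shows "AE x in lebesgue_on \<Omega>. weak_deriv \<Omega> w u x = g x" "L2_rep \<Omega> (weak_deriv \<Omega> w u) g"
proof -
  have \<Omega>b: "\<Omega> \<in> sets borel" using \<Omega> by simp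
  have wd: "is_weak_deriv \<Omega> w u (weak_deriv \<Omega> w u)" by (rule is_weak_deriv_weak_deriv[OF d])
  then have "weak_deriv \<Omega> w u \<in> L2 (lebesgue_on \<Omega>)" by (simp add: is_weak_deriv_def)
  from L2_rep_exists[OF \<Omega>b this] obtain h where h: "L2_rep \<Omega> (weak_deriv \<Omega> w u) h" ..
  have "AE x in lborel. h x = g x" by (rule weak_deriv_unique[OF \<Omega> wd d h r])
  then have "AE x in lebesgue_on \<Omega>. h x = g x" by (intro AE_lebesgue_on_lborel[OF \<Omega>b]) auto
  with L2_repD(3)[OF h] show ae: "AE x in lebesgue_on \<Omega>. weak_deriv \<Omega> w u x = g x" by eventually_elim simp
  then show "L2_rep \<Omega> (weak_deriv \<Omega> w u) g" using L2_repD(1,2,4)[OF r] by (simp add: L2_rep_def)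
qed

definition sq_error :: "(real^'d::finite) set \<Rightarrow> ('d list \<Rightarrow> real^'d \<Rightarrow> real) \<Rightarrow> (real^'d \<Rightarrow> real) \<Rightarrow> 'd list \<Rightarrow> ennreal" where
  "sq_error \<Omega> G v w = (\<integral>\<^sup>+x. ennreal ((G w x - partials w v x)\<^sup>2) * indicator \<Omega> x \<partial>lborel)"

text \<open>The assumption \<open>sym\<close> appears because integration by parts identifies the
  weak derivative of a smooth function for \<open>w\<close> with the classical one for
  \<open>rev w\<close>.\<close>

lemma Hk_norm_diff_smooth:
  fixes u v :: "real^'d::finite \<Rightarrow> real"
  assumes \<Omega>: "open \<Omega>" "bounded \<Omega>" and u: "u \<in> Hk k \<Omega>" and v: "C_infinity v"
    and sym: "\<And>w. length w \<le> k \<Longrightarrow> partials (rev w) v = partials w v"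
    and G: "\<And>w. length w \<le> k \<Longrightarrow> L2_rep \<Omega> (weak_deriv \<Omega> w u) (G w)"
  shows "ennreal ((Hk_norm k \<Omega> (\<lambda>x. u x - v x))\<^sup>2) = (\<Sum>w\<in>{w. length w \<le> k}. sq_error \<Omega> G v w)"
proof -
  have \<Omega>b[measurable]: "\<Omega> \<in> sets borel" using \<Omega> by simp
  have "ennreal ((L2_norm (lebesgue_on \<Omega>) (weak_deriv \<Omega> w (\<lambda>x. u x - v x)))\<^sup>2) = sq_error \<Omega> G v w"
    if w: "length w \<le> k" for w
  proof -
    have du: "is_weak_deriv \<Omega> w u (weak_deriv \<Omega> w u)"
      using u w is_weak_deriv_weak_deriv unfolding Hk_def by blast
    have dv: "is_weak_deriv \<Omega> w v (partials w v)"
      using is_weak_deriv_smooth[OF \<Omega> v, of w] sym[OF w] by simp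
    have uL: "u \<in> L2 (lebesgue_on \<Omega>)" using u by (simp add: Hk_def)
    note d = is_weak_deriv_diff[OF \<Omega> uL du L2_rep_smooth(2)[OF \<Omega> v] dv]
    have r: "L2_rep \<Omega> (\<lambda>x. weak_deriv \<Omega> w u x - partials w v x) (\<lambda>x. G w x - indicator \<Omega> x * partials w v x)"
      by (rule L2_rep_diff[OF G[OF w] L2_rep_smooth(1)[OF \<Omega> C_infinity_partials[OF v]]])
    note rd = weak_deriv_AE(2)[OF \<Omega>(1) d r]
    have m: "weak_deriv \<Omega> w (\<lambda>x. u x - v x) \<in> borel_measurable (lebesgue_on \<Omega>)"
      using is_weak_deriv_weak_deriv[OF d] by (simp add: is_weak_deriv_def L2_def)
    have "ennreal ((L2_norm (lebesgue_on \<Omega>) (weak_deriv \<Omega> w (\<lambda>x. u x - v x)))\<^sup>2)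
        = ennreal (\<integral>x. (G w x - indicator \<Omega> x * partials w v x)\<^sup>2 \<partial>lborel)"
      unfolding L2_norm_rep[OF \<Omega>b m rd] ..
    also have "\<dots> = (\<integral>\<^sup>+x. ennreal ((G w x - indicator \<Omega> x * partials w v x)\<^sup>2) \<partial>lborel)"
      by (rule nn_integral_eq_integral[symmetric, OF L2_repD(5)[OF rd]]) simp
    also have "\<dots> = sq_error \<Omega> G v w"
      unfolding sq_error_def using L2_repD(2)[OF G[OF w]] by (intro nn_integral_cong) (auto simp: indicator_def)
    finally show ?thesis .
  qed
  then show ?thesis
    unfolding Hk_norm_def by (simp add: sum_nonneg sum_ennreal[symmetric])
qed

lemma sq_error_triangle:
  assumes [measurable]: "G w \<in> borel_measurable borel" "\<Omega> \<in> sets borel" and v: "C_infinity v" "C_infinity v'"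
  shows "(\<integral>\<^sup>+x. ennreal ((partials w v x - partials w v' x)\<^sup>2) * indicator \<Omega> x \<partial>lborel) \<le> 2 * sq_error \<Omega> G v w + 2 * sq_error \<Omega> G v' w"
    "sq_error \<Omega> G v w \<le> 2 * sq_error \<Omega> G v' w + 2 * (\<integral>\<^sup>+x. ennreal ((partials w v' x - partials w v x)\<^sup>2) * indicator \<Omega> x \<partial>lborel)"
proof -
  have [measurable]: "partials w v \<in> borel_measurable borel" "partials w v' \<in> borel_measurable borel"
    using v by (auto intro: C_infinity_borel C_infinity_partials)
  have *: "(\<integral>\<^sup>+x. ennreal ((a x + b x)\<^sup>2) * indicator \<Omega> x \<partial>lborel) \<le> 2 * (\<integral>\<^sup>+x. ennreal ((a x)\<^sup>2) * indicator \<Omega> x \<partial>lborel) + 2 * (\<integral>\<^sup>+x. ennreal ((b x)\<^sup>2) * indicator \<Omega> x \<partial>lborel)"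
    if [measurable]: "a \<in> borel_measurable borel" "b \<in> borel_measurable borel" for a b :: "real^'a \<Rightarrow> real"
  proof -
    have "(\<integral>\<^sup>+x. ennreal ((a x + b x)\<^sup>2) * indicator \<Omega> x \<partial>lborel) \<le> (\<integral>\<^sup>+x. 2 * (ennreal ((a x)\<^sup>2) * indicator \<Omega> x) + 2 * (ennreal ((b x)\<^sup>2) * indicator \<Omega> x) \<partial>lborel)"
      by (intro nn_integral_mono) (auto simp: indicator_def intro: ennreal_sq_add_le)
    then show ?thesis by (simp add: nn_integral_add nn_integral_cmult)
  qed
  have "(\<integral>\<^sup>+x. ennreal ((partials w v x - partials w v' x)\<^sup>2) * indicator \<Omega> x \<partial>lborel)
    = (\<integral>\<^sup>+x. ennreal ((- (G w x - partials w v x) + (G w x - partials w v' x))\<^sup>2) * indicator \<Omega> x \<partial>lborel)" by simp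
  also have "\<dots> \<le> 2 * (\<integral>\<^sup>+x. ennreal ((- (G w x - partials w v x))\<^sup>2) * indicator \<Omega> x \<partial>lborel) + 2 * (\<integral>\<^sup>+x. ennreal ((G w x - partials w v' x)\<^sup>2) * indicator \<Omega> x \<partial>lborel)"
    by (rule *) measurable
  also have "\<dots> = 2 * sq_error \<Omega> G v w + 2 * sq_error \<Omega> G v' w" by (simp add: sq_error_def power2_commute)
  finally show "(\<integral>\<^sup>+x. ennreal ((partials w v x - partials w v' x)\<^sup>2) * indicator \<Omega> x \<partial>lborel) \<le> 2 * sq_error \<Omega> G v w + 2 * sq_error \<Omega> G v' w" .
  have "sq_error \<Omega> G v w = (\<integral>\<^sup>+x. ennreal (((G w x - partials w v' x) + (partials w v' x - partials w v x))\<^sup>2) * indicator \<Omega> x \<partial>lborel)"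
    by (simp add: sq_error_def)
  also have "\<dots> \<le> 2 * sq_error \<Omega> G v' w + 2 * (\<integral>\<^sup>+x. ennreal ((partials w v' x - partials w v x)\<^sup>2) * indicator \<Omega> x \<partial>lborel)"
    unfolding sq_error_def by (rule *) measurable
  finally show "sq_error \<Omega> G v w \<le> 2 * sq_error \<Omega> G v' w + 2 * (\<integral>\<^sup>+x. ennreal ((partials w v' x - partials w v x)\<^sup>2) * indicator \<Omega> x \<partial>lborel)" .
qed

subsection \<open>Networks close to a Sobolev function\<close>

lemma network_smooth:
  assumes "smooth \<sigma>"
  shows "C_infinity (\<lambda>x. rcomb \<sigma> L x + \<beta>)"
    "partials (rev w) (\<lambda>x. rcomb \<sigma> L x + \<beta>) = partials w (\<lambda>x. rcomb \<sigma> L x + \<beta>)"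
proof -
  show "C_infinity (\<lambda>x. rcomb \<sigma> L x + \<beta>)" by (rule C_infinity_add[OF C_infinity_rcomb[OF assms] C_infinity_const])
  show "partials (rev w) (\<lambda>x. rcomb \<sigma> L x + \<beta>) = partials w (\<lambda>x. rcomb \<sigma> L x + \<beta>)"
    unfolding partials_add[OF C_infinity_rcomb[OF assms] C_infinity_const] partials_rcomb_rev[OF assms] partials_const by simp
qed

lemma network_sobolev_dense:
  fixes \<Omega> :: "(real^'d::finite) set" and G :: "'d list \<Rightarrow> real^'d \<Rightarrow> real"
  assumes \<Omega>: "open \<Omega>" "bounded \<Omega>" and cover: "cone_cover \<Omega> Z r e \<rho>"
    and G: "\<And>w. length w \<le> 2 \<Longrightarrow> sq_int (G w)" "\<And>w x. length w \<le> 2 \<Longrightarrow> x \<notin> \<Omega> \<Longrightarrow> G w x = 0"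
    and ibp: "\<And>w \<phi>. length w \<le> 2 \<Longrightarrow> test_function \<Omega> \<phi> \<Longrightarrow>
      (\<integral>x. G [] x * partials w \<phi> x \<partial>lborel) = (-1) ^ length w * (\<integral>x. G w x * \<phi> x \<partial>lborel)"
    and \<sigma>: "smooth \<sigma>" "\<And>n. \<exists>b. (deriv ^^ n) \<sigma> b \<noteq> 0" and "\<eta> > 0"
  shows "\<exists>L \<beta>. \<forall>w. length w \<le> 2 \<longrightarrow> sq_error \<Omega> G (\<lambda>x. rcomb \<sigma> L x + \<beta>) w \<le> ennreal \<eta>"
proof -
  have \<Omega>b[measurable]: "\<Omega> \<in> sets borel" using \<Omega> by simp
  have e4: "\<eta> / 4 > 0" using \<open>\<eta> > 0\<close> by simp
  obtain P where P: "\<forall>w. length w \<le> 2 \<longrightarrow>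
    (\<integral>\<^sup>+x. ennreal ((G w x - partials w (rcomb exp P) x)\<^sup>2) * indicator \<Omega> x \<partial>lborel) \<le> ennreal (\<eta> / 4)"
    using sobolev_approximation[OF \<Omega> cover G ibp e4] by blast
  obtain R where R: "\<forall>x\<in>\<Omega>. norm x \<le> R" "R > 0" using \<Omega>(2) bounded_pos by blast
  define vol where "vol = measure lborel \<Omega>"
  have vol: "emeasure lborel \<Omega> = ennreal vol" "vol \<ge> 0"
    using emeasure_bounded_finite[OF \<Omega>(2)] by (auto simp: vol_def emeasure_eq_ennreal_measure)
  \<comment> \<open>A uniform error \<open>a\<close> on \<Omega> contributes at most
    \<open>a\<^sup>2 * vol \<le> \<eta> / 4\<close>; with the error \<open>\<eta> / 4\<close> of the
    exponential sum, the triangle inequality gives \<open>\<eta>\<close>.\<close>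
  define a where "a = sqrt (\<eta> / (4 * (vol + 1)))"
  have a: "a > 0" using \<open>\<eta> > 0\<close> vol by (simp add: a_def)
  obtain L \<beta> where L: "\<forall>w x. length w \<le> 2 \<longrightarrow> norm x \<le> R \<longrightarrow>
    \<bar>partials w (rcomb exp P) x - partials w (\<lambda>x. rcomb \<sigma> L x + \<beta>) x\<bar> \<le> a"
    using network_dense_exp[OF \<sigma> a, of R P] R(2) by auto
  have "sq_error \<Omega> G (\<lambda>x. rcomb \<sigma> L x + \<beta>) w \<le> ennreal \<eta>" if w: "length w \<le> 2" for w
  proof -
    have "(\<integral>\<^sup>+x. ennreal ((partials w (rcomb exp P) x - partials w (\<lambda>x. rcomb \<sigma> L x + \<beta>) x)\<^sup>2) * indicator \<Omega> x \<partial>lborel)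
        \<le> (\<integral>\<^sup>+x. ennreal (a\<^sup>2) * indicator \<Omega> x \<partial>lborel)"
    proof (rule nn_integral_mono)
      fix x
      show "ennreal ((partials w (rcomb exp P) x - partials w (\<lambda>x. rcomb \<sigma> L x + \<beta>) x)\<^sup>2) * indicator \<Omega> x \<le> ennreal (a\<^sup>2) * indicator \<Omega> x"
      proof (cases "x \<in> \<Omega>")
        case True
        then have "\<bar>partials w (rcomb exp P) x - partials w (\<lambda>x. rcomb \<sigma> L x + \<beta>) x\<bar> \<le> a" using L w R by blast
        from power_mono[OF this, of 2] show ?thesis using True by (simp add: ennreal_leI)
      qed simp
    qed
    also have "\<dots> = ennreal (a\<^sup>2 * vol)" using vol by (subst nn_integral_cmult_indicator) (auto simp: ennreal_mult)
    also have "\<dots> \<le> ennreal (\<eta> / 4)"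
    proof (rule ennreal_leI)
      have asq: "a\<^sup>2 = \<eta> / (4 * (vol + 1))" using \<open>\<eta> > 0\<close> vol by (simp add: a_def)
      have q: "\<eta> / (4 * c) * v \<le> \<eta> / 4" if "0 \<le> v" "v \<le> c" "c > 0" for v c
        using that \<open>\<eta> > 0\<close> by (simp add: field_simps)
      show "a\<^sup>2 * vol \<le> \<eta> / 4" unfolding asq by (rule q) (use vol(2) in auto)
    qed
    finally have 1: "(\<integral>\<^sup>+x. ennreal ((partials w (rcomb exp P) x - partials w (\<lambda>x. rcomb \<sigma> L x + \<beta>) x)\<^sup>2) * indicator \<Omega> x \<partial>lborel) \<le> ennreal (\<eta> / 4)" .
    have "sq_error \<Omega> G (\<lambda>x. rcomb \<sigma> L x + \<beta>) w \<le> 2 * sq_error \<Omega> G (rcomb exp P) w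
        + 2 * (\<integral>\<^sup>+x. ennreal ((partials w (rcomb exp P) x - partials w (\<lambda>x. rcomb \<sigma> L x + \<beta>) x)\<^sup>2) * indicator \<Omega> x \<partial>lborel)"
      by (rule sq_error_triangle(2)[where G = G and w = w and v' = "rcomb exp P", OF sq_intD(1)[OF G(1)[OF w]] \<Omega>b network_smooth(1)[OF \<sigma>(1)] C_infinity_rcomb[OF smooth_exp]])
    also have "\<dots> \<le> 2 * ennreal (\<eta> / 4) + 2 * ennreal (\<eta> / 4)"
      using P w 1 by (intro add_mono mult_left_mono) (auto simp: sq_error_def)
    also have "\<dots> = ennreal \<eta>" using ennreal_calc(1)[of "\<eta> / 4"] \<open>\<eta> > 0\<close> by simp
    finally show ?thesis .
  qed
  then show ?thesis by blast
qed

text \<open>The bound for smooth functions passes to \<open>u\<close> because the part of \<open>\<bar>u - v\<bar>\<close> above the bound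
  is dominated by the \<open>L\<^sup>2\<close> distance of \<open>u\<close> to arbitrarily good smooth approximations.\<close>

lemma sobolev_sup_error:
  fixes \<Omega> :: "(real^'d::finite) set" and G :: "'d list \<Rightarrow> real^'d \<Rightarrow> real"
  assumes \<Omega>: "open \<Omega>" and G: "\<And>w. length w \<le> 2 \<Longrightarrow> G w \<in> borel_measurable borel"
    and sup: "\<And>v x. C_infinity v \<Longrightarrow> x \<in> \<Omega> \<Longrightarrow> ennreal ((v x)\<^sup>2) \<le> ennreal C * sobolev_energy 2 \<Omega> v" and "C \<ge> 0"
    and dense: "\<And>\<eta>. \<eta> > 0 \<Longrightarrow> \<exists>v. C_infinity v \<and> (\<forall>w. length w \<le> 2 \<longrightarrow> sq_error \<Omega> G v w \<le> ennreal \<eta>)"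
    and v: "C_infinity v" "\<And>w. length w \<le> 2 \<Longrightarrow> sq_error \<Omega> G v w \<le> ennreal \<eta>" and "\<eta> > 0"
  shows "AE x in lborel. x \<in> \<Omega> \<longrightarrow> (G [] x - v x)\<^sup>2 \<le> 4 * C * card {w :: 'd list. length w \<le> 2} * \<eta>"
proof -
  let ?W = "{w :: 'd list. length w \<le> 2}"
  have \<Omega>b[measurable]: "\<Omega> \<in> sets borel" using \<Omega> by simp
  have [measurable]: "v \<in> borel_measurable borel" "G [] \<in> borel_measurable borel"
    using C_infinity_borel[OF v(1)] G by auto
  \<comment> \<open>The factor \<open>4\<close>: the difference of two functions of squared error at
    most \<open>\<eta>\<close> has squared norm at most \<open>2 * \<eta> + 2 * \<eta>\<close>, for
    each of the \<open>card ?W\<close> words.\<close>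
  define \<kappa> where "\<kappa> = sqrt (4 * C * card ?W * \<eta>)"
  have \<kappa>: "\<kappa> \<ge> 0" "\<kappa>\<^sup>2 = 4 * C * card ?W * \<eta>" using \<open>C \<ge> 0\<close> \<open>\<eta> > 0\<close> by (auto simp: \<kappa>_def)
  define h where "h = (\<lambda>x. indicator \<Omega> x * max 0 (\<bar>G [] x - v x\<bar> - \<kappa>))"
  have hm[measurable]: "h \<in> borel_measurable borel" unfolding h_def by measurable
  have small: "(\<integral>\<^sup>+x. ennreal ((h x)\<^sup>2) \<partial>lborel) \<le> ennreal a" if "a > 0" for a
  proof -
    have a': "min a \<eta> > 0" using that \<open>\<eta> > 0\<close> by simp
    obtain v' where v': "C_infinity v'" "\<And>w. length w \<le> 2 \<Longrightarrow> sq_error \<Omega> G v' w \<le> ennreal (min a \<eta>)"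
      using dense[OF a'] by blast
    have diff: "(v' x - v x)\<^sup>2 \<le> \<kappa>\<^sup>2" if x: "x \<in> \<Omega>" for x
    proof -
      have "ennreal ((v' x - v x)\<^sup>2) \<le> ennreal C * sobolev_energy 2 \<Omega> (\<lambda>x. v' x - v x)"
        by (rule sup[OF C_infinity_diff[OF v'(1) v(1)] x])
      also have "sobolev_energy 2 \<Omega> (\<lambda>x. v' x - v x) \<le> (\<Sum>w\<in>?W. ennreal (4 * \<eta>))"
        unfolding sobolev_energy_def
      proof (rule sum_mono)
        fix w assume "w \<in> ?W"
        then have w: "length w \<le> 2" by simp
        have "(\<integral>\<^sup>+y. ennreal ((partials w (\<lambda>x. v' x - v x) y)\<^sup>2) * indicator \<Omega> y \<partial>lborel)
          \<le> 2 * sq_error \<Omega> G v' w + 2 * sq_error \<Omega> G v w"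
          unfolding partials_diff[OF v'(1) v(1)] by (rule sq_error_triangle(1)[where G = G and w = w, OF G[OF w] \<Omega>b v'(1) v(1)])
        also have "\<dots> \<le> 2 * ennreal \<eta> + 2 * ennreal \<eta>"
        proof -
          have "sq_error \<Omega> G v' w \<le> ennreal \<eta>" by (rule order_trans[OF v'(2)[OF w]]) (rule ennreal_leI, simp)
          then show ?thesis using v(2)[OF w] by (intro add_mono mult_left_mono) auto
        qed
        also have "\<dots> = ennreal (4 * \<eta>)" using ennreal_calc(1)[of \<eta>] \<open>\<eta> > 0\<close> by simp
        finally show "(\<integral>\<^sup>+y. ennreal ((partials w (\<lambda>x. v' x - v x) y)\<^sup>2) * indicator \<Omega> y \<partial>lborel) \<le> ennreal (4 * \<eta>)" .
      qed
      also have "(\<Sum>w\<in>?W. ennreal (4 * \<eta>)) = ennreal (card ?W * (4 * \<eta>))"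
        using \<open>\<eta> > 0\<close> by (simp add: ennreal_of_nat_eq_real_of_nat ennreal_mult)
      also have "ennreal C * ennreal (card ?W * (4 * \<eta>)) = ennreal (\<kappa>\<^sup>2)"
        using \<open>C \<ge> 0\<close> \<open>\<eta> > 0\<close> by (simp add: \<kappa>(2) ennreal_mult[symmetric] mult_ac)
      finally show ?thesis by (simp add: mult_left_mono)
    qed
    have "(\<integral>\<^sup>+x. ennreal ((h x)\<^sup>2) \<partial>lborel) \<le> sq_error \<Omega> G v' []"
      unfolding sq_error_def
    proof (rule nn_integral_mono)
      fix x
      show "ennreal ((h x)\<^sup>2) \<le> ennreal ((G [] x - partials [] v' x)\<^sup>2) * indicator \<Omega> x"
      proof (cases "x \<in> \<Omega>")
        case True
        have "\<bar>v' x - v x\<bar> \<le> \<kappa>" using diff[OF True] \<kappa>(1) by (metis abs_le_square_iff abs_of_nonneg)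
        then have "\<bar>h x\<bar> \<le> \<bar>G [] x - v' x\<bar>" using True by (simp add: h_def)
        then have "(h x)\<^sup>2 \<le> (G [] x - v' x)\<^sup>2" by (simp add: abs_le_square_iff)
        then show ?thesis using True by (simp add: ennreal_leI)
      qed (simp add: h_def)
    qed
    also have "\<dots> \<le> ennreal (min a \<eta>)" by (rule v'(2)) simp
    also have "\<dots> \<le> ennreal a" by (rule ennreal_leI) simp
    finally show ?thesis .
  qed
  have "(\<integral>\<^sup>+x. ennreal ((h x)\<^sup>2) \<partial>lborel) \<le> 0"
    by (rule ennreal_le_epsilon) (use small in simp)
  then have "(\<integral>\<^sup>+x. ennreal ((h x)\<^sup>2) \<partial>lborel) = 0" by simp
  then have "AE x in lborel. h x = 0" by (subst (asm) nn_integral_0_iff_AE) auto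
  then show ?thesis
  proof eventually_elim
    fix x assume hx: "h x = 0"
    show "x \<in> \<Omega> \<longrightarrow> (G [] x - v x)\<^sup>2 \<le> 4 * C * card ?W * \<eta>"
    proof
      assume "x \<in> \<Omega>"
      then have "\<bar>G [] x - v x\<bar> \<le> \<kappa>" using hx by (simp add: h_def max_def split: if_splits)
      then show "(G [] x - v x)\<^sup>2 \<le> 4 * C * card ?W * \<eta>" unfolding \<kappa>(2)[symmetric]
        using power_mono[of "\<bar>G [] x - v x\<bar>" \<kappa> 2] by simp
    qed
  qed
qed

lemma boundary_error:
  fixes \<Omega> :: "(real^'d::finite) set" and G :: "'d list \<Rightarrow> real^'d \<Rightarrow> real"
  assumes \<Omega>: "open \<Omega>" "bounded \<Omega>" and u: "u \<in> H10 \<Omega>"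
    and G: "\<And>w. length w \<le> 1 \<Longrightarrow> L2_rep \<Omega> (weak_deriv \<Omega> w u) (G w)"
    and trace: "\<And>v. C_infinity v \<Longrightarrow> (\<integral>\<^sup>+x. ennreal ((v x)\<^sup>2) \<partial>boundary_measure \<Omega>)
      \<le> ennreal C * (\<integral>\<^sup>+y. ennreal (gradient_energy v y) * indicator \<Omega> y \<partial>lborel)" and "C \<ge> 0"
    and v: "C_infinity v" "\<And>w. length w \<le> 1 \<Longrightarrow> sq_error \<Omega> G v w \<le> ennreal \<eta>" and "\<eta> > 0"
  shows "(\<integral>\<^sup>+x. ennreal ((v x)\<^sup>2) \<partial>boundary_measure \<Omega>) \<le> ennreal (4 * C * (1 + CARD('d)) * \<eta>)"
proof -
  have \<Omega>b[measurable]: "\<Omega> \<in> sets borel" using \<Omega> by simp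
  obtain \<phi> where \<phi>: "\<And>n::nat. test_function \<Omega> (\<phi> n)" "(\<lambda>n. Hk_norm 1 \<Omega> (\<lambda>x. u x - \<phi> n x)) \<longlonglongrightarrow> 0"
    and u1: "u \<in> Hk 1 \<Omega>" using u unfolding H10_def by blast
  have "(\<lambda>n. (Hk_norm 1 \<Omega> (\<lambda>x. u x - \<phi> n x))\<^sup>2) \<longlonglongrightarrow> 0\<^sup>2" by (intro tendsto_intros \<phi>(2))
  then have "\<forall>\<^sub>F n in sequentially. (Hk_norm 1 \<Omega> (\<lambda>x. u x - \<phi> n x))\<^sup>2 < \<eta>"
    using \<open>\<eta> > 0\<close> by (intro order_tendstoD(2)) auto
  then obtain n where n: "(Hk_norm 1 \<Omega> (\<lambda>x. u x - \<phi> n x))\<^sup>2 < \<eta>" by (auto simp: eventually_sequentially)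
  let ?\<phi> = "\<phi> n"
  have C\<phi>: "C_infinity ?\<phi>" using \<phi>(1) by (simp add: test_function_def)
  \<comment> \<open>Words of length at most one equal their reversal, so the formula for the norm of
    the error applies to an arbitrary test function.\<close>
  have sym: "partials (rev w) ?\<phi> = partials w ?\<phi>" if "length w \<le> 1" for w
    using that by (cases w) auto
  have E\<phi>: "sq_error \<Omega> G ?\<phi> w \<le> ennreal \<eta>" if "length w \<le> 1" for w
  proof -
    have "sq_error \<Omega> G ?\<phi> w \<le> (\<Sum>w\<in>{w. length w \<le> 1}. sq_error \<Omega> G ?\<phi> w)"
      using that by (intro member_le_sum finite_words) auto
    also have "\<dots> = ennreal ((Hk_norm 1 \<Omega> (\<lambda>x. u x - ?\<phi> x))\<^sup>2)"
      by (rule Hk_norm_diff_smooth[OF \<Omega> u1 C\<phi> sym G, symmetric])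
    also have "\<dots> \<le> ennreal \<eta>" using n by (intro ennreal_leI) simp
    finally show ?thesis .
  qed
  define d where "d = (\<lambda>x. v x - ?\<phi> x)"
  have Cd: "C_infinity d" unfolding d_def by (rule C_infinity_diff[OF v(1) C\<phi>])
  have dw: "(\<integral>\<^sup>+y. ennreal ((partials w d y)\<^sup>2) * indicator \<Omega> y \<partial>lborel) \<le> ennreal (4 * \<eta>)" if w: "length w \<le> 1" for w
  proof -
    have "(\<integral>\<^sup>+y. ennreal ((partials w d y)\<^sup>2) * indicator \<Omega> y \<partial>lborel) \<le> 2 * sq_error \<Omega> G v w + 2 * sq_error \<Omega> G ?\<phi> w"
      unfolding d_def partials_diff[OF v(1) C\<phi>] by (rule sq_error_triangle(1)[where G = G and w = w, OF L2_repD(1)[OF G[OF w]] \<Omega>b v(1) C\<phi>])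
    also have "\<dots> \<le> 2 * ennreal \<eta> + 2 * ennreal \<eta>"
      using v(2)[OF w] E\<phi>[OF w] by (intro add_mono mult_left_mono) auto
    also have "\<dots> = ennreal (4 * \<eta>)" using ennreal_calc(1)[of \<eta>] \<open>\<eta> > 0\<close> by simp
    finally show ?thesis .
  qed
  have dm[measurable]: "partials w d \<in> borel_measurable borel" for w by (intro C_infinity_borel C_infinity_partials Cd)
  have "(\<integral>\<^sup>+y. ennreal (gradient_energy d y) * indicator \<Omega> y \<partial>lborel)
    = (\<integral>\<^sup>+y. ennreal ((partials [] d y)\<^sup>2) * indicator \<Omega> y + (\<Sum>i\<in>UNIV. ennreal ((partials [i] d y)\<^sup>2) * indicator \<Omega> y) \<partial>lborel)"
    unfolding gradient_energy_def
    by (intro nn_integral_cong) (auto simp: indicator_def ennreal_plus[OF _ sum_nonneg] sum_ennreal)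
  also have "\<dots> = (\<integral>\<^sup>+y. ennreal ((partials [] d y)\<^sup>2) * indicator \<Omega> y \<partial>lborel)
    + (\<Sum>i\<in>UNIV. \<integral>\<^sup>+y. ennreal ((partials [i] d y)\<^sup>2) * indicator \<Omega> y \<partial>lborel)"
    by (subst nn_integral_add, measurable, measurable) (subst nn_integral_sum, measurable)
  also have "\<dots> \<le> ennreal (4 * \<eta>) + (\<Sum>i\<in>(UNIV::'d set). ennreal (4 * \<eta>))"
    by (intro add_mono sum_mono dw) auto
  also have "\<dots> = ennreal ((1 + CARD('d)) * (4 * \<eta>))"
    using \<open>\<eta> > 0\<close> by (simp add: ennreal_of_nat_eq_real_of_nat ennreal_mult[symmetric] ennreal_plus[symmetric] distrib_right del: ennreal_plus)
  finally have e: "(\<integral>\<^sup>+y. ennreal (gradient_energy d y) * indicator \<Omega> y \<partial>lborel) \<le> ennreal ((1 + CARD('d)) * (4 * \<eta>))" .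
  have "(\<integral>\<^sup>+x. ennreal ((v x)\<^sup>2) \<partial>boundary_measure \<Omega>) = (\<integral>\<^sup>+x. ennreal ((d x)\<^sup>2) \<partial>boundary_measure \<Omega>)"
  proof (rule nn_integral_cong)
    fix x assume "x \<in> space (boundary_measure \<Omega>)"
    then have "x \<in> frontier \<Omega>" by (simp add: boundary_measure_def space_restrict_space)
    then have "x \<notin> \<Omega>" using \<Omega>(1) by (simp add: frontier_def interior_open)
    then have "?\<phi> x = 0" using test_function_zero(1)[OF \<phi>(1), of x "[]"] by simp
    then show "ennreal ((v x)\<^sup>2) = ennreal ((d x)\<^sup>2)" by (simp add: d_def)
  qed
  also have "\<dots> \<le> ennreal C * ennreal ((1 + CARD('d)) * (4 * \<eta>))"
    by (rule order_trans[OF trace[OF Cd] mult_left_mono[OF e]]) simp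
  also have "\<dots> = ennreal (4 * C * (1 + CARD('d)) * \<eta>)"
    using \<open>C \<ge> 0\<close> \<open>\<eta> > 0\<close> by (simp add: ennreal_mult[symmetric] mult_ac)
  finally show ?thesis .
qed


subsection \<open>The residual\<close>

text \<open>With \<open>s\<close>, \<open>p\<close> for the approximant and \<open>t\<close>,
  \<open>g\<close> for the solution, the splitting
  \<open>s * p - t * g = s * (p - g) + (s - t) * g\<close> puts the uniform bounds on
  \<open>s\<close> and \<open>s - t\<close>, so that the gradients enter only through their squares.
  The factor \<open>3\<close> comes from the three terms, \<open>CARD('d)\<close> from
  Cauchy-Schwarz over the coordinates.\<close>

lemma residual_pointwise:
  fixes a p g :: "'d::finite \<Rightarrow> real"
  assumes s: "\<bar>s\<bar> \<le> M" and st: "(t - s)\<^sup>2 \<le> \<kappa>"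
  shows "(- \<nu> * (\<Sum>i\<in>UNIV. a i) + (\<Sum>i\<in>UNIV. s * p i - t * g i))\<^sup>2
    \<le> 3 * CARD('d) * (\<Sum>i\<in>UNIV. \<nu>\<^sup>2 * (a i)\<^sup>2 + M\<^sup>2 * (g i - p i)\<^sup>2 + \<kappa> * (g i)\<^sup>2)"
proof -
  have three: "(x + y + z)\<^sup>2 \<le> 3 * (x\<^sup>2 + y\<^sup>2 + z\<^sup>2)" for x y z :: real
  proof -
    have "0 \<le> (x - y)\<^sup>2 + (y - z)\<^sup>2 + (x - z)\<^sup>2" by simp
    then show ?thesis by (simp add: power2_eq_square algebra_simps)
  qed
  have s2: "s\<^sup>2 \<le> M\<^sup>2" using power_mono[OF s, of 2] by simp
  have "(- \<nu> * (\<Sum>i\<in>UNIV. a i) + (\<Sum>i\<in>UNIV. s * p i - t * g i))\<^sup>2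
      = (\<Sum>i\<in>UNIV. - \<nu> * a i + s * (p i - g i) + (s - t) * g i)\<^sup>2"
    unfolding sum_distrib_left sum.distrib[symmetric] by (intro arg_cong[where f = "\<lambda>x. x\<^sup>2"] sum.cong) (auto simp: algebra_simps)
  also have "\<dots> \<le> (\<Sum>i\<in>UNIV. (- \<nu> * a i + s * (p i - g i) + (s - t) * g i)\<^sup>2) * CARD('d)"
    by (rule sum_squared_le_sum_of_squares)
  also have "\<dots> \<le> (\<Sum>i\<in>UNIV. 3 * (\<nu>\<^sup>2 * (a i)\<^sup>2 + M\<^sup>2 * (g i - p i)\<^sup>2 + \<kappa> * (g i)\<^sup>2)) * CARD('d)"
  proof (intro mult_right_mono sum_mono)
    fix i
    have "(- \<nu> * a i + s * (p i - g i) + (s - t) * g i)\<^sup>2 \<le> 3 * ((- \<nu> * a i)\<^sup>2 + (s * (p i - g i))\<^sup>2 + ((s - t) * g i)\<^sup>2)"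
      by (rule three)
    also have "\<dots> = 3 * (\<nu>\<^sup>2 * (a i)\<^sup>2 + s\<^sup>2 * (g i - p i)\<^sup>2 + (t - s)\<^sup>2 * (g i)\<^sup>2)"
      by (simp add: power_mult_distrib power2_commute)
    also have "\<dots> \<le> 3 * (\<nu>\<^sup>2 * (a i)\<^sup>2 + M\<^sup>2 * (g i - p i)\<^sup>2 + \<kappa> * (g i)\<^sup>2)"
      by (intro mult_left_mono add_mono mult_right_mono s2 st order_refl) auto
    finally show "(- \<nu> * a i + s * (p i - g i) + (s - t) * g i)\<^sup>2 \<le> 3 * (\<nu>\<^sup>2 * (a i)\<^sup>2 + M\<^sup>2 * (g i - p i)\<^sup>2 + \<kappa> * (g i)\<^sup>2)" .
  qed simp
  finally show ?thesis unfolding sum_distrib_left[symmetric] by (simp only: mult_ac)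
qed

text \<open>Derivative errors are small in mean square, while the uniform error
  \<open>K * \<eta>\<close> is paired with the fixed bound \<open>\<Gamma>\<close> for the gradient
  of the solution; each product is thus linear in \<open>\<eta>\<close>. Summing over the
  coordinates gives the second factor \<open>CARD('d)\<close>.\<close>

lemma residual_error:
  fixes \<Omega> :: "(real^'d::finite) set" and G :: "'d list \<Rightarrow> real^'d \<Rightarrow> real" and \<nu> \<eta> \<Gamma> M K :: real
  assumes \<Omega>: "\<Omega> \<in> sets borel" and G: "\<And>w. length w \<le> 2 \<Longrightarrow> G w \<in> borel_measurable borel"
    and \<Gamma>: "\<And>i. (\<integral>\<^sup>+x. ennreal ((G [i] x)\<^sup>2) * indicator \<Omega> x \<partial>lborel) \<le> ennreal \<Gamma>" "\<Gamma> \<ge> 0"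
    and v: "C_infinity v" "\<And>w. length w \<le> 2 \<Longrightarrow> sq_error \<Omega> G v w \<le> ennreal \<eta>" and "\<eta> > 0"
    and M: "AE x in lborel. x \<in> \<Omega> \<longrightarrow> \<bar>v x\<bar> \<le> M" and K: "AE x in lborel. x \<in> \<Omega> \<longrightarrow> (G [] x - v x)\<^sup>2 \<le> K * \<eta>" "K \<ge> 0"
  shows "(\<integral>\<^sup>+x. ennreal ((- \<nu> * (\<Sum>i\<in>UNIV. partials [i, i] v x - G [i, i] x)
      + (\<Sum>i\<in>UNIV. v x * partials [i] v x - G [] x * G [i] x))\<^sup>2) * indicator \<Omega> x \<partial>lborel)
    \<le> ennreal (3 * (CARD('d))\<^sup>2 * (\<nu>\<^sup>2 + M\<^sup>2 + K * \<Gamma>) * \<eta>)"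
proof -
  let ?c = "ennreal (3 * CARD('d))"
  have [measurable]: "\<Omega> \<in> sets borel" "\<And>i. G [i, i] \<in> borel_measurable borel" "\<And>i. G [i] \<in> borel_measurable borel"
    using \<Omega> G by auto
  have pm[measurable]: "partials w v \<in> borel_measurable borel" for w by (intro C_infinity_borel C_infinity_partials v)
  have K\<eta>: "K * \<eta> \<ge> 0" using K(2) \<open>\<eta> > 0\<close> by simp
  define A where "A = (\<lambda>i x. ennreal ((partials [i, i] v x - G [i, i] x)\<^sup>2) * indicator \<Omega> x)"
  define B where "B = (\<lambda>i x. ennreal ((G [i] x - partials [i] v x)\<^sup>2) * indicator \<Omega> x)"
  define D where "D = (\<lambda>i x. ennreal ((G [i] x)\<^sup>2) * indicator \<Omega> x)"
  have m[measurable]: "A i \<in> borel_measurable borel" "B i \<in> borel_measurable borel" "D i \<in> borel_measurable borel" for i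
    unfolding A_def B_def D_def using pm[of "[i, i]"] pm[of "[i]"] by (auto simp del: partials.simps)
  have "(\<integral>\<^sup>+x. ennreal ((- \<nu> * (\<Sum>i\<in>UNIV. partials [i, i] v x - G [i, i] x)
      + (\<Sum>i\<in>UNIV. v x * partials [i] v x - G [] x * G [i] x))\<^sup>2) * indicator \<Omega> x \<partial>lborel)
    \<le> (\<integral>\<^sup>+x. ?c * (\<Sum>i\<in>UNIV. ennreal (\<nu>\<^sup>2) * A i x + ennreal (M\<^sup>2) * B i x + ennreal (K * \<eta>) * D i x) \<partial>lborel)"
  proof (rule nn_integral_mono_AE)
    show "AE x in lborel. ennreal ((- \<nu> * (\<Sum>i\<in>UNIV. partials [i, i] v x - G [i, i] x)
      + (\<Sum>i\<in>UNIV. v x * partials [i] v x - G [] x * G [i] x))\<^sup>2) * indicator \<Omega> x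
      \<le> ?c * (\<Sum>i\<in>UNIV. ennreal (\<nu>\<^sup>2) * A i x + ennreal (M\<^sup>2) * B i x + ennreal (K * \<eta>) * D i x)"
      using M K(1)
    proof eventually_elim
      case (elim x)
      show ?case
      proof (cases "x \<in> \<Omega>")
        case True
        then have "\<bar>v x\<bar> \<le> M" "(G [] x - v x)\<^sup>2 \<le> K * \<eta>" using elim by auto
        note le = ennreal_leI[OF residual_pointwise[OF this, of \<nu> "\<lambda>i. partials [i, i] v x - G [i, i] x" "\<lambda>i. partials [i] v x" "\<lambda>i. G [i] x"]]
        have "ennreal (3 * CARD('d) * (\<Sum>i\<in>UNIV. \<nu>\<^sup>2 * (partials [i, i] v x - G [i, i] x)\<^sup>2 + M\<^sup>2 * (G [i] x - partials [i] v x)\<^sup>2 + K * \<eta> * (G [i] x)\<^sup>2))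
          = ?c * (\<Sum>i\<in>UNIV. ennreal (\<nu>\<^sup>2) * A i x + ennreal (M\<^sup>2) * B i x + ennreal (K * \<eta>) * D i x)"
          using True K\<eta> unfolding A_def B_def D_def
          by (simp add: ennreal_mult sum_nonneg sum_ennreal[symmetric] ennreal_plus mult_nonneg_nonneg del: partials.simps)
        with le show ?thesis using True by simp
      qed simp
    qed
  qed
  also have "\<dots> = ?c * (\<Sum>i\<in>UNIV. ennreal (\<nu>\<^sup>2) * (\<integral>\<^sup>+x. A i x \<partial>lborel) + ennreal (M\<^sup>2) * (\<integral>\<^sup>+x. B i x \<partial>lborel)
      + ennreal (K * \<eta>) * (\<integral>\<^sup>+x. D i x \<partial>lborel))"
    by (simp add: nn_integral_cmult nn_integral_sum nn_integral_add)
  also have "\<dots> \<le> ?c * (\<Sum>i\<in>(UNIV::'d set). ennreal (\<nu>\<^sup>2) * ennreal \<eta> + ennreal (M\<^sup>2) * ennreal \<eta> + ennreal (K * \<eta>) * ennreal \<Gamma>)"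
  proof (intro mult_left_mono sum_mono add_mono)
    fix i
    show "(\<integral>\<^sup>+x. A i x \<partial>lborel) \<le> ennreal \<eta>" "(\<integral>\<^sup>+x. B i x \<partial>lborel) \<le> ennreal \<eta>" "(\<integral>\<^sup>+x. D i x \<partial>lborel) \<le> ennreal \<Gamma>"
      using v(2)[of "[i, i]"] v(2)[of "[i]"] \<Gamma>(1)[of i] by (auto simp: A_def B_def D_def sq_error_def power2_commute simp del: partials.simps)
  qed auto
  also have "\<dots> = ?c * (\<Sum>i\<in>(UNIV::'d set). ennreal ((\<nu>\<^sup>2 + M\<^sup>2 + K * \<Gamma>) * \<eta>))"
    using \<open>\<eta> > 0\<close> K\<eta> \<Gamma>(2) K(2)
    by (simp add: ennreal_mult[symmetric] ennreal_plus[symmetric] algebra_simps del: ennreal_plus)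
  also have "\<dots> = ennreal (3 * (CARD('d))\<^sup>2 * (\<nu>\<^sup>2 + M\<^sup>2 + K * \<Gamma>) * \<eta>)"
    using \<open>\<eta> > 0\<close> \<Gamma>(2) K(2)
    by (simp add: ennreal_of_nat_eq_real_of_nat ennreal_mult[symmetric] power2_eq_square mult_ac)
  finally show ?thesis .
qed

text \<open>The equation replaces \<open>f\<close> by the operator applied to \<open>u\<close>, so
  the residual becomes a difference that can be written with classical derivatives of
  \<open>v\<close> and representatives of those of \<open>u\<close>.\<close>

lemma burgers_residual:
  fixes u v :: "real^'d::finite \<Rightarrow> real"
  assumes \<Omega>: "open \<Omega>" "bounded \<Omega>" and v: "C_infinity v"
    and sym: "\<And>w. length w \<le> 2 \<Longrightarrow> partials (rev w) v = partials w v"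
    and G: "\<And>w. length w \<le> 2 \<Longrightarrow> L2_rep \<Omega> (weak_deriv \<Omega> w u) (G w)" and u: "L2_rep \<Omega> u (G [])"
    and f: "f \<in> L2 (lebesgue_on \<Omega>)" "AE x in lebesgue_on \<Omega>. burgers_op \<nu> \<Omega> u x = f x"
  shows "(\<lambda>x. burgers_op \<nu> \<Omega> v x - f x) \<in> borel_measurable (lebesgue_on \<Omega>)"
    "AE x in lebesgue_on \<Omega>. burgers_op \<nu> \<Omega> v x - f x = - \<nu> * (\<Sum>i\<in>UNIV. partials [i, i] v x - G [i, i] x)
      + (\<Sum>i\<in>UNIV. v x * partials [i] v x - G [] x * G [i] x)"
proof -
  have wd: "is_weak_deriv \<Omega> w v (weak_deriv \<Omega> w v)" for w
    by (rule is_weak_deriv_weak_deriv[OF is_weak_deriv_smooth[OF \<Omega> v]])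
  have [measurable]: "f \<in> borel_measurable (lebesgue_on \<Omega>)" "v \<in> borel_measurable (lebesgue_on \<Omega>)"
    "weak_deriv \<Omega> w v \<in> borel_measurable (lebesgue_on \<Omega>)" for w
    using f(1) L2_rep_smooth(2)[OF \<Omega> v] wd[of w] by (auto simp: L2_def is_weak_deriv_def)
  show "(\<lambda>x. burgers_op \<nu> \<Omega> v x - f x) \<in> borel_measurable (lebesgue_on \<Omega>)"
    unfolding burgers_op_def laplacian_def by measurable
  have inn: "AE x in lebesgue_on \<Omega>. x \<in> \<Omega>" using \<Omega>(1) by (intro AE_lebesgue_on_lborel) auto
  have dv: "AE x in lebesgue_on \<Omega>. weak_deriv \<Omega> w v x = partials w v x" if "length w \<le> 2" for w
    using weak_deriv_AE(1)[OF \<Omega>(1) is_weak_deriv_smooth[OF \<Omega> v] L2_rep_smooth(1)[OF \<Omega> C_infinity_partials[OF v]], of w] inn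
    unfolding sym[OF that] by eventually_elim simp
  have dv1: "AE x in lebesgue_on \<Omega>. \<forall>i\<in>UNIV. weak_deriv \<Omega> [i] v x = partials [i] v x"
    by (rule AE_finite_allI[OF finite]) (rule dv, simp)
  have dv2: "AE x in lebesgue_on \<Omega>. \<forall>i\<in>UNIV. weak_deriv \<Omega> [i, i] v x = partials [i, i] v x"
    by (rule AE_finite_allI[OF finite]) (rule dv, simp)
  have du1: "AE x in lebesgue_on \<Omega>. \<forall>i\<in>UNIV. weak_deriv \<Omega> [i] u x = G [i] x"
    by (rule AE_finite_allI[OF finite]) (rule L2_repD(3)[OF G], simp)
  have du2: "AE x in lebesgue_on \<Omega>. \<forall>i\<in>UNIV. weak_deriv \<Omega> [i, i] u x = G [i, i] x"
    by (rule AE_finite_allI[OF finite]) (rule L2_repD(3)[OF G], simp)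
  show "AE x in lebesgue_on \<Omega>. burgers_op \<nu> \<Omega> v x - f x = - \<nu> * (\<Sum>i\<in>UNIV. partials [i, i] v x - G [i, i] x)
      + (\<Sum>i\<in>UNIV. v x * partials [i] v x - G [] x * G [i] x)"
    using dv1 dv2 du1 du2 f(2) L2_repD(3)[OF u]
  proof eventually_elim
    case (elim x)
    have v: "burgers_op \<nu> \<Omega> v x = - \<nu> * (\<Sum>i\<in>UNIV. partials [i, i] v x) + (\<Sum>i\<in>UNIV. v x * partials [i] v x)"
      unfolding burgers_op_def laplacian_def using elim(1,2) by (simp del: partials.simps)
    have f: "f x = - \<nu> * (\<Sum>i\<in>UNIV. G [i, i] x) + (\<Sum>i\<in>UNIV. G [] x * G [i] x)"
      unfolding elim(5)[symmetric] burgers_op_def laplacian_def using elim(3,4,6) by simp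
    show ?case unfolding v f sum_subtractf by (simp add: algebra_simps del: partials.simps)
  qed
qed

subsection \<open>Network approximation of the strong solution\<close>

text \<open>\<open>G []\<close> has to represent both \<open>u\<close> and the chosen
  \<open>weak_deriv \<Omega> [] u\<close>; this is consistent because \<open>u\<close> is its own
  weak derivative of order zero.\<close>

lemma weak_deriv_representatives:
  fixes u :: "real^'d::finite \<Rightarrow> real"
  assumes \<Omega>: "open \<Omega>" and u: "u \<in> Hk k \<Omega>"
  obtains G where "L2_rep \<Omega> u (G [])" "\<And>w. length w \<le> k \<Longrightarrow> L2_rep \<Omega> (weak_deriv \<Omega> w u) (G w)"
    "\<And>w \<phi>. length w \<le> k \<Longrightarrow> test_function \<Omega> \<phi> \<Longrightarrow>
      (\<integral>x. G [] x * partials w \<phi> x \<partial>lborel) = (-1) ^ length w * (\<integral>x. G w x * \<phi> x \<partial>lborel)"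
proof -
  have \<Omega>b: "\<Omega> \<in> sets borel" using \<Omega> by simp
  have uL: "u \<in> L2 (lebesgue_on \<Omega>)" using u by (simp add: Hk_def)
  have d: "is_weak_deriv \<Omega> w u (weak_deriv \<Omega> w u)" if "length w \<le> k" for w
    using u that is_weak_deriv_weak_deriv unfolding Hk_def by blast
  obtain U where U: "L2_rep \<Omega> u U" using L2_rep_exists[OF \<Omega>b uL] ..
  define G where "G = (\<lambda>w. if w = [] then U else (SOME g. L2_rep \<Omega> (weak_deriv \<Omega> w u) g))"
  have G0: "L2_rep \<Omega> u (G [])" using U by (simp add: G_def)
  have "is_weak_deriv \<Omega> [] u u" using uL by (simp add: is_weak_deriv_def)
  from weak_deriv_AE(2)[OF \<Omega> this U] have U': "L2_rep \<Omega> (weak_deriv \<Omega> [] u) U" .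
  have G: "L2_rep \<Omega> (weak_deriv \<Omega> w u) (G w)" if "length w \<le> k" for w
  proof (cases "w = []")
    case True
    then show ?thesis using U' by (simp add: G_def)
  next
    case False
    have "weak_deriv \<Omega> w u \<in> L2 (lebesgue_on \<Omega>)" using d[OF that] by (simp add: is_weak_deriv_def)
    from someI_ex[OF L2_rep_exists[OF \<Omega>b this]] show ?thesis using False by (simp add: G_def)
  qed
  show thesis
    by (rule that[OF G0 G is_weak_deriv_rep[OF \<Omega> uL d G0 G]])
qed

lemma network_approximates_solution:
  fixes \<Omega> :: "(real^'d::finite) set" and \<nu> :: real
  assumes dim: "CARD('d) \<le> 3" and \<Omega>: "open \<Omega>" "bounded \<Omega>" and cover: "cone_cover \<Omega> Z r e \<rho>"
    and f: "f \<in> L2 (lebesgue_on \<Omega>)" "AE x in lebesgue_on \<Omega>. burgers_op \<nu> \<Omega> u x = f x"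
    and u: "u \<in> Hk 2 \<Omega>" "u \<in> H10 \<Omega>" and \<sigma>: "smooth_activation \<sigma>" and "\<epsilon> > 0"
  shows "\<exists>N. \<exists>v\<in>DNN \<sigma> N. v \<in> Hk 2 \<Omega> \<and> Hk_norm 2 \<Omega> (\<lambda>x. u x - v x) \<le> \<epsilon> \<and>
    (\<lambda>x. burgers_op \<nu> \<Omega> v x - f x) \<in> L2 (lebesgue_on \<Omega>) \<and> v \<in> L2 (boundary_measure \<Omega>) \<and>
    (L2_norm (lebesgue_on \<Omega>) (\<lambda>x. burgers_op \<nu> \<Omega> v x - f x))\<^sup>2 + (L2_norm (boundary_measure \<Omega>) v)\<^sup>2 \<le> \<epsilon>\<^sup>2"
proof -
  let ?W = "{w :: 'd list. length w \<le> 2}"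
  have \<Omega>b[measurable]: "\<Omega> \<in> sets borel" using \<Omega> by simp
  obtain G where G0: "L2_rep \<Omega> u (G [])" and G: "\<And>w. length w \<le> 2 \<Longrightarrow> L2_rep \<Omega> (weak_deriv \<Omega> w u) (G w)"
    and ibp: "\<And>w \<phi>. length w \<le> 2 \<Longrightarrow> test_function \<Omega> \<phi> \<Longrightarrow>
      (\<integral>x. G [] x * partials w \<phi> x \<partial>lborel) = (-1) ^ length w * (\<integral>x. G w x * \<phi> x \<partial>lborel)"
  proof (rule weak_deriv_representatives[OF \<Omega>(1) u(1)])
    fix G assume a: "L2_rep \<Omega> u (G [])" "\<And>w. length w \<le> 2 \<Longrightarrow> L2_rep \<Omega> (weak_deriv \<Omega> w u) (G w)"
      "\<And>w \<phi>. length w \<le> 2 \<Longrightarrow> test_function \<Omega> \<phi> \<Longrightarrow>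
        (\<integral>x. G [] x * partials w \<phi> x \<partial>lborel) = (-1) ^ length w * (\<integral>x. G w x * \<phi> x \<partial>lborel)"
    show thesis by (rule that[OF a])
  qed
  have Gsq: "sq_int (G w)" if "length w \<le> 2" for w using L2_repD(1,4)[OF G[OF that]] by (simp add: sq_int_def)
  note Gm = L2_repD(1)[OF G]
  note Gout = L2_repD(2)[OF G]
  note \<sigma>s = smooth_activation_smooth[OF \<sigma>]
  define net where "net = (\<lambda>L \<beta> (x :: real^'d). rcomb \<sigma> L x + \<beta>)"
  have netC: "C_infinity (net L \<beta>)" for L \<beta> unfolding net_def by (rule network_smooth(1)[OF \<sigma>s])
  have netsym: "partials (rev w) (net L \<beta>) = partials w (net L \<beta>)" for L \<beta> w unfolding net_def by (rule network_smooth(2)[OF \<sigma>s])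
  have dense: "\<exists>L \<beta>. \<forall>w. length w \<le> 2 \<longrightarrow> sq_error \<Omega> G (net L \<beta>) w \<le> ennreal \<eta>" if "\<eta> > 0" for \<eta>
    unfolding net_def
    by (rule network_sobolev_dense[OF \<Omega> cover Gsq Gout ibp \<sigma>s smooth_activation_nonpolynomial[OF \<sigma>] that])
  obtain Cs where Cs: "Cs \<ge> 0" "\<And>v x. C_infinity v \<Longrightarrow> x \<in> \<Omega> \<Longrightarrow> ennreal ((v x)\<^sup>2) \<le> ennreal Cs * sobolev_energy 2 \<Omega> v"
    using sobolev_sup_bound[OF \<Omega>(1) cover dim] by blast
  obtain Ct where Ct: "Ct \<ge> 0" "\<And>v. C_infinity v \<Longrightarrow> (\<integral>\<^sup>+x. ennreal ((v x)\<^sup>2) \<partial>boundary_measure \<Omega>)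
      \<le> ennreal Ct * (\<integral>\<^sup>+y. ennreal (gradient_energy v y) * indicator \<Omega> y \<partial>lborel)"
    using trace_inequality[OF \<Omega>(1) cover] by blast
  define K where "K = 4 * Cs * card ?W"
  have K0: "K \<ge> 0" using Cs(1) by (simp add: K_def)
  have sup: "AE x in lborel. x \<in> \<Omega> \<longrightarrow> (G [] x - net L \<beta> x)\<^sup>2 \<le> K * \<eta>"
    if "\<eta> > 0" "\<And>w. length w \<le> 2 \<Longrightarrow> sq_error \<Omega> G (net L \<beta>) w \<le> ennreal \<eta>" for L \<beta> \<eta>
    unfolding K_def using netC dense
    by (intro sobolev_sup_error[OF \<Omega>(1) Gm Cs(2) Cs(1) _ netC that(2) that(1)]) blast+
  \<comment> \<open>A reference network of accuracy \<open>1\<close>: being bounded on \<Omega> and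
    uniformly close to the solution, it yields a bound for all later networks that is available
    before their accuracy is chosen.\<close>
  obtain L\<^sub>0 \<beta>\<^sub>0 where N0: "\<And>w. length w \<le> 2 \<Longrightarrow> sq_error \<Omega> G (net L\<^sub>0 \<beta>\<^sub>0) w \<le> ennreal 1"
    using dense[of 1] by auto
  have "compact (net L\<^sub>0 \<beta>\<^sub>0 ` closure \<Omega>)"
    using \<Omega> by (intro compact_continuous_image C_infinity_continuous netC) (simp add: compact_closure)
  then obtain B where B: "\<And>x. x \<in> \<Omega> \<Longrightarrow> \<bar>net L\<^sub>0 \<beta>\<^sub>0 x\<bar> \<le> B"
    using compact_imp_bounded bounded_iff closure_subset by (metis image_eqI real_norm_def subsetD)
  have sup0: "AE x in lborel. x \<in> \<Omega> \<longrightarrow> (G [] x - net L\<^sub>0 \<beta>\<^sub>0 x)\<^sup>2 \<le> K * 1"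
    by (rule sup[OF zero_less_one N0])
  \<comment> \<open>The reference network is at most \<open>B\<close>, and its distance to the
    solution and the distance from there to another network with \<open>\<eta> \<le> 1\<close> are
    at most \<open>sqrt K\<close> each.\<close>
  define M where "M = B + sqrt K + sqrt K"
  have bounded: "AE x in lborel. x \<in> \<Omega> \<longrightarrow> \<bar>net L \<beta> x\<bar> \<le> M"
    if "AE x in lborel. x \<in> \<Omega> \<longrightarrow> (G [] x - net L \<beta> x)\<^sup>2 \<le> K * \<eta>" "\<eta> \<le> 1" for L \<beta> \<eta>
    using that(1) sup0
  proof eventually_elim
    case (elim x)
    show ?case
    proof
      assume x: "x \<in> \<Omega>"
      have "K * \<eta> \<le> K" using K0 that(2) by (simp add: mult_left_le)
      then have "(G [] x - net L \<beta> x)\<^sup>2 \<le> K" "(G [] x - net L\<^sub>0 \<beta>\<^sub>0 x)\<^sup>2 \<le> K" using elim x by auto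
      then have "\<bar>G [] x - net L \<beta> x\<bar> \<le> sqrt K" "\<bar>G [] x - net L\<^sub>0 \<beta>\<^sub>0 x\<bar> \<le> sqrt K"
        by (auto simp: real_le_rsqrt)
      then show "\<bar>net L \<beta> x\<bar> \<le> M" using B[OF x] unfolding M_def by linarith
    qed
  qed
  define \<Gamma> where "\<Gamma> = (\<Sum>i\<in>UNIV. \<integral>x. (G [i] x)\<^sup>2 \<partial>lborel)"
  have \<Gamma>0: "\<Gamma> \<ge> 0" unfolding \<Gamma>_def by (intro sum_nonneg) simp
  have \<Gamma>: "(\<integral>\<^sup>+x. ennreal ((G [i] x)\<^sup>2) * indicator \<Omega> x \<partial>lborel) \<le> ennreal \<Gamma>" for i
  proof -
    have "(\<integral>\<^sup>+x. ennreal ((G [i] x)\<^sup>2) * indicator \<Omega> x \<partial>lborel) \<le> (\<integral>\<^sup>+x. ennreal ((G [i] x)\<^sup>2) \<partial>lborel)"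
      by (intro nn_integral_mono) (auto simp: indicator_def)
    also have "\<dots> = ennreal (\<integral>x. (G [i] x)\<^sup>2 \<partial>lborel)"
      using sq_intD(2)[OF Gsq, of "[i]"] by (intro nn_integral_eq_integral) auto
    also have "\<dots> \<le> ennreal \<Gamma>" unfolding \<Gamma>_def by (intro ennreal_leI member_le_sum) auto
    finally show ?thesis .
  qed
  define K2 where "K2 = 3 * (CARD('d))\<^sup>2 * (\<nu>\<^sup>2 + M\<^sup>2 + K * \<Gamma>)"
  define K3 where "K3 = 4 * Ct * (1 + CARD('d))"
  have K23: "K2 \<ge> 0" "K3 \<ge> 0" using K0 \<Gamma>0 Ct(1) by (auto simp: K2_def K3_def)
  \<comment> \<open>\<open>card ?W\<close> is the constant of the Sobolev error and
    \<open>K2 + K3\<close> that of the residual and the boundary term; one \<open>\<eta>\<close>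
    serves both estimates, and the added one makes \<open>S\<close> positive.\<close>
  define S where "S = card ?W + K2 + K3 + 1"
  have S: "S > 0" "card ?W \<le> S" "K2 + K3 \<le> S" using K23 by (auto simp: S_def)
  define \<eta> where "\<eta> = min 1 (\<epsilon>\<^sup>2 / S)"
  have \<eta>: "\<eta> > 0" "\<eta> \<le> 1" using S(1) \<open>\<epsilon> > 0\<close> by (auto simp: \<eta>_def)
  have S\<eta>: "c * \<eta> \<le> \<epsilon>\<^sup>2" if "c \<le> S" for c
  proof -
    have "c * \<eta> \<le> S * \<eta>" using that \<eta>(1) by (simp add: mult_right_mono)
    also have "\<dots> \<le> S * (\<epsilon>\<^sup>2 / S)" using S(1) by (intro mult_left_mono) (auto simp: \<eta>_def)
    finally show ?thesis using S(1) by simp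
  qed
  obtain L \<beta> where N: "\<And>w. length w \<le> 2 \<Longrightarrow> sq_error \<Omega> G (net L \<beta>) w \<le> ennreal \<eta>"
    using dense[OF \<eta>(1)] by blast
  let ?v = "net L \<beta>"
  have "ennreal ((Hk_norm 2 \<Omega> (\<lambda>x. u x - ?v x))\<^sup>2) = (\<Sum>w\<in>?W. sq_error \<Omega> G ?v w)"
    by (rule Hk_norm_diff_smooth[OF \<Omega> u(1) netC netsym G])
  also have "\<dots> \<le> (\<Sum>w\<in>?W. ennreal \<eta>)" by (intro sum_mono N) simp
  also have "\<dots> = ennreal (card ?W * \<eta>)" using \<eta>(1) by (simp add: ennreal_of_nat_eq_real_of_nat ennreal_mult)
  also have "\<dots> \<le> ennreal (\<epsilon>\<^sup>2)" by (intro ennreal_leI S\<eta> S(2))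
  finally have "(Hk_norm 2 \<Omega> (\<lambda>x. u x - ?v x))\<^sup>2 \<le> \<epsilon>\<^sup>2" by simp
  then have H2: "Hk_norm 2 \<Omega> (\<lambda>x. u x - ?v x) \<le> \<epsilon>" by (rule power2_le_imp_le) (use \<open>\<epsilon> > 0\<close> in simp)
  let ?R = "\<lambda>x. - \<nu> * (\<Sum>i\<in>UNIV. partials [i, i] ?v x - G [i, i] x) + (\<Sum>i\<in>UNIV. ?v x * partials [i] ?v x - G [] x * G [i] x)"
  have sup_v: "AE x in lborel. x \<in> \<Omega> \<longrightarrow> (G [] x - ?v x)\<^sup>2 \<le> K * \<eta>" by (rule sup[OF \<eta>(1) N])
  have burgers: "(\<lambda>x. burgers_op \<nu> \<Omega> ?v x - f x) \<in> borel_measurable (lebesgue_on \<Omega>)"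
    "AE x in lebesgue_on \<Omega>. burgers_op \<nu> \<Omega> ?v x - f x = ?R x"
    by (rule burgers_residual[OF \<Omega> netC netsym G G0 f]; assumption)+
  have pm: "partials w ?v \<in> borel_measurable borel" for w by (intro C_infinity_borel C_infinity_partials netC)
  have R[measurable]: "?R \<in> borel_measurable borel"
    by (intro borel_measurable_add borel_measurable_times borel_measurable_sum borel_measurable_diff
        borel_measurable_const pm pm[of "[]", simplified] Gm) auto
  have "(\<integral>\<^sup>+x. ennreal ((burgers_op \<nu> \<Omega> ?v x - f x)\<^sup>2) \<partial>lebesgue_on \<Omega>) = (\<integral>\<^sup>+x. ennreal ((?R x)\<^sup>2) \<partial>lebesgue_on \<Omega>)"
    using burgers(2) by (intro nn_integral_cong_AE) auto
  also have "\<dots> = (\<integral>\<^sup>+x. ennreal ((?R x)\<^sup>2) * indicator \<Omega> x \<partial>lborel)"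
    by (rule nn_integral_lebesgue_on[OF \<Omega>b]) (use R in measurable)
  also have "\<dots> \<le> ennreal (K2 * \<eta>)"
    unfolding K2_def by (rule residual_error[OF \<Omega>b Gm \<Gamma> \<Gamma>0 netC N \<eta>(1) bounded[OF sup_v \<eta>(2)] sup_v K0])
  finally have res: "(\<integral>\<^sup>+x. ennreal ((burgers_op \<nu> \<Omega> ?v x - f x)\<^sup>2) \<partial>lebesgue_on \<Omega>) \<le> ennreal (K2 * \<eta>)" .
  note res = L2_norm_le[OF burgers(1) res mult_nonneg_nonneg[OF K23(1) less_imp_le[OF \<eta>(1)]]]
  have bm: "?v \<in> borel_measurable (boundary_measure \<Omega>)"
    unfolding boundary_measure_def using C_infinity_borel[OF netC, of L \<beta>]
    by (intro measurable_restrict_space1) (simp cong: measurable_cong_sets)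
  have "(\<integral>\<^sup>+x. ennreal ((?v x)\<^sup>2) \<partial>boundary_measure \<Omega>) \<le> ennreal (K3 * \<eta>)"
    unfolding K3_def by (rule boundary_error[OF \<Omega> u(2) G Ct(2,1) netC N \<eta>(1)]) auto
  note bdry = L2_norm_le[OF bm this mult_nonneg_nonneg[OF K23(2) less_imp_le[OF \<eta>(1)]]]
  have "?v \<in> Hk 2 \<Omega>"
    unfolding Hk_def using L2_rep_smooth(2)[OF \<Omega> netC] is_weak_deriv_smooth[OF \<Omega> netC] by blast
  moreover have "K2 * \<eta> + K3 * \<eta> \<le> \<epsilon>\<^sup>2" using S\<eta>[OF S(3)] by (simp add: distrib_right)
  moreover obtain N where "?v \<in> DNN \<sigma> N" unfolding net_def using rcomb_DNN by blast
  ultimately show ?thesis using H2 res bdry by (intro exI[of _ N] bexI[of _ ?v]) auto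
qed

theorem theorem3p6:
  fixes \<Omega> :: "(real^'d::finite) set"
  assumes dim: "CARD('d) \<in> {2, 3}"
    and domain: "open \<Omega>" "connected \<Omega>" "\<Omega> \<noteq> {}" "bounded \<Omega>"
    and shape: "convex \<Omega> \<or> C2_boundary \<Omega>"
  shows "\<exists>C :: real \<Rightarrow> real \<Rightarrow> real \<Rightarrow> real. (\<forall>a b c. C a b c > 0) \<and>
    (\<forall>\<nu> f u \<sigma>. \<nu> > 0 \<and> f \<in> L2 (lebesgue_on \<Omega>) \<and> u \<in> Hk 2 \<Omega> \<inter> H10 \<Omega> \<and>
       (AE x in lebesgue_on \<Omega>. burgers_op \<nu> \<Omega> u x = f x) \<and> smooth_activation \<sigma> \<longrightarrow>
       (\<forall>\<epsilon>>0. \<exists>N. \<exists>uN\<in>DNN \<sigma> N.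
          uN \<in> Hk 2 \<Omega> \<and>
          Hk_norm 2 \<Omega> (\<lambda>x. u x - uN x) \<le> \<epsilon> \<and>
          (\<lambda>x. burgers_op \<nu> \<Omega> uN x - f x) \<in> L2 (lebesgue_on \<Omega>) \<and>
          uN \<in> L2 (boundary_measure \<Omega>) \<and>
          (L2_norm (lebesgue_on \<Omega>) (\<lambda>x. burgers_op \<nu> \<Omega> uN x - f x))\<^sup>2
            + (L2_norm (boundary_measure \<Omega>) uN)\<^sup>2
            \<le> C \<nu> (L2_norm (lebesgue_on \<Omega>) f) (trace_const \<Omega>) * \<epsilon>\<^sup>2))"
proof -
  obtain Z r e \<rho> where cover: "cone_cover \<Omega> Z r e \<rho>"
    using cone_cover_exists[OF domain(1,3,4) shape] by blast
  have "CARD('d) \<le> 3" using dim by auto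
  note approx = network_approximates_solution[OF this domain(1,4) cover]
  show ?thesis
    by (intro exI[of _ "\<lambda>_ _ _. 1"] conjI allI impI) (simp, elim conjE IntE, simp only: mult_1, rule approx, assumption+)
qed

end
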